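(* Let $\mathcal{S}\subset\{-1,0,1\}^3\setminus\{(0,0,0)\}$ be a non-trivial three-dimensional model with $|\mathcal{S}|\le 6$ whose associated group $G(\mathcal{S})=\langle\phi,\psi,\tau\rangle$ has order at least $200$. (Up to permutation of the coordinates there are $20634$ such models.) Then $G(\mathcal{S})$ is infinite.
   Context: A model is a finite set of steps $\mathcal{S}\subset\{-1,0,1\}^3\setminus\{(0,0,0)\}$. An octant walk is a finite walk starting at $(0,0,0)$, with steps in $\mathcal{S}$, all of whose points lie in $\mathbb{N}^3$, where $\mathbb{N}=\{0,1,2,\dots\}$. Dimension: for a step $s=(s_x,s_y,s_z)$, consider the three inequalities $$\sum_{s\in\mathcal{S}}a_ss_x\ge 0,\qquad \sum_{s\in\mathcal{S}}a_ss_y\ge 0,\qquad \sum_{s\in\mathcal{S}}a_ss_z\ge 0$$ in non-negative integers $(a_s)_{s\in\mathcal{S}}$. The model $\mathcal{S}$ has dimension at most $d$ ($d\in\{0,1,2,3\}$) if one can choose $d$ of these inequalities such that every tuple of non-negative integers satisfying these $d$ inequalities satisfies all three; it has dimension $d$ if $d$ is the least such number. Non-trivial models: $\mathcal{S}$ is non-trivial if its dimension is $2$ or $3$ and every step of $\mathcal{S}$ occurs in at least one octant walk with steps in $\mathcal{S}$. Models are counted up to permutations of the coordinates. A three-dimensional model is one of dimension $3$. Group: the characteristic polynomial of $\mathcal{S}$ is the Laurent polynomial $S(x,y,z)=\sum_{(i,j,k)\in\mathcal{S}}x^iy^jz^k$. Write $$S(x,y,z)=x^{-1}A_-(y,z)+A_0(y,z)+xA_+(y,z)=y^{-1}B_-(x,z)+B_0(x,z)+yB_+(x,z)=z^{-1}C_-(x,y)+C_0(x,y)+zC_+(x,y).$$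 For these models $A_\pm,B_\pm,C_\pm$ are non-zero. The associated group $G(\mathcal{S})$ is the group of birational transformations of $[x,y,z]$ generated by the involutions $$\phi([x,y,z])=\left[\frac1x\frac{A_-(y,z)}{A_+(y,z)},y,z\right],\quad \psi([x,y,z])=\left[x,\frac1y\frac{B_-(x,z)}{B_+(x,z)},z\right],\quad \tau([x,y,z])=\left[x,y,\frac1z\frac{C_-(x,y)}{C_+(x,y)}\right].$$ An infinite group is regarded as having order at least $200$. *)

theory Defs
  imports
    "HOL-Computational_Algebra.Polynomial"
    "HOL-Computational_Algebra.Fraction_Field"
    "HOL-Algebra.Generated_Groups"
    "HOL-Combinatorics.Permutations"
begin

section \<open>Models, octant walks, dimension\<close>

type_synonym step = "int \<times> int \<times> int"

fun coord :: "nat \<Rightarrow> step \<Rightarrow> int" where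
  "coord i (a, b, c) = (if i = 0 then a else if i = 1 then b else c)"

definition is_model :: "step set \<Rightarrow> bool" where
  "is_model S \<longleftrightarrow> S \<subseteq> ({-1, 0, 1} \<times> {-1, 0, 1} \<times> {-1, 0, 1}) - {(0, 0, 0)}"

text \<open>A walk is the list of its steps; the point reached after \<open>n\<close> steps has
  \<open>i\<close>-th coordinate \<open>\<Sum>s\<leftarrow>take n w. coord i s\<close>.\<close>

definition octant_walk :: "step set \<Rightarrow> step list \<Rightarrow> bool" where
  "octant_walk S w \<longleftrightarrow>
     set w \<subseteq> S \<and> (\<forall>n\<le>length w. \<forall>i<3. 0 \<le> (\<Sum>s\<leftarrow>take n w. coord i s))"

definition satisfies_ineq :: "step set \<Rightarrow> (step \<Rightarrow> nat) \<Rightarrow> nat \<Rightarrow> bool" where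
  "satisfies_ineq S a i \<longleftrightarrow> 0 \<le> (\<Sum>s\<in>S. int (a s) * coord i s)"

definition dim_at_most :: "step set \<Rightarrow> nat \<Rightarrow> bool" where
  "dim_at_most S d \<longleftrightarrow>
     (\<exists>I\<subseteq>{..<3}. card I = d \<and>
        (\<forall>a. (\<forall>i\<in>I. satisfies_ineq S a i) \<longrightarrow> (\<forall>i<3. satisfies_ineq S a i)))"

definition model_dim :: "step set \<Rightarrow> nat" where
  "model_dim S = (LEAST d. dim_at_most S d)"

definition nontrivial_model :: "step set \<Rightarrow> bool" where
  "nontrivial_model S \<longleftrightarrow>
     model_dim S \<in> {2, 3} \<and> (\<forall>s\<in>S. \<exists>w. octant_walk S w \<and> s \<in> set w)"

definition permute_step :: "(nat \<Rightarrow> nat) \<Rightarrow> step \<Rightarrow> step" where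
  "permute_step \<sigma> s = (coord (\<sigma> 0) s, coord (\<sigma> 1) s, coord (\<sigma> 2) s)"

definition same_up_to_permutation :: "(step set \<times> step set) set" where
  "same_up_to_permutation = {(S, T). \<exists>\<sigma>. \<sigma> permutes {..<3} \<and> T = permute_step \<sigma> ` S}"


section \<open>Birational transformations of three-dimensional space\<close>

text \<open>The innermost variable of \<open>rat poly poly poly\<close> is \<open>x\<close>, the outermost one is \<open>z\<close>;
  thus \<open>ratfun\<close> is the field \<open>\<rat>(x,y,z)\<close>. The generators of the group of a model have
  coefficients in \<open>\<rat>\<close>, so its order does not depend on which field of characteristic 0 is
  taken for the constants.\<close>

type_synonym pol = "rat poly poly poly"
type_synonym ratfun = "pol fract"
type_synonym ratmap = "ratfun \<times> ratfun \<times> ratfun"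

definition vX :: ratfun where "vX = Fract [:[:[:0, 1:]:]:] 1"
definition vY :: ratfun where "vY = Fract [:[:0, 1:]:] 1"
definition vZ :: ratfun where "vZ = Fract [:0, 1:] 1"

definition rconst :: "rat \<Rightarrow> ratfun" where
  "rconst c = Fract [:[:[:c:]:]:] 1"

fun peval :: "pol \<Rightarrow> ratmap \<Rightarrow> ratfun" where
  "peval p (a, b, c) =
     poly (map_poly (\<lambda>q. poly (map_poly (\<lambda>r. poly (map_poly rconst r) a) q) b) p) c"

definition is_subst :: "ratfun \<Rightarrow> ratmap \<Rightarrow> ratfun \<Rightarrow> bool" where
  "is_subst f G h \<longleftrightarrow> (\<exists>p q. f = Fract p q \<and> peval q G \<noteq> 0 \<and> h = peval p G / peval q G)"

text \<open>\<open>rsubst f (a, b, c)\<close> is \<open>f(a, b, c)\<close>. It is specified if \<open>f\<close> can be written with a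
  denominator that does not vanish at \<open>(a, b, c)\<close>, so for every \<open>f\<close> if \<open>(a, b, c)\<close> is dominant.\<close>

definition rsubst :: "ratfun \<Rightarrow> ratmap \<Rightarrow> ratfun" where
  "rsubst f G = (THE h. is_subst f G h)"

fun rcomp :: "ratmap \<Rightarrow> ratmap \<Rightarrow> ratmap" where
  "rcomp (f, g, h) G = (rsubst f G, rsubst g G, rsubst h G)"

definition rid :: ratmap where
  "rid = (vX, vY, vZ)"

definition dominant :: "ratmap \<Rightarrow> bool" where
  "dominant G \<longleftrightarrow> (\<forall>p. p \<noteq> 0 \<longrightarrow> peval p G \<noteq> 0)"

definition birational :: "ratmap \<Rightarrow> bool" where
  "birational F \<longleftrightarrow>
     dominant F \<and> (\<exists>G. dominant G \<and> rcomp F G = rid \<and> rcomp G F = rid)"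

definition Bir :: "ratmap monoid" where
  "Bir = \<lparr>carrier = {F. birational F}, mult = rcomp, one = rid\<rparr>"


section \<open>The group of a model\<close>

definition char_poly :: "step set \<Rightarrow> ratfun" where
  "char_poly S = (\<Sum>(i, j, k)\<in>S. vX powi i * vY powi j * vZ powi k)"

text \<open>For \<open>e = -1, 0, 1\<close> these are the coefficients \<open>A\<close>, \<open>B\<close>, \<open>C\<close> with index \<open>-\<close>, \<open>0\<close>, \<open>+\<close>
  in the decompositions of \<open>char_poly S\<close> by powers of one variable, see
  \<open>char_poly_decomp\<close> below.\<close>

definition coeffA :: "step set \<Rightarrow> int \<Rightarrow> ratfun" where
  "coeffA S e = (\<Sum>(i, j, k)\<in>{s\<in>S. coord 0 s = e}. vY powi j * vZ powi k)"

definition coeffB :: "step set \<Rightarrow> int \<Rightarrow> ratfun" where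
  "coeffB S e = (\<Sum>(i, j, k)\<in>{s\<in>S. coord 1 s = e}. vX powi i * vZ powi k)"

definition coeffC :: "step set \<Rightarrow> int \<Rightarrow> ratfun" where
  "coeffC S e = (\<Sum>(i, j, k)\<in>{s\<in>S. coord 2 s = e}. vX powi i * vY powi j)"

definition phi :: "step set \<Rightarrow> ratmap" where
  "phi S = (1 / vX * (coeffA S (-1) / coeffA S 1), vY, vZ)"

definition psi :: "step set \<Rightarrow> ratmap" where
  "psi S = (vX, 1 / vY * (coeffB S (-1) / coeffB S 1), vZ)"

definition tau :: "step set \<Rightarrow> ratmap" where
  "tau S = (vX, vY, 1 / vZ * (coeffC S (-1) / coeffC S 1))"

definition model_group :: "step set \<Rightarrow> ratmap monoid" where
  "model_group S = Bir\<lparr>carrier := generate Bir {phi S, psi S, tau S}\<rparr>"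

definition group_order_at_least :: "nat \<Rightarrow> step set \<Rightarrow> bool" where
  "group_order_at_least n S \<longleftrightarrow>
     infinite (carrier (model_group S)) \<or> n \<le> card (carrier (model_group S))"

definition large_group_models :: "step set set" where
  "large_group_models =
     {S. is_model S \<and> nontrivial_model S \<and> model_dim S = 3 \<and> card S \<le> 6
         \<and> group_order_at_least 200 S}"

lemma char_poly_decomp:
  assumes "is_model S"
  shows "char_poly S = inverse vX * coeffA S (-1) + coeffA S 0 + vX * coeffA S 1"
    and "char_poly S = inverse vY * coeffB S (-1) + coeffB S 0 + vY * coeffB S 1"
    and "char_poly S = inverse vZ * coeffC S (-1) + coeffC S 0 + vZ * coeffC S 1"
proof -
  have fin: "finite S"
    using assms unfolding is_model_def by (rule finite_subset) auto
  have split: "(\<Sum>s\<in>S. f s) = (\<Sum>s\<in>{s\<in>S. coord n s = -1}. f s) + (\<Sum>s\<in>{s\<in>S. coord n s = 0}. f s)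
      + (\<Sum>s\<in>{s\<in>S. coord n s = 1}. f s)" for n and f :: "step \<Rightarrow> ratfun"
  proof -
    have "S = ({s\<in>S. coord n s = -1} \<union> {s\<in>S. coord n s = 0}) \<union> {s\<in>S. coord n s = 1}"
      using assms unfolding is_model_def by (auto split: if_splits)
    hence "(\<Sum>s\<in>S. f s) =
        sum f (({s\<in>S. coord n s = -1} \<union> {s\<in>S. coord n s = 0}) \<union> {s\<in>S. coord n s = 1})"
      by simp
    also have "\<dots> = sum f ({s\<in>S. coord n s = -1} \<union> {s\<in>S. coord n s = 0})
        + sum f {s\<in>S. coord n s = 1}"
      using fin by (intro sum.union_disjoint) auto
    also have "sum f ({s\<in>S. coord n s = -1} \<union> {s\<in>S. coord n s = 0}) =
        sum f {s\<in>S. coord n s = -1} + sum f {s\<in>S. coord n s = 0}"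
      using fin by (intro sum.union_disjoint) auto
    finally show ?thesis .
  qed
  show "char_poly S = inverse vX * coeffA S (-1) + coeffA S 0 + vX * coeffA S 1"
    unfolding char_poly_def coeffA_def split[of _ 0] sum_distrib_left
    by (intro arg_cong2[of _ _ _ _ "(+)"] sum.cong) (auto simp: mult_ac)
  show "char_poly S = inverse vY * coeffB S (-1) + coeffB S 0 + vY * coeffB S 1"
    unfolding char_poly_def coeffB_def split[of _ 1] sum_distrib_left
    by (intro arg_cong2[of _ _ _ _ "(+)"] sum.cong) (auto simp: mult_ac)
  show "char_poly S = inverse vZ * coeffC S (-1) + coeffC S 0 + vZ * coeffC S 1"
    unfolding char_poly_def coeffC_def split[of _ 2] sum_distrib_left
    by (intro arg_cong2[of _ _ _ _ "(+)"] sum.cong) (auto simp: mult_ac)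
qed


section \<open>Birational transformations form a group that contains the involutions\<close>

definition is_hom :: "('a::comm_ring_1 \<Rightarrow> 'b::comm_ring_1) \<Rightarrow> bool" where
  "is_hom h \<longleftrightarrow> h 0 = 0 \<and> h 1 = 1 \<and> (\<forall>a b. h (a + b) = h a + h b) \<and> (\<forall>a b. h (a * b) = h a * h b)"

lemma is_hom_map_poly:
  assumes "is_hom h"
  shows "is_hom (\<lambda>p. poly (map_poly h p) a)"
proof -
  have h0: "h 0 = 0" and h1: "h 1 = 1" and hadd: "\<And>a b. h (a + b) = h a + h b"
    and hmult: "\<And>a b. h (a * b) = h a * h b"
    using assms by (auto simp: is_hom_def)
  have add: "map_poly h (p + q) = map_poly h p + map_poly h q" for p q
    by (intro poly_eqI) (simp add: coeff_map_poly h0 hadd)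
  have mult: "map_poly h (p * q) = map_poly h p * map_poly h q" for p q
  proof (induction p)
    case (pCons c p)
    have "map_poly h (smult c q) = smult (h c) (map_poly h q)"
      by (intro poly_eqI) (simp add: coeff_map_poly h0 hmult)
    with pCons show ?case
      by (simp add: add map_poly_pCons h0)
  qed auto
  show ?thesis
    using h0 h1 by (auto simp: is_hom_def add mult)
qed

lemma is_hom_rconst: "is_hom rconst"
  by (auto simp: is_hom_def rconst_def Zero_fract_def One_fract_def pCons_one mult.commute)

lemma is_hom_peval: "is_hom (\<lambda>p. peval p G)"
proof (cases G)
  case (fields a b c)
  show ?thesis
    unfolding fields peval.simps by (intro is_hom_map_poly is_hom_rconst)
qed

lemma peval_hom [simp]:
  "peval 0 G = 0" "peval 1 G = 1" "peval (p + q) G = peval p G + peval q G"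
  "peval (p * q) G = peval p G * peval q G"
  using is_hom_peval[of G] by (auto simp: is_hom_def)

lemma rconst_0 [simp]: "rconst 0 = 0" and rconst_1 [simp]: "rconst 1 = 1"
  using is_hom_rconst by (auto simp: is_hom_def)

lemma peval_var [simp]:
  "peval [:[:[:0, 1:]:]:] (a, b, c) = a"
  "peval [:[:0, 1:]:] (a, b, c) = b"
  "peval [:0, 1:] (a, b, c) = c"
  "peval [:[:[:r:]:]:] (a, b, c) = rconst r"
  by (simp_all add: map_poly_pCons one_pCons)

lemma hom_poly_expand:
  assumes "is_hom k"
  shows "k p = poly (map_poly (\<lambda>c. k [:c:]) p) (k [:0, 1:])"
proof (induction p)
  case 0
  then show ?case using assms by (simp add: is_hom_def)
next
  case (pCons c p)
  have "pCons c p = [:c:] + [:0, 1:] * p" by simp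
  hence "k (pCons c p) = k [:c:] + k [:0, 1:] * k p"
    using assms unfolding is_hom_def by metis
  moreover have "k [:0:] = 0" using assms by (simp add: is_hom_def)
  ultimately show ?case
    using pCons.IH by (simp add: map_poly_pCons)
qed

lemma is_hom_const: "is_hom k \<Longrightarrow> is_hom (\<lambda>c. k [:c:])"
proof -
  assume k: "is_hom k"
  have "k [:a + b:] = k [:a:] + k [:b:]" for a b
    using k by (metis is_hom_def add_pCons add_0_right)
  moreover have "k [:a * b:] = k [:a:] * k [:b:]" for a b
  proof -
    have "[:a * b:] = [:a:] * [:b:]" by simp
    thus ?thesis using k by (metis is_hom_def)
  qed
  ultimately show ?thesis
    using k by (auto simp: is_hom_def pCons_one)
qed

lemma hom_eq_peval:
  fixes k :: "pol \<Rightarrow> ratfun"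
  assumes k: "is_hom k" and c: "\<And>r. k [:[:[:r:]:]:] = rconst r"
  shows "k p = peval p (k [:[:[:0, 1:]:]:], k [:[:0, 1:]:], k [:0, 1:])"
proof -
  have 1: "is_hom (\<lambda>q. k [:q:])" using is_hom_const[OF k] .
  have 2: "is_hom (\<lambda>q. k [:[:q:]:])" using is_hom_const[OF 1] .
  show ?thesis
    by (subst hom_poly_expand[OF k], subst hom_poly_expand[OF 1], subst hom_poly_expand[OF 2])
       (simp add: c)
qed

lemma peval_rid: "peval p rid = Fract p 1"
proof -
  have "is_hom (\<lambda>p::pol. Fract p 1)"
    by (auto simp: is_hom_def Zero_fract_def One_fract_def)
  from hom_eq_peval[OF this, of p] show ?thesis
    by (simp add: rid_def vX_def vY_def vZ_def rconst_def)
qed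

lemma is_subst_unique:
  assumes "is_subst f G h" "is_subst f G h'"
  shows "h = h'"
proof -
  from assms obtain p q p' q' where
    1: "f = Fract p q" "peval q G \<noteq> 0" "h = peval p G / peval q G" and
    2: "f = Fract p' q'" "peval q' G \<noteq> 0" "h' = peval p' G / peval q' G"
    unfolding is_subst_def by metis
  have "q \<noteq> 0" "q' \<noteq> 0" using 1 2 by auto
  with 1 2 have "p * q' = p' * q" by (simp add: eq_fract)
  hence "peval p G * peval q' G = peval p' G * peval q G" by (metis peval_hom(4))
  hence "peval p G / peval q G = peval p' G / peval q' G" using 1 2 by (simp add: frac_eq_eq)
  thus ?thesis using 1 2 by simp
qed

lemma rsubst_eqI: "is_subst f G h \<Longrightarrow> rsubst f G = h"
  unfolding rsubst_def using is_subst_unique by blast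

lemma is_subst_Fract: "peval q G \<noteq> 0 \<Longrightarrow> is_subst (Fract p q) G (peval p G / peval q G)"
  unfolding is_subst_def by blast

lemma is_subst_poly: "is_subst (Fract p 1) G (peval p G)"
  using is_subst_Fract[of 1 G p] by simp

lemma is_subst_var:
  "is_subst vX (a, b, c) a" "is_subst vY (a, b, c) b" "is_subst vZ (a, b, c) c"
  unfolding vX_def vY_def vZ_def by (metis is_subst_poly peval_var)+

lemma is_subst_rconst: "is_subst (rconst r) G (rconst r)"
  unfolding rconst_def[of r] by (metis is_subst_poly peval_var(4) prod_cases3 rconst_def)

lemma is_subst_0: "is_subst 0 G 0" and is_subst_1: "is_subst 1 G 1"
  using is_subst_rconst[of 0 G] is_subst_rconst[of 1 G] by simp_all

lemma is_subst_add:
  assumes "is_subst f G h" "is_subst f' G h'"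
  shows "is_subst (f + f') G (h + h')"
proof -
  from assms obtain p q p' q' where
    1: "f = Fract p q" "peval q G \<noteq> 0" "h = peval p G / peval q G" and
    2: "f' = Fract p' q'" "peval q' G \<noteq> 0" "h' = peval p' G / peval q' G"
    unfolding is_subst_def by metis
  have "q \<noteq> 0" "q' \<noteq> 0" using 1 2 by auto
  hence "f + f' = Fract (p * q' + p' * q) (q * q')" using 1 2 by simp
  moreover have "h + h' = peval (p * q' + p' * q) G / peval (q * q') G"
    using 1 2 by (simp add: field_simps)
  moreover have "peval (q * q') G \<noteq> 0" using 1 2 by simp
  ultimately show ?thesis using is_subst_Fract by metis
qed

lemma is_subst_mult:
  assumes "is_subst f G h" "is_subst f' G h'"
  shows "is_subst (f * f') G (h * h')"
proof -
  from assms obtain p q p' q' where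
    1: "f = Fract p q" "peval q G \<noteq> 0" "h = peval p G / peval q G" and
    2: "f' = Fract p' q'" "peval q' G \<noteq> 0" "h' = peval p' G / peval q' G"
    unfolding is_subst_def by metis
  have "f * f' = Fract (p * p') (q * q')" using 1 2 by simp
  moreover have "h * h' = peval (p * p') G / peval (q * q') G"
    using 1 2 by simp
  moreover have "peval (q * q') G \<noteq> 0" using 1 2 by simp
  ultimately show ?thesis using is_subst_Fract by metis
qed

lemma is_subst_inverse:
  assumes "is_subst f G h" "h \<noteq> 0"
  shows "is_subst (inverse f) G (inverse h)"
proof -
  from assms obtain p q where
    1: "f = Fract p q" "peval q G \<noteq> 0" "h = peval p G / peval q G"
    unfolding is_subst_def by metis
  have "peval p G \<noteq> 0" using 1 assms by auto
  from is_subst_Fract[OF this, of q] show ?thesis using 1 by simp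
qed

lemma is_subst_divide:
  assumes "is_subst f G h" "is_subst f' G h'" "h' \<noteq> 0"
  shows "is_subst (f / f') G (h / h')"
  using is_subst_mult[OF assms(1) is_subst_inverse[OF assms(2,3)]] by (simp add: divide_inverse)

lemma is_subst_power: "is_subst f G h \<Longrightarrow> is_subst (f ^ n) G (h ^ n)"
  by (induction n) (auto intro: is_subst_1 is_subst_mult)

lemma is_subst_powi: "is_subst f G h \<Longrightarrow> h \<noteq> 0 \<Longrightarrow> is_subst (f powi n) G (h powi n)"
  by (auto simp: power_int_def intro: is_subst_power is_subst_inverse)

lemma is_subst_sum:
  assumes "\<And>s. s \<in> S \<Longrightarrow> is_subst (f s) G (h s)"
  shows "is_subst (sum f S) G (sum h S)"
  using assms by (induction S rule: infinite_finite_induct) (auto intro: is_subst_0 is_subst_add)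

lemma is_subst_map_poly:
  assumes "\<And>c. is_subst (k c) G (k' c)" "k 0 = 0" "k' 0 = 0" "is_subst f G h"
  shows "is_subst (poly (map_poly k p) f) G (poly (map_poly k' p) h)"
  using assms
  by (induction p) (auto simp: map_poly_pCons intro!: is_subst_0 is_subst_add is_subst_mult)

lemma is_subst_peval:
  assumes "is_subst a G a'" "is_subst b G b'" "is_subst c G c'"
  shows "is_subst (peval p (a, b, c)) G (peval p (a', b', c'))"
  unfolding peval.simps
  by (intro is_subst_map_poly is_subst_rconst assms) auto

text \<open>A map that has a left inverse is dominant.\<close>

lemma dominantI:
  assumes "is_subst a G vX" "is_subst b G vY" "is_subst c G vZ"
  shows "dominant (a, b, c)"
  unfolding dominant_def
proof (intro allI impI notI)
  fix p assume p: "p \<noteq> 0" "peval p (a, b, c) = 0"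
  have "is_subst 0 G (peval p rid)"
    using is_subst_peval[OF assms, of p] p by (simp add: rid_def)
  hence "peval p rid = 0" using is_subst_unique is_subst_0 by blast
  hence "Fract p 1 = Fract 0 1" by (simp add: peval_rid Zero_fract_def)
  thus False using p by (simp add: eq_fract)
qed

lemma is_subst_rsubst:
  assumes "dominant G"
  shows "is_subst f G (rsubst f G)"
proof -
  obtain p q where "f = Fract p q" "q \<noteq> 0" by (cases f) auto
  hence "is_subst f G (peval p G / peval q G)"
    using assms is_subst_Fract unfolding dominant_def by blast
  thus ?thesis using rsubst_eqI by metis
qed

lemma rsubst_nonzero:
  assumes "dominant G" "f \<noteq> 0"
  shows "rsubst f G \<noteq> 0"
proof -
  obtain p q where pq: "f = Fract p q" "q \<noteq> 0" by (cases f) auto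
  have "p \<noteq> 0" using assms(2) pq by (auto simp: fract_collapse)
  hence nz: "peval p G \<noteq> 0" "peval q G \<noteq> 0" using assms(1) pq by (auto simp: dominant_def)
  have "rsubst f G = peval p G / peval q G"
    using is_subst_Fract[OF nz(2)] pq by (intro rsubst_eqI) simp
  thus ?thesis using nz by simp
qed

lemma rsubst_peval:
  assumes "dominant G"
  shows "rsubst (peval p F) G = peval p (rcomp F G)"
  by (cases F) (use is_subst_rsubst[OF assms] in
      \<open>simp only: rcomp.simps; intro rsubst_eqI is_subst_peval; blast\<close>)

lemma dominant_rcomp:
  assumes "dominant F" "dominant G"
  shows "dominant (rcomp F G)"
  using assms rsubst_nonzero unfolding dominant_def[of F] dominant_def[of "rcomp F G"]
  by (metis rsubst_peval)

lemma rsubst_rcomp: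
  assumes "dominant F" "dominant G"
  shows "rsubst (rsubst f F) G = rsubst f (rcomp F G)"
proof -
  obtain p q where pq: "f = Fract p q" "q \<noteq> 0" by (cases f) auto
  have nz: "peval q F \<noteq> 0" "peval q (rcomp F G) \<noteq> 0"
    using assms dominant_rcomp[OF assms] pq by (auto simp: dominant_def)
  have "rsubst f F = peval p F / peval q F"
    using is_subst_Fract[OF nz(1)] pq by (intro rsubst_eqI) simp
  moreover have "rsubst f (rcomp F G) = peval p (rcomp F G) / peval q (rcomp F G)"
    using is_subst_Fract[OF nz(2)] pq by (intro rsubst_eqI) simp
  moreover have "rsubst (peval p F / peval q F) G = peval p (rcomp F G) / peval q (rcomp F G)"
  proof (intro rsubst_eqI is_subst_divide)
    show "is_subst (peval p F) G (peval p (rcomp F G))"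
         "is_subst (peval q F) G (peval q (rcomp F G))"
      using is_subst_rsubst[OF assms(2)] by (simp_all flip: rsubst_peval[OF assms(2)])
  qed (fact nz)
  ultimately show ?thesis by simp
qed

lemma rcomp_assoc:
  assumes "dominant G" "dominant H"
  shows "rcomp (rcomp F G) H = rcomp F (rcomp G H)"
  using assms by (cases F) (simp add: rsubst_rcomp)

lemma dominant_rid: "dominant rid"
  unfolding dominant_def peval_rid by (auto simp: Zero_fract_def eq_fract)

lemma rcomp_rid: "rcomp rid F = F" "rcomp F rid = F"
proof -
  show "rcomp rid F = F"
    by (cases F) (auto simp: rid_def intro!: rsubst_eqI is_subst_var)
  have "rsubst f rid = f" for f
  proof -
    obtain p q where pq: "f = Fract p q" "q \<noteq> 0" by (cases f) auto
    hence "peval q rid \<noteq> 0" using dominant_rid by (auto simp: dominant_def)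
    from is_subst_Fract[OF this, of p] have "is_subst f rid f"
      using pq by (simp add: peval_rid)
    thus ?thesis by (rule rsubst_eqI)
  qed
  thus "rcomp F rid = F" by (cases F) simp
qed

lemma birational_rcomp:
  assumes "birational F" "birational G"
  shows "birational (rcomp F G)"
proof -
  from assms obtain F' G' where
    F: "dominant F" "dominant F'" "rcomp F F' = rid" "rcomp F' F = rid" and
    G: "dominant G" "dominant G'" "rcomp G G' = rid" "rcomp G' G = rid"
    unfolding birational_def by blast
  have *: "rcomp (rcomp F G) (rcomp G' F') = rid"
    if "dominant F" "dominant G" "dominant F'" "dominant G'" "rcomp F F' = rid" "rcomp G G' = rid"
    for F G F' G'
  proof -
    have "rcomp (rcomp F G) (rcomp G' F') = rcomp F (rcomp (rcomp G G') F')"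
      using that(1-4) by (simp add: rcomp_assoc dominant_rcomp)
    thus ?thesis using that(5,6) by (simp add: rcomp_rid)
  qed
  have "rcomp (rcomp F G) (rcomp G' F') = rid \<and> rcomp (rcomp G' F') (rcomp F G) = rid"
    using *[of F G F' G'] *[of G' F' G F] F G by simp
  thus ?thesis
    unfolding birational_def using F G dominant_rcomp by blast
qed

lemma birational_rid: "birational rid"
  unfolding birational_def using dominant_rid rcomp_rid by blast

lemma group_Bir: "group Bir"
proof (rule groupI)
  fix F G H
  assume "F \<in> carrier Bir" "G \<in> carrier Bir" "H \<in> carrier Bir"
  thus "F \<otimes>\<^bsub>Bir\<^esub> G \<otimes>\<^bsub>Bir\<^esub> H = F \<otimes>\<^bsub>Bir\<^esub> (G \<otimes>\<^bsub>Bir\<^esub> H)"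
    by (simp add: Bir_def birational_def rcomp_assoc)
next
  fix F assume "F \<in> carrier Bir"
  then obtain G where "dominant F" "dominant G" "rcomp F G = rid" "rcomp G F = rid"
    unfolding Bir_def birational_def by auto
  thus "\<exists>G\<in>carrier Bir. G \<otimes>\<^bsub>Bir\<^esub> F = \<one>\<^bsub>Bir\<^esub>"
    unfolding Bir_def birational_def
    by (intro bexI[of _ G]) (simp, simp only: mem_Collect_eq partial_object.simps, blast)
qed (auto simp: Bir_def birational_rcomp birational_rid rcomp_rid)

lemma involution_in_Bir:
  assumes "is_subst a (a, b, c) vX" "is_subst b (a, b, c) vY" "is_subst c (a, b, c) vZ"
  shows "(a, b, c) \<in> carrier Bir" "rcomp (a, b, c) (a, b, c) = rid"
proof -
  show *: "rcomp (a, b, c) (a, b, c) = rid"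
    using assms by (simp add: rid_def rsubst_eqI)
  have "dominant (a, b, c)" using assms by (rule dominantI)
  with * show "(a, b, c) \<in> carrier Bir" by (auto simp: Bir_def birational_def)
qed

lemma var_nonzero [simp]: "vX \<noteq> 0" "vY \<noteq> 0" "vZ \<noteq> 0"
  by (simp_all add: vX_def vY_def vZ_def Zero_fract_def eq_fract)

lemma is_subst_coeff:
  "is_subst (coeffA S e) (u, vY, vZ) (coeffA S e)"
  "is_subst (coeffB S e) (vX, u, vZ) (coeffB S e)"
  "is_subst (coeffC S e) (vX, vY, u) (coeffC S e)"
  unfolding coeffA_def coeffB_def coeffC_def
  by (auto intro!: is_subst_sum is_subst_mult is_subst_powi is_subst_var split: prod.splits)

lemma phi_involution:
  assumes "coeffA S (-1) \<noteq> 0" "coeffA S 1 \<noteq> 0"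
  shows "phi S \<in> carrier Bir" "rcomp (phi S) (phi S) = rid"
proof -
  let ?u = "1 / vX * (coeffA S (-1) / coeffA S 1)"
  have "is_subst ?u (?u, vY, vZ) (1 / ?u * (coeffA S (-1) / coeffA S 1))"
    by (intro is_subst_mult is_subst_divide is_subst_1 is_subst_var is_subst_coeff)
       (use assms in auto)
  moreover have "1 / ?u * (coeffA S (-1) / coeffA S 1) = vX"
    using assms by simp
  ultimately have "is_subst ?u (?u, vY, vZ) vX" by simp
  from involution_in_Bir[OF this is_subst_var(2,3)]
  show "phi S \<in> carrier Bir" "rcomp (phi S) (phi S) = rid" by (simp_all add: phi_def)
qed

lemma psi_involution:
  assumes "coeffB S (-1) \<noteq> 0" "coeffB S 1 \<noteq> 0"
  shows "psi S \<in> carrier Bir" "rcomp (psi S) (psi S) = rid"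
proof -
  let ?u = "1 / vY * (coeffB S (-1) / coeffB S 1)"
  have "is_subst ?u (vX, ?u, vZ) (1 / ?u * (coeffB S (-1) / coeffB S 1))"
    by (intro is_subst_mult is_subst_divide is_subst_1 is_subst_var is_subst_coeff)
       (use assms in auto)
  moreover have "1 / ?u * (coeffB S (-1) / coeffB S 1) = vY"
    using assms by simp
  ultimately have "is_subst ?u (vX, ?u, vZ) vY" by simp
  from involution_in_Bir[OF is_subst_var(1) this is_subst_var(3)]
  show "psi S \<in> carrier Bir" "rcomp (psi S) (psi S) = rid" by (simp_all add: psi_def)
qed

lemma tau_involution:
  assumes "coeffC S (-1) \<noteq> 0" "coeffC S 1 \<noteq> 0"
  shows "tau S \<in> carrier Bir" "rcomp (tau S) (tau S) = rid"
proof -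
  let ?u = "1 / vZ * (coeffC S (-1) / coeffC S 1)"
  have "is_subst ?u (vX, vY, ?u) (1 / ?u * (coeffC S (-1) / coeffC S 1))"
    by (intro is_subst_mult is_subst_divide is_subst_1 is_subst_var is_subst_coeff)
       (use assms in auto)
  moreover have "1 / ?u * (coeffC S (-1) / coeffC S 1) = vZ"
    using assms by simp
  ultimately have "is_subst ?u (vX, vY, ?u) vZ" by simp
  from involution_in_Bir[OF is_subst_var(1,2) this]
  show "tau S \<in> carrier Bir" "rcomp (tau S) (tau S) = rid" by (simp_all add: tau_def)
qed

end

theory Submission
  imports
    Defs
    "HOL-Computational_Algebra.Formal_Laurent_Series"
    "HOL-Algebra.Multiplicative_Group"
    "HOL-Library.Nat_Bijection"
    "HOL-Library.Product_Lexorder"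
begin

text \<open>
  Two kinds of models have to be told apart: those whose group is infinite, and those whose group
  is finite and then has fewer than 200 elements. The generators are involutions, so the simplest
  reason for a group to be infinite is that a product of two of them, say \<open>T = \<psi> \<phi>\<close>, has infinite
  order. This is what happens in all models with a large group, for a suitable choice of the two
  coordinates.

  To see that \<open>T\<close> has infinite order, it is applied to points whose coordinates are Laurent series
  with positive leading coefficients. The coefficients of the step polynomials are positive as
  well, so leading terms never cancel, and \<open>T\<close> acts on the orders of the coordinates by a piecewise
  linear map, the tropical pair map. In a generic direction this map, and the way in which \<open>T\<close>
  changes a small multiplicative perturbation of the point, depend on four integers only, the
  slopes. For most slopes the piecewise linear map has a period \<open>q\<close> in \<open>{2, 3, 4, 5, 7, 8}\<close>, and
  \<open>T\<^sup>q\<close> fixes the orders of a generic point and is tangent to the identity there. If \<open>T\<close> has finite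
  order, then so has \<open>T\<^sup>q\<close>, and in characteristic 0 this forces \<open>T\<^sup>q\<close> to be the identity near the
  point, hence everywhere (\<open>finite_order_period\<close>). For the other slopes the tropical map itself has
  infinite order. So \<open>T\<close> has infinite order as soon as \<open>T\<^sup>q\<close> moves a single point, which is
  detected by a computation modulo 11 (\<open>infinite_test_sound\<close>).

  The models for which this test fails have finite groups. In most of them the third generator
  commutes with the other two, and the group is the product of a dihedral group and a group of
  order 2. In the others the generators are monomial maps, so the group is a finite group of integer
  matrices (\<open>certifies_sound\<close>).

  It remains to go through all models. By \<open>nontrivial_3_iff\<close>, a model is non-trivial and of
  dimension 3 iff it contains a step from each of 28 explicit sets. This turns the enumeration into
  a search tree, which visits every model once (\<open>search_enumerates\<close>). A model is counted if it is
  the least one in its orbit under permutations of the coordinates (\<open>card_orbits\<close>). The search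
  meets 20634 least models that pass the test, and 170 that carry a certificate of finiteness.
\<close>


section \<open>Evaluating rational maps at points of a field\<close>

definition peval_at :: "(rat \<Rightarrow> 'k::field) \<Rightarrow> pol \<Rightarrow> 'k \<times> 'k \<times> 'k \<Rightarrow> 'k" where
  "peval_at c p = (\<lambda>(x, y, z).
     poly (map_poly (\<lambda>q. poly (map_poly (\<lambda>r. poly (map_poly c r) x) q) y) p) z)"

text \<open>As for \<open>is_subst\<close>, a rational function may be evaluated through any representation whose
  denominator does not vanish at the point.\<close>

definition has_value :: "(rat \<Rightarrow> 'k::field) \<Rightarrow> ratfun \<Rightarrow> 'k \<times> 'k \<times> 'k \<Rightarrow> 'k \<Rightarrow> bool" where
  "has_value c f P h \<longleftrightarrow>
     (\<exists>p q. f = Fract p q \<and> peval_at c q P \<noteq> 0 \<and> h = peval_at c p P / peval_at c q P)"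

definition maps_to ::
    "(rat \<Rightarrow> 'k::field) \<Rightarrow> ratmap \<Rightarrow> 'k \<times> 'k \<times> 'k \<Rightarrow> 'k \<times> 'k \<times> 'k \<Rightarrow> bool" where
  "maps_to c = (\<lambda>(f, g, h) P (x, y, z). has_value c f P x \<and> has_value c g P y \<and> has_value c h P z)"

locale constants =
  fixes c :: "rat \<Rightarrow> 'k::field"
  assumes hom: "is_hom c"
begin

lemma c_hom [simp]: "c 0 = 0" "c 1 = 1" "c (a + b) = c a + c b" "c (a * b) = c a * c b"
  using hom by (auto simp: is_hom_def)

lemma is_hom_peval_at: "is_hom (\<lambda>p. peval_at c p P)"
proof (cases P)
  case (fields x y z)
  show ?thesis
    unfolding fields peval_at_def case_prod_conv by (intro is_hom_map_poly hom)
qed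

lemma peval_at_hom [simp]:
  "peval_at c 0 P = 0" "peval_at c 1 P = 1" "peval_at c (p + q) P = peval_at c p P + peval_at c q P"
  "peval_at c (p * q) P = peval_at c p P * peval_at c q P"
  using is_hom_peval_at[of P] by (auto simp: is_hom_def)

lemma peval_at_diff [simp]: "peval_at c (p - q) P = peval_at c p P - peval_at c q P"
proof -
  have "peval_at c ((p - q) + q) P = peval_at c (p - q) P + peval_at c q P" by (rule peval_at_hom)
  thus ?thesis by simp
qed

lemma peval_at_var [simp]:
  "peval_at c [:[:[:0, 1:]:]:] (x, y, z) = x"
  "peval_at c [:[:0, 1:]:] (x, y, z) = y"
  "peval_at c [:0, 1:] (x, y, z) = z"
  "peval_at c [:[:[:r:]:]:] (x, y, z) = c r"
  by (simp_all add: peval_at_def map_poly_pCons one_pCons)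

lemma has_value_unique:
  assumes "has_value c f P h" "has_value c f P h'"
  shows "h = h'"
proof -
  from assms obtain p q p' q' where
    1: "f = Fract p q" "peval_at c q P \<noteq> 0" "h = peval_at c p P / peval_at c q P" and
    2: "f = Fract p' q'" "peval_at c q' P \<noteq> 0" "h' = peval_at c p' P / peval_at c q' P"
    unfolding has_value_def by metis
  have "q \<noteq> 0" "q' \<noteq> 0" using 1 2 by auto
  with 1 2 have "p * q' = p' * q" by (simp add: eq_fract)
  hence "peval_at c p P * peval_at c q' P = peval_at c p' P * peval_at c q P"
    by (metis peval_at_hom(4))
  thus ?thesis using 1 2 by (simp add: frac_eq_eq)
qed

lemma has_value_Fract:
  "peval_at c q P \<noteq> 0 \<Longrightarrow> has_value c (Fract p q) P (peval_at c p P / peval_at c q P)"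
  unfolding has_value_def by blast

lemma has_value_poly: "has_value c (Fract p 1) P (peval_at c p P)"
  using has_value_Fract[of 1 P p] by simp

lemma has_value_var:
  "has_value c vX (x, y, z) x" "has_value c vY (x, y, z) y" "has_value c vZ (x, y, z) z"
  unfolding vX_def vY_def vZ_def by (metis has_value_poly peval_at_var)+

lemma has_value_const: "has_value c (rconst r) P (c r)"
  unfolding rconst_def[of r] by (metis has_value_poly peval_at_var(4) prod_cases3)

lemma has_value_0: "has_value c 0 P 0" and has_value_1: "has_value c 1 P 1"
  using has_value_const[of 0 P] has_value_const[of 1 P] by simp_all

lemma has_value_add:
  assumes "has_value c f P h" "has_value c f' P h'"
  shows "has_value c (f + f') P (h + h')"
proof -
  from assms obtain p q p' q' where
    1: "f = Fract p q" "peval_at c q P \<noteq> 0" "h = peval_at c p P / peval_at c q P" and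
    2: "f' = Fract p' q'" "peval_at c q' P \<noteq> 0" "h' = peval_at c p' P / peval_at c q' P"
    unfolding has_value_def by metis
  have "q \<noteq> 0" "q' \<noteq> 0" using 1 2 by auto
  hence "f + f' = Fract (p * q' + p' * q) (q * q')" using 1 2 by simp
  moreover have "h + h' = peval_at c (p * q' + p' * q) P / peval_at c (q * q') P"
    unfolding 1(3) 2(3) using 1(2) 2(2) by (simp add: add_frac_eq)
  moreover have "peval_at c (q * q') P \<noteq> 0" using 1 2 by simp
  ultimately show ?thesis using has_value_Fract by metis
qed

lemma has_value_mult:
  assumes "has_value c f P h" "has_value c f' P h'"
  shows "has_value c (f * f') P (h * h')"
proof -
  from assms obtain p q p' q' where
    1: "f = Fract p q" "peval_at c q P \<noteq> 0" "h = peval_at c p P / peval_at c q P" and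
    2: "f' = Fract p' q'" "peval_at c q' P \<noteq> 0" "h' = peval_at c p' P / peval_at c q' P"
    unfolding has_value_def by metis
  have "f * f' = Fract (p * p') (q * q')" using 1 2 by simp
  moreover have "h * h' = peval_at c (p * p') P / peval_at c (q * q') P"
    using 1 2 by simp
  moreover have "peval_at c (q * q') P \<noteq> 0" using 1 2 by simp
  ultimately show ?thesis using has_value_Fract by metis
qed

lemma has_value_inverse:
  assumes "has_value c f P h" "h \<noteq> 0"
  shows "has_value c (inverse f) P (inverse h)"
proof -
  from assms obtain p q where
    1: "f = Fract p q" "peval_at c q P \<noteq> 0" "h = peval_at c p P / peval_at c q P"
    unfolding has_value_def by metis
  have "peval_at c p P \<noteq> 0" using 1 assms by auto
  from has_value_Fract[OF this, of q] show ?thesis using 1 by simp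
qed

lemma has_value_divide:
  assumes "has_value c f P h" "has_value c f' P h'" "h' \<noteq> 0"
  shows "has_value c (f / f') P (h / h')"
  using has_value_mult[OF assms(1) has_value_inverse[OF assms(2,3)]] by (simp add: divide_inverse)

lemma has_value_power: "has_value c f P h \<Longrightarrow> has_value c (f ^ n) P (h ^ n)"
  by (induction n) (auto intro: has_value_1 has_value_mult)

lemma has_value_powi:
  "has_value c f P h \<Longrightarrow> h \<noteq> 0 \<Longrightarrow> has_value c (f powi n) P (h powi n)"
  by (auto simp: power_int_def intro: has_value_power has_value_inverse)

lemma has_value_sum:
  assumes "\<And>s. s \<in> S \<Longrightarrow> has_value c (f s) P (h s)"
  shows "has_value c (sum f S) P (sum h S)"
  using assms
  by (induction S rule: infinite_finite_induct) (auto intro: has_value_0 has_value_add)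

lemma has_value_map_poly:
  assumes "\<And>a. has_value c (k a) P (k' a)" "k 0 = 0" "k' 0 = 0" "has_value c f P h"
  shows "has_value c (poly (map_poly k p) f) P (poly (map_poly k' p) h)"
  using assms
  by (induction p) (auto simp: map_poly_pCons intro!: has_value_0 has_value_add has_value_mult)

lemma has_value_peval:
  assumes "maps_to c G P Q"
  shows "has_value c (peval p G) P (peval_at c p Q)"
proof (cases G; cases Q)
  fix a1 a2 a3 b1 b2 b3
  assume "G = (a1, a2, a3)" "Q = (b1, b2, b3)"
  thus ?thesis
    using assms unfolding peval_at_def maps_to_def
    by (auto intro!: has_value_map_poly has_value_const)
qed

text \<open>Evaluation is compatible with substitution, even where the substituted map is not
  defined everywhere: it suffices that it has a value at the point in question.\<close>

lemma has_value_rsubst: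
  assumes "maps_to c G P Q" "has_value c f Q h"
  shows "has_value c (rsubst f G) P h"
proof -
  from assms(2) obtain p q where
    1: "f = Fract p q" "peval_at c q Q \<noteq> 0" "h = peval_at c p Q / peval_at c q Q"
    unfolding has_value_def by metis
  note v = has_value_peval[OF assms(1)]
  have "peval q G \<noteq> 0"
    using v[of q] 1(2) has_value_unique has_value_0 by metis
  hence "rsubst f G = peval p G / peval q G"
    unfolding 1(1) by (intro rsubst_eqI is_subst_Fract)
  thus ?thesis
    using has_value_divide[OF v[of p] v[of q] 1(2)] 1(3) by simp
qed

lemma maps_to_rcomp:
  assumes "maps_to c G P Q" "maps_to c F Q R"
  shows "maps_to c (rcomp F G) P R"
  using assms has_value_rsubst[OF assms(1)]
  by (cases F; cases R) (auto simp: maps_to_def split: prod.splits)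

lemma maps_to_rid: "maps_to c rid P P"
  by (cases P) (auto simp: maps_to_def rid_def intro: has_value_var)

lemma maps_to_unique:
  assumes "maps_to c F P Q" "maps_to c F P R"
  shows "Q = R"
  using assms
  by (cases F; cases Q; cases R; cases P) (simp add: maps_to_def, metis has_value_unique)

end

definition coeffA_at :: "step set \<Rightarrow> int \<Rightarrow> 'k::field \<Rightarrow> 'k \<Rightarrow> 'k" where
  "coeffA_at S e y z = (\<Sum>(i, j, k)\<in>{s\<in>S. coord 0 s = e}. y powi j * z powi k)"

definition coeffB_at :: "step set \<Rightarrow> int \<Rightarrow> 'k::field \<Rightarrow> 'k \<Rightarrow> 'k" where
  "coeffB_at S e x z = (\<Sum>(i, j, k)\<in>{s\<in>S. coord 1 s = e}. x powi i * z powi k)"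

definition phi_at :: "step set \<Rightarrow> 'k::field \<times> 'k \<times> 'k \<Rightarrow> 'k \<times> 'k \<times> 'k" where
  "phi_at S = (\<lambda>(x, y, z). (coeffA_at S (-1) y z / coeffA_at S 1 y z / x, y, z))"

definition psi_at :: "step set \<Rightarrow> 'k::field \<times> 'k \<times> 'k \<Rightarrow> 'k \<times> 'k \<times> 'k" where
  "psi_at S = (\<lambda>(x, y, z). (x, coeffB_at S (-1) x z / coeffB_at S 1 x z / y, z))"

definition pair_map :: "step set \<Rightarrow> ratmap" where
  "pair_map S = rcomp (psi S) (phi S)"

definition pair_at :: "step set \<Rightarrow> 'k::field \<times> 'k \<times> 'k \<Rightarrow> 'k \<times> 'k \<times> 'k" where
  "pair_at S P = psi_at S (phi_at S P)"

context constants
begin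

lemma has_value_coeff:
  assumes "x \<noteq> 0" "y \<noteq> 0" "z \<noteq> 0"
  shows "has_value c (coeffA S e) (x, y, z) (coeffA_at S e y z)"
    and "has_value c (coeffB S e) (x, y, z) (coeffB_at S e x z)"
  unfolding coeffA_def coeffB_def coeffA_at_def coeffB_at_def using assms
  by (auto intro!: has_value_sum has_value_mult has_value_powi has_value_var split: prod.splits)

lemma maps_to_phi:
  assumes "x \<noteq> 0" "y \<noteq> 0" "z \<noteq> 0" "coeffA_at S 1 y z \<noteq> 0"
  shows "maps_to c (phi S) (x, y, z) (phi_at S (x, y, z))"
proof -
  have "has_value c (1 / vX * (coeffA S (-1) / coeffA S 1)) (x, y, z)
      (1 / x * (coeffA_at S (-1) y z / coeffA_at S 1 y z))"
    using assms
    by (intro has_value_mult has_value_divide has_value_1 has_value_var has_value_coeff) auto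
  thus ?thesis
    by (auto simp: maps_to_def phi_def phi_at_def mult_ac divide_simps intro: has_value_var)
qed

lemma maps_to_psi:
  assumes "x \<noteq> 0" "y \<noteq> 0" "z \<noteq> 0" "coeffB_at S 1 x z \<noteq> 0"
  shows "maps_to c (psi S) (x, y, z) (psi_at S (x, y, z))"
proof -
  have "has_value c (1 / vY * (coeffB S (-1) / coeffB S 1)) (x, y, z)
      (1 / y * (coeffB_at S (-1) x z / coeffB_at S 1 x z))"
    using assms
    by (intro has_value_mult has_value_divide has_value_1 has_value_var has_value_coeff) auto
  thus ?thesis
    by (auto simp: maps_to_def psi_def psi_at_def mult_ac divide_simps intro: has_value_var)
qed

end

lemma constants_of_rat: "constants (of_rat :: rat \<Rightarrow> 'k::field_char_0)"
  by unfold_locales (auto simp: is_hom_def of_rat_add of_rat_mult)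


unbundle fps_syntax

section \<open>Laurent series with positive leading coefficient\<close>

type_synonym series = "rat fls"

text \<open>Positivity of the leading coefficient is the invariant of all orbits below: it is preserved by
  sums, products and quotients, and it makes the order of a sum the least order of its terms.\<close>

definition pos_lead :: "int \<Rightarrow> series \<Rightarrow> bool" where
  "pos_lead n f \<longleftrightarrow> fls_subdegree f = n \<and> 0 < f $$ n"

definition vanishes_below :: "int \<Rightarrow> series \<Rightarrow> bool" where
  "vanishes_below n f \<longleftrightarrow> (\<forall>k<n. f $$ k = 0)"

lemma pos_lead_nonzero: "pos_lead n f \<Longrightarrow> f \<noteq> 0"
  by (auto simp: pos_lead_def)

lemma pos_lead_unique: "pos_lead n f \<Longrightarrow> pos_lead m f \<Longrightarrow> n = m"
  by (auto simp: pos_lead_def)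

lemma pos_leadI: "vanishes_below n f \<Longrightarrow> 0 < f $$ n \<Longrightarrow> pos_lead n f"
  unfolding pos_lead_def vanishes_below_def
  using fls_subdegree_eqI[of f n] order_less_imp_not_eq2[of 0 "f $$ n"] by blast

lemma pos_lead_vanishes: "pos_lead n f \<Longrightarrow> vanishes_below n f"
  by (auto simp: pos_lead_def vanishes_below_def)

lemma pos_lead_nth: "pos_lead n f \<Longrightarrow> 0 < f $$ n"
  by (auto simp: pos_lead_def)

lemma pos_lead_mult: "pos_lead n f \<Longrightarrow> pos_lead m g \<Longrightarrow> pos_lead (n + m) (f * g)"
proof -
  assume fg: "pos_lead n f" "pos_lead m g"
  hence "fls_subdegree (f * g) = n + m"
    using pos_lead_nonzero[OF fg(1)] pos_lead_nonzero[OF fg(2)] by (simp add: pos_lead_def)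
  moreover have "(f * g) $$ (n + m) = f $$ n * g $$ m"
    using fls_times_base[of f g] fg unfolding pos_lead_def by metis
  ultimately show ?thesis using fg by (simp add: pos_lead_def)
qed

lemma pos_lead_1: "pos_lead 0 1"
  by (simp add: pos_lead_def)

lemma pos_lead_inverse:
  assumes "pos_lead n f"
  shows "pos_lead (-n) (inverse f)"
proof -
  have f: "f \<noteq> 0" using assms by (rule pos_lead_nonzero)
  hence "fls_subdegree (inverse f) + fls_subdegree f = fls_subdegree (inverse f * f)"
    by (subst fls_subdegree_mult) auto
  hence sub: "fls_subdegree (inverse f) = - n"
    using f assms by (simp add: pos_lead_def)
  have "inverse f $$ (-n) * f $$ n = 1"
    using fls_times_base[of "inverse f" f] sub f assms unfolding pos_lead_def
    by (metis add.left_inverse left_inverse fls_one_nth)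
  hence "0 < inverse f $$ (-n)"
    using assms unfolding pos_lead_def by (metis zero_less_mult_pos2 zero_less_one)
  thus ?thesis using sub by (simp add: pos_lead_def)
qed

lemma pos_lead_divide: "pos_lead n f \<Longrightarrow> pos_lead m g \<Longrightarrow> pos_lead (n - m) (f / g)"
  using pos_lead_mult[OF _ pos_lead_inverse, of n f m g] by (simp add: divide_inverse)

lemma pos_lead_power: "pos_lead n f \<Longrightarrow> pos_lead (int k * n) (f ^ k)"
proof (induction k)
  case (Suc k)
  from pos_lead_mult[OF Suc.prems Suc.IH[OF Suc.prems]] show ?case
    by (simp add: algebra_simps)
qed (simp add: pos_lead_1)

lemma pos_lead_powi:
  assumes "pos_lead n f"
  shows "pos_lead (k * n) (f powi k)"
proof (cases "k \<ge> 0")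
  case True
  thus ?thesis using pos_lead_power[OF assms, of "nat k"] by (simp add: power_int_def)
next
  case False
  thus ?thesis using pos_lead_power[OF pos_lead_inverse[OF assms], of "nat (-k)"]
    by (simp add: power_int_def)
qed

lemma pos_lead_add:
  assumes "pos_lead n f" "pos_lead m g"
  shows "pos_lead (min n m) (f + g)"
proof (rule pos_leadI)
  show "vanishes_below (min n m) (f + g)"
    using assms by (auto simp: pos_lead_def vanishes_below_def)
  have nonneg: "0 \<le> h $$ i" if "pos_lead k h" "i \<le> k" for h i k
    using that by (cases "i = k") (auto simp: pos_lead_def)
  have "0 \<le> f $$ min n m" "0 \<le> g $$ min n m"
    using nonneg[OF assms(1)] nonneg[OF assms(2)] by auto
  moreover have "0 < f $$ min n m \<or> 0 < g $$ min n m"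
    using pos_lead_nth[OF assms(1)] pos_lead_nth[OF assms(2)] by (auto simp: min_def)
  ultimately show "0 < (f + g) $$ min n m"
    by (simp only: fls_plus_nth) linarith
qed

lemma pos_lead_sum:
  assumes "finite J" "J \<noteq> {}" "\<And>t. t \<in> J \<Longrightarrow> pos_lead (e t) (f t)"
  shows "pos_lead (Min (e ` J)) (sum f J)"
  using assms
proof (induction J rule: finite_ne_induct)
  case (insert t J)
  thus ?case using pos_lead_add[of "e t" "f t" "Min (e ` J)" "sum f J"] by simp
qed auto

lemma vanishes_mult:
  assumes "vanishes_below n f" "vanishes_below m g"
  shows "vanishes_below (n + m) (f * g)"
proof (cases "f = 0 \<or> g = 0")
  case False
  hence "n \<le> fls_subdegree f" "m \<le> fls_subdegree g"
    using assms unfolding vanishes_below_def by (simp_all add: fls_subdegree_geI)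
  thus ?thesis
    by (auto simp: vanishes_below_def intro!: fls_times_nth_eq0)
qed (auto simp: vanishes_below_def)

lemma vanishes_add: "vanishes_below n f \<Longrightarrow> vanishes_below n g \<Longrightarrow> vanishes_below n (f + g)"
  and vanishes_diff: "vanishes_below n f \<Longrightarrow> vanishes_below n g \<Longrightarrow> vanishes_below n (f - g)"
  and vanishes_minus: "vanishes_below n f \<Longrightarrow> vanishes_below n (- f)"
  and vanishes_mono: "vanishes_below n f \<Longrightarrow> m \<le> n \<Longrightarrow> vanishes_below m f"
  and vanishes_0: "vanishes_below n 0"
  unfolding vanishes_below_def by simp_all

lemma vanishes_sum: "(\<And>t. t \<in> J \<Longrightarrow> vanishes_below n (f t)) \<Longrightarrow> vanishes_below n (sum f J)"
  by (induction J rule: infinite_finite_induct) (auto intro: vanishes_add vanishes_0)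


section \<open>Congruence of series modulo higher order terms\<close>

text \<open>For positive \<open>r\<close> these are the multiplicative subgroups \<open>1 + T\<^sup>r \<rat>[[T]]\<close>; for
  \<open>r = 0\<close> all non-zero series are admitted.\<close>

definition near_one :: "nat \<Rightarrow> series \<Rightarrow> bool" where
  "near_one r u \<longleftrightarrow> u \<noteq> 0 \<and> (0 < r \<longrightarrow> vanishes_below (int r) (u - 1))"

definition congr :: "nat \<Rightarrow> series \<Rightarrow> series \<Rightarrow> bool" where
  "congr r u v \<longleftrightarrow> u \<noteq> 0 \<and> v \<noteq> 0 \<and> near_one r (u / v)"

lemma near_one_pos_lead:
  assumes "near_one r u" "0 < r"
  shows "pos_lead 0 u"
proof (rule pos_leadI)
  have *: "\<forall>k<int r. (u - 1) $$ k = 0"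
    using assms unfolding near_one_def vanishes_below_def by blast
  show "vanishes_below 0 u"
    unfolding vanishes_below_def
  proof (intro allI impI)
    fix k :: int assume k: "k < 0"
    have "(u - 1) $$ k = 0" using * k assms(2) by simp
    thus "u $$ k = 0" using k by simp
  qed
  have "(u - 1) $$ 0 = 0" using * assms(2) by simp
  thus "0 < u $$ 0" by simp
qed

lemma near_one_1: "near_one r 1"
  by (simp add: near_one_def vanishes_0)

lemma near_one_mult: "near_one r u \<Longrightarrow> near_one r v \<Longrightarrow> near_one r (u * v)"
proof (cases "r = 0")
  case False
  assume u: "near_one r u" and v: "near_one r v"
  have "vanishes_below (int r + 0) ((u - 1) * v)"
    using u v False by (intro vanishes_mult)
      (auto simp: near_one_def intro!: pos_lead_vanishes near_one_pos_lead[of r])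
  hence "vanishes_below (int r) ((u - 1) * v + (v - 1))"
    using v False by (intro vanishes_add) (auto simp: near_one_def)
  moreover have "(u - 1) * v + (v - 1) = u * v - 1" by (simp add: algebra_simps)
  ultimately show ?thesis using u v by (simp add: near_one_def)
qed (auto simp: near_one_def)

lemma near_one_inverse: "near_one r u \<Longrightarrow> near_one r (inverse u)"
proof (cases "r = 0")
  case False
  assume u: "near_one r u"
  hence nz: "u \<noteq> 0" by (simp add: near_one_def)
  have "vanishes_below 0 (inverse u)"
    using pos_lead_inverse[OF near_one_pos_lead[OF u]] False by (auto dest: pos_lead_vanishes)
  hence "vanishes_below (int r + 0) ((u - 1) * - inverse u)"
    using u False by (intro vanishes_mult vanishes_minus) (auto simp: near_one_def)
  moreover have "(u - 1) * - inverse u = inverse u - 1" using nz by (simp add: algebra_simps)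
  ultimately show ?thesis using nz by (simp add: near_one_def)
qed (auto simp: near_one_def)

lemma near_one_divide: "near_one r u \<Longrightarrow> near_one r v \<Longrightarrow> near_one r (u / v)"
  by (simp add: divide_inverse near_one_mult near_one_inverse)

lemma near_one_power: "near_one r u \<Longrightarrow> near_one r (u ^ k)"
  by (induction k) (auto intro: near_one_1 near_one_mult)

lemma near_one_powi: "near_one r u \<Longrightarrow> near_one r (u powi k)"
  by (auto simp: power_int_def intro: near_one_power near_one_inverse)

lemma near_one_mono: "near_one r u \<Longrightarrow> s \<le> r \<Longrightarrow> near_one s u"
  by (auto simp: near_one_def elim: vanishes_mono)

lemma congr_refl: "u \<noteq> 0 \<Longrightarrow> congr r u u"
  by (simp add: congr_def near_one_1)

lemma congr_sym: "congr r u v \<Longrightarrow> congr r v u"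
  using near_one_inverse[of r "u / v"] by (simp add: congr_def)

lemma congr_trans: "congr r u v \<Longrightarrow> congr r v w \<Longrightarrow> congr r u w"
  using near_one_mult[of r "u / v" "v / w"] by (simp add: congr_def)

lemma congr_mult: "congr r u v \<Longrightarrow> congr r u' v' \<Longrightarrow> congr r (u * u') (v * v')"
  using near_one_mult[of r "u / v" "u' / v'"] by (simp add: congr_def)

lemma congr_inverse: "congr r u v \<Longrightarrow> congr r (inverse u) (inverse v)"
  using near_one_inverse[of r "u / v"] by (simp add: congr_def divide_inverse mult.commute)

lemma congr_divide: "congr r u v \<Longrightarrow> congr r u' v' \<Longrightarrow> congr r (u / u') (v / v')"
  by (simp add: divide_inverse congr_mult congr_inverse)

lemma congr_powi: "congr r u v \<Longrightarrow> congr r (u powi k) (v powi k)"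
  using near_one_powi[of r "u / v" k] by (simp add: congr_def power_int_divide_distrib)

lemma congr_mono: "congr r u v \<Longrightarrow> s \<le> r \<Longrightarrow> congr s u v"
  by (auto simp: congr_def intro: near_one_mono)

lemma near_one_congr: "congr r u v \<Longrightarrow> near_one r v \<Longrightarrow> near_one r u"
  using near_one_mult[of r "u / v" v] by (simp add: congr_def)

text \<open>A sum with a unique term of lowest order behaves like this term.\<close>

lemma dominated_sum:
  assumes "finite J" "t\<^sub>0 \<in> J" "\<And>t. t \<in> J \<Longrightarrow> pos_lead (e t) (f t)"
    and "\<And>t. t \<in> J - {t\<^sub>0} \<Longrightarrow> e t\<^sub>0 < e t"
  shows "pos_lead (e t\<^sub>0) (sum f J)" "congr 1 (sum f J) (f t\<^sub>0)"
proof -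
  have "Min (e ` J) = e t\<^sub>0"
    using assms by (intro Min_eqI) (auto simp: order_le_less)
  thus lead: "pos_lead (e t\<^sub>0) (sum f J)"
    using pos_lead_sum[of J e f] assms by auto
  have nz: "f t\<^sub>0 \<noteq> 0" "sum f J \<noteq> 0" using assms(2,3) lead pos_lead_nonzero by blast+
  have "sum f J / f t\<^sub>0 - 1 = (\<Sum>t\<in>J - {t\<^sub>0}. f t / f t\<^sub>0)"
    using assms(1,2) nz by (simp add: sum.remove add_divide_distrib sum_divide_distrib)
  moreover have "vanishes_below 1 \<dots>"
  proof (rule vanishes_sum)
    fix t assume that: "t \<in> J - {t\<^sub>0}"
    thus "vanishes_below 1 (f t / f t\<^sub>0)"
    using pos_lead_vanishes[OF pos_lead_divide[of "e t" "f t" "e t\<^sub>0" "f t\<^sub>0"]] that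
      assms(2,3) assms(4)[OF that] by (auto elim!: vanishes_mono)
  qed
  ultimately show "congr 1 (sum f J) (f t\<^sub>0)"
    using nz by (simp add: congr_def near_one_def)
qed

lemma dominated_sum_ratio:
  assumes "finite J" "t\<^sub>0 \<in> J" "\<And>t. t \<in> J \<Longrightarrow> pos_lead (e t) (f t)"
    and "\<And>t. t \<in> J - {t\<^sub>0} \<Longrightarrow> e t\<^sub>0 < e t"
    and "\<And>t. t \<in> J \<Longrightarrow> pos_lead (e' t) (g t)"
    and "\<And>t. t \<in> J - {t\<^sub>0} \<Longrightarrow> e' t\<^sub>0 < e' t"
    and near: "\<And>t. t \<in> J \<Longrightarrow> near_one r (g t / f t)"
  shows "congr (Suc r) (sum g J / sum f J) (g t\<^sub>0 / f t\<^sub>0)"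
proof (cases "r = 0")
  case True
  thus ?thesis
    using congr_divide dominated_sum(2)[of J t\<^sub>0 e f] dominated_sum(2)[of J t\<^sub>0 e' g] assms
    by simp
next
  case False
  let ?q = "g t\<^sub>0 / f t\<^sub>0"
  have lead: "pos_lead (e t\<^sub>0) (sum f J)" "pos_lead (e' t\<^sub>0) (sum g J)"
    using dominated_sum(1)[of J t\<^sub>0 e f] dominated_sum(1)[of J t\<^sub>0 e' g] assms by auto
  have nz: "f t \<noteq> 0" "g t \<noteq> 0" if "t \<in> J" for t using assms(3,5) that pos_lead_nonzero by blast+
  have q: "pos_lead 0 ?q" using near_one_pos_lead[OF near[OF assms(2)]] False by simp
  have nz': "sum f J \<noteq> 0" "sum g J \<noteq> 0" "?q \<noteq> 0"
    using lead q pos_lead_nonzero by blast+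
  have "sum g J - sum f J * ?q = (\<Sum>t\<in>J. f t * (g t / f t - ?q))"
    using nz assms(2) by (simp add: sum_distrib_right sum_subtractf right_diff_distrib sum_divide_distrib)
  also have "\<dots> = (\<Sum>t\<in>J - {t\<^sub>0}. f t * (g t / f t - ?q))"
    using assms(1,2) by (simp add: sum.remove)
  finally have diff: "sum g J - sum f J * ?q = \<dots>" .
  have "vanishes_below (e t\<^sub>0 + int r + 1) (f t * (g t / f t - ?q))" if t: "t \<in> J - {t\<^sub>0}" for t
  proof -
    have "vanishes_below (int r) (g t / f t - 1)" "vanishes_below (int r) (?q - 1)"
      using near[of t] near[of t\<^sub>0] t assms(2) False by (simp_all add: near_one_def)
    from vanishes_diff[OF this] have "vanishes_below (int r) (g t / f t - ?q)" by simp
    hence "vanishes_below (e t + int r) (f t * (g t / f t - ?q))"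
      using t assms(3) by (intro vanishes_mult) (auto intro: pos_lead_vanishes)
    thus ?thesis by (rule vanishes_mono) (use assms(4)[OF t] in auto)
  qed
  hence "vanishes_below (e t\<^sub>0 + int r + 1) (sum g J - sum f J * ?q)"
    unfolding diff by (rule vanishes_sum)
  moreover have "vanishes_below (- (e t\<^sub>0 + 0)) (inverse (sum f J * ?q))"
    by (intro pos_lead_vanishes pos_lead_inverse pos_lead_mult lead q)
  ultimately have "vanishes_below (e t\<^sub>0 + int r + 1 + - (e t\<^sub>0 + 0))
      ((sum g J - sum f J * ?q) * inverse (sum f J * ?q))"
    by (rule vanishes_mult)
  moreover have "(sum g J - sum f J * ?q) * inverse (sum f J * ?q) = sum g J / sum f J / ?q - 1"
  proof -
    have "(A - B * q) * inverse (B * q) = A / B / q - 1" if "B \<noteq> 0" "q \<noteq> 0" for A B q :: series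
      using that by (simp add: field_simps)
    thus ?thesis using nz' by blast
  qed
  ultimately have "vanishes_below (int r + 1) (sum g J / sum f J / ?q - 1)"
    by (simp add: algebra_simps)
  thus ?thesis
    using nz' by (simp add: congr_def near_one_def add.commute)
qed

text \<open>In characteristic 0 the groups of series near 1 have no torsion between consecutive
  levels.\<close>

lemma near_one_root:
  assumes u: "near_one r u" and pow: "near_one (Suc r) (u ^ n)" and n: "0 < n"
    and pos: "r = 0 \<Longrightarrow> \<exists>m. pos_lead m u"
  shows "near_one (Suc r) u"
proof (cases "r = 0")
  case True
  then obtain m where m: "pos_lead m u" using pos by blast
  have p0: "pos_lead 0 (u ^ n)" using near_one_pos_lead[OF pow] by simp
  hence "int n * m = 0" using pos_lead_power[OF m, of n] pos_lead_unique by blast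
  hence m0: "m = 0" using n by simp
  have nth: "(u ^ k) $$ 0 = (u $$ 0) ^ k" for k
  proof (induction k)
    case (Suc k)
    have "fls_subdegree (u ^ k) = 0" "fls_subdegree u = 0"
      using pos_lead_power[of 0 u k] m m0 by (auto simp: pos_lead_def)
    thus ?case using fls_times_base[of u "u ^ k"] Suc by simp
  qed simp
  have "(u ^ n - 1) $$ 0 = 0"
    using pow True by (auto simp: near_one_def vanishes_below_def)
  hence "(u $$ 0) ^ n = 1" by (simp add: nth)
  moreover have "0 < u $$ 0" using m m0 by (simp add: pos_lead_def)
  ultimately have "u $$ 0 = 1" using n power_eq_iff_eq_base[of n "u $$ 0" 1] by simp
  moreover have "vanishes_below 0 u" using m m0 pos_lead_vanishes by simp
  ultimately have "vanishes_below 1 (u - 1)"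
    by (auto simp: vanishes_below_def)
  thus ?thesis using u True by (simp add: near_one_def)
next
  case False
  hence lead: "pos_lead 0 u" using near_one_pos_lead[OF u] by simp
  have *: "pos_lead (Min ((\<lambda>i::nat. 0) ` {..<n})) (\<Sum>i<n. u ^ i)"
  proof (rule pos_lead_sum)
    show "{..<n} \<noteq> {}" using n by auto
    show "pos_lead 0 (u ^ i)" for i using pos_lead_power[OF lead, of i] by simp
  qed simp
  moreover have "(\<lambda>i::nat. 0::int) ` {..<n} = {0}" using n by auto
  ultimately have sum: "pos_lead 0 (\<Sum>i<n. u ^ i)" by simp
  have "vanishes_below (int (Suc r)) (u ^ n - 1)" using pow by (simp add: near_one_def)
  from vanishes_mult[OF this pos_lead_vanishes[OF pos_lead_inverse[OF sum]]]
  have "vanishes_below (int (Suc r)) ((u ^ n - 1) * inverse (\<Sum>i<n. u ^ i))" by simp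
  moreover have "u ^ n - 1 = (u - 1) * (\<Sum>i<n. u ^ i)"
    by (rule power_diff_1_eq)
  moreover have "(u - 1) * (\<Sum>i<n. u ^ i) * inverse (\<Sum>i<n. u ^ i) = u - 1"
    using pos_lead_nonzero[OF sum] by (simp add: mult.assoc)
  ultimately have "vanishes_below (int (Suc r)) (u - 1)" by metis
  thus ?thesis using u by (simp add: near_one_def)
qed

lemma near_one_all_levels:
  assumes "\<And>r. near_one r u"
  shows "u = 1"
proof -
  have "(u - 1) $$ k = 0" for k
    using assms[of "Suc (nat k)"] by (simp add: near_one_def vanishes_below_def)
  hence "u - 1 = 0" by (intro fls_eqI) simp
  thus ?thesis by simp
qed


section \<open>The tropical pair map\<close>

text \<open>The order of a coefficient polynomial at a point whose coordinates have orders \<open>a, b, c\<close> and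
  positive leading coefficients is the least order of its monomials.\<close>

definition tropA :: "step set \<Rightarrow> int \<Rightarrow> int \<Rightarrow> int \<Rightarrow> int" where
  "tropA S e b c = Min ((\<lambda>s. coord 1 s * b + coord 2 s * c) ` {s\<in>S. coord 0 s = e})"

definition tropB :: "step set \<Rightarrow> int \<Rightarrow> int \<Rightarrow> int \<Rightarrow> int" where
  "tropB S e a c = Min ((\<lambda>s. coord 0 s * a + coord 2 s * c) ` {s\<in>S. coord 1 s = e})"

definition phi_trop :: "step set \<Rightarrow> int \<times> int \<times> int \<Rightarrow> int \<times> int \<times> int" where
  "phi_trop S = (\<lambda>(a, b, c). (tropA S (-1) b c - tropA S 1 b c - a, b, c))"

definition psi_trop :: "step set \<Rightarrow> int \<times> int \<times> int \<Rightarrow> int \<times> int \<times> int" where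
  "psi_trop S = (\<lambda>(a, b, c). (a, tropB S (-1) a c - tropB S 1 a c - b, c))"

definition pair_trop :: "step set \<Rightarrow> int \<times> int \<times> int \<Rightarrow> int \<times> int \<times> int" where
  "pair_trop S v = psi_trop S (phi_trop S v)"

definition pos_point :: "int \<times> int \<times> int \<Rightarrow> series \<times> series \<times> series \<Rightarrow> bool" where
  "pos_point = (\<lambda>(a, b, c) (x, y, z). pos_lead a x \<and> pos_lead b y \<and> pos_lead c z)"

interpretation fls_const: constants "fls_const :: rat \<Rightarrow> series"
  by unfold_locales (auto simp: is_hom_def fls_plus_const)

lemma coeffA_at_eq: "coeffA_at S e y z = (\<Sum>s\<in>{s\<in>S. coord 0 s = e}. y powi coord 1 s * z powi coord 2 s)"
  and coeffB_at_eq: "coeffB_at S e x z = (\<Sum>s\<in>{s\<in>S. coord 1 s = e}. x powi coord 0 s * z powi coord 2 s)"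
  unfolding coeffA_at_def coeffB_at_def by (auto intro!: sum.cong)

definition iter_map :: "ratmap \<Rightarrow> nat \<Rightarrow> ratmap" where
  "iter_map F n = (rcomp F ^^ n) rid"

lemma divide_swap: "(p / q) / (p' / q') = (p / p') / (q / q')" for p :: "'k::field"
  by (simp add: mult.commute)

locale pair_model =
  fixes S :: "step set"
  assumes model: "is_model S"
    and nonempty: "e \<in> {-1, 1} \<Longrightarrow> {s\<in>S. coord 0 s = e} \<noteq> {}"
      "e \<in> {-1, 1} \<Longrightarrow> {s\<in>S. coord 1 s = e} \<noteq> {}"
begin

lemma finite_S: "finite S"
  using model unfolding is_model_def by (rule finite_subset) auto

lemma coord_range: "s \<in> S \<Longrightarrow> coord i s \<in> {-1, 0, 1}"
  using model unfolding is_model_def by (cases s) auto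

lemma pos_lead_coeff:
  assumes "pos_lead a x" "pos_lead b y" "pos_lead c z" "e \<in> {-1, 1}"
  shows "pos_lead (tropA S e b c) (coeffA_at S e y z)"
    and "pos_lead (tropB S e a c) (coeffB_at S e x z)"
  unfolding coeffA_at_eq coeffB_at_eq tropA_def tropB_def
  using assms finite_S nonempty
  by (intro pos_lead_sum pos_lead_mult pos_lead_powi; simp)+

lemma phi_pos_point:
  assumes "pos_point v P"
  shows "pos_point (phi_trop S v) (phi_at S P)" "maps_to fls_const (phi S) P (phi_at S P)"
proof -
  obtain a b c x y z where v: "v = (a, b, c)" "P = (x, y, z)" by (cases v; cases P) auto
  have pl: "pos_lead a x" "pos_lead b y" "pos_lead c z" using assms v by (auto simp: pos_point_def)
  note co = pos_lead_coeff(1)[OF pl]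
  show "pos_point (phi_trop S v) (phi_at S P)"
    unfolding v phi_trop_def phi_at_def pos_point_def
    using pl pos_lead_divide[OF pos_lead_divide[OF co[of "-1"] co[of 1]] pl(1)] by simp
  show "maps_to fls_const (phi S) P (phi_at S P)"
    unfolding v
    by (rule fls_const.maps_to_phi) (use pl co[of 1] pos_lead_nonzero in auto)
qed

lemma psi_pos_point:
  assumes "pos_point v P"
  shows "pos_point (psi_trop S v) (psi_at S P)" "maps_to fls_const (psi S) P (psi_at S P)"
proof -
  obtain a b c x y z where v: "v = (a, b, c)" "P = (x, y, z)" by (cases v; cases P) auto
  have pl: "pos_lead a x" "pos_lead b y" "pos_lead c z" using assms v by (auto simp: pos_point_def)
  note co = pos_lead_coeff(2)[OF pl]
  show "pos_point (psi_trop S v) (psi_at S P)"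
    unfolding v psi_trop_def psi_at_def pos_point_def
    using pl pos_lead_divide[OF pos_lead_divide[OF co[of "-1"] co[of 1]] pl(2)] by simp
  show "maps_to fls_const (psi S) P (psi_at S P)"
    unfolding v
    by (rule fls_const.maps_to_psi) (use pl co[of 1] pos_lead_nonzero in auto)
qed

lemma pair_pos_point:
  assumes "pos_point v P"
  shows "pos_point (pair_trop S v) (pair_at S P)" "maps_to fls_const (pair_map S) P (pair_at S P)"
  unfolding pair_trop_def pair_at_def pair_map_def
  using psi_pos_point[OF phi_pos_point(1)[OF assms]] phi_pos_point(2)[OF assms]
  by (auto intro: fls_const.maps_to_rcomp)

lemma iter_pos_point:
  assumes "pos_point v P"
  shows "pos_point ((pair_trop S ^^ n) v) ((pair_at S ^^ n) P)"
    "maps_to fls_const (iter_map (pair_map S) n) P ((pair_at S ^^ n) P)"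
  using assms unfolding iter_map_def
  by (induction n)
     (auto intro: fls_const.maps_to_rid fls_const.maps_to_rcomp pair_pos_point)

lemma iter_fixed_point:
  assumes "pos_point v P" "iter_map (pair_map S) n = rid"
  shows "(pair_at S ^^ n) P = P"
  using iter_pos_point(2)[OF assms(1), of n] fls_const.maps_to_rid fls_const.maps_to_unique
  unfolding assms(2) by blast

lemma pos_lead_fls_X_powi: "pos_lead a (fls_X powi a)"
  using pos_lead_powi[of 1 fls_X a] by (simp add: pos_lead_def)

text \<open>A trivial power of the pair map acts trivially on orders, and every triple of orders occurs at
  some point.\<close>

lemma trop_fixed_point:
  assumes "iter_map (pair_map S) n = rid"
  shows "(pair_trop S ^^ n) v = v"
proof -
  obtain a b c where v: "v = (a, b, c)" by (cases v)
  define P :: "series \<times> series \<times> series" where "P = (fls_X powi a, fls_X powi b, fls_X powi c)"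
  have P: "pos_point v P"
    unfolding v P_def pos_point_def using pos_lead_fls_X_powi by simp
  have "pos_point ((pair_trop S ^^ n) v) P"
    using iter_pos_point(1)[OF P, of n] iter_fixed_point[OF P assms] by simp
  with P show ?thesis
    by (cases "(pair_trop S ^^ n) v"; cases v; cases P)
       (auto simp: pos_point_def dest: pos_lead_unique)
qed


section \<open>Linear behaviour of the pair map at generic points\<close>

text \<open>The least exponent determines the order of a polynomial in a series of positive order, the
  greatest one in a series of negative order.\<close>

definition extreme :: "int \<Rightarrow> int set \<Rightarrow> int" where
  "extreme b J = (if 0 < b then Min J else Max J)"

text \<open>The first exponent of a monomial dominates the second one, which is at most 1 in absolute value,
  once the order of the first coordinate exceeds 2 in absolute value.\<close>

definition agrees :: "int \<Rightarrow> int \<Rightarrow> bool" where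
  "agrees b B \<longleftrightarrow> 0 < b \<and> 2 < B \<or> b < 0 \<and> B < - 2"

lemma extreme_term:
  fixes f g :: "'a \<Rightarrow> int"
  assumes "finite J" "J \<noteq> {}" "inj_on (\<lambda>t. (f t, g t)) J" "\<And>t. t \<in> J \<Longrightarrow> \<bar>g t\<bar> \<le> 1" "b \<noteq> 0"
  shows "\<exists>t\<^sub>0\<in>J. f t\<^sub>0 = extreme b (f ` J) \<and>
    (\<forall>B. agrees b B \<longrightarrow> (\<forall>t\<in>J - {t\<^sub>0}. f t\<^sub>0 * B + g t\<^sub>0 < f t * B + g t))"
proof -
  define m where "m = extreme b (f ` J)"
  have "m \<in> f ` J"
    using assms(1,2) by (auto simp: m_def extreme_def)
  define J0 where "J0 = {t\<in>J. f t = m}"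
  have J0: "finite J0" "J0 \<noteq> {}" using assms(1) \<open>m \<in> f ` J\<close> by (auto simp: J0_def)
  define t0 where "t0 = arg_min_on g J0"
  have t0: "t0 \<in> J0" "\<And>t. t \<in> J0 \<Longrightarrow> g t0 \<le> g t"
    unfolding t0_def using J0 by (auto intro: arg_min_if_finite arg_min_least)
  have t0J: "t0 \<in> J" "f t0 = m" using t0 by (auto simp: J0_def)
  have "f t0 * B + g t0 < f t * B + g t" if B: "agrees b B" and t: "t \<in> J - {t0}" for B t
  proof (cases "f t = m")
    case True
    hence "g t0 \<le> g t" "g t0 \<noteq> g t"
      using t t0 t0J assms(3) by (auto simp: J0_def inj_on_def)
    thus ?thesis using True t0J by simp
  next
    case False
    have *: "\<bar>g t\<bar> \<le> 1" "\<bar>g t0\<bar> \<le> 1" using assms(4) t t0J by auto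
    show ?thesis
    proof (cases "0 < b")
      case True
      hence "m \<le> f t" using t assms(1) by (auto simp: m_def extreme_def)
      hence "m + 1 \<le> f t" using False by simp
      moreover have "2 < B" using B True by (auto simp: agrees_def)
      ultimately have "(m + 1) * B \<le> f t * B" by (intro mult_right_mono) auto
      thus ?thesis using * t0J \<open>2 < B\<close> by (simp add: algebra_simps)
    next
      case b: False
      hence "f t \<le> m" using t assms(1) by (auto simp: m_def extreme_def)
      hence "f t \<le> m - 1" using False by simp
      moreover have "B < -2" using B b by (auto simp: agrees_def)
      ultimately have "(m - 1) * B \<le> f t * B" by (intro mult_right_mono_neg) auto
      thus ?thesis using * t0J \<open>B < -2\<close> by (simp add: algebra_simps)
    qed
  qed
  thus ?thesis using t0J unfolding m_def by blast
qed

text \<open>The contribution of one coefficient polynomial: both its order and its relative change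
  are those of a single monomial, which depends on the sign of \<open>b\<close> only.\<close>

lemma extreme_term_sum:
  fixes f g :: "'a \<Rightarrow> int"
  assumes "finite J" "J \<noteq> {}" "inj_on (\<lambda>t. (f t, g t)) J" "\<And>t. t \<in> J \<Longrightarrow> \<bar>g t\<bar> \<le> 1" "b \<noteq> 0"
  shows "\<exists>d. \<bar>d\<bar> \<le> 1 \<and> (\<forall>B. agrees b B \<longrightarrow>
      Min ((\<lambda>t. f t * B + g t) ` J) = extreme b (f ` J) * B + d)"
    and "\<lbrakk>agrees b B; agrees b B'; pos_lead B y; pos_lead B' y'; pos_lead 1 z; near_one r (y' / y)\<rbrakk>
      \<Longrightarrow> congr (Suc r) ((\<Sum>t\<in>J. y' powi f t * z powi g t) / (\<Sum>t\<in>J. y powi f t * z powi g t))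
           ((y' / y) powi extreme b (f ` J))"
proof -
  obtain t0 where t0: "t0 \<in> J" "f t0 = extreme b (f ` J)"
    "\<And>B t. agrees b B \<Longrightarrow> t \<in> J - {t0} \<Longrightarrow> f t0 * B + g t0 < f t * B + g t"
    using extreme_term[OF assms] by metis
  show "\<exists>d. \<bar>d\<bar> \<le> 1 \<and> (\<forall>B. agrees b B \<longrightarrow>
      Min ((\<lambda>t. f t * B + g t) ` J) = extreme b (f ` J) * B + d)"
  proof (intro exI[of _ "g t0"] conjI allI impI)
    fix B assume "agrees b B"
    hence "f t0 * B + g t0 \<le> f t * B + g t" if "t \<in> J" for t
      using t0(3)[of B t] that by (cases "t = t0") auto
    thus "Min ((\<lambda>t. f t * B + g t) ` J) = extreme b (f ` J) * B + g t0"
      unfolding t0(2)[symmetric] using assms(1) t0(1) by (intro Min_eqI) auto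
  qed (use assms(4) t0 in auto)
  assume B: "agrees b B" "agrees b B'" and y: "pos_lead B y" "pos_lead B' y'" and z: "pos_lead 1 z"
    and near: "near_one r (y' / y)"
  have nz: "y \<noteq> 0" "y' \<noteq> 0" "z \<noteq> 0" using y z pos_lead_nonzero by auto
  have lead: "pos_lead (f t * B + g t) (y powi f t * z powi g t)"
    "pos_lead (f t * B' + g t) (y' powi f t * z powi g t)" for t
    using pos_lead_mult[OF pos_lead_powi[OF y(1), of "f t"] pos_lead_powi[OF z, of "g t"]]
      pos_lead_mult[OF pos_lead_powi[OF y(2), of "f t"] pos_lead_powi[OF z, of "g t"]] by simp_all
  have ratio: "y' powi f t * z powi g t / (y powi f t * z powi g t) = (y' / y) powi f t" for t
    using nz by (simp add: power_int_divide_distrib)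
  have *: "congr (Suc r) ((\<Sum>t\<in>J. y' powi f t * z powi g t) / (\<Sum>t\<in>J. y powi f t * z powi g t))
      (y' powi f t0 * z powi g t0 / (y powi f t0 * z powi g t0))"
    by (rule dominated_sum_ratio[where e = "\<lambda>t. f t * B + g t" and e' = "\<lambda>t. f t * B' + g t",
          OF assms(1) t0(1) lead(1) t0(3)[OF B(1)] lead(2) t0(3)[OF B(2)]])
       (simp_all only: ratio near_one_powi near)
  show "congr (Suc r) ((\<Sum>t\<in>J. y' powi f t * z powi g t) / (\<Sum>t\<in>J. y powi f t * z powi g t))
           ((y' / y) powi extreme b (f ` J))"
    using *[unfolded ratio, unfolded t0(2)] .
qed

definition slopeA :: "int \<Rightarrow> int" where
  "slopeA b = extreme b (coord 1 ` {s\<in>S. coord 0 s = -1}) - extreme b (coord 1 ` {s\<in>S. coord 0 s = 1})"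

definition slopeB :: "int \<Rightarrow> int" where
  "slopeB a = extreme a (coord 0 ` {s\<in>S. coord 1 s = -1}) - extreme a (coord 0 ` {s\<in>S. coord 1 s = 1})"

lemma extreme_cong: "(0 < b \<longleftrightarrow> 0 < b') \<Longrightarrow> extreme b J = extreme b' J"
  by (simp add: extreme_def)

lemma coord_inj:
  "inj_on (\<lambda>s. (coord 1 s, coord 2 s)) {s\<in>S. coord 0 s = e}"
  "inj_on (\<lambda>s. (coord 0 s, coord 2 s)) {s\<in>S. coord 1 s = e}"
  by (auto simp: inj_on_def)

lemma abs_coord: "s \<in> S \<Longrightarrow> \<bar>coord i s\<bar> \<le> 1"
  using coord_range[of s i] by auto

lemma abs_extreme:
  assumes "J \<noteq> {}" "J \<subseteq> S"
  shows "\<bar>extreme b (coord i ` J)\<bar> \<le> 1"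
proof -
  have "finite J" using assms finite_S finite_subset by blast
  hence "extreme b (coord i ` J) \<in> coord i ` J" using assms by (auto simp: extreme_def)
  thus ?thesis using assms(2) abs_coord by auto
qed

lemma abs_slope: "\<bar>slopeA b\<bar> \<le> 2" "\<bar>slopeB b\<bar> \<le> 2"
proof -
  have "\<bar>extreme b (coord 1 ` {s\<in>S. coord 0 s = e})\<bar> \<le> 1"
    "\<bar>extreme b (coord 0 ` {s\<in>S. coord 1 s = e})\<bar> \<le> 1" if "e \<in> {-1, 1}" for e
    using nonempty that by (intro abs_extreme; auto)+
  from this[of "-1"] this[of 1] show "\<bar>slopeA b\<bar> \<le> 2" "\<bar>slopeB b\<bar> \<le> 2"
    unfolding slopeA_def slopeB_def by auto
qed

lemma tropA_linear:
  assumes "b \<noteq> 0"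
  shows "\<exists>d. \<bar>d\<bar> \<le> 2 \<and> (\<forall>B. agrees b B \<longrightarrow> tropA S (-1) B 1 - tropA S 1 B 1 = slopeA b * B + d)"
proof -
  have "\<exists>d. \<bar>d\<bar> \<le> 1 \<and> (\<forall>B. agrees b B \<longrightarrow>
      tropA S e B 1 = extreme b (coord 1 ` {s\<in>S. coord 0 s = e}) * B + d)" if "e \<in> {-1, 1}" for e
    unfolding tropA_def mult_1_right
    using finite_S nonempty that assms abs_coord coord_inj by (intro extreme_term_sum) auto
  from this[of "-1"] this[of 1] obtain d d' where d: "\<bar>d\<bar> \<le> 1" "\<bar>d'\<bar> \<le> 1"
    "\<And>B. agrees b B \<Longrightarrow>
      tropA S (-1) B 1 = extreme b (coord 1 ` {s\<in>S. coord 0 s = -1}) * B + d"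
    "\<And>B. agrees b B \<Longrightarrow>
      tropA S 1 B 1 = extreme b (coord 1 ` {s\<in>S. coord 0 s = 1}) * B + d'"
    by auto
  show ?thesis
    using d(1,2) by (intro exI[of _ "d - d'"]) (auto simp: d(3,4) slopeA_def algebra_simps)
qed

lemma tropB_linear:
  assumes "b \<noteq> 0"
  shows "\<exists>d. \<bar>d\<bar> \<le> 2 \<and> (\<forall>B. agrees b B \<longrightarrow> tropB S (-1) B 1 - tropB S 1 B 1 = slopeB b * B + d)"
proof -
  have "\<exists>d. \<bar>d\<bar> \<le> 1 \<and> (\<forall>B. agrees b B \<longrightarrow>
      tropB S e B 1 = extreme b (coord 0 ` {s\<in>S. coord 1 s = e}) * B + d)" if "e \<in> {-1, 1}" for e
    unfolding tropB_def mult_1_right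
    using finite_S nonempty that assms abs_coord coord_inj by (intro extreme_term_sum) auto
  from this[of "-1"] this[of 1] obtain d d' where d: "\<bar>d\<bar> \<le> 1" "\<bar>d'\<bar> \<le> 1"
    "\<And>B. agrees b B \<Longrightarrow>
      tropB S (-1) B 1 = extreme b (coord 0 ` {s\<in>S. coord 1 s = -1}) * B + d"
    "\<And>B. agrees b B \<Longrightarrow>
      tropB S 1 B 1 = extreme b (coord 0 ` {s\<in>S. coord 1 s = 1}) * B + d'"
    by auto
  show ?thesis
    using d(1,2) by (intro exI[of _ "d - d'"]) (auto simp: d(3,4) slopeB_def algebra_simps)
qed

lemma ratioA:
  assumes "b \<noteq> 0" "agrees b B" "agrees b B'" "pos_lead B y" "pos_lead B' y'" "pos_lead 1 z"
    "near_one r (y' / y)"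
  shows "congr (Suc r)
    ((coeffA_at S (-1) y' z / coeffA_at S 1 y' z) / (coeffA_at S (-1) y z / coeffA_at S 1 y z))
    ((y' / y) powi slopeA b)"
proof -
  have nz: "y' / y \<noteq> 0" using assms(7) by (simp add: near_one_def)
  have "congr (Suc r) (coeffA_at S e y' z / coeffA_at S e y z)
     ((y' / y) powi extreme b (coord 1 ` {s\<in>S. coord 0 s = e}))" if "e \<in> {-1, 1}" for e
    unfolding coeffA_at_eq
    using finite_S nonempty that abs_coord coord_inj assms
    by (intro extreme_term_sum(2)[of _ _ _ b B B']) auto
  from congr_divide[OF this[of "-1"] this[of 1]]
  have "congr (Suc r)
    (coeffA_at S (-1) y' z / coeffA_at S (-1) y z / (coeffA_at S 1 y' z / coeffA_at S 1 y z))
    ((y' / y) powi slopeA b)"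
    by (simp only: slopeA_def power_int_diff nz simp_thms insert_iff)
  thus ?thesis by (simp only: divide_swap)
qed

lemma ratioB:
  assumes "b \<noteq> 0" "agrees b B" "agrees b B'" "pos_lead B x" "pos_lead B' x'" "pos_lead 1 z"
    "near_one r (x' / x)"
  shows "congr (Suc r)
    ((coeffB_at S (-1) x' z / coeffB_at S 1 x' z) / (coeffB_at S (-1) x z / coeffB_at S 1 x z))
    ((x' / x) powi slopeB b)"
proof -
  have nz: "x' / x \<noteq> 0" using assms(7) by (simp add: near_one_def)
  have "congr (Suc r) (coeffB_at S e x' z / coeffB_at S e x z)
     ((x' / x) powi extreme b (coord 0 ` {s\<in>S. coord 1 s = e}))" if "e \<in> {-1, 1}" for e
    unfolding coeffB_at_eq
    using finite_S nonempty that abs_coord coord_inj assms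
    by (intro extreme_term_sum(2)[of _ _ _ b B B']) auto
  from congr_divide[OF this[of "-1"] this[of 1]]
  have "congr (Suc r)
    (coeffB_at S (-1) x' z / coeffB_at S (-1) x z / (coeffB_at S 1 x' z / coeffB_at S 1 x z))
    ((x' / x) powi slopeB b)"
    by (simp only: slopeB_def power_int_diff nz simp_thms insert_iff)
  thus ?thesis by (simp only: divide_swap)
qed

end


section \<open>Pair maps of finite order\<close>

context pair_model
begin

text \<open>The map \<open>vstep\<close> is the limit of the tropical pair map far away from the origin. In the same
  range the map acts on small multiplicative perturbations of a point by monomials, whose exponents
  are collected by \<open>mstep\<close>; a pair of pairs is a 2 by 2 matrix, row by row.\<close>

definition mid :: "int \<times> int \<Rightarrow> int" where
  "mid = (\<lambda>(a, b). slopeA b * b - a)"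

definition vstep :: "int \<times> int \<Rightarrow> int \<times> int" where
  "vstep v = (mid v, slopeB (mid v) * mid v - snd v)"

definition mstep :: "int \<times> int \<Rightarrow> (int \<times> int) \<times> (int \<times> int) \<Rightarrow> (int \<times> int) \<times> (int \<times> int)" where
  "mstep v = (\<lambda>((m1, m2), (n1, n2)).
     let \<alpha> = slopeA (snd v); \<beta> = slopeB (mid v); p1 = \<alpha> * n1 - m1; p2 = \<alpha> * n2 - m2
     in ((p1, p2), (\<beta> * p1 - n1, \<beta> * p2 - n2)))"

fun mats :: "int \<times> int \<Rightarrow> nat \<Rightarrow> (int \<times> int) \<times> (int \<times> int)" where
  "mats v 0 = ((1, 0), (0, 1))"
| "mats v (Suc n) = mstep ((vstep ^^ n) v) (mats v n)"

definition generic :: "int \<times> int \<Rightarrow> bool" where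
  "generic v \<longleftrightarrow> snd v \<noteq> 0 \<and> mid v \<noteq> 0"

definition tracks_step :: "int \<times> int \<Rightarrow> int \<times> int \<times> int \<Rightarrow> bool" where
  "tracks_step v t \<longleftrightarrow> generic v \<and> agrees (snd v) (fst (snd t)) \<and> agrees (mid v) (fst (phi_trop S t))
     \<and> snd (snd t) = 1"

lemma agreesI:
  assumes "\<bar>B - K * b\<bar> \<le> D" "b \<noteq> 0" "D + 2 < K"
  shows "agrees b B"
proof (cases "0 < b")
  case True
  have "K * 1 \<le> K * b" using True assms by (intro mult_left_mono) auto
  thus ?thesis using True assms unfolding agrees_def by auto
next
  case False
  have "K * b \<le> K * (-1)" using False assms by (intro mult_left_mono) auto
  thus ?thesis using False assms unfolding agrees_def by auto
qed

text \<open>The tropical map and its linear limit differ by a bounded amount, so the deviation grows at most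
  geometrically along an orbit. Starting far enough out keeps the orbit in the linear range.\<close>

lemma phi_trop_dev:
  assumes "\<bar>a' - K * a\<bar> \<le> D" "\<bar>b' - K * b\<bar> \<le> D" "b \<noteq> 0" "D + 2 < K"
  shows "\<bar>fst (phi_trop S (a', b', 1)) - K * (slopeA b * b - a)\<bar> \<le> 3 * D + 2"
proof -
  obtain d where d: "\<bar>d\<bar> \<le> 2" "tropA S (-1) b' 1 - tropA S 1 b' 1 = slopeA b * b' + d"
    using tropA_linear[OF assms(3)] agreesI[OF assms(2-4)] by blast
  have "fst (phi_trop S (a', b', 1)) - K * (slopeA b * b - a)
      = slopeA b * (b' - K * b) + d - (a' - K * a)"
    using d(2) by (simp add: phi_trop_def algebra_simps)
  moreover have "\<bar>slopeA b * (b' - K * b)\<bar> \<le> 2 * D"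
    unfolding abs_mult using abs_slope(1)[of b] assms(2) by (intro mult_mono) auto
  ultimately show ?thesis using d(1) assms(1) by linarith
qed

lemma psi_trop_dev:
  assumes "\<bar>a' - K * a\<bar> \<le> D" "\<bar>b' - K * b\<bar> \<le> D" "a \<noteq> 0" "D + 2 < K"
  shows "\<bar>fst (snd (psi_trop S (a', b', 1))) - K * (slopeB a * a - b)\<bar> \<le> 3 * D + 2"
proof -
  obtain d where d: "\<bar>d\<bar> \<le> 2" "tropB S (-1) a' 1 - tropB S 1 a' 1 = slopeB a * a' + d"
    using tropB_linear[OF assms(3)] agreesI[OF assms(1,3,4)] by blast
  have "fst (snd (psi_trop S (a', b', 1))) - K * (slopeB a * a - b)
      = slopeB a * (a' - K * a) + d - (b' - K * b)"
    using d(2) by (simp add: psi_trop_def algebra_simps)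
  moreover have "\<bar>slopeB a * (a' - K * a)\<bar> \<le> 2 * D"
    unfolding abs_mult using abs_slope(2)[of a] assms(1) by (intro mult_mono) auto
  ultimately show ?thesis using d(1) assms(2) by linarith
qed

lemma pair_trop_eq:
  "pair_trop S (a, b, c) =
     (fst (phi_trop S (a, b, c)), fst (snd (psi_trop S (fst (phi_trop S (a, b, c)), b, c))), c)"
  by (simp add: pair_trop_def phi_trop_def psi_trop_def)

lemma tracks_large:
  assumes gen: "\<And>i. generic ((vstep ^^ i) v)" and K: "9 ^ Suc M \<le> K" and "n \<le> M"
  shows "\<exists>a' b'. (pair_trop S ^^ n) (K * fst v, K * snd v, 1) = (a', b', 1)
     \<and> \<bar>a' - K * fst ((vstep ^^ n) v)\<bar> \<le> 9 ^ n - 1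
     \<and> \<bar>b' - K * snd ((vstep ^^ n) v)\<bar> \<le> 9 ^ n - 1
     \<and> tracks_step ((vstep ^^ n) v) (a', b', 1)"
proof -
  have main: "(\<exists>a' b'. (pair_trop S ^^ n) (K * fst v, K * snd v, 1) = (a', b', 1)
     \<and> \<bar>a' - K * fst ((vstep ^^ n) v)\<bar> \<le> 9 ^ n - 1
     \<and> \<bar>b' - K * snd ((vstep ^^ n) v)\<bar> \<le> 9 ^ n - 1)" if "n \<le> M" for n
    using that
  proof (induction n)
    case (Suc n)
    define w where "w = (vstep ^^ n) v"
    define D where "D = (9::int) ^ n - 1"
    from Suc obtain a' b' where ab: "(pair_trop S ^^ n) (K * fst v, K * snd v, 1) = (a', b', 1)"
      "\<bar>a' - K * fst w\<bar> \<le> D" "\<bar>b' - K * snd w\<bar> \<le> D" unfolding w_def D_def by auto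
    have g: "snd w \<noteq> 0" "mid w \<noteq> 0" using gen[of n] by (auto simp: generic_def w_def)
    have "(9::int) ^ Suc (Suc n) \<le> 9 ^ Suc M" using Suc.prems by (intro power_increasing) auto
    from order_trans[OF this K] have K': "9 * (9 * (D + 1)) \<le> K" by (simp add: D_def)
    have D0: "0 \<le> D" by (simp add: D_def)
    define a1 where "a1 = fst (phi_trop S (a', b', 1))"
    have a1: "\<bar>a1 - K * mid w\<bar> \<le> 3 * D + 2"
      using phi_trop_dev[OF ab(2,3) g(1)] K' D0 by (auto simp: a1_def mid_def split: prod.splits)
    define b1 where "b1 = fst (snd (psi_trop S (a1, b', 1)))"
    have "\<bar>b1 - K * (slopeB (mid w) * mid w - snd w)\<bar> \<le> 3 * (3 * D + 2) + 2"
      unfolding b1_def using a1 ab(3) D0 K' by (intro psi_trop_dev g(2)) auto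
    moreover have "(pair_trop S ^^ Suc n) (K * fst v, K * snd v, 1) = (a1, b1, 1)"
      by (simp add: ab(1) pair_trop_eq a1_def b1_def)
    moreover have "3 * D + 2 \<le> 9 * (D + 1) - 1" "3 * (3 * D + 2) + 2 \<le> 9 * (D + 1) - 1"
      using D0 by simp_all
    moreover have "9 ^ Suc n - 1 = 9 * (D + 1) - 1" by (simp add: D_def)
    moreover have "(vstep ^^ Suc n) v = (mid w, slopeB (mid w) * mid w - snd w)"
      by (simp add: vstep_def w_def)
    ultimately show ?case using a1 by (intro exI[of _ a1] exI[of _ b1]) auto
  qed simp
  define w where "w = (vstep ^^ n) v"
  define D where "D = (9::int) ^ n - 1"
  from main[OF \<open>n \<le> M\<close>] obtain a' b' where
    ab: "(pair_trop S ^^ n) (K * fst v, K * snd v, 1) = (a', b', 1)"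
      "\<bar>a' - K * fst w\<bar> \<le> D" "\<bar>b' - K * snd w\<bar> \<le> D" unfolding w_def D_def by auto
  have g: "generic w" "snd w \<noteq> 0" "mid w \<noteq> 0" using gen[of n] by (auto simp: generic_def w_def)
  have "(9::int) ^ Suc n \<le> 9 ^ Suc M" using \<open>n \<le> M\<close> by (intro power_increasing) auto
  from order_trans[OF this K] have K': "9 * (D + 1) \<le> K" by (simp add: D_def)
  have D0: "0 \<le> D" by (simp add: D_def)
  have "agrees (snd w) b'" using ab(3) g K' D0 by (intro agreesI[of b' K _ D]) auto
  moreover have "\<bar>fst (phi_trop S (a', b', 1)) - K * mid w\<bar> \<le> 3 * D + 2"
    using phi_trop_dev[OF ab(2,3) g(2)] K' D0 by (auto simp: mid_def split: prod.splits)
  hence "agrees (mid w) (fst (phi_trop S (a', b', 1)))"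
    using g K' D0 by (intro agreesI[of _ K _ "3 * D + 2"]) auto
  ultimately have "tracks_step w (a', b', 1)" using g by (simp add: tracks_step_def)
  thus ?thesis using ab unfolding w_def D_def by blast
qed

lemma pair_at_z: "snd (snd (pair_at S P)) = snd (snd P)"
  by (cases P) (simp add: pair_at_def phi_at_def psi_at_def)

lemma ratio_step:
  assumes "pos_point t (x, y, z)" "pos_point t' (x', y', z)" "tracks_step v t" "tracks_step v t'"
    and near: "near_one r (x' / x)" "near_one r (y' / y)"
    and c: "congr (Suc r) (x' / x) u" "congr (Suc r) (y' / y) w"
  defines "u' \<equiv> w powi slopeA (snd v) / u"
  shows "congr (Suc r) (fst (pair_at S (x', y', z)) / fst (pair_at S (x, y, z))) u'"
    and "congr (Suc r) (fst (snd (pair_at S (x', y', z))) / fst (snd (pair_at S (x, y, z))))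
           (u' powi slopeB (mid v) / w)"
proof -
  obtain a b a' b' where t: "t = (a, b, 1)" "t' = (a', b', 1)"
    using assms(3,4) unfolding tracks_step_def by (cases t; cases t') auto
  have pl: "pos_lead a x" "pos_lead b y" "pos_lead 1 z" "pos_lead a' x'" "pos_lead b' y'"
    using assms(1,2) by (auto simp: pos_point_def t)
  have g: "snd v \<noteq> 0" "mid v \<noteq> 0" "agrees (snd v) b" "agrees (snd v) b'"
    "agrees (mid v) (fst (phi_trop S t))" "agrees (mid v) (fst (phi_trop S t'))"
    using assms(3,4) by (auto simp: tracks_step_def generic_def t)
  define x1 where "x1 = coeffA_at S (-1) y z / coeffA_at S 1 y z / x"
  define x1' where "x1' = coeffA_at S (-1) y' z / coeffA_at S 1 y' z / x'"
  have phi: "phi_at S (x, y, z) = (x1, y, z)" "phi_at S (x', y', z) = (x1', y', z)"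
    by (simp_all add: phi_at_def x1_def x1'_def)
  have px: "pos_lead (fst (phi_trop S t)) x1" "pos_lead (fst (phi_trop S t')) x1'"
    using phi_pos_point(1)[OF assms(1)] phi_pos_point(1)[OF assms(2)] unfolding phi
    by (auto simp: pos_point_def split: prod.splits)
  have "x1' / x1 = (coeffA_at S (-1) y' z / coeffA_at S 1 y' z)
      / (coeffA_at S (-1) y z / coeffA_at S 1 y z) / (x' / x)"
    unfolding x1_def x1'_def by (rule divide_swap)
  moreover have "congr (Suc r) ((coeffA_at S (-1) y' z / coeffA_at S 1 y' z)
      / (coeffA_at S (-1) y z / coeffA_at S 1 y z)) (w powi slopeA (snd v))"
    using congr_trans[OF ratioA[OF g(1,3,4) pl(2,5,3) near(2)] congr_powi[OF c(2)]] .
  ultimately have c1: "congr (Suc r) (x1' / x1) u'"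
    unfolding u'_def using congr_divide[OF _ c(1)] by metis
  have near1: "near_one r (x1' / x1)"
  proof (rule near_one_congr[OF congr_mono[OF c1]])
    have "near_one r u" "near_one r w"
      using near c near_one_congr congr_sym congr_mono by (metis le_SucI order_refl)+
    thus "near_one r u'" unfolding u'_def by (intro near_one_divide near_one_powi)
  qed simp
  define y1 where "y1 = coeffB_at S (-1) x1 z / coeffB_at S 1 x1 z / y"
  define y1' where "y1' = coeffB_at S (-1) x1' z / coeffB_at S 1 x1' z / y'"
  have pair: "pair_at S (x, y, z) = (x1, y1, z)" "pair_at S (x', y', z) = (x1', y1', z)"
    by (simp_all add: pair_at_def phi psi_at_def y1_def y1'_def)
  have "y1' / y1 = (coeffB_at S (-1) x1' z / coeffB_at S 1 x1' z)
      / (coeffB_at S (-1) x1 z / coeffB_at S 1 x1 z) / (y' / y)"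
    unfolding y1_def y1'_def by (rule divide_swap)
  moreover have "congr (Suc r) ((coeffB_at S (-1) x1' z / coeffB_at S 1 x1' z)
      / (coeffB_at S (-1) x1 z / coeffB_at S 1 x1 z)) (u' powi slopeB (mid v))"
    using congr_trans[OF ratioB[OF g(2,5,6) px pl(3) near1] congr_powi[OF c1]] .
  ultimately have "congr (Suc r) (y1' / y1) (u' powi slopeB (mid v) / w)"
    using congr_divide[OF _ c(2)] by metis
  with c1 show "congr (Suc r) (fst (pair_at S (x', y', z)) / fst (pair_at S (x, y, z))) u'"
    "congr (Suc r) (fst (snd (pair_at S (x', y', z))) / fst (snd (pair_at S (x, y, z))))
           (u' powi slopeB (mid v) / w)"
    unfolding pair by simp_all
qed

text \<open>The relative change of two neighbouring orbits is the monomial change predicted by the matrices,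
  up to terms of higher order.\<close>

lemma ratio_run:
  assumes "pos_point t P" "pos_point t' P'" "snd (snd P') = snd (snd P)"
    and tr: "\<And>i. i < n \<Longrightarrow> tracks_step ((vstep ^^ i) v) ((pair_trop S ^^ i) t)"
      "\<And>i. i < n \<Longrightarrow> tracks_step ((vstep ^^ i) v) ((pair_trop S ^^ i) t')"
    and near: "near_one r (fst P' / fst P)" "near_one r (fst (snd P') / fst (snd P))"
  shows "congr (Suc r) (fst ((pair_at S ^^ n) P') / fst ((pair_at S ^^ n) P))
      ((fst P' / fst P) powi fst (fst (mats v n)) * (fst (snd P') / fst (snd P)) powi snd (fst (mats v n)))
    \<and> congr (Suc r) (fst (snd ((pair_at S ^^ n) P')) / fst (snd ((pair_at S ^^ n) P)))
      ((fst P' / fst P) powi fst (snd (mats v n)) * (fst (snd P') / fst (snd P)) powi snd (snd (mats v n)))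
    \<and> snd (snd ((pair_at S ^^ n) P')) = snd (snd ((pair_at S ^^ n) P))"
  using tr
proof (induction n)
  case 0
  have "fst P' / fst P \<noteq> 0" "fst (snd P') / fst (snd P) \<noteq> 0"
    using near by (auto simp: near_one_def)
  thus ?case using assms(3) by (auto intro: congr_refl)
next
  case (Suc n)
  let ?u0 = "fst P' / fst P" and ?w0 = "fst (snd P') / fst (snd P)"
  have nz: "?u0 \<noteq> 0" "?w0 \<noteq> 0" using near by (auto simp: near_one_def)
  obtain m1 m2 n1 n2 where m: "mats v n = ((m1, m2), (n1, n2))" by (metis surj_pair)
  obtain x y z where Q: "(pair_at S ^^ n) P = (x, y, z)" by (metis surj_pair)
  obtain x' y' z' where Q': "(pair_at S ^^ n) P' = (x', y', z')" by (metis surj_pair)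
  have IH: "congr (Suc r) (x' / x) (?u0 powi m1 * ?w0 powi m2)"
    "congr (Suc r) (y' / y) (?u0 powi n1 * ?w0 powi n2)" "z' = z"
    using Suc.IH Suc.prems by (auto simp: m Q Q')
  have pp: "pos_point ((pair_trop S ^^ n) t) (x, y, z)" "pos_point ((pair_trop S ^^ n) t') (x', y', z)"
    using iter_pos_point(1)[OF assms(1), of n] iter_pos_point(1)[OF assms(2), of n] IH(3)
    by (simp_all add: Q Q')
  have near': "near_one r (x' / x)" "near_one r (y' / y)"
    by (rule near_one_congr[OF congr_mono[OF IH(1)]] near_one_congr[OF congr_mono[OF IH(2)]];
        simp add: near_one_mult near_one_powi near)+
  note st = ratio_step[OF pp Suc.prems(1)[of n] Suc.prems(2)[of n] near' IH(1,2)]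
  define v' where "v' = (vstep ^^ n) v"
  have split: "(?u0 powi p * ?w0 powi q) powi k / (?u0 powi p' * ?w0 powi q')
      = ?u0 powi (k * p - p') * ?w0 powi (k * q - q')" for p q k p' q'
  proof -
    have "(?u0 powi p * ?w0 powi q) powi k = ?u0 powi (k * p) * ?w0 powi (k * q)"
      by (simp only: power_int_mult_distrib power_int_mult mult.commute[of k])
    thus ?thesis by (simp only: power_int_diff nz simp_thms times_divide_times_eq)
  qed
  have ms: "mats v (Suc n) = ((slopeA (snd v') * n1 - m1, slopeA (snd v') * n2 - m2),
     (slopeB (mid v') * (slopeA (snd v') * n1 - m1) - n1,
      slopeB (mid v') * (slopeA (snd v') * n2 - m2) - n2))"
    by (simp add: m mstep_def v'_def Let_def)
  have "(pair_at S ^^ Suc n) P = pair_at S (x, y, z)" "(pair_at S ^^ Suc n) P' = pair_at S (x', y', z)"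
    by (simp_all add: Q Q' IH(3))
  moreover have "snd (snd (pair_at S (x', y', z))) = snd (snd (pair_at S (x, y, z)))"
    by (simp add: pair_at_z)
  ultimately show ?case
    using st unfolding split v'_def[symmetric] by (simp add: ms del: mats.simps)
qed

lemma prod_congr:
  "(\<And>i. i < n \<Longrightarrow> congr r (u i) w) \<Longrightarrow> congr r (\<Prod>i<n. u i) (w ^ n)"
proof (induction n)
  case 0
  thus ?case by (simp add: congr_refl)
next
  case (Suc n)
  have "congr r ((\<Prod>i<n. u i) * u n) (w ^ n * w)"
    using Suc by (intro congr_mult) auto
  thus ?case by (simp add: mult.commute)
qed

lemma telescope:
  assumes "\<And>i. f i \<noteq> (0::series)"
  shows "(\<Prod>i<n. f (Suc i) / f i) = f n / f 0"
  using assms by (induction n) (auto simp: divide_simps)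

text \<open>A map of finite order that is tangent to the identity is trivial: its orbit has constant
  quotients of consecutive points up to higher order terms, and the product of these quotients
  is 1.\<close>

lemma finite_order_fixes_points:
  assumes gen: "\<And>i. generic ((vstep ^^ i) v)"
    and per: "(vstep ^^ q) v = v" "mats v q = ((1, 0), (0, 1))"
    and order: "iter_map (pair_map S) N = rid" "0 < N"
    and K: "9 ^ Suc (q * Suc N) \<le> K"
    and P: "pos_point (K * fst v, K * snd v, 1) P"
  shows "(pair_at S ^^ q) P = P"
proof -
  define t where "t i = (pair_trop S ^^ (q * i)) (K * fst v, K * snd v, 1)" for i
  define Q where "Q i = (pair_at S ^^ (q * i)) P" for i
  define X where "X i = fst (Q i)" for i
  define Y where "Y i = fst (snd (Q i))" for i
  have Qs: "Q (i + j) = (pair_at S ^^ (q * j)) (Q i)" for i j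
    by (simp add: Q_def funpow_add[symmetric, THEN fun_cong, unfolded comp_def] algebra_simps)
  have ts: "(pair_trop S ^^ k) (t i) = (pair_trop S ^^ (q * i + k)) (K * fst v, K * snd v, 1)" for i k
    by (simp add: t_def funpow_add[symmetric, THEN fun_cong, unfolded comp_def] add.commute)
  have vper: "(vstep ^^ (q * i + k)) v = (vstep ^^ k) v" for i k
  proof (induction i)
    case (Suc i)
    have "(vstep ^^ (q * Suc i + k)) v = (vstep ^^ (q * i + k)) ((vstep ^^ q) v)"
      by (simp add: funpow_add[symmetric, THEN fun_cong, unfolded comp_def] algebra_simps)
    thus ?case using Suc per(1) by simp
  qed simp
  have pp: "pos_point (t i) (Q i)" for i
    unfolding t_def Q_def by (rule iter_pos_point(1)[OF P])
  have z: "snd (snd (Q i)) = snd (snd P)" for i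
  proof -
    have "snd (snd ((pair_at S ^^ k) P)) = snd (snd P)" for k
      by (induction k) (auto simp: pair_at_z)
    thus ?thesis by (simp add: Q_def)
  qed
  have tr: "tracks_step ((vstep ^^ k) v) ((pair_trop S ^^ k) (t i))" if "k < q" "i \<le> N" for i k
  proof -
    have "q * i + k \<le> q * Suc N"
    proof -
      show ?thesis using mult_le_mono2[OF that(2), of q] that(1)
        by (simp only: mult_Suc_right)
    qed
    from tracks_large[OF gen K this] show ?thesis
      unfolding ts vper by auto
  qed
  have nz: "X i \<noteq> 0" "Y i \<noteq> 0" for i
    using pp[of i] pos_lead_nonzero by (auto simp: X_def Y_def pos_point_def split: prod.splits)
  have step: "congr (Suc r) (X (Suc (Suc i)) / X (Suc i)) (X (Suc i) / X i) \<and>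
      congr (Suc r) (Y (Suc (Suc i)) / Y (Suc i)) (Y (Suc i) / Y i)"
    if "near_one r (X (Suc i) / X i)" "near_one r (Y (Suc i) / Y i)" "Suc i \<le> N" for r i
    using ratio_run[OF pp[of i] pp[of "Suc i"] _ tr[of _ i] tr[of _ "Suc i"], of q r] that
      Qs[of i 1] Qs[of "Suc i" 1]
    by (simp add: z per(2) X_def Y_def)
  have last: "Q N = Q 0"
  proof -
    have "(pair_at S ^^ (k * N)) P = P" for k
      using iter_fixed_point[OF P order(1)]
      by (induction k) (simp_all add: funpow_add)
    thus ?thesis by (simp add: Q_def)
  qed
  have near: "\<forall>i<N. near_one r (X (Suc i) / X i) \<and> near_one r (Y (Suc i) / Y i)" for r
  proof (induction r)
    case 0
    show ?case using nz by (auto simp: near_one_def)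
  next
    case (Suc r)
    have c: "congr (Suc r) (X (Suc i) / X i) (X 1 / X 0) \<and> congr (Suc r) (Y (Suc i) / Y i) (Y 1 / Y 0)"
      if "i < N" for i
      using that
    proof (induction i)
      case 0
      show ?case using nz by (auto intro: congr_refl)
    next
      case (Suc i)
      thus ?case using step[of r i] \<open>\<forall>i<N. _ i\<close> by (auto intro: congr_trans)
    qed
    have root: "near_one (Suc r) (Z 1 / Z 0)"
      if Z: "\<And>i. i < N \<Longrightarrow> congr (Suc r) (Z (Suc i) / Z i) (Z 1 / Z 0)"
        "Z N = Z 0" "near_one r (Z 1 / Z 0)" "\<And>i. \<exists>m. pos_lead m (Z i)" for Z
    proof (rule near_one_root[OF Z(3) _ order(2)])
      have Znz: "Z i \<noteq> 0" for i using Z(4)[of i] pos_lead_nonzero by auto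
      have "congr (Suc r) (\<Prod>i<N. Z (Suc i) / Z i) ((Z 1 / Z 0) ^ N)"
        by (rule prod_congr) (rule Z(1))
      hence "congr (Suc r) 1 ((Z 1 / Z 0) ^ N)"
        using telescope[of Z N] Znz Z(2) by simp
      thus "near_one (Suc r) ((Z 1 / Z 0) ^ N)"
        using near_one_congr[OF congr_sym near_one_1] by blast
      show "\<exists>m. pos_lead m (Z 1 / Z 0)"
        using Z(4)[of 0] Z(4)[of 1] pos_lead_divide by blast
    qed
    have plX: "\<exists>m. pos_lead m (X i)" and plY: "\<exists>m. pos_lead m (Y i)" for i
      using pp[of i] by (auto simp: X_def Y_def pos_point_def split: prod.splits)
    have "near_one (Suc r) (X 1 / X 0)" "near_one (Suc r) (Y 1 / Y 0)"
      using c Suc.IH order(2) last plX plY by (intro root; force simp: X_def Y_def)+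
    thus ?case using c near_one_congr by blast
  qed
  have "near_one r (X 1 / X 0)" "near_one r (Y 1 / Y 0)" for r
    using near[of r] order(2) by (simp_all only: One_nat_def)
  hence "X 1 / X 0 = 1" "Y 1 / Y 0 = 1" by (intro near_one_all_levels; blast)+
  hence "X 1 = X 0" "Y 1 = Y 0" using nz by auto
  hence "Q 1 = Q 0" using z[of 1] z[of 0] unfolding X_def Y_def by (metis prod.expand)
  thus ?thesis by (simp add: Q_def)
qed

end


lemma poly_coeffs_zero:
  fixes e :: "nat \<Rightarrow> 'k::field"
  assumes "infinite T" "\<And>t. t \<in> T \<Longrightarrow> (\<Sum>j\<le>d. e j * t ^ j) = 0" "j \<le> d"
  shows "e j = 0"
proof -
  define Q where "Q = (\<Sum>j\<le>d. Polynomial.monom (e j) j)"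
  have "poly Q t = 0" if "t \<in> T" for t
    using assms(2)[OF that] by (simp add: Q_def poly_sum poly_monom)
  hence "T \<subseteq> {t. poly Q t = 0}" by auto
  hence "infinite {t. poly Q t = 0}" using assms(1) finite_subset by blast
  hence "Q = 0" using poly_roots_finite by blast
  hence "Polynomial.coeff Q j = 0" by simp
  thus ?thesis using assms(3) by (simp add: Q_def coeff_sum)
qed

lemma poly_map_poly_sum:
  fixes f :: "'a::zero \<Rightarrow> 'b::comm_ring_1"
  assumes "degree p \<le> d" "f 0 = 0"
  shows "poly (map_poly f p) x = (\<Sum>i\<le>d. f (Polynomial.coeff p i) * x ^ i)"
proof -
  have "poly (map_poly f p) x = (\<Sum>i\<le>degree (map_poly f p). f (Polynomial.coeff p i) * x ^ i)"
    by (simp add: poly_altdef coeff_map_poly assms(2))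
  also have "\<dots> = (\<Sum>i\<le>d. f (Polynomial.coeff p i) * x ^ i)"
  proof (rule sum.mono_neutral_left)
    have "degree (map_poly f p) \<le> d"
      using assms by (intro degree_le) (auto simp: coeff_map_poly coeff_eq_0)
    thus "{..degree (map_poly f p)} \<subseteq> {..d}" by auto
    show "\<forall>i\<in>{..d} - {..degree (map_poly f p)}. f (Polynomial.coeff p i) * x ^ i = 0"
    proof
      fix i assume "i \<in> {..d} - {..degree (map_poly f p)}"
      hence "Polynomial.coeff (map_poly f p) i = 0" by (intro coeff_eq_0) auto
      thus "f (Polynomial.coeff p i) * x ^ i = 0" by (simp add: coeff_map_poly assms(2))
    qed
  qed simp
  finally show ?thesis .
qed

lemma fls_X_independent:
  assumes "(\<Sum>k\<le>d. fls_const (a k) * fls_X ^ k) = (0 :: series)" "k \<le> d"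
  shows "a k = 0"
proof -
  have sum: "fls_nth (\<Sum>i\<in>I. g i) n = (\<Sum>i\<in>I. fls_nth (g i) n)" if "finite I"
    for I :: "nat set" and g :: "nat \<Rightarrow> series" and n
    using that by induction auto
  have "fls_nth (fls_const b * fls_X ^ i) (int k) = (if i = k then b else 0)" for b :: rat and i
    by (simp add: fls_X_power_nth)
  hence "fls_nth (\<Sum>i\<le>d. fls_const (a i) * fls_X ^ i) (int k) = (\<Sum>i\<le>d. if i = k then a i else 0)"
    by (simp add: sum)
  thus ?thesis using assms by simp
qed

definition test_point :: "int \<Rightarrow> int \<Rightarrow> rat \<Rightarrow> rat \<Rightarrow> series \<times> series \<times> series" where
  "test_point a b l m = (fls_const l * fls_X powi a, fls_const m * fls_X powi b, fls_X)"

text \<open>The points with fixed orders and arbitrary positive leading coefficients are dense.\<close>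

lemma test_points_dense:
  assumes "\<And>l m. 0 < l \<Longrightarrow> 0 < m \<Longrightarrow> peval_at fls_const r (test_point a b l m) = 0"
  shows "r = 0"
proof -
  define c :: "nat \<Rightarrow> nat \<Rightarrow> nat \<Rightarrow> rat" where "c k j i = Polynomial.coeff (Polynomial.coeff (Polynomial.coeff r k) j) i" for k j i
  define d where "d = Max (insert (degree r) ((\<lambda>k. Max (insert (degree (Polynomial.coeff r k))
      ((\<lambda>j. degree (Polynomial.coeff (Polynomial.coeff r k) j)) ` {..degree (Polynomial.coeff r k)}))) ` {..degree r}))"
  have d0: "degree r \<le> d" by (simp add: d_def)
  have dk: "Max (insert (degree (Polynomial.coeff r k)) ((\<lambda>j. degree (Polynomial.coeff (Polynomial.coeff r k) j)) ` {..degree (Polynomial.coeff r k)})) \<le> d"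
    if "k \<le> degree r" for k
    unfolding d_def by (rule Max_ge) (use that in auto)
  have d1: "degree (Polynomial.coeff r k) \<le> d" for k
  proof (cases "k \<le> degree r")
    case True
    show ?thesis by (rule order_trans[OF _ dk[OF True]]) simp
  qed (simp add: coeff_eq_0)
  have d2: "degree (Polynomial.coeff (Polynomial.coeff r k) j) \<le> d" for k j
  proof (cases "k \<le> degree r \<and> j \<le> degree (Polynomial.coeff r k)")
    case True
    show ?thesis
      by (rule order_trans[OF Max_ge dk[OF conjunct1[OF True]]]) (use True in auto)
  qed (auto simp: coeff_eq_0)
  define u :: series where "u = fls_X powi a"
  define v :: series where "v = fls_X powi b"
  have uv: "u \<noteq> 0" "v \<noteq> 0" by (simp_all add: u_def v_def)
  have expand: "peval_at fls_const r (x, y, z) =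
      (\<Sum>k\<le>d. \<Sum>j\<le>d. \<Sum>i\<le>d. fls_const (c k j i) * x ^ i * y ^ j * z ^ k)" for x y z :: series
    unfolding peval_at_def case_prod_conv
    by (simp add: poly_map_poly_sum[OF d0] poly_map_poly_sum[OF d1] poly_map_poly_sum[OF d2] c_def
        sum_distrib_right)
  have inf: "infinite (fls_const ` {0<..} :: series set)"
  proof -
    have "infinite {0::rat<..}" by (rule infinite_Ioi)
    moreover have "inj (fls_const :: rat \<Rightarrow> series)" by (rule injI) (metis fls_const_nth)
    ultimately show ?thesis by (simp add: finite_image_iff inj_on_subset)
  qed
  have "c k j i = 0" if "k \<le> d" "j \<le> d" "i \<le> d" for k j i
  proof -
    have y: "(\<Sum>k\<le>d. \<Sum>i\<le>d. fls_const (c k j i) * (fls_const l * u) ^ i * fls_X ^ k) * v ^ j = 0"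
      if l: "0 < l" and "j \<le> d" for l j
    proof (rule poly_coeffs_zero[OF inf _ \<open>j \<le> d\<close>])
      fix t :: series assume "t \<in> fls_const ` {0<..}"
      then obtain m where m: "t = fls_const m" "0 < m" by auto
      have "0 = peval_at fls_const r (test_point a b l m)" using assms[OF l m(2)] by simp
      also have "\<dots> = (\<Sum>k\<le>d. \<Sum>j\<le>d. \<Sum>i\<le>d. fls_const (c k j i) * (fls_const l * u) ^ i * (t * v) ^ j * fls_X ^ k)"
        unfolding test_point_def expand by (simp add: u_def v_def m)
      also have "\<dots> = (\<Sum>j\<le>d. \<Sum>k\<le>d. \<Sum>i\<le>d. fls_const (c k j i) * (fls_const l * u) ^ i * (t * v) ^ j * fls_X ^ k)"
        by (rule sum.swap)
      also have "\<dots> = (\<Sum>j\<le>d. (\<Sum>k\<le>d. \<Sum>i\<le>d. fls_const (c k j i) * (fls_const l * u) ^ i * fls_X ^ k) * v ^ j * t ^ j)"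
        by (simp only: sum_distrib_right power_mult_distrib) (simp only: mult_ac)
      finally show "(\<Sum>j\<le>d. (\<Sum>k\<le>d. \<Sum>i\<le>d. fls_const (c k j i) * (fls_const l * u) ^ i * fls_X ^ k) * v ^ j * t ^ j) = 0"
        by simp
    qed
    have "(\<Sum>k\<le>d. fls_const (c k j i) * fls_X ^ k) * u ^ i = 0"
    proof (rule poly_coeffs_zero[OF inf _ \<open>i \<le> d\<close>])
      fix t :: series assume "t \<in> fls_const ` {0<..}"
      then obtain l where l: "t = fls_const l" "0 < l" by auto
      have "0 = (\<Sum>k\<le>d. \<Sum>i\<le>d. fls_const (c k j i) * (t * u) ^ i * fls_X ^ k)"
        using y[OF l(2) \<open>j \<le> d\<close>] uv l(1) by simp
      also have "\<dots> = (\<Sum>i\<le>d. \<Sum>k\<le>d. fls_const (c k j i) * (t * u) ^ i * fls_X ^ k)"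
        by (rule sum.swap)
      also have "\<dots> = (\<Sum>i\<le>d. (\<Sum>k\<le>d. fls_const (c k j i) * fls_X ^ k) * u ^ i * t ^ i)"
        by (simp only: sum_distrib_right power_mult_distrib) (simp only: mult_ac)
      finally show "(\<Sum>i\<le>d. (\<Sum>k\<le>d. fls_const (c k j i) * fls_X ^ k) * u ^ i * t ^ i) = 0" by simp
    qed
    hence "(\<Sum>k\<le>d. fls_const (c k j i) * fls_X ^ k) = 0" using uv by simp
    thus ?thesis using fls_X_independent[of "\<lambda>k. c k j i" d k] \<open>k \<le> d\<close> by simp
  qed
  moreover have "c k j i = 0" if out: "\<not> (k \<le> d \<and> j \<le> d \<and> i \<le> d)" for k j i
  proof -
    consider "d < k" | "d < j" | "d < i" using out by linarith
    thus ?thesis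
    proof cases
      case 1
      hence "Polynomial.coeff r k = 0" using d0 by (intro coeff_eq_0) auto
      thus ?thesis by (simp add: c_def)
    next
      case 2
      hence "Polynomial.coeff (Polynomial.coeff r k) j = 0" using d1[of k] by (intro coeff_eq_0) auto
      thus ?thesis by (simp add: c_def)
    next
      case 3
      thus ?thesis using d2[of k j] by (simp add: c_def coeff_eq_0)
    qed
  qed
  ultimately have "c k j i = 0" for k j i by blast
  thus "r = 0" unfolding c_def by (intro poly_eqI) simp
qed

lemma rational_map_determined:
  assumes "\<And>l m. 0 < l \<Longrightarrow> 0 < m \<Longrightarrow>
     has_value fls_const f (test_point a b l m) (peval_at fls_const p (test_point a b l m))"
  shows "f = Fract p 1"
proof -
  obtain u w where f: "f = Fract u w" "w \<noteq> 0" by (cases f) auto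
  have "(u - p * w) * w = 0"
  proof (rule test_points_dense)
    fix l m :: rat assume lm: "0 < l" "0 < m"
    define P where "P = test_point a b l m"
    show "peval_at fls_const ((u - p * w) * w) (test_point a b l m) = 0"
    proof (cases "peval_at fls_const w P = 0")
      case False
      hence "peval_at fls_const u P / peval_at fls_const w P = peval_at fls_const p P"
        using assms[OF lm] fls_const.has_value_Fract[OF False, of u] fls_const.has_value_unique
        unfolding f(1) P_def by blast
      thus ?thesis using False by (simp add: P_def field_simps)
    qed (simp add: P_def)
  qed
  hence "u = p * w" using f(2) by simp
  thus ?thesis using f by (simp add: eq_fract)
qed

context pair_model
begin

text \<open>A trivial power of the pair map yields a trivial \<open>q\<close>-th power, where \<open>q\<close> is the period of
  the linear limit at a generic direction: the \<open>q\<close>-th power fixes all points in this direction with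
  positive leading coefficients, and these points are dense.\<close>

theorem finite_order_period:
  assumes gen: "\<And>i. generic ((vstep ^^ i) v)"
    and per: "(vstep ^^ q) v = v" "mats v q = ((1, 0), (0, 1))"
    and order: "iter_map (pair_map S) N = rid" "0 < N"
  shows "iter_map (pair_map S) q = rid"
proof -
  \<comment> \<open>One application of the pair map multiplies the deviation from linearity by at most 9, and
    the orbit has to be followed for \<open>q * N\<close> steps.\<close>
  define K :: int where "K = 9 ^ Suc (q * Suc N)"
  define a b where "a = K * fst v" and "b = K * snd v"
  have "pos_lead (0 + a) (fls_const l * fls_X powi a)" if "0 < l" for l a
    by (intro pos_lead_mult pos_lead_fls_X_powi) (use that in \<open>auto simp: pos_lead_def\<close>)
  hence pp: "pos_point (a, b, 1) (test_point a b l m)" if "0 < l" "0 < m" for l m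
    using that by (auto simp: pos_point_def test_point_def) (simp add: pos_lead_def)
  have "maps_to fls_const (iter_map (pair_map S) q) (test_point a b l m) (test_point a b l m)"
    if "0 < l" "0 < m" for l m
    using iter_pos_point(2)[OF pp[OF that], of q]
      finite_order_fixes_points[OF gen per order, of K] pp[OF that]
    unfolding a_def b_def K_def by auto
  note maps = this
  obtain f g h where F: "iter_map (pair_map S) q = (f, g, h)" by (metis surj_pair)
  have "f = Fract [:[:[:0, 1:]:]:] 1" "g = Fract [:[:0, 1:]:] 1" "h = Fract [:0, 1:] 1"
    using maps unfolding F maps_to_def
    by (auto intro!: rational_map_determined[of _ a b] simp: test_point_def)
  thus ?thesis unfolding F rid_def vX_def vY_def vZ_def by simp
qed

end


section \<open>Infinite groups from pair maps of infinite order\<close>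

interpretation rat_point: constants "of_rat :: rat \<Rightarrow> rat"
  by (rule constants_of_rat)

text \<open>These conditions make the coefficients of both signs non-zero for all three coordinates, so the
  generators are involutions in the group of birational maps.\<close>

locale octant_model =
  fixes S :: "step set"
  assumes model: "is_model S"
    and nonempty: "i < 3 \<Longrightarrow> e \<in> {-1, 1} \<Longrightarrow> {s\<in>S. coord i s = e} \<noteq> {}"

sublocale octant_model \<subseteq> pair_model
  using model nonempty[of 0] nonempty[of 1] by unfold_locales auto

context octant_model
begin

text \<open>At the point (1, 1, 1) a coefficient polynomial counts its monomials.\<close>

lemma coeff_nonzero:
  assumes "e \<in> {-1, 1}"
  shows "coeffA S e \<noteq> 0" "coeffB S e \<noteq> 0" "coeffC S e \<noteq> 0"
proof -
  have card: "of_nat (card {s\<in>S. coord i s = e}) \<noteq> (0 :: rat)" if "i < 3" for i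
  proof -
    have "finite {s\<in>S. coord i s = e}" using finite_S by (rule rev_finite_subset) blast
    hence "card {s\<in>S. coord i s = e} \<noteq> 0" using nonempty[OF that assms] card_0_eq by blast
    thus ?thesis by (simp only: of_nat_eq_0_iff not_False_eq_True)
  qed
  have c: "coeffA_at S e 1 1 = (of_nat (card {s\<in>S. coord 0 s = e}) :: rat)"
    "coeffB_at S e 1 1 = (of_nat (card {s\<in>S. coord 1 s = e}) :: rat)"
    unfolding coeffA_at_eq coeffB_at_eq by simp_all
  have v: "has_value (of_rat :: rat \<Rightarrow> rat) (coeffA S e) (1, 1, 1) (of_nat (card {s\<in>S. coord 0 s = e}))"
    "has_value (of_rat :: rat \<Rightarrow> rat) (coeffB S e) (1, 1, 1) (of_nat (card {s\<in>S. coord 1 s = e}))"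
    unfolding c[symmetric] by (rule rat_point.has_value_coeff; simp)+
  have "has_value (of_rat :: rat \<Rightarrow> rat) (coeffC S e) (1, 1, 1) (\<Sum>s\<in>{s\<in>S. coord 2 s = e}. 1)"
    unfolding coeffC_def
  proof (rule rat_point.has_value_sum)
    fix s :: step
    obtain i j k where s: "s = (i, j, k)" by (cases s)
    have "has_value (of_rat :: rat \<Rightarrow> rat) (vX powi i * vY powi j) (1, 1, 1) (1 powi i * 1 powi j)"
      by (intro rat_point.has_value_mult rat_point.has_value_powi rat_point.has_value_var) simp_all
    thus "has_value (of_rat :: rat \<Rightarrow> rat) (case s of (i, j, k) \<Rightarrow> vX powi i * vY powi j) (1, 1, 1) 1"
      by (simp add: s)
  qed
  hence "has_value (of_rat :: rat \<Rightarrow> rat) (coeffC S e) (1, 1, 1) (of_nat (card {s\<in>S. coord 2 s = e}))"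
    by simp
  note v = v this
  have "f \<noteq> 0" if "has_value (of_rat :: rat \<Rightarrow> rat) f (1, 1, 1) (h :: rat)" "h \<noteq> 0" for f h
    using that rat_point.has_value_unique[OF rat_point.has_value_0] by blast
  from this[OF v(1) card[of 0]] this[OF v(2) card[of 1]] this[OF v(3) card[of 2]]
  show "coeffA S e \<noteq> 0" "coeffB S e \<noteq> 0" "coeffC S e \<noteq> 0" by simp_all
qed

lemma generators_in_Bir: "{phi S, psi S, tau S} \<subseteq> carrier Bir"
  using phi_involution(1)[of S] psi_involution(1)[of S] tau_involution(1)[of S]
    coeff_nonzero[of "-1"] coeff_nonzero[of 1] by simp

lemma group_model_group: "group (model_group S)"
  unfolding model_group_def
  using group.generate_is_subgroup[OF group_Bir generators_in_Bir] group_Bir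
  by (rule subgroup.subgroup_is_group)

lemma finite_group_finite_order:
  assumes "finite (carrier (model_group S))"
  shows "\<exists>N>0. iter_map (pair_map S) N = rid"
proof -
  interpret G: group "model_group S" by (rule group_model_group)
  have mult: "x \<otimes>\<^bsub>model_group S\<^esub> y = rcomp x y" for x y
    by (simp add: model_group_def Bir_def)
  have one: "\<one>\<^bsub>model_group S\<^esub> = rid" by (simp add: model_group_def Bir_def)
  have "phi S \<in> generate Bir {phi S, psi S, tau S}" "psi S \<in> generate Bir {phi S, psi S, tau S}"
    by (auto intro: generate.incl)
  hence T: "pair_map S \<in> carrier (model_group S)"
    using G.m_closed[of "psi S" "phi S"] by (simp add: model_group_def pair_map_def Bir_def)
  have pow: "pair_map S [^]\<^bsub>model_group S\<^esub> n = iter_map (pair_map S) n" for n :: nat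
  proof (induction n)
    case 0
    show ?case by (simp add: iter_map_def one)
  next
    case (Suc n)
    thus ?case using G.nat_pow_Suc2[OF T, of n] by (simp add: iter_map_def mult)
  qed
  have "0 < order (model_group S)" using assms by (simp add: G.order_gt_0_iff_finite)
  moreover have "iter_map (pair_map S) (order (model_group S)) = rid"
    using G.pow_order_eq_1[OF T] by (simp add: pow one)
  ultimately show ?thesis by blast
qed

end


section \<open>Which power of the pair map can be trivial\<close>

text \<open>The pair map multiplies the orders at a generic point by an integral piecewise linear map
  of the plane, which depends on four slopes only. The table gives its period for all slopes
  that occur, and 0 if it has none.\<close>

definition period_table :: "((int \<times> int \<times> int \<times> int) \<times> nat) list" where
  "period_table = [
    ((-2, -2, -1, -1), 4), ((-2, -1, -2, -1), 4), ((-2, -1, -1, -1), 7), ((-2, 0, 0, -1), 3),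
    ((-1, -2, -1, -2), 4), ((-1, -2, -1, -1), 7), ((-1, -1, -2, -2), 4),
    ((-1, -1, -2, -1), 7), ((-1, -1, -1, -2), 7), ((-1, -1, -1, -1), 3),
    ((-1, -1, -1, 0), 8), ((-1, -1, 0, -1), 8), ((-1, 0, -1, -1), 8), ((-1, 0, -1, 0), 7),
    ((-1, 0, 0, -2), 3), ((-1, 0, 0, -1), 5), ((-1, 0, 1, -1), 7), ((-1, 1, 0, -1), 7),
    ((-1, 1, 0, 0), 2), ((-1, 1, 0, 1), 7), ((0, -2, -1, 0), 3), ((0, -1, -2, 0), 3),
    ((0, -1, -1, -1), 8), ((0, -1, -1, 0), 5), ((0, -1, -1, 1), 7), ((0, -1, 0, -1), 7),
    ((0, 0, -1, 1), 2), ((0, 0, 0, 0), 2), ((0, 0, 1, -1), 2), ((0, 1, -1, 1), 7),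
    ((0, 1, 0, 1), 5), ((0, 1, 0, 2), 3), ((0, 1, 1, 0), 7), ((0, 1, 1, 1), 8),
    ((0, 2, 0, 1), 3), ((1, -1, -1, 0), 7), ((1, -1, 0, 0), 2), ((1, -1, 1, 0), 7),
    ((1, 0, 0, 1), 7), ((1, 0, 1, -1), 7), ((1, 0, 1, 0), 5), ((1, 0, 1, 1), 8),
    ((1, 0, 2, 0), 3), ((1, 1, 0, 1), 8), ((1, 1, 1, 0), 8), ((1, 1, 1, 1), 3),
    ((1, 1, 1, 2), 7), ((1, 1, 2, 1), 7), ((1, 1, 2, 2), 4), ((1, 2, 1, 1), 7),
    ((1, 2, 2, 1), 4), ((2, 0, 1, 0), 3), ((2, 0, 2, 0), 0), ((2, 1, 1, 1), 7),
    ((2, 1, 1, 2), 4), ((2, 1, 2, 1), 0), ((2, 1, 2, 2), 0), ((2, 2, 1, 1), 4),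
    ((2, 2, 2, 1), 0)]"

type_synonym linear_state = "(int \<times> int) \<times> (int \<times> int) \<times> (int \<times> int)"

text \<open>A version of \<open>vstep\<close> and \<open>mstep\<close> that computes with given slopes. All slopes are tested with
  the direction (301, 100), which is generic for every row of the table with a period.\<close>

definition slope_step :: "int \<times> int \<times> int \<times> int \<Rightarrow> linear_state \<Rightarrow> linear_state" where
  "slope_step = (\<lambda>(p, m, p', m') ((a, b), (m1, m2), (n1, n2)).
     let \<alpha> = (if 0 < b then p else m); a' = \<alpha> * b - a; \<beta> = (if 0 < a' then p' else m');
         k1 = \<alpha> * n1 - m1; k2 = \<alpha> * n2 - m2
     in ((a', \<beta> * a' - b), (k1, k2), (\<beta> * k1 - n1, \<beta> * k2 - n2)))"

definition slope_generic :: "int \<times> int \<times> int \<times> int \<Rightarrow> linear_state \<Rightarrow> bool" where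
  "slope_generic = (\<lambda>(p, m, p', m') ((a, b), M). b \<noteq> 0 \<and> (if 0 < b then p else m) * b - a \<noteq> 0)"

primrec slope_run :: "nat \<Rightarrow> int \<times> int \<times> int \<times> int \<Rightarrow> linear_state \<Rightarrow> bool" where
  "slope_run 0 c st \<longleftrightarrow> st = ((301, 100), (1, 0), (0, 1))"
| "slope_run (Suc n) c st \<longleftrightarrow> slope_generic c st \<and> slope_run n c (slope_step c st)"

definition period_ok :: "(int \<times> int \<times> int \<times> int) \<times> nat \<Rightarrow> bool" where
  "period_ok = (\<lambda>(c, q). if q = 0 then fst c = 2 \<and> fst (snd (snd c)) = 2
     else slope_run q c ((301, 100), (1, 0), (0, 1)))"

lemma slope_run_numeral:
  "slope_run (numeral k) c st \<longleftrightarrow> slope_generic c st \<and> slope_run (pred_numeral k) c (slope_step c st)"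
  by (simp add: numeral_eq_Suc)

lemma period_table_ok: "list_all period_ok period_table"
  by code_simp

context octant_model
begin

definition slopes :: "int \<times> int \<times> int \<times> int" where
  "slopes = (slopeA 1, slopeA (-1), slopeB 1, slopeB (-1))"

lemma slope_sign:
  "slopeA b = (if 0 < b then slopeA 1 else slopeA (-1))"
  "slopeB b = (if 0 < b then slopeB 1 else slopeB (-1))"
  unfolding slopeA_def slopeB_def extreme_def by auto

lemma slope_step_eq: "slope_step slopes (v, mats w n) = (vstep v, mstep v (mats w n))"
  and slope_generic_eq: "slope_generic slopes (v, M) \<longleftrightarrow> generic v"
proof -
  define p m p' m' where pm: "p = slopeA 1" "m = slopeA (-1)" "p' = slopeB 1" "m' = slopeB (-1)"
  have s: "slopeA b = (if 0 < b then p else m)" "slopeB b = (if 0 < b then p' else m')" for b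
    unfolding pm by (rule slope_sign)+
  have sl: "slopes = (p, m, p', m')" by (simp add: slopes_def pm)
  show "slope_step slopes (v, mats w n) = (vstep v, mstep v (mats w n))"
  proof -
    obtain a b where v: "v = (a, b)" by (cases v)
    obtain m1 m2 n1 n2 where M: "mats w n = ((m1, m2), (n1, n2))" by (metis surj_pair)
    show ?thesis
      unfolding sl slope_step_def vstep_def mid_def mstep_def v M s Let_def case_prod_conv
        fst_conv snd_conv by (rule refl)
  qed
  show "slope_generic slopes (v, M) \<longleftrightarrow> generic v"
  proof -
    obtain a b where v: "v = (a, b)" by (cases v)
    show ?thesis
      unfolding sl slope_generic_def generic_def mid_def s v case_prod_conv fst_conv snd_conv
      by (rule refl)
  qed
qed

lemma slope_run_sound:
  assumes "slope_run q slopes ((vstep ^^ n) v, mats v n)"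
  shows "(\<forall>i<q. generic ((vstep ^^ (n + i)) v)) \<and> (vstep ^^ (n + q)) v = (301, 100)
     \<and> mats v (n + q) = ((1, 0), (0, 1))"
  using assms
proof (induction q arbitrary: n)
  case (Suc q)
  hence 1: "generic ((vstep ^^ n) v)" "slope_run q slopes ((vstep ^^ Suc n) v, mats v (Suc n))"
    by (simp_all add: slope_generic_eq slope_step_eq)
  from Suc.IH[OF 1(2)] have 2: "(\<forall>i<q. generic ((vstep ^^ (Suc n + i)) v))"
    "(vstep ^^ (n + Suc q)) v = (301, 100)" "mats v (n + Suc q) = ((1, 0), (0, 1))" by simp_all
  have "generic ((vstep ^^ (n + i)) v)" if "i < Suc q" for i
    using 1(1) 2(1) that by (cases i) auto
  thus ?case using 2 by blast
qed auto

text \<open>For period 0 both positive slopes are 2, and the orbit of the orders (1, 2) runs off to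
  infinity along the diagonal.\<close>

theorem period_sound:
  assumes "(slopes, q) \<in> set period_table" "iter_map (pair_map S) N = rid" "0 < N"
  shows "q \<noteq> 0" "iter_map (pair_map S) q = rid"
proof -
  have ok: "period_ok (slopes, q)"
    using assms(1) period_table_ok by (auto simp: list_all_iff)
  show q: "q \<noteq> 0"
  proof
    assume "q = 0"
    hence sl: "slopeA 1 = 2" "slopeB 1 = 2" using ok by (auto simp: period_ok_def slopes_def)
    have A: "tropA S (-1) b 0 - tropA S 1 b 0 = 2 * b" if "0 < b" for b
    proof -
      have "tropA S e b 0 = extreme 1 (coord 1 ` {s\<in>S. coord 0 s = e}) * b" if "e \<in> {-1, 1}" for e
      proof -
        have "mono (\<lambda>j. j * b)" using \<open>0 < b\<close> by (auto simp: mono_def intro: mult_right_mono)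
        from mono_Min_commute[OF this, of "coord 1 ` {s\<in>S. coord 0 s = e}"] show ?thesis
          using finite_S nonempty[of 0 e] that by (simp add: tropA_def extreme_def image_image)
      qed
      thus ?thesis using sl(1) by (simp add: slopeA_def algebra_simps flip: distrib_left)
    qed
    have B: "tropB S (-1) b 0 - tropB S 1 b 0 = 2 * b" if "0 < b" for b
    proof -
      have "tropB S e b 0 = extreme 1 (coord 0 ` {s\<in>S. coord 1 s = e}) * b" if "e \<in> {-1, 1}" for e
      proof -
        have "mono (\<lambda>j. j * b)" using \<open>0 < b\<close> by (auto simp: mono_def intro: mult_right_mono)
        from mono_Min_commute[OF this, of "coord 0 ` {s\<in>S. coord 1 s = e}"] show ?thesis
          using finite_S nonempty[of 1 e] that by (simp add: tropB_def extreme_def image_image)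
      qed
      thus ?thesis using sl(2) by (simp add: slopeB_def algebra_simps flip: distrib_left)
    qed
    have "(pair_trop S ^^ n) (1, 2, 0) = (1 + 2 * int n, 2 + 2 * int n, 0)" for n
      by (induction n) (simp_all add: pair_trop_def phi_trop_def psi_trop_def A B)
    thus False using trop_fixed_point[OF assms(2), of "(1, 2, 0)"] assms(3) by simp
  qed
  let ?v = "(301, 100) :: int \<times> int"
  from ok q have "slope_run q slopes (?v, mats ?v 0)" by (simp add: period_ok_def)
  from slope_run_sound[of q 0 ?v] this have *: "\<forall>i<q. generic ((vstep ^^ i) ?v)"
    "(vstep ^^ q) ?v = ?v" "mats ?v q = ((1, 0), (0, 1))" by simp_all
  have "generic ((vstep ^^ i) ?v)" for i
  proof -
    have "(vstep ^^ i) ?v = (vstep ^^ (i mod q)) ?v"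
      by (rule funpow_mod_eq[OF *(2), symmetric])
    thus ?thesis using *(1) q by simp
  qed
  from finite_order_period[OF this *(2,3) assms(2,3)]
  show "iter_map (pair_map S) q = rid" .
qed

end


section \<open>Permuting the coordinates\<close>

definition var_at :: "nat \<Rightarrow> ratfun" where
  "var_at i = (if i = 0 then vX else if i = 1 then vY else vZ)"

definition tuple3 :: "(nat \<Rightarrow> ratfun) \<Rightarrow> ratmap" where
  "tuple3 f = (f 0, f 1, f 2)"

definition gen_coeff :: "step set \<Rightarrow> nat \<Rightarrow> int \<Rightarrow> ratfun" where
  "gen_coeff S i e = (\<Sum>s\<in>{s\<in>S. coord i s = e}. \<Prod>j\<in>{..<3} - {i}. var_at j powi coord j s)"

definition gen_map :: "step set \<Rightarrow> nat \<Rightarrow> ratmap" where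
  "gen_map S i = tuple3 (\<lambda>j. if j = i then 1 / var_at i * (gen_coeff S i (-1) / gen_coeff S i 1)
     else var_at j)"

lemma coord_sel: "coord 0 s = fst s" "coord 1 s = fst (snd s)" "coord 2 s = snd (snd s)"
  by (cases s; simp)+

lemma lessThan_3: "{..<3::nat} = {0, 1, 2}"
  by auto

lemma gen_coeff_eq: "gen_coeff S 0 e = coeffA S e" "gen_coeff S 1 e = coeffB S e"
    "gen_coeff S 2 e = coeffC S e"
proof -
  have *: "{..<3::nat} - {0} = {1, 2}" "{..<3::nat} - {1} = {0, 2}" "{..<3::nat} - {2} = {0, 1}"
    by auto
  show "gen_coeff S 0 e = coeffA S e" "gen_coeff S 1 e = coeffB S e" "gen_coeff S 2 e = coeffC S e"
    unfolding gen_coeff_def coeffA_def coeffB_def coeffC_def *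
    by (auto intro!: sum.cong simp: var_at_def)
qed

lemma gen_map_eq: "gen_map S 0 = phi S" "gen_map S 1 = psi S" "gen_map S 2 = tau S"
  using gen_coeff_eq[of S]
  by (simp_all add: gen_map_def tuple3_def phi_def psi_def tau_def var_at_def)

lemma is_subst_var_at: "i < 3 \<Longrightarrow> is_subst (var_at i) (tuple3 f) (f i)"
  using is_subst_var by (auto simp: var_at_def tuple3_def numeral_eq_Suc less_Suc_eq)

lemma var_at_nonzero: "var_at i \<noteq> 0"
  by (simp add: var_at_def)

lemma rcomp_tuple3:
  assumes "\<And>i. i < 3 \<Longrightarrow> is_subst (f i) G (g i)"
  shows "rcomp (tuple3 f) G = tuple3 g"
  using assms[of 0] assms[of 1] assms[of 2] by (simp add: tuple3_def rsubst_eqI)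

text \<open>A permutation of the coordinates of the steps conjugates the generators by the corresponding
  permutation of the variables.\<close>

definition perm_map :: "(nat \<Rightarrow> nat) \<Rightarrow> ratmap" where
  "perm_map \<sigma> = tuple3 (\<lambda>i. var_at (\<sigma> i))"

context
  fixes \<sigma> :: "nat \<Rightarrow> nat"
  assumes perm: "\<sigma> permutes {..<3}"
begin

lemma perm_less: "i < 3 \<Longrightarrow> \<sigma> i < 3"
  using permutes_in_image[OF perm, of i] by simp

lemma perm_eq: "\<sigma> i = \<sigma> j \<longleftrightarrow> i = j"
  using permutes_inj[OF perm] by (auto simp: inj_def)

lemma coord_permute_step: "i < 3 \<Longrightarrow> coord i (permute_step \<sigma> s) = coord (\<sigma> i) s"
  by (auto simp: permute_step_def numeral_eq_Suc less_Suc_eq)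

lemma inj_permute_step: "inj (permute_step \<sigma>)"
proof (rule injI)
  fix s t assume st: "permute_step \<sigma> s = permute_step \<sigma> t"
  have "coord i s = coord i t" if "i < 3" for i
  proof -
    have "i \<in> \<sigma> ` {..<3}" using permutes_image[OF perm] that by simp
    then obtain j where "j < 3" "\<sigma> j = i" by auto
    thus ?thesis using arg_cong[OF st, of "coord j"] by (simp add: coord_permute_step)
  qed
  from this[of 0] this[of 1] this[of 2] show "s = t" 
    by (simp add: coord_sel coord_sel(2)[unfolded One_nat_def] prod_eq_iff)
qed

lemma perm_map_subst:
  assumes "i < 3"
  shows "is_subst (gen_coeff (permute_step \<sigma> ` S) i e) (perm_map \<sigma>) (gen_coeff S (\<sigma> i) e)"
proof -
  let ?S = "permute_step \<sigma> ` S"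
  have "is_subst (gen_coeff ?S i e) (perm_map \<sigma>)
      (\<Sum>s\<in>{s\<in>?S. coord i s = e}. \<Prod>j\<in>{..<3} - {i}. var_at (\<sigma> j) powi coord j s)"
    unfolding gen_coeff_def
  proof (rule is_subst_sum)
    fix s
    have *: "is_subst (\<Prod>j\<in>J. var_at j powi coord j s) (perm_map \<sigma>) (\<Prod>j\<in>J. var_at (\<sigma> j) powi coord j s)"
      if "J \<subseteq> {..<3}" for J
    proof -
      have "finite J" using that finite_subset by blast
      thus ?thesis using that
      proof (induction J)
        case (insert j J)
        have "j < 3" using insert.prems by simp
        hence "is_subst (var_at j powi coord j s) (perm_map \<sigma>) (var_at (\<sigma> j) powi coord j s)"
          unfolding perm_map_def by (intro is_subst_powi is_subst_var_at var_at_nonzero)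
        moreover have "is_subst (\<Prod>j\<in>J. var_at j powi coord j s) (perm_map \<sigma>)
            (\<Prod>j\<in>J. var_at (\<sigma> j) powi coord j s)"
          using insert.IH insert.prems by blast
        ultimately show ?case
          unfolding prod.insert[OF insert.hyps(1,2)] by (rule is_subst_mult)
      qed (simp add: is_subst_1)
    qed
    show "is_subst (\<Prod>j\<in>{..<3} - {i}. var_at j powi coord j s) (perm_map \<sigma>)
       (\<Prod>j\<in>{..<3} - {i}. var_at (\<sigma> j) powi coord j s)" by (rule *[of "{..<3} - {i}"]) blast
  qed
  also have "(\<Sum>s\<in>{s\<in>?S. coord i s = e}. \<Prod>j\<in>{..<3} - {i}. var_at (\<sigma> j) powi coord j s)
     = (\<Sum>s\<in>{s\<in>S. coord (\<sigma> i) s = e}. \<Prod>j\<in>{..<3} - {i}. var_at (\<sigma> j) powi coord (\<sigma> j) s)"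
  proof -
    have "{s\<in>?S. coord i s = e} = permute_step \<sigma> ` {s\<in>S. coord (\<sigma> i) s = e}"
      using coord_permute_step[OF assms] by auto
    thus ?thesis
      by (auto simp: sum.reindex[OF inj_on_subset[OF inj_permute_step]] coord_permute_step
          intro!: sum.cong prod.cong)
  qed
  also have "\<dots> = gen_coeff S (\<sigma> i) e"
  proof -
    have "{..<3} - {\<sigma> i} = \<sigma> ` ({..<3} - {i})"
      using permutes_image[OF perm] by (auto simp: perm_eq perm_less)
    thus ?thesis
      unfolding gen_coeff_def by (auto simp: prod.reindex[OF permutes_inj_on[OF perm]] intro!: sum.cong)
  qed
  finally show ?thesis .
qed

lemma perm_map_gen:
  assumes "i < 3" "gen_coeff S (\<sigma> i) 1 \<noteq> 0"
  shows "rcomp (perm_map \<sigma>) (gen_map S (\<sigma> i)) = rcomp (gen_map (permute_step \<sigma> ` S) i) (perm_map \<sigma>)"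
proof -
  define g where "g j = (if j = i then 1 / var_at (\<sigma> i) * (gen_coeff S (\<sigma> i) (-1) / gen_coeff S (\<sigma> i) 1)
     else var_at (\<sigma> j))" for j
  have "rcomp (perm_map \<sigma>) (gen_map S (\<sigma> i)) = tuple3 g"
    unfolding perm_map_def
  proof (rule rcomp_tuple3)
    fix j :: nat assume "j < 3"
    from is_subst_var_at[OF perm_less[OF this], of "\<lambda>j. if j = \<sigma> i
      then 1 / var_at (\<sigma> i) * (gen_coeff S (\<sigma> i) (-1) / gen_coeff S (\<sigma> i) 1) else var_at j"]
    show "is_subst (var_at (\<sigma> j)) (gen_map S (\<sigma> i)) (g j)"
      unfolding gen_map_def g_def by (simp only: perm_eq)
  qed
  moreover have "rcomp (gen_map (permute_step \<sigma> ` S) i) (perm_map \<sigma>) = tuple3 g"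
    unfolding gen_map_def
  proof (rule rcomp_tuple3)
    fix j :: nat assume j: "j < 3"
    have v: "is_subst (var_at k) (perm_map \<sigma>) (var_at (\<sigma> k))" if "k < 3" for k
      unfolding perm_map_def using is_subst_var_at[OF that] .
    show "is_subst (if j = i then 1 / var_at i * (gen_coeff (permute_step \<sigma> ` S) i (- 1) /
        gen_coeff (permute_step \<sigma> ` S) i 1) else var_at j) (perm_map \<sigma>) (g j)"
      using j assms
      by (auto simp: g_def var_at_nonzero
          intro!: v is_subst_mult is_subst_divide is_subst_1 perm_map_subst)
  qed
  ultimately show ?thesis by simp
qed

end

lemma perm_map_comp:
  assumes "\<sigma> permutes {..<3}" "\<rho> permutes {..<3}"
  shows "rcomp (perm_map \<sigma>) (perm_map \<rho>) = perm_map (\<rho> \<circ> \<sigma>)"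
  unfolding perm_map_def
  by (rule rcomp_tuple3) (use is_subst_var_at[OF perm_less[OF assms(1)]] in \<open>simp add: comp_def\<close>)

lemma perm_map_id: "perm_map id = rid"
  by (simp add: perm_map_def tuple3_def var_at_def rid_def)

lemma perm_map_Bir:
  assumes "\<sigma> permutes {..<3}"
  shows "perm_map \<sigma> \<in> carrier Bir"
proof -
  have dom: "dominant (perm_map \<rho>)" if "\<rho> permutes {..<3}" for \<rho>
  proof -
    have "is_subst (var_at (\<rho> i)) (perm_map (inv_into UNIV \<rho>)) (var_at i)" if "i < 3" for i
      using is_subst_var_at[OF perm_less[OF \<open>\<rho> permutes {..<3}\<close> that], of "\<lambda>j. var_at (inv_into UNIV \<rho> j)"]
        permutes_inverses(2)[OF \<open>\<rho> permutes {..<3}\<close>]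
      by (simp add: perm_map_def)
    from this[of 0] this[of 1] this[of 2] show ?thesis
      unfolding perm_map_def[of \<rho>] tuple3_def by (intro dominantI) (simp_all add: var_at_def)
  qed
  have i: "inv_into UNIV \<sigma> permutes {..<3}" using permutes_inv[OF assms] .
  have "rcomp (perm_map \<sigma>) (perm_map (inv_into UNIV \<sigma>)) = rid" "rcomp (perm_map (inv_into UNIV \<sigma>)) (perm_map \<sigma>) = rid"
    by (simp_all add: perm_map_comp[OF assms i] perm_map_comp[OF i assms] permutes_inv_o[OF assms]
        perm_map_id)
  hence "birational (perm_map \<sigma>)"
    unfolding birational_def using dom[OF assms] dom[OF i] by blast
  thus ?thesis by (simp add: Bir_def)
qed

lemma model_group_permute:
  assumes perm: "\<sigma> permutes {..<3}" and gens: "{phi S, psi S, tau S} \<subseteq> carrier Bir"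
    and coeffs: "\<And>i. i < 3 \<Longrightarrow> gen_coeff S i 1 \<noteq> 0"
  shows "\<exists>f. bij_betw f (carrier (model_group S)) (carrier (model_group (permute_step \<sigma> ` S)))"
proof -
  interpret B: group Bir by (rule group_Bir)
  define p where "p = perm_map \<sigma>"
  have p: "p \<in> carrier Bir" unfolding p_def by (rule perm_map_Bir[OF perm])
  define h where "h F = p \<otimes>\<^bsub>Bir\<^esub> F \<otimes>\<^bsub>Bir\<^esub> inv\<^bsub>Bir\<^esub> p" for F
  interpret h: group_hom Bir Bir h
  proof unfold_locales
    show "h \<in> hom Bir Bir"
      using p by (auto simp: hom_def h_def B.m_assoc B.inv_solve_left)
  qed
  have set3: "{phi T, psi T, tau T} = gen_map T ` {..<3}" for T
    by (simp only: lessThan_3 image_insert image_empty gen_map_eq)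
  have G: "gen_map S i \<in> carrier Bir" if "i < 3" for i
    using gens that unfolding set3 by auto
  have "h (gen_map S (\<sigma> i)) = gen_map (permute_step \<sigma> ` S) i" if "i < 3" for i
  proof -
    have "p \<otimes>\<^bsub>Bir\<^esub> gen_map S (\<sigma> i) = rcomp (gen_map (permute_step \<sigma> ` S) i) p"
      using perm_map_gen[OF perm that(1) coeffs[OF perm_less[OF perm that(1)]]]
      by (simp add: p_def Bir_def)
    hence "h (gen_map S (\<sigma> i)) = rcomp (rcomp (gen_map (permute_step \<sigma> ` S) i) p) (inv\<^bsub>Bir\<^esub> p)"
      by (simp add: h_def) (simp add: Bir_def)
    also have "\<dots> = rcomp (gen_map (permute_step \<sigma> ` S) i) (rcomp p (inv\<^bsub>Bir\<^esub> p))"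
      using p B.inv_closed[OF p] by (intro rcomp_assoc) (auto simp: Bir_def birational_def)
    also have "rcomp p (inv\<^bsub>Bir\<^esub> p) = rid"
      using B.r_inv[OF p] by (simp add: Bir_def)
    finally show ?thesis by (simp add: rcomp_rid)
  qed
  hence "h ` gen_map S ` {..<3} = gen_map (permute_step \<sigma> ` S) ` {..<3}"
    using permutes_image[OF perm] by (metis (no_types, lifting) image_cong image_image lessThan_iff)
  hence "carrier (model_group (permute_step \<sigma> ` S)) = h ` carrier (model_group S)"
    using h.generate_img[OF gens] by (simp add: model_group_def set3)
  moreover have "inj_on h (carrier (model_group S))"
  proof (rule inj_on_inverseI)
    fix F assume "F \<in> carrier (model_group S)"
    hence F: "F \<in> carrier Bir" using B.generate_incl[OF gens] by (auto simp: model_group_def)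
    have "inv\<^bsub>Bir\<^esub> p \<otimes>\<^bsub>Bir\<^esub> (p \<otimes>\<^bsub>Bir\<^esub> F) = F"
      using p F by (simp add: B.m_assoc[symmetric])
    thus "inv\<^bsub>Bir\<^esub> p \<otimes>\<^bsub>Bir\<^esub> h F \<otimes>\<^bsub>Bir\<^esub> p = F"
      using p F by (simp add: h_def B.m_assoc)
  qed
  ultimately show ?thesis by (auto simp: bij_betw_def)
qed


section \<open>Arithmetic modulo 11 by tables\<close>

text \<open>Residues are constructors of a datatype, so that evaluation by rewriting is a table lookup.\<close>

datatype g11 = G0 | G1 | G2 | G3 | G4 | G5 | G6 | G7 | G8 | G9 | G10

primrec g_val :: "g11 \<Rightarrow> nat" where
  "g_val G0 = 0" | "g_val G1 = 1" | "g_val G2 = 2" | "g_val G3 = 3" | "g_val G4 = 4" | "g_val G5 = 5"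
| "g_val G6 = 6" | "g_val G7 = 7" | "g_val G8 = 8" | "g_val G9 = 9" | "g_val G10 = 10"

definition g_of :: "nat \<Rightarrow> g11" where
  "g_of n = [G0, G1, G2, G3, G4, G5, G6, G7, G8, G9, G10] ! (n mod 11)"

definition g_add :: "g11 \<Rightarrow> g11 \<Rightarrow> g11" where "g_add a b = g_of (g_val a + g_val b)"
definition g_mul :: "g11 \<Rightarrow> g11 \<Rightarrow> g11" where "g_mul a b = g_of (g_val a * g_val b)"
text \<open>This is the inverse of a non-zero residue by the theorem of Fermat, and 0 for 0. So a quotient
  with vanishing denominator becomes 0 and is noticed by a test for non-zero results.\<close>

definition g_inv :: "g11 \<Rightarrow> g11" where "g_inv a = g_of (g_val a ^ 9)"
definition g_eq :: "g11 \<Rightarrow> g11 \<Rightarrow> bool" where "g_eq a b \<longleftrightarrow> a = b"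

lemma g_add_table:
  "g_add G0 G0 = G0" "g_add G0 G1 = G1" "g_add G0 G2 = G2" "g_add G0 G3 = G3" "g_add G0 G4 = G4"
  "g_add G0 G5 = G5" "g_add G0 G6 = G6" "g_add G0 G7 = G7" "g_add G0 G8 = G8" "g_add G0 G9 = G9"
  "g_add G0 G10 = G10" "g_add G1 G0 = G1" "g_add G1 G1 = G2" "g_add G1 G2 = G3"
  "g_add G1 G3 = G4" "g_add G1 G4 = G5" "g_add G1 G5 = G6" "g_add G1 G6 = G7" "g_add G1 G7 = G8"
  "g_add G1 G8 = G9" "g_add G1 G9 = G10" "g_add G1 G10 = G0" "g_add G2 G0 = G2"
  "g_add G2 G1 = G3" "g_add G2 G2 = G4" "g_add G2 G3 = G5" "g_add G2 G4 = G6" "g_add G2 G5 = G7"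
  "g_add G2 G6 = G8" "g_add G2 G7 = G9" "g_add G2 G8 = G10" "g_add G2 G9 = G0"
  "g_add G2 G10 = G1" "g_add G3 G0 = G3" "g_add G3 G1 = G4" "g_add G3 G2 = G5" "g_add G3 G3 = G6"
  "g_add G3 G4 = G7" "g_add G3 G5 = G8" "g_add G3 G6 = G9" "g_add G3 G7 = G10" "g_add G3 G8 = G0"
  "g_add G3 G9 = G1" "g_add G3 G10 = G2" "g_add G4 G0 = G4" "g_add G4 G1 = G5" "g_add G4 G2 = G6"
  "g_add G4 G3 = G7" "g_add G4 G4 = G8" "g_add G4 G5 = G9" "g_add G4 G6 = G10" "g_add G4 G7 = G0"
  "g_add G4 G8 = G1" "g_add G4 G9 = G2" "g_add G4 G10 = G3" "g_add G5 G0 = G5" "g_add G5 G1 = G6"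
  "g_add G5 G2 = G7" "g_add G5 G3 = G8" "g_add G5 G4 = G9" "g_add G5 G5 = G10" "g_add G5 G6 = G0"
  "g_add G5 G7 = G1" "g_add G5 G8 = G2" "g_add G5 G9 = G3" "g_add G5 G10 = G4" "g_add G6 G0 = G6"
  "g_add G6 G1 = G7" "g_add G6 G2 = G8" "g_add G6 G3 = G9" "g_add G6 G4 = G10" "g_add G6 G5 = G0"
  "g_add G6 G6 = G1" "g_add G6 G7 = G2" "g_add G6 G8 = G3" "g_add G6 G9 = G4" "g_add G6 G10 = G5"
  "g_add G7 G0 = G7" "g_add G7 G1 = G8" "g_add G7 G2 = G9" "g_add G7 G3 = G10" "g_add G7 G4 = G0"
  "g_add G7 G5 = G1" "g_add G7 G6 = G2" "g_add G7 G7 = G3" "g_add G7 G8 = G4" "g_add G7 G9 = G5"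
  "g_add G7 G10 = G6" "g_add G8 G0 = G8" "g_add G8 G1 = G9" "g_add G8 G2 = G10"
  "g_add G8 G3 = G0" "g_add G8 G4 = G1" "g_add G8 G5 = G2" "g_add G8 G6 = G3" "g_add G8 G7 = G4"
  "g_add G8 G8 = G5" "g_add G8 G9 = G6" "g_add G8 G10 = G7" "g_add G9 G0 = G9"
  "g_add G9 G1 = G10" "g_add G9 G2 = G0" "g_add G9 G3 = G1" "g_add G9 G4 = G2" "g_add G9 G5 = G3"
  "g_add G9 G6 = G4" "g_add G9 G7 = G5" "g_add G9 G8 = G6" "g_add G9 G9 = G7" "g_add G9 G10 = G8"
  "g_add G10 G0 = G10" "g_add G10 G1 = G0" "g_add G10 G2 = G1" "g_add G10 G3 = G2"
  "g_add G10 G4 = G3" "g_add G10 G5 = G4" "g_add G10 G6 = G5" "g_add G10 G7 = G6"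
  "g_add G10 G8 = G7" "g_add G10 G9 = G8" "g_add G10 G10 = G9"
  by (simp_all add: g_add_def g_of_def)

lemma g_mul_table:
  "g_mul G0 G0 = G0" "g_mul G0 G1 = G0" "g_mul G0 G2 = G0" "g_mul G0 G3 = G0" "g_mul G0 G4 = G0"
  "g_mul G0 G5 = G0" "g_mul G0 G6 = G0" "g_mul G0 G7 = G0" "g_mul G0 G8 = G0" "g_mul G0 G9 = G0"
  "g_mul G0 G10 = G0" "g_mul G1 G0 = G0" "g_mul G1 G1 = G1" "g_mul G1 G2 = G2" "g_mul G1 G3 = G3"
  "g_mul G1 G4 = G4" "g_mul G1 G5 = G5" "g_mul G1 G6 = G6" "g_mul G1 G7 = G7" "g_mul G1 G8 = G8"
  "g_mul G1 G9 = G9" "g_mul G1 G10 = G10" "g_mul G2 G0 = G0" "g_mul G2 G1 = G2"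
  "g_mul G2 G2 = G4" "g_mul G2 G3 = G6" "g_mul G2 G4 = G8" "g_mul G2 G5 = G10" "g_mul G2 G6 = G1"
  "g_mul G2 G7 = G3" "g_mul G2 G8 = G5" "g_mul G2 G9 = G7" "g_mul G2 G10 = G9" "g_mul G3 G0 = G0"
  "g_mul G3 G1 = G3" "g_mul G3 G2 = G6" "g_mul G3 G3 = G9" "g_mul G3 G4 = G1" "g_mul G3 G5 = G4"
  "g_mul G3 G6 = G7" "g_mul G3 G7 = G10" "g_mul G3 G8 = G2" "g_mul G3 G9 = G5"
  "g_mul G3 G10 = G8" "g_mul G4 G0 = G0" "g_mul G4 G1 = G4" "g_mul G4 G2 = G8" "g_mul G4 G3 = G1"
  "g_mul G4 G4 = G5" "g_mul G4 G5 = G9" "g_mul G4 G6 = G2" "g_mul G4 G7 = G6" "g_mul G4 G8 = G10"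
  "g_mul G4 G9 = G3" "g_mul G4 G10 = G7" "g_mul G5 G0 = G0" "g_mul G5 G1 = G5"
  "g_mul G5 G2 = G10" "g_mul G5 G3 = G4" "g_mul G5 G4 = G9" "g_mul G5 G5 = G3" "g_mul G5 G6 = G8"
  "g_mul G5 G7 = G2" "g_mul G5 G8 = G7" "g_mul G5 G9 = G1" "g_mul G5 G10 = G6" "g_mul G6 G0 = G0"
  "g_mul G6 G1 = G6" "g_mul G6 G2 = G1" "g_mul G6 G3 = G7" "g_mul G6 G4 = G2" "g_mul G6 G5 = G8"
  "g_mul G6 G6 = G3" "g_mul G6 G7 = G9" "g_mul G6 G8 = G4" "g_mul G6 G9 = G10"
  "g_mul G6 G10 = G5" "g_mul G7 G0 = G0" "g_mul G7 G1 = G7" "g_mul G7 G2 = G3"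
  "g_mul G7 G3 = G10" "g_mul G7 G4 = G6" "g_mul G7 G5 = G2" "g_mul G7 G6 = G9" "g_mul G7 G7 = G5"
  "g_mul G7 G8 = G1" "g_mul G7 G9 = G8" "g_mul G7 G10 = G4" "g_mul G8 G0 = G0" "g_mul G8 G1 = G8"
  "g_mul G8 G2 = G5" "g_mul G8 G3 = G2" "g_mul G8 G4 = G10" "g_mul G8 G5 = G7" "g_mul G8 G6 = G4"
  "g_mul G8 G7 = G1" "g_mul G8 G8 = G9" "g_mul G8 G9 = G6" "g_mul G8 G10 = G3" "g_mul G9 G0 = G0"
  "g_mul G9 G1 = G9" "g_mul G9 G2 = G7" "g_mul G9 G3 = G5" "g_mul G9 G4 = G3" "g_mul G9 G5 = G1"
  "g_mul G9 G6 = G10" "g_mul G9 G7 = G8" "g_mul G9 G8 = G6" "g_mul G9 G9 = G4"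
  "g_mul G9 G10 = G2" "g_mul G10 G0 = G0" "g_mul G10 G1 = G10" "g_mul G10 G2 = G9"
  "g_mul G10 G3 = G8" "g_mul G10 G4 = G7" "g_mul G10 G5 = G6" "g_mul G10 G6 = G5"
  "g_mul G10 G7 = G4" "g_mul G10 G8 = G3" "g_mul G10 G9 = G2" "g_mul G10 G10 = G1"
  by (simp_all add: g_mul_def g_of_def)

lemma g_inv_table:
  "g_inv G0 = G0" "g_inv G1 = G1" "g_inv G2 = G6" "g_inv G3 = G4" "g_inv G4 = G3" "g_inv G5 = G9" "g_inv G6 = G2" "g_inv G7 = G8" "g_inv G8 = G7" "g_inv G9 = G5" "g_inv G10 = G10"
  by (simp_all add: g_inv_def g_of_def)

lemmas g_eq_table = g_eq_def g11.distinct


section \<open>Models as lists of encoded steps\<close>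

datatype tri = Neg | Zer | Pos
datatype code = C tri tri tri
datatype term2 = D tri tri

primrec tri_int :: "tri \<Rightarrow> int" where
  "tri_int Neg = -1" | "tri_int Zer = 0" | "tri_int Pos = 1"

primrec code_step :: "code \<Rightarrow> step" where
  "code_step (C a b c) = (tri_int a, tri_int b, tri_int c)"

definition tri_eq :: "tri \<Rightarrow> tri \<Rightarrow> bool" where "tri_eq a b \<longleftrightarrow> a = b"
lemma tri_eq_table: "tri_eq a a = True" "tri_eq Neg Zer = False" "tri_eq Neg Pos = False"
  "tri_eq Zer Neg = False" "tri_eq Zer Pos = False" "tri_eq Pos Neg = False" "tri_eq Pos Zer = False"
  by (simp_all add: tri_eq_def)

definition cons_if :: "bool \<Rightarrow> 'a \<Rightarrow> 'a list \<Rightarrow> 'a list" where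
  "cons_if b x l = (if b then x # l else l)"
lemma cons_if_simps: "cons_if True x l = x # l" "cons_if False x l = l"
  by (simp_all add: cons_if_def)

fun termsA :: "tri \<Rightarrow> code list \<Rightarrow> term2 list" where
  "termsA t [] = []"
| "termsA t (C a b c # l) = cons_if (tri_eq t a) (D b c) (termsA t l)"

fun termsB :: "tri \<Rightarrow> code list \<Rightarrow> term2 list" where
  "termsB t [] = []"
| "termsB t (C a b c # l) = cons_if (tri_eq t b) (D a c) (termsB t l)"

definition tri_min :: "tri \<Rightarrow> tri \<Rightarrow> tri" where
  "tri_min a b = (if tri_int a \<le> tri_int b then a else b)"
definition tri_max :: "tri \<Rightarrow> tri \<Rightarrow> tri" where
  "tri_max a b = (if tri_int a \<le> tri_int b then b else a)"
definition tri_diff :: "tri \<Rightarrow> tri \<Rightarrow> int" where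
  "tri_diff a b = tri_int a - tri_int b"

lemma tri_table:
  "tri_min Neg Neg = Neg" "tri_max Neg Neg = Neg" "tri_diff Neg Neg = 0" "tri_min Neg Zer = Neg" "tri_max Neg Zer = Zer" "tri_diff Neg Zer = -1" "tri_min Neg Pos = Neg" "tri_max Neg Pos = Pos" "tri_diff Neg Pos = -2"
  "tri_min Zer Neg = Neg" "tri_max Zer Neg = Zer" "tri_diff Zer Neg = 1" "tri_min Zer Zer = Zer" "tri_max Zer Zer = Zer" "tri_diff Zer Zer = 0" "tri_min Zer Pos = Zer" "tri_max Zer Pos = Pos" "tri_diff Zer Pos = -1"
  "tri_min Pos Neg = Neg" "tri_max Pos Neg = Pos" "tri_diff Pos Neg = 2" "tri_min Pos Zer = Zer" "tri_max Pos Zer = Pos" "tri_diff Pos Zer = 1" "tri_min Pos Pos = Pos" "tri_max Pos Pos = Pos" "tri_diff Pos Pos = 0"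
  by (simp_all add: tri_min_def tri_max_def tri_diff_def)


fun min_exp :: "term2 list \<Rightarrow> tri" where
  "min_exp [] = Pos" | "min_exp (D b c # l) = tri_min b (min_exp l)"
fun max_exp :: "term2 list \<Rightarrow> tri" where
  "max_exp [] = Neg" | "max_exp (D b c # l) = tri_max b (max_exp l)"

definition period_of :: "int \<Rightarrow> int \<Rightarrow> int \<Rightarrow> int \<Rightarrow> nat option" where
  "period_of p m p' m' = map_of period_table (p, m, p', m')"

lemma period_of_table:
  "period_of (-2) (-2) (-1) (-1) = Some (Suc (Suc (Suc (Suc (0)))))" "period_of (-2) (-1) (-2) (-1) = Some (Suc (Suc (Suc (Suc (0)))))"
  "period_of (-2) (-1) (-1) (-1) = Some (Suc (Suc (Suc (Suc (Suc (Suc (Suc (0))))))))" "period_of (-2) 0 0 (-1) = Some (Suc (Suc (Suc (0))))"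
  "period_of (-1) (-2) (-1) (-2) = Some (Suc (Suc (Suc (Suc (0)))))" "period_of (-1) (-2) (-1) (-1) = Some (Suc (Suc (Suc (Suc (Suc (Suc (Suc (0))))))))"
  "period_of (-1) (-1) (-2) (-2) = Some (Suc (Suc (Suc (Suc (0)))))" "period_of (-1) (-1) (-2) (-1) = Some (Suc (Suc (Suc (Suc (Suc (Suc (Suc (0))))))))"
  "period_of (-1) (-1) (-1) (-2) = Some (Suc (Suc (Suc (Suc (Suc (Suc (Suc (0))))))))" "period_of (-1) (-1) (-1) (-1) = Some (Suc (Suc (Suc (0))))"
  "period_of (-1) (-1) (-1) 0 = Some (Suc (Suc (Suc (Suc (Suc (Suc (Suc (Suc (0)))))))))" "period_of (-1) (-1) 0 (-1) = Some (Suc (Suc (Suc (Suc (Suc (Suc (Suc (Suc (0)))))))))"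
  "period_of (-1) 0 (-1) (-1) = Some (Suc (Suc (Suc (Suc (Suc (Suc (Suc (Suc (0)))))))))" "period_of (-1) 0 (-1) 0 = Some (Suc (Suc (Suc (Suc (Suc (Suc (Suc (0))))))))"
  "period_of (-1) 0 0 (-2) = Some (Suc (Suc (Suc (0))))" "period_of (-1) 0 0 (-1) = Some (Suc (Suc (Suc (Suc (Suc (0))))))"
  "period_of (-1) 0 1 (-1) = Some (Suc (Suc (Suc (Suc (Suc (Suc (Suc (0))))))))" "period_of (-1) 1 0 (-1) = Some (Suc (Suc (Suc (Suc (Suc (Suc (Suc (0))))))))"
  "period_of (-1) 1 0 0 = Some (Suc (Suc (0)))" "period_of (-1) 1 0 1 = Some (Suc (Suc (Suc (Suc (Suc (Suc (Suc (0))))))))"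
  "period_of 0 (-2) (-1) 0 = Some (Suc (Suc (Suc (0))))" "period_of 0 (-1) (-2) 0 = Some (Suc (Suc (Suc (0))))"
  "period_of 0 (-1) (-1) (-1) = Some (Suc (Suc (Suc (Suc (Suc (Suc (Suc (Suc (0)))))))))" "period_of 0 (-1) (-1) 0 = Some (Suc (Suc (Suc (Suc (Suc (0))))))"
  "period_of 0 (-1) (-1) 1 = Some (Suc (Suc (Suc (Suc (Suc (Suc (Suc (0))))))))" "period_of 0 (-1) 0 (-1) = Some (Suc (Suc (Suc (Suc (Suc (Suc (Suc (0))))))))"
  "period_of 0 0 (-1) 1 = Some (Suc (Suc (0)))" "period_of 0 0 0 0 = Some (Suc (Suc (0)))"
  "period_of 0 0 1 (-1) = Some (Suc (Suc (0)))" "period_of 0 1 (-1) 1 = Some (Suc (Suc (Suc (Suc (Suc (Suc (Suc (0))))))))"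
  "period_of 0 1 0 1 = Some (Suc (Suc (Suc (Suc (Suc (0))))))" "period_of 0 1 0 2 = Some (Suc (Suc (Suc (0))))"
  "period_of 0 1 1 0 = Some (Suc (Suc (Suc (Suc (Suc (Suc (Suc (0))))))))" "period_of 0 1 1 1 = Some (Suc (Suc (Suc (Suc (Suc (Suc (Suc (Suc (0)))))))))"
  "period_of 0 2 0 1 = Some (Suc (Suc (Suc (0))))" "period_of 1 (-1) (-1) 0 = Some (Suc (Suc (Suc (Suc (Suc (Suc (Suc (0))))))))"
  "period_of 1 (-1) 0 0 = Some (Suc (Suc (0)))" "period_of 1 (-1) 1 0 = Some (Suc (Suc (Suc (Suc (Suc (Suc (Suc (0))))))))"
  "period_of 1 0 0 1 = Some (Suc (Suc (Suc (Suc (Suc (Suc (Suc (0))))))))" "period_of 1 0 1 (-1) = Some (Suc (Suc (Suc (Suc (Suc (Suc (Suc (0))))))))"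
  "period_of 1 0 1 0 = Some (Suc (Suc (Suc (Suc (Suc (0))))))" "period_of 1 0 1 1 = Some (Suc (Suc (Suc (Suc (Suc (Suc (Suc (Suc (0)))))))))"
  "period_of 1 0 2 0 = Some (Suc (Suc (Suc (0))))" "period_of 1 1 0 1 = Some (Suc (Suc (Suc (Suc (Suc (Suc (Suc (Suc (0)))))))))"
  "period_of 1 1 1 0 = Some (Suc (Suc (Suc (Suc (Suc (Suc (Suc (Suc (0)))))))))" "period_of 1 1 1 1 = Some (Suc (Suc (Suc (0))))"
  "period_of 1 1 1 2 = Some (Suc (Suc (Suc (Suc (Suc (Suc (Suc (0))))))))" "period_of 1 1 2 1 = Some (Suc (Suc (Suc (Suc (Suc (Suc (Suc (0))))))))"
  "period_of 1 1 2 2 = Some (Suc (Suc (Suc (Suc (0)))))" "period_of 1 2 1 1 = Some (Suc (Suc (Suc (Suc (Suc (Suc (Suc (0))))))))"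
  "period_of 1 2 2 1 = Some (Suc (Suc (Suc (Suc (0)))))" "period_of 2 0 1 0 = Some (Suc (Suc (Suc (0))))"
  "period_of 2 0 2 0 = Some (0)" "period_of 2 1 1 1 = Some (Suc (Suc (Suc (Suc (Suc (Suc (Suc (0))))))))"
  "period_of 2 1 1 2 = Some (Suc (Suc (Suc (Suc (0)))))" "period_of 2 1 2 1 = Some (0)"
  "period_of 2 1 2 2 = Some (0)" "period_of 2 2 1 1 = Some (Suc (Suc (Suc (Suc (0)))))"
  "period_of 2 2 2 1 = Some (0)"
  by (simp_all add: period_of_def period_table_def)


datatype point = Pt g11 g11 g11
text \<open>The period of the pair map together with the coefficient polynomials
  \<open>A\<^sub>-, A\<^sub>+, B\<^sub>-, B\<^sub>+\<close>. The period does not depend on the point and is looked up once.\<close>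

datatype prepared = PR nat "term2 list" "term2 list" "term2 list" "term2 list" | Unknown

definition prepare' :: "nat option \<Rightarrow> term2 list \<Rightarrow> term2 list \<Rightarrow> term2 list \<Rightarrow> term2 list \<Rightarrow> prepared" where
  "prepare' q am ap bm bp = (case q of Some q \<Rightarrow> PR q am ap bm bp | None \<Rightarrow> Unknown)"
definition prepare2 :: "term2 list \<Rightarrow> term2 list \<Rightarrow> term2 list \<Rightarrow> term2 list \<Rightarrow> prepared" where
  "prepare2 am ap bm bp = prepare' (period_of (tri_diff (min_exp am) (min_exp ap))
     (tri_diff (max_exp am) (max_exp ap)) (tri_diff (min_exp bm) (min_exp bp))
     (tri_diff (max_exp bm) (max_exp bp))) am ap bm bp"
definition prepare :: "code list \<Rightarrow> prepared" where
  "prepare l = prepare2 (termsA Neg l) (termsA Pos l) (termsB Neg l) (termsB Pos l)"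

lemma prepare'_Some: "prepare' (Some q) am ap bm bp = PR q am ap bm bp"
  by (simp add: prepare'_def)

primrec g_pow :: "tri \<Rightarrow> g11 \<Rightarrow> g11 \<Rightarrow> g11" where
  "g_pow Neg y yi = yi" | "g_pow Zer y yi = G1" | "g_pow Pos y yi = y"

fun g_sum :: "term2 list \<Rightarrow> g11 \<Rightarrow> g11 \<Rightarrow> g11 \<Rightarrow> g11 \<Rightarrow> g11" where
  "g_sum [] y yi z zi = G0"
| "g_sum (D b c # l) y yi z zi = g_add (g_mul (g_pow b y yi) (g_pow c z zi)) (g_sum l y yi z zi)"

definition or_else :: "bool \<Rightarrow> bool \<Rightarrow> bool" where "or_else a b \<longleftrightarrow> a \<or> b"

definition g_step :: "term2 list \<Rightarrow> term2 list \<Rightarrow> g11 \<Rightarrow> g11 \<Rightarrow> g11 \<Rightarrow> g11 \<Rightarrow> g11 \<Rightarrow> g11" where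
  "g_step lm lp y yi z zi x = g_mul (g_sum lm y yi z zi) (g_inv (g_mul (g_sum lp y yi z zi) x))"

definition moved :: "g11 \<Rightarrow> g11 \<Rightarrow> g11 \<Rightarrow> g11 \<Rightarrow> bool" where
  "moved x y x0 y0 \<longleftrightarrow> \<not> (g_eq x x0 \<and> g_eq y y0)"

fun orbit :: "nat \<Rightarrow> term2 list \<Rightarrow> term2 list \<Rightarrow> term2 list \<Rightarrow> term2 list \<Rightarrow>
    g11 \<Rightarrow> g11 \<Rightarrow> g11 \<Rightarrow> g11 \<Rightarrow> g11 \<Rightarrow> g11 \<Rightarrow> bool" where
  "orbit 0 am ap bm bp x y z zi x0 y0 = moved x y x0 y0"
| "orbit (Suc n) am ap bm bp x y z zi x0 y0 =
     (let x' = g_step am ap y (g_inv y) z zi x; y' = g_step bm bp x' (g_inv x') z zi y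
      in x' \<noteq> G0 \<and> y' \<noteq> G0 \<and> orbit n am ap bm bp x' y' z zi x0 y0)"

definition orbitA where "orbitA x' n am ap bm bp y z zi x0 y0 =
     (let y' = g_step bm bp x' (g_inv x') z zi y
      in x' \<noteq> G0 \<and> y' \<noteq> G0 \<and> orbit n am ap bm bp x' y' z zi x0 y0)"
definition orbitB where "orbitB y' x' n am ap bm bp z zi x0 y0 =
     (y' \<noteq> G0 \<and> orbit n am ap bm bp x' y' z zi x0 y0)"
definition orbitA' where "orbitA' (b::bool) x' n am ap bm bp y z zi x0 y0 =
     (\<not> b \<and> orbitB (g_step bm bp x' (g_inv x') z zi y) x' n am ap bm bp z zi x0 y0)"
definition orbitB' where "orbitB' (b::bool) y' x' n am ap bm bp z zi x0 y0 =
     (\<not> b \<and> orbit n am ap bm bp x' y' z zi x0 y0)"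

lemma orbit_simps:
  "orbit 0 am ap bm bp x y z zi x0 y0 = moved x y x0 y0"
  "orbit (Suc n) am ap bm bp x y z zi x0 y0 =
     orbitA (g_step am ap y (g_inv y) z zi x) n am ap bm bp y z zi x0 y0"
  "orbitA x' n am ap bm bp y z zi x0 y0 = orbitA' (g_eq x' G0) x' n am ap bm bp y z zi x0 y0"
  "orbitA' True x' n am ap bm bp y z zi x0 y0 = False"
  "orbitA' False x' n am ap bm bp y z zi x0 y0 =
     orbitB (g_step bm bp x' (g_inv x') z zi y) x' n am ap bm bp z zi x0 y0"
  "orbitB y' x' n am ap bm bp z zi x0 y0 = orbitB' (g_eq y' G0) y' x' n am ap bm bp z zi x0 y0"
  "orbitB' True y' x' n am ap bm bp z zi x0 y0 = False"
  "orbitB' False y' x' n am ap bm bp z zi x0 y0 = orbit n am ap bm bp x' y' z zi x0 y0"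
  by (simp_all add: orbitA_def orbitA'_def orbitB_def orbitB'_def Let_def g_eq_def)

text \<open>Period 0 stands for a pair map of infinite order.\<close>

fun moves :: "point \<Rightarrow> prepared \<Rightarrow> bool" where
  "moves p Unknown = False"
| "moves (Pt x y z) (PR 0 am ap bm bp) = True"
| "moves (Pt x y z) (PR (Suc n) am ap bm bp) = orbit (Suc n) am ap bm bp x y z (g_inv z) x y"

fun any_moves :: "point list \<Rightarrow> prepared \<Rightarrow> prepared \<Rightarrow> prepared \<Rightarrow> bool" where
  "any_moves [] r1 r2 r3 = False"
| "any_moves (p # ps) r1 r2 r3 = (moves p r1 \<or> moves p r2 \<or> moves p r3 \<or> any_moves ps r1 r2 r3)"

definition any1 where "any1 b p ps r1 r2 r3 = (b \<or> moves p r2 \<or> moves p r3 \<or> any_moves ps r1 r2 r3)"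
definition any2 where "any2 b p ps r1 r2 r3 = (b \<or> moves p r3 \<or> any_moves ps r1 r2 r3)"
definition any3 where "any3 b ps r1 r2 r3 = (b \<or> any_moves ps r1 r2 r3)"

lemma any_simps:
  "any_moves [] r1 r2 r3 = False"
  "any_moves (p # ps) r1 r2 r3 = any1 (moves p r1) p ps r1 r2 r3"
  "any1 True p ps r1 r2 r3 = True" "any1 False p ps r1 r2 r3 = any2 (moves p r2) p ps r1 r2 r3"
  "any2 True p ps r1 r2 r3 = True" "any2 False p ps r1 r2 r3 = any3 (moves p r3) ps r1 r2 r3"
  "any3 True ps r1 r2 r3 = True" "any3 False ps r1 r2 r3 = any_moves ps r1 r2 r3"
  by (simp_all add: any1_def any2_def any3_def)

fun swap_yz :: "code list \<Rightarrow> code list" where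
  "swap_yz [] = []" | "swap_yz (C a b c # l) = C a c b # swap_yz l"
fun rotate3 :: "code list \<Rightarrow> code list" where
  "rotate3 [] = []" | "rotate3 (C a b c # l) = C b c a # rotate3 l"

text \<open>Together with the three choices of two coordinates, these twelve points refute the triviality
  of a power of the pair map for every least model with an infinite group.\<close>

definition test_points :: "point list" where
  "test_points = [Pt G5 G3 G1, Pt G3 G5 G3, Pt G2 G5 G8, Pt G10 G5 G9, Pt G4 G1 G6, Pt G2 G3 G10, Pt G8 G7 G7, Pt G4 G6 G9, Pt G8 G5 G9, Pt G7 G5 G1, Pt G1 G9 G10, Pt G1 G5 G5]"

definition infinite_test :: "code list \<Rightarrow> bool" where
  "infinite_test l = any_moves test_points (prepare l) (prepare (swap_yz l)) (prepare (rotate3 l))"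

lemmas test_simps = g_add_table g_mul_table g_inv_table g_eq_table tri_eq_table cons_if_simps
  termsA.simps termsB.simps tri_table min_exp.simps max_exp.simps period_of_table prepare'_Some
  prepare2_def prepare_def g_pow.simps g_sum.simps g_step_def moved_def orbit_simps moves.simps
  any_simps swap_yz.simps rotate3.simps infinite_test_def test_points_def
  not_True_eq_False not_False_eq_True simp_thms


section \<open>Searching the models\<close>

text \<open>A clause is a property that some step of a model must have.\<close>

datatype clause = Stuck bool bool bool | Half nat int int

definition neg_in :: "tri \<Rightarrow> bool \<Rightarrow> bool" where "neg_in a p \<longleftrightarrow> (a = Neg \<longrightarrow> p)"
definition pos_out :: "tri \<Rightarrow> bool \<Rightarrow> bool" where "pos_out a p \<longleftrightarrow> a = Pos \<and> \<not> p"
definition below :: "int \<Rightarrow> int \<Rightarrow> tri \<Rightarrow> tri \<Rightarrow> tri \<Rightarrow> bool" where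
  "below l m a b c \<longleftrightarrow> 2 * tri_int a < l * tri_int b + m * tri_int c"

lemma neg_in_table: "neg_in a True = True" "neg_in Neg False = False" "neg_in Zer False = True" "neg_in Pos False = True"
  and pos_out_table: "pos_out a True = False" "pos_out Neg False = False" "pos_out Zer False = False" "pos_out Pos False = True"
  by (simp_all add: neg_in_def pos_out_def)

lemma below_table:
  "below 0 0 Neg Neg Neg = True" "below 0 0 Neg Neg Zer = True" "below 0 0 Neg Neg Pos = True"
  "below 0 0 Neg Zer Neg = True" "below 0 0 Neg Zer Zer = True" "below 0 0 Neg Zer Pos = True"
  "below 0 0 Neg Pos Neg = True" "below 0 0 Neg Pos Zer = True" "below 0 0 Neg Pos Pos = True"
  "below 0 0 Zer Neg Neg = False" "below 0 0 Zer Neg Zer = False" "below 0 0 Zer Neg Pos = False"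
  "below 0 0 Zer Zer Neg = False" "below 0 0 Zer Zer Zer = False" "below 0 0 Zer Zer Pos = False"
  "below 0 0 Zer Pos Neg = False" "below 0 0 Zer Pos Zer = False" "below 0 0 Zer Pos Pos = False"
  "below 0 0 Pos Neg Neg = False" "below 0 0 Pos Neg Zer = False" "below 0 0 Pos Neg Pos = False"
  "below 0 0 Pos Zer Neg = False" "below 0 0 Pos Zer Zer = False" "below 0 0 Pos Zer Pos = False"
  "below 0 0 Pos Pos Neg = False" "below 0 0 Pos Pos Zer = False" "below 0 0 Pos Pos Pos = False"
  "below 0 2 Neg Neg Neg = False" "below 0 2 Neg Neg Zer = True" "below 0 2 Neg Neg Pos = True"
  "below 0 2 Neg Zer Neg = False" "below 0 2 Neg Zer Zer = True" "below 0 2 Neg Zer Pos = True"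
  "below 0 2 Neg Pos Neg = False" "below 0 2 Neg Pos Zer = True" "below 0 2 Neg Pos Pos = True"
  "below 0 2 Zer Neg Neg = False" "below 0 2 Zer Neg Zer = False" "below 0 2 Zer Neg Pos = True"
  "below 0 2 Zer Zer Neg = False" "below 0 2 Zer Zer Zer = False" "below 0 2 Zer Zer Pos = True"
  "below 0 2 Zer Pos Neg = False" "below 0 2 Zer Pos Zer = False" "below 0 2 Zer Pos Pos = True"
  "below 0 2 Pos Neg Neg = False" "below 0 2 Pos Neg Zer = False" "below 0 2 Pos Neg Pos = False"
  "below 0 2 Pos Zer Neg = False" "below 0 2 Pos Zer Zer = False" "below 0 2 Pos Zer Pos = False"
  "below 0 2 Pos Pos Neg = False" "below 0 2 Pos Pos Zer = False" "below 0 2 Pos Pos Pos = False"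
  "below 2 0 Neg Neg Neg = False" "below 2 0 Neg Neg Zer = False" "below 2 0 Neg Neg Pos = False"
  "below 2 0 Neg Zer Neg = True" "below 2 0 Neg Zer Zer = True" "below 2 0 Neg Zer Pos = True"
  "below 2 0 Neg Pos Neg = True" "below 2 0 Neg Pos Zer = True" "below 2 0 Neg Pos Pos = True"
  "below 2 0 Zer Neg Neg = False" "below 2 0 Zer Neg Zer = False" "below 2 0 Zer Neg Pos = False"
  "below 2 0 Zer Zer Neg = False" "below 2 0 Zer Zer Zer = False" "below 2 0 Zer Zer Pos = False"
  "below 2 0 Zer Pos Neg = True" "below 2 0 Zer Pos Zer = True" "below 2 0 Zer Pos Pos = True"
  "below 2 0 Pos Neg Neg = False" "below 2 0 Pos Neg Zer = False" "below 2 0 Pos Neg Pos = False"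
  "below 2 0 Pos Zer Neg = False" "below 2 0 Pos Zer Zer = False" "below 2 0 Pos Zer Pos = False"
  "below 2 0 Pos Pos Neg = False" "below 2 0 Pos Pos Zer = False" "below 2 0 Pos Pos Pos = False"
  "below 2 2 Neg Neg Neg = False" "below 2 2 Neg Neg Zer = False" "below 2 2 Neg Neg Pos = True"
  "below 2 2 Neg Zer Neg = False" "below 2 2 Neg Zer Zer = True" "below 2 2 Neg Zer Pos = True"
  "below 2 2 Neg Pos Neg = True" "below 2 2 Neg Pos Zer = True" "below 2 2 Neg Pos Pos = True"
  "below 2 2 Zer Neg Neg = False" "below 2 2 Zer Neg Zer = False" "below 2 2 Zer Neg Pos = False"
  "below 2 2 Zer Zer Neg = False" "below 2 2 Zer Zer Zer = False" "below 2 2 Zer Zer Pos = True"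
  "below 2 2 Zer Pos Neg = False" "below 2 2 Zer Pos Zer = True" "below 2 2 Zer Pos Pos = True"
  "below 2 2 Pos Neg Neg = False" "below 2 2 Pos Neg Zer = False" "below 2 2 Pos Neg Pos = False"
  "below 2 2 Pos Zer Neg = False" "below 2 2 Pos Zer Zer = False" "below 2 2 Pos Zer Pos = False"
  "below 2 2 Pos Pos Neg = False" "below 2 2 Pos Pos Zer = False" "below 2 2 Pos Pos Pos = True"
  "below 2 4 Neg Neg Neg = False" "below 2 4 Neg Neg Zer = False" "below 2 4 Neg Neg Pos = True"
  "below 2 4 Neg Zer Neg = False" "below 2 4 Neg Zer Zer = True" "below 2 4 Neg Zer Pos = True"
  "below 2 4 Neg Pos Neg = False" "below 2 4 Neg Pos Zer = True" "below 2 4 Neg Pos Pos = True"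
  "below 2 4 Zer Neg Neg = False" "below 2 4 Zer Neg Zer = False" "below 2 4 Zer Neg Pos = True"
  "below 2 4 Zer Zer Neg = False" "below 2 4 Zer Zer Zer = False" "below 2 4 Zer Zer Pos = True"
  "below 2 4 Zer Pos Neg = False" "below 2 4 Zer Pos Zer = True" "below 2 4 Zer Pos Pos = True"
  "below 2 4 Pos Neg Neg = False" "below 2 4 Pos Neg Zer = False" "below 2 4 Pos Neg Pos = False"
  "below 2 4 Pos Zer Neg = False" "below 2 4 Pos Zer Zer = False" "below 2 4 Pos Zer Pos = True"
  "below 2 4 Pos Pos Neg = False" "below 2 4 Pos Pos Zer = False" "below 2 4 Pos Pos Pos = True"
  "below 4 2 Neg Neg Neg = False" "below 4 2 Neg Neg Zer = False" "below 4 2 Neg Neg Pos = False"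
  "below 4 2 Neg Zer Neg = False" "below 4 2 Neg Zer Zer = True" "below 4 2 Neg Zer Pos = True"
  "below 4 2 Neg Pos Neg = True" "below 4 2 Neg Pos Zer = True" "below 4 2 Neg Pos Pos = True"
  "below 4 2 Zer Neg Neg = False" "below 4 2 Zer Neg Zer = False" "below 4 2 Zer Neg Pos = False"
  "below 4 2 Zer Zer Neg = False" "below 4 2 Zer Zer Zer = False" "below 4 2 Zer Zer Pos = True"
  "below 4 2 Zer Pos Neg = True" "below 4 2 Zer Pos Zer = True" "below 4 2 Zer Pos Pos = True"
  "below 4 2 Pos Neg Neg = False" "below 4 2 Pos Neg Zer = False" "below 4 2 Pos Neg Pos = False"
  "below 4 2 Pos Zer Neg = False" "below 4 2 Pos Zer Zer = False" "below 4 2 Pos Zer Pos = False"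
  "below 4 2 Pos Pos Neg = False" "below 4 2 Pos Pos Zer = True" "below 4 2 Pos Pos Pos = True"
  "below 1 1 Neg Neg Neg = False" "below 1 1 Neg Neg Zer = True" "below 1 1 Neg Neg Pos = True"
  "below 1 1 Neg Zer Neg = True" "below 1 1 Neg Zer Zer = True" "below 1 1 Neg Zer Pos = True"
  "below 1 1 Neg Pos Neg = True" "below 1 1 Neg Pos Zer = True" "below 1 1 Neg Pos Pos = True"
  "below 1 1 Zer Neg Neg = False" "below 1 1 Zer Neg Zer = False" "below 1 1 Zer Neg Pos = False"
  "below 1 1 Zer Zer Neg = False" "below 1 1 Zer Zer Zer = False" "below 1 1 Zer Zer Pos = True"
  "below 1 1 Zer Pos Neg = False" "below 1 1 Zer Pos Zer = True" "below 1 1 Zer Pos Pos = True"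
  "below 1 1 Pos Neg Neg = False" "below 1 1 Pos Neg Zer = False" "below 1 1 Pos Neg Pos = False"
  "below 1 1 Pos Zer Neg = False" "below 1 1 Pos Zer Zer = False" "below 1 1 Pos Zer Pos = False"
  "below 1 1 Pos Pos Neg = False" "below 1 1 Pos Pos Zer = False" "below 1 1 Pos Pos Pos = False"
  by (simp_all add: below_def)


fun hits :: "clause \<Rightarrow> code \<Rightarrow> bool" where
  "hits (Stuck p q r) (C a b c) \<longleftrightarrow> (neg_in a p \<and> neg_in b q \<and> neg_in c r) \<and> (pos_out a p \<or> pos_out b q \<or> pos_out c r)"
| "hits (Half 0 l m) (C a b c) \<longleftrightarrow> below l m a b c"
| "hits (Half (Suc 0) l m) (C a b c) \<longleftrightarrow> below l m b a c"
| "hits (Half (Suc (Suc i)) l m) (C a b c) \<longleftrightarrow> below l m c a b"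

definition clauses :: "clause list" where
  "clauses = [Stuck False False False, Stuck False False True, Stuck False True False, Stuck False True True, Stuck True False False, Stuck True False True, Stuck True True False, Half 0 0 0, Half 0 0 2, Half 0 2 0, Half 0 2 2, Half 0 2 4, Half 0 4 2, Half 0 1 1, Half (Suc 0) 0 0, Half (Suc 0) 0 2, Half (Suc 0) 2 0, Half (Suc 0) 2 2, Half (Suc 0) 2 4, Half (Suc 0) 4 2, Half (Suc 0) 1 1, Half (Suc (Suc 0)) 0 0, Half (Suc (Suc 0)) 0 2, Half (Suc (Suc 0)) 2 0, Half (Suc (Suc 0)) 2 2, Half (Suc (Suc 0)) 2 4, Half (Suc (Suc 0)) 4 2, Half (Suc (Suc 0)) 1 1]"

definition all_codes :: "code list" where
  "all_codes = [C Neg Neg Neg, C Neg Neg Zer, C Neg Neg Pos, C Neg Zer Neg, C Neg Zer Zer, C Neg Zer Pos, C Neg Pos Neg, C Neg Pos Zer, C Neg Pos Pos, C Zer Neg Neg, C Zer Neg Zer, C Zer Neg Pos, C Zer Zer Neg, C Zer Zer Pos, C Zer Pos Neg, C Zer Pos Zer, C Zer Pos Pos, C Pos Neg Neg, C Pos Neg Zer, C Pos Neg Pos, C Pos Zer Neg, C Pos Zer Zer, C Pos Zer Pos, C Pos Pos Neg, C Pos Pos Zer, C Pos Pos Pos]"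

fun rev_onto :: "'a list \<Rightarrow> 'a list \<Rightarrow> 'a list" where
  "rev_onto [] l = l" | "rev_onto (x # k) l = rev_onto k (x # l)"

fun unhit :: "code \<Rightarrow> clause list \<Rightarrow> clause list" where
  "unhit s [] = []" | "unhit s (c # cs) = cons_if (\<not> hits c s) c (unhit s cs)"

definition suc_if :: "bool \<Rightarrow> nat \<Rightarrow> nat" where "suc_if b n = (if b then Suc n else n)"
lemma suc_if_simps: "suc_if True n = Suc n" "suc_if False n = n" by (simp_all add: suc_if_def)

fun countX :: "tri \<Rightarrow> code list \<Rightarrow> nat" where
  "countX t [] = 0" | "countX t (C a b c # l) = suc_if (tri_eq t a) (countX t l)"
fun countY :: "tri \<Rightarrow> code list \<Rightarrow> nat" where
  "countY t [] = 0" | "countY t (C a b c # l) = suc_if (tri_eq t b) (countY t l)"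
fun countZ :: "tri \<Rightarrow> code list \<Rightarrow> nat" where
  "countZ t [] = 0" | "countZ t (C a b c # l) = suc_if (tri_eq t c) (countZ t l)"

fun code_bit :: "code \<Rightarrow> nat" where
  "code_bit (C a b c) = 2 ^ nat (9 * tri_int a + 3 * tri_int b + tri_int c + 14)"

lemma code_bit_table:
  "code_bit (C Neg Neg Neg) = 2"
  "code_bit (C Neg Neg Zer) = 4"
  "code_bit (C Neg Neg Pos) = 8"
  "code_bit (C Neg Zer Neg) = 16"
  "code_bit (C Neg Zer Zer) = 32"
  "code_bit (C Neg Zer Pos) = 64"
  "code_bit (C Neg Pos Neg) = 128"
  "code_bit (C Neg Pos Zer) = 256"
  "code_bit (C Neg Pos Pos) = 512"
  "code_bit (C Zer Neg Neg) = 1024"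
  "code_bit (C Zer Neg Zer) = 2048"
  "code_bit (C Zer Neg Pos) = 4096"
  "code_bit (C Zer Zer Neg) = 8192"
  "code_bit (C Zer Zer Pos) = 32768"
  "code_bit (C Zer Pos Neg) = 65536"
  "code_bit (C Zer Pos Zer) = 131072"
  "code_bit (C Zer Pos Pos) = 262144"
  "code_bit (C Pos Neg Neg) = 524288"
  "code_bit (C Pos Neg Zer) = 1048576"
  "code_bit (C Pos Neg Pos) = 2097152"
  "code_bit (C Pos Zer Neg) = 4194304"
  "code_bit (C Pos Zer Zer) = 8388608"
  "code_bit (C Pos Zer Pos) = 16777216"
  "code_bit (C Pos Pos Neg) = 33554432"
  "code_bit (C Pos Pos Zer) = 67108864"
  "code_bit (C Pos Pos Pos) = 134217728"
  by simp_all

primrec mask :: "code list \<Rightarrow> nat" where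
  "mask [] = 0" | "mask (s # l) = code_bit s + mask l"


section \<open>Residues of rational numbers\<close>

text \<open>A rational number may be reduced modulo 11 if 11 does not divide some denominator of it.\<close>

definition res :: "rat \<Rightarrow> g11 \<Rightarrow> bool" where
  "res r g \<longleftrightarrow> (\<exists>a b. r = of_int a / of_int b \<and> \<not> 11 dvd b \<and> 11 dvd a - b * int (g_val g))"

lemma g_val_of: "g_val (g_of n) = n mod 11"
proof -
  have "n mod 11 = 0 \<or> n mod 11 = 1 \<or> n mod 11 = 2 \<or> n mod 11 = 3 \<or> n mod 11 = 4 \<or> n mod 11 = 5
    \<or> n mod 11 = 6 \<or> n mod 11 = 7 \<or> n mod 11 = 8 \<or> n mod 11 = 9 \<or> n mod 11 = 10" by arith
  thus ?thesis by (elim disjE) (simp_all add: g_of_def)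
qed

lemma g_val_less: "g_val g < 11"
  by (cases g) simp_all

lemma g_val_inj: "g_val g = g_val h \<Longrightarrow> g = h"
  by (cases g; cases h) simp_all

lemma prime_11: "prime (11::int)"
  by simp

lemma mod_11_expand: "int (n mod 11) = int n - 11 * (int n div 11)"
  by (simp add: zmod_int minus_mult_div_eq_mod)

lemma resI: "r * of_int b = of_int a \<Longrightarrow> \<not> 11 dvd b \<Longrightarrow> a = b * int (g_val g) + 11 * k \<Longrightarrow> res r g"
proof -
  assume *: "r * of_int b = of_int a" "\<not> 11 dvd b" "a = b * int (g_val g) + 11 * k"
  have "b \<noteq> 0" using *(2) by auto
  hence "r = of_int a / of_int b" using *(1) by (simp add: field_simps)
  thus ?thesis unfolding res_def using *(2,3) by (intro exI[of _ a] exI[of _ b]) simp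
qed

lemma resE:
  assumes "res r g"
  obtains a b k where "r * of_int b = of_int a" "\<not> 11 dvd b" "a = b * int (g_val g) + 11 * k"
proof -
  obtain a b where *: "r = of_int a / of_int b" "\<not> 11 dvd b" "11 dvd a - b * int (g_val g)"
    using assms unfolding res_def by blast
  obtain k where "a - b * int (g_val g) = 11 * k" using *(3) by (rule dvdE)
  moreover have "b \<noteq> 0" using *(2) by auto
  ultimately show ?thesis using * that[of b a k] by simp
qed

lemma not_dvd_mult_11: "\<not> 11 dvd a \<Longrightarrow> \<not> 11 dvd b \<Longrightarrow> \<not> 11 dvd a * (b::int)"
  using prime_dvd_mult_iff[OF prime_11] by blast

lemma res_add:
  assumes "res r g" "res s h"
  shows "res (r + s) (g_add g h)"
proof -
  obtain a b k where 1: "r * of_int b = of_int a" "\<not> 11 dvd b" "a = b * int (g_val g) + 11 * k"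
    using assms(1) by (rule resE)
  obtain a' b' k' where 2: "s * of_int b' = of_int a'" "\<not> 11 dvd b'" "a' = b' * int (g_val h) + 11 * k'"
    using assms(2) by (rule resE)
  define t where "t = int (g_val g + g_val h) div 11"
  have g: "int (g_val (g_add g h)) = int (g_val g) + int (g_val h) - 11 * t"
    unfolding g_add_def g_val_of mod_11_expand t_def by simp
  show ?thesis
  proof (rule resI)
    have "(r + s) * of_int (b * b') = r * of_int b * of_int b' + s * of_int b' * of_int b"
      by (simp add: algebra_simps)
    thus "(r + s) * of_int (b * b') = of_int (a * b' + a' * b)" by (simp add: 1(1) 2(1))
    show "\<not> 11 dvd b * b'" using 1(2) 2(2) by (rule not_dvd_mult_11)
    show "a * b' + a' * b = b * b' * int (g_val (g_add g h)) + 11 * (k * b' + k' * b + b * b' * t)"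
      unfolding g 1(3) 2(3) by (simp add: algebra_simps)
  qed
qed

lemma res_mult:
  assumes "res r g" "res s h"
  shows "res (r * s) (g_mul g h)"
proof -
  obtain a b k where 1: "r * of_int b = of_int a" "\<not> 11 dvd b" "a = b * int (g_val g) + 11 * k"
    using assms(1) by (rule resE)
  obtain a' b' k' where 2: "s * of_int b' = of_int a'" "\<not> 11 dvd b'" "a' = b' * int (g_val h) + 11 * k'"
    using assms(2) by (rule resE)
  define t where "t = int (g_val g * g_val h) div 11"
  have g: "int (g_val (g_mul g h)) = int (g_val g) * int (g_val h) - 11 * t"
    unfolding g_mul_def g_val_of mod_11_expand t_def by simp
  show ?thesis
  proof (rule resI)
    have "r * s * of_int (b * b') = (r * of_int b) * (s * of_int b')"
      by (simp add: algebra_simps)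
    thus "r * s * of_int (b * b') = of_int (a * a')" by (simp add: 1(1) 2(1))
    show "\<not> 11 dvd b * b'" using 1(2) 2(2) by (rule not_dvd_mult_11)
    show "a * a' = b * b' * int (g_val (g_mul g h))
        + 11 * (b * int (g_val g) * k' + b' * int (g_val h) * k + 11 * k * k' + b * b' * t)"
      unfolding g 1(3) 2(3) by (simp add: algebra_simps)
  qed
qed

lemma g_val_0: "g_val g = 0 \<longleftrightarrow> g = G0"
  by (cases g) simp_all

lemma res_inverse:
  assumes "res r g" "g \<noteq> G0"
  shows "r \<noteq> 0" "res (inverse r) (g_inv g)"
proof -
  obtain a b k where 1: "r * of_int b = of_int a" "\<not> 11 dvd b" "a = b * int (g_val g) + 11 * k"
    using assms(1) by (rule resE)
  have "\<not> 11 dvd int (g_val g)"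
    using assms(2) g_val_less[of g] g_val_0[of g] by (auto dest: zdvd_imp_le)
  hence "\<not> 11 dvd b * int (g_val g)" using 1(2) by (intro not_dvd_mult_11)
  hence a: "\<not> 11 dvd a" unfolding 1(3) by (simp add: dvd_add_left_iff)
  hence "a \<noteq> 0" by auto
  thus r: "r \<noteq> 0" using 1(1) by auto
  have "int (g_val g) * int (g_val (g_inv g)) mod 11 = 1"
    using assms(2) by (cases g) (simp_all add: g_inv_table)
  then obtain t where t: "int (g_val g) * int (g_val (g_inv g)) = 1 + 11 * t"
    by (metis add.commute mult_div_mod_eq)
  show "res (inverse r) (g_inv g)"
  proof (rule resI)
    show "inverse r * of_int a = of_int b" using r by (simp flip: 1(1))
    have "b * int (g_val g) * int (g_val (g_inv g)) = b * (1 + 11 * t)"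
      by (simp only: t mult.assoc)
    thus "b = a * int (g_val (g_inv g)) + 11 * (- b * t - k * int (g_val (g_inv g)))"
      unfolding 1(3) by (simp add: algebra_simps)
  qed (fact a)
qed

lemma res_unique:
  assumes "res r g" "res r h"
  shows "g = h"
proof -
  obtain a b k where 1: "r * of_int b = of_int a" "\<not> 11 dvd b" "a = b * int (g_val g) + 11 * k"
    using assms(1) by (rule resE)
  obtain a' b' k' where 2: "r * of_int b' = of_int a'" "\<not> 11 dvd b'" "a' = b' * int (g_val h) + 11 * k'"
    using assms(2) by (rule resE)
  have "of_int (a * b') = (of_int (a' * b) :: rat)"
    using 1(1) 2(1) by (metis mult.assoc mult.commute of_int_mult)
  hence "a * b' = a' * b" by (simp only: of_int_eq_iff)
  hence "b * b' * (int (g_val g) - int (g_val h)) = 11 * (k' * b - k * b')"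
    unfolding 1(3) 2(3) by (simp add: algebra_simps)
  hence "11 dvd b * b' * (int (g_val g) - int (g_val h))" by simp
  hence "11 dvd int (g_val g) - int (g_val h)"
    using not_dvd_mult_11[OF not_dvd_mult_11[OF 1(2) 2(2)]] by blast
  moreover have "\<bar>int (g_val g) - int (g_val h)\<bar> < 11" using g_val_less[of g] g_val_less[of h] by linarith
  ultimately have "int (g_val g) - int (g_val h) = 0"
    using dvd_imp_le_int[of "int (g_val g) - int (g_val h)" 11] by linarith
  thus ?thesis by (intro g_val_inj) simp
qed

lemma res_of_nat: "res (of_nat (g_val g)) g"
  by (rule resI[of _ 1 _ _ 0]) simp_all

lemma res_0: "res 0 G0" and res_1: "res 1 G1"
  using res_of_nat[of G0] res_of_nat[of G1] by simp_all

lemma res_powi: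
  assumes "res y g" "g \<noteq> G0"
  shows "res (y powi tri_int b) (g_pow b g (g_inv g))"
proof -
  have "y powi (-1) = inverse y" by (simp add: power_int_def)
  thus ?thesis using assms(1) res_inverse(2)[OF assms] res_1 by (cases b) simp_all
qed

primrec term_at :: "rat \<Rightarrow> rat \<Rightarrow> term2 \<Rightarrow> rat" where
  "term_at y z (D b c) = y powi tri_int b * z powi tri_int c"

lemma res_g_sum:
  assumes "res y gy" "res z gz" "gy \<noteq> G0" "gz \<noteq> G0"
  shows "res (sum_list (map (term_at y z) L)) (g_sum L gy (g_inv gy) gz (g_inv gz))"
proof (induction L)
  case (Cons t L)
  thus ?case using assms by (cases t) (simp add: res_add res_mult res_powi)
qed (simp add: res_0)

lemma tri_int_eq: "tri_int a = tri_int b \<longleftrightarrow> a = b"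
  by (cases a; cases b) simp_all

lemma inj_code_step: "inj code_step"
proof (rule injI)
  fix s t assume "code_step s = code_step t"
  thus "s = t" by (cases s; cases t) (simp add: tri_int_eq)
qed

lemma sum_code_steps:
  assumes "distinct l"
  shows "(\<Sum>s\<in>{s\<in>code_step ` set l. P s}. f s) = sum_list (map (\<lambda>u. if P (code_step u) then f (code_step u) else 0) l)"
proof -
  have "(\<Sum>s\<in>{s\<in>code_step ` set l. P s}. f s) = (\<Sum>s\<in>code_step ` set l. if P s then f s else 0)"
    by (simp add: sum.inter_filter)
  also have "\<dots> = (\<Sum>u\<in>set l. if P (code_step u) then f (code_step u) else 0)"
    by (subst sum.reindex) (auto intro: inj_on_subset[OF inj_code_step])
  finally show ?thesis using assms by (simp add: sum.distinct_set_conv_list)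
qed

lemma coeff_at_terms:
  assumes "distinct l"
  shows "coeffA_at (code_step ` set l) (tri_int t) y z = sum_list (map (term_at y z) (termsA t l))"
    and "coeffB_at (code_step ` set l) (tri_int t) x z = sum_list (map (term_at x z) (termsB t l))"
proof -
  have "sum_list (map (\<lambda>u. if coord 0 (code_step u) = tri_int t
      then (case code_step u of (i, j, k) \<Rightarrow> y powi j * z powi k) else 0) l) = sum_list (map (term_at y z) (termsA t l))"
    by (induction l rule: termsA.induct[of _ t, case_names Nil Cons])
       (auto simp: tri_int_eq tri_eq_def cons_if_def)
  thus "coeffA_at (code_step ` set l) (tri_int t) y z = sum_list (map (term_at y z) (termsA t l))"
    unfolding coeffA_at_def by (subst sum_code_steps[OF assms])
  have "sum_list (map (\<lambda>u. if coord 1 (code_step u) = tri_int t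
      then (case code_step u of (i, j, k) \<Rightarrow> x powi i * z powi k) else 0) l) = sum_list (map (term_at x z) (termsB t l))"
    by (induction l rule: termsB.induct[of _ t, case_names Nil Cons])
       (auto simp: tri_int_eq tri_eq_def cons_if_def)
  thus "coeffB_at (code_step ` set l) (tri_int t) x z = sum_list (map (term_at x z) (termsB t l))"
    unfolding coeffB_at_def by (subst sum_code_steps[OF assms])
qed


section \<open>The orbit of a point\<close>

lemma g_mul_nonzero: "g_mul a b \<noteq> G0 \<Longrightarrow> a \<noteq> G0 \<and> b \<noteq> G0"
  by (cases a; cases b) (simp_all add: g_mul_table)

lemma g_inv_nonzero: "g_inv a \<noteq> G0 \<Longrightarrow> a \<noteq> G0"
  by (cases a) (simp_all add: g_inv_table)

lemma g_step_sound:
  assumes "res y gy" "res z gz" "res x gx" "gy \<noteq> G0" "gz \<noteq> G0"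
    and "g_step lm lp gy (g_inv gy) gz (g_inv gz) gx \<noteq> G0"
  shows "sum_list (map (term_at y z) lp) \<noteq> 0"
    and "res (sum_list (map (term_at y z) lm) / sum_list (map (term_at y z) lp) / x)
      (g_step lm lp gy (g_inv gy) gz (g_inv gz) gx)"
proof -
  let ?p = "g_sum lp gy (g_inv gy) gz (g_inv gz)"
  have nz: "g_mul ?p gx \<noteq> G0" "?p \<noteq> G0"
    using assms(6) g_mul_nonzero g_inv_nonzero unfolding g_step_def by blast+
  note r = res_g_sum[OF assms(1,2,4,5)]
  show "sum_list (map (term_at y z) lp) \<noteq> 0" by (rule res_inverse(1)[OF r nz(2)])
  have "res (sum_list (map (term_at y z) lm) * inverse (sum_list (map (term_at y z) lp) * x))
      (g_step lm lp gy (g_inv gy) gz (g_inv gz) gx)"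
    unfolding g_step_def by (intro res_mult res_inverse(2) r assms nz(1))
  thus "res (sum_list (map (term_at y z) lm) / sum_list (map (term_at y z) lp) / x)
      (g_step lm lp gy (g_inv gy) gz (g_inv gz) gx)"
    by (simp add: divide_inverse mult.assoc)
qed

text \<open>All coordinates stay non-zero modulo 11 along the orbit, so the pair map has a value at each of
  its points, and this value reduces to the point computed with residues.\<close>

lemma orbit_sound:
  assumes "distinct l" "S = code_step ` set l" "res z gz" "gz \<noteq> G0"
  shows "orbit n (termsA Neg l) (termsA Pos l) (termsB Neg l) (termsB Pos l) gx gy gz (g_inv gz) g0 h0 \<Longrightarrow>
    res x gx \<Longrightarrow> res y gy \<Longrightarrow> gx \<noteq> G0 \<Longrightarrow> gy \<noteq> G0 \<Longrightarrow> maps_to of_rat G P0 (x, y, z) \<Longrightarrow>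
    \<exists>X Y a b. maps_to of_rat ((rcomp (pair_map S) ^^ n) G) P0 (X, Y, z) \<and> res X a \<and> res Y b \<and> moved a b g0 h0"
proof (induction n arbitrary: gx gy x y G)
  case 0
  thus ?case by auto
next
  case (Suc n)
  let ?am = "termsA Neg l" and ?ap = "termsA Pos l" and ?bm = "termsB Neg l" and ?bp = "termsB Pos l"
  define gx' where "gx' = g_step ?am ?ap gy (g_inv gy) gz (g_inv gz) gx"
  define gy' where "gy' = g_step ?bm ?bp gx' (g_inv gx') gz (g_inv gz) gy"
  have o: "gx' \<noteq> G0" "gy' \<noteq> G0" "orbit n ?am ?ap ?bm ?bp gx' gy' gz (g_inv gz) g0 h0"
    using Suc.prems(1) unfolding gx'_def gy'_def by (simp_all add: Let_def)
  note c = coeff_at_terms[OF assms(1), folded assms(2)]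
  define x' where "x' = coeffA_at S (-1) y z / coeffA_at S 1 y z / x"
  define y' where "y' = coeffB_at S (-1) x' z / coeffB_at S 1 x' z / y"
  have A: "coeffA_at S (-1) y z = sum_list (map (term_at y z) ?am)"
    "coeffA_at S 1 y z = sum_list (map (term_at y z) ?ap)"
    using c(1)[of Neg y z] c(1)[of Pos y z] by simp_all
  have B: "coeffB_at S (-1) x' z = sum_list (map (term_at x' z) ?bm)"
    "coeffB_at S 1 x' z = sum_list (map (term_at x' z) ?bp)"
    using c(2)[of Neg x' z] c(2)[of Pos x' z] by simp_all
  have x': "coeffA_at S 1 y z \<noteq> 0" "res x' gx'"
    using g_step_sound[OF Suc.prems(3) assms(3) Suc.prems(2,5) assms(4), of ?am ?ap] o(1)
    unfolding gx'_def x'_def A by simp_all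
  have y': "coeffB_at S 1 x' z \<noteq> 0" "res y' gy'"
    using g_step_sound[OF x'(2) assms(3) Suc.prems(3) o(1) assms(4), of ?bm ?bp] o(2)
    unfolding gy'_def y'_def B by simp_all
  have nz: "x \<noteq> 0" "y \<noteq> 0" "z \<noteq> 0" "x' \<noteq> 0"
    using res_inverse(1) Suc.prems(2-5) assms(3,4) x'(2) o(1) by blast+
  have "maps_to of_rat (phi S) (x, y, z) (x', y, z)"
    using rat_point.maps_to_phi[OF nz(1-3) x'(1)] by (simp add: phi_at_def x'_def)
  moreover have "maps_to of_rat (psi S) (x', y, z) (x', y', z)"
    using rat_point.maps_to_psi[OF nz(4,2,3) y'(1)] by (simp add: psi_at_def y'_def)
  ultimately have "maps_to of_rat (pair_map S) (x, y, z) (x', y', z)"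
    unfolding pair_map_def by (rule rat_point.maps_to_rcomp)
  with Suc.prems(6) have "maps_to of_rat (rcomp (pair_map S) G) P0 (x', y', z)"
    by (rule rat_point.maps_to_rcomp)
  from Suc.IH[OF o(3) x'(2) y'(2) o(1,2) this] show ?case
    by (simp add: funpow_swap1)
qed

primrec proper :: "point \<Rightarrow> bool" where
  "proper (Pt x y z) \<longleftrightarrow> x \<noteq> G0 \<and> y \<noteq> G0 \<and> z \<noteq> G0"

primrec term_fst :: "term2 \<Rightarrow> int" where
  "term_fst (D b c) = tri_int b"

lemma tri_min_int: "tri_int (tri_min a b) = min (tri_int a) (tri_int b)"
  and tri_max_int: "tri_int (tri_max a b) = max (tri_int a) (tri_int b)"
  by (simp_all add: tri_min_def tri_max_def)

lemma min_exp_Min: "L \<noteq> [] \<Longrightarrow> tri_int (min_exp L) = Min (term_fst ` set L)"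
  and max_exp_Max: "L \<noteq> [] \<Longrightarrow> tri_int (max_exp L) = Max (term_fst ` set L)"
proof -
  have t: "tri_int a \<le> 1" "-1 \<le> tri_int a" for a by (cases a; simp)+
  show "L \<noteq> [] \<Longrightarrow> tri_int (min_exp L) = Min (term_fst ` set L)"
  proof (induction L)
    case (Cons u L)
    thus ?case using t by (cases u; cases "L = []") (simp_all add: tri_min_int)
  qed simp
  show "L \<noteq> [] \<Longrightarrow> tri_int (max_exp L) = Max (term_fst ` set L)"
  proof (induction L)
    case (Cons u L)
    thus ?case using t by (cases u; cases "L = []") (simp_all add: tri_max_int)
  qed simp
qed

lemma terms_fst:
  "term_fst ` set (termsA t l) = coord 1 ` {s\<in>code_step ` set l. coord 0 s = tri_int t}"
  "term_fst ` set (termsB t l) = coord 0 ` {s\<in>code_step ` set l. coord 1 s = tri_int t}"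
proof -
  have *: "{s\<in>code_step ` set (u # l). P s} = (if P (code_step u) then {code_step u} else {}) \<union> {s\<in>code_step ` set l. P s}"
    for u l P by auto
  show "term_fst ` set (termsA t l) = coord 1 ` {s\<in>code_step ` set l. coord 0 s = tri_int t}"
    by (induction l rule: termsA.induct[of _ t, case_names Nil Cons])
       (simp, simp only: * image_Un, simp add: tri_int_eq tri_eq_def cons_if_def)
  show "term_fst ` set (termsB t l) = coord 0 ` {s\<in>code_step ` set l. coord 1 s = tri_int t}"
    by (induction l rule: termsB.induct[of _ t, case_names Nil Cons])
       (simp, simp only: * image_Un, simp add: tri_int_eq tri_eq_def cons_if_def)
qed

lemma (in pair_model) tri_diff_extreme:
  assumes "L \<noteq> []" "M \<noteq> []"
  shows "tri_diff (min_exp L) (min_exp M) = extreme 1 (term_fst ` set L) - extreme 1 (term_fst ` set M)"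
    and "tri_diff (max_exp L) (max_exp M) = extreme (-1) (term_fst ` set L) - extreme (-1) (term_fst ` set M)"
  using assms by (simp_all add: tri_diff_def extreme_def min_exp_Min max_exp_Max)

text \<open>If the group were finite, the \<open>q\<close>-th power of the pair map would be the identity, but it
  moves a point.\<close>

lemma moves_sound:
  assumes "octant_model S" "S = code_step ` set l" "distinct l" "moves p (prepare l)" "proper p"
  shows "infinite (carrier (model_group S))"
proof
  assume fin: "finite (carrier (model_group S))"
  interpret octant_model S by (rule assms(1))
  let ?am = "termsA Neg l" and ?ap = "termsA Pos l" and ?bm = "termsB Neg l" and ?bp = "termsB Pos l"
  obtain N where N: "0 < N" "iter_map (pair_map S) N = rid" using finite_group_finite_order[OF fin] by blast
  have ne: "term_fst ` set (termsA t l) \<noteq> {}" "term_fst ` set (termsB t l) \<noteq> {}" if "t \<noteq> Zer" for t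
  proof -
    have "tri_int t \<in> {-1, 1}" using that by (cases t) auto
    from nonempty[of 0, OF _ this] nonempty[of 1, OF _ this]
    show "term_fst ` set (termsA t l) \<noteq> {}" "term_fst ` set (termsB t l) \<noteq> {}"
      unfolding terms_fst assms(2) by auto
  qed
  have ne': "?am \<noteq> []" "?ap \<noteq> []" "?bm \<noteq> []" "?bp \<noteq> []"
    using ne[of Neg] ne[of Pos] by auto
  have sl: "slopes = (tri_diff (min_exp ?am) (min_exp ?ap), tri_diff (max_exp ?am) (max_exp ?ap),
      tri_diff (min_exp ?bm) (min_exp ?bp), tri_diff (max_exp ?bm) (max_exp ?bp))"
    unfolding slopes_def slopeA_def slopeB_def tri_diff_extreme[OF ne'(1,2)] tri_diff_extreme[OF ne'(3,4)]
      terms_fst by (simp add: assms(2))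
  obtain q where q: "map_of period_table slopes = Some q" "prepare l = PR q ?am ?ap ?bm ?bp"
    using assms(4) unfolding prepare_def prepare2_def prepare'_def period_of_def sl[symmetric]
    by (cases "map_of period_table slopes"; cases p) auto
  have T: "q \<noteq> 0" "iter_map (pair_map S) q = rid"
    using period_sound[OF map_of_SomeD[OF q(1)] N(2,1)] by blast+
  obtain gx gy gz where p: "p = Pt gx gy gz" by (cases p)
  have g: "gx \<noteq> G0" "gy \<noteq> G0" "gz \<noteq> G0" using assms(5) p by auto
  have "orbit q ?am ?ap ?bm ?bp gx gy gz (g_inv gz) gx gy"
    using assms(4) T(1) unfolding q(2) p by (cases q) auto
  from orbit_sound[OF assms(3,2) res_of_nat g(3) this res_of_nat res_of_nat g(1,2) rat_point.maps_to_rid]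
  obtain X Y a b where XY: "maps_to of_rat (iter_map (pair_map S) q)
      (of_nat (g_val gx), of_nat (g_val gy), of_nat (g_val gz)) (X, Y, of_nat (g_val gz))"
    "res X a" "res Y b" "moved a b gx gy"
    unfolding iter_map_def by blast
  have "(X, Y, of_nat (g_val gz)) = (of_nat (g_val gx), of_nat (g_val gy), of_nat (g_val gz) :: rat)"
    using XY(1) unfolding T(2) by (rule rat_point.maps_to_unique[OF _ rat_point.maps_to_rid])
  hence "a = gx" "b = gy" using XY(2,3) res_of_nat res_unique by blast+
  thus False using XY(4) by (simp add: moved_def g_eq_def)
qed

lemma is_model_permute:
  assumes "\<sigma> permutes {..<3}" "is_model S"
  shows "is_model (permute_step \<sigma> ` S)"
proof -
  have "permute_step \<sigma> s \<in> ({-1, 0, 1} \<times> {-1, 0, 1} \<times> {-1, 0, 1}) - {(0, 0, 0)}" if "s \<in> S" for s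
  proof -
    have s: "s \<in> ({-1, 0, 1} \<times> {-1, 0, 1} \<times> {-1, 0, 1}) - {(0, 0, 0)}"
      using that assms(2) unfolding is_model_def by blast
    have c: "coord j s \<in> {-1, 0, 1}" for j using s by (cases s) auto
    have "permute_step \<sigma> s \<noteq> (0, 0, 0)"
    proof
      assume "permute_step \<sigma> s = (0, 0, 0)"
      moreover have "permute_step \<sigma> (0, 0, 0) = (0, 0, 0)" by (simp add: permute_step_def)
      ultimately have "s = (0, 0, 0)" using inj_permute_step[OF assms(1)] by (metis injD)
      thus False using s by simp
    qed
    moreover have "permute_step \<sigma> s \<in> {-1, 0, 1} \<times> {-1, 0, 1} \<times> {-1, 0, 1}"
      unfolding permute_step_def by (intro SigmaI c)
    ultimately show ?thesis by (intro DiffI) simp_all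
  qed
  thus ?thesis unfolding is_model_def by (rule image_subsetI)
qed

lemma octant_model_permute:
  assumes "\<sigma> permutes {..<3}" "octant_model S"
  shows "octant_model (permute_step \<sigma> ` S)"
proof -
  interpret octant_model S by (rule assms(2))
  show ?thesis
  proof
    show "is_model (permute_step \<sigma> ` S)" by (rule is_model_permute[OF assms(1) model])
    fix i :: nat and e :: int assume ie: "i < 3" "e \<in> {-1, 1}"
    obtain s where "s \<in> S" "coord (\<sigma> i) s = e"
      using nonempty[OF perm_less[OF assms(1) ie(1)] ie(2)] by blast
    thus "{s \<in> permute_step \<sigma> ` S. coord i s = e} \<noteq> {}"
      using coord_permute_step[OF assms(1) ie(1)] by blast
  qed
qed

lemma finite_model_group_permute:
  assumes "\<sigma> permutes {..<3}" "octant_model S"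
  shows "\<exists>f. bij_betw f (carrier (model_group S)) (carrier (model_group (permute_step \<sigma> ` S)))"
proof -
  interpret octant_model S by (rule assms(2))
  have "gen_coeff S i 1 \<noteq> 0" if "i < 3" for i
  proof -
    have "i = 0 \<or> i = 1 \<or> i = 2" using that by auto
    thus ?thesis using coeff_nonzero[of 1] gen_coeff_eq[of S 1] by auto
  qed
  from model_group_permute[OF assms(1) generators_in_Bir this] show ?thesis by blast
qed

text \<open>The cyclic permutation of the coordinates that \<open>rotate3\<close> applies to codes.\<close>

definition turn :: "nat \<Rightarrow> nat" where
  "turn = transpose 0 1 \<circ> transpose 1 2"

lemma turn_permutes: "turn permutes {..<3}" and swap_permutes: "transpose 1 2 permutes {..<3::nat}"
  unfolding turn_def by (intro permutes_compose permutes_swap_id; simp)+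

lemma swap_yz_steps: "code_step ` set (swap_yz l) = permute_step (transpose 1 2) ` code_step ` set l"
  by (induction l rule: swap_yz.induct) (simp_all add: permute_step_def transpose_def)

lemma rotate3_steps: "code_step ` set (rotate3 l) = permute_step turn ` code_step ` set l"
  by (induction l rule: rotate3.induct) (simp_all add: permute_step_def turn_def transpose_def)

lemma distinct_permuted:
  assumes "distinct l"
  shows "distinct (swap_yz l)" "distinct (rotate3 l)"
proof -
  have 1: "C a b c \<in> set (swap_yz l) \<longleftrightarrow> C a c b \<in> set l" for a b c l
    by (induction l rule: swap_yz.induct) auto
  have 2: "C a b c \<in> set (rotate3 l) \<longleftrightarrow> C c a b \<in> set l" for a b c l
    by (induction l rule: rotate3.induct) auto
  show "distinct (swap_yz l)" using assms by (induction l rule: swap_yz.induct) (auto simp: 1)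
  show "distinct (rotate3 l)" using assms by (induction l rule: rotate3.induct) (auto simp: 2)
qed

lemma any_moves_iff:
  "any_moves ps r1 r2 r3 \<longleftrightarrow> (\<exists>p\<in>set ps. moves p r1 \<or> moves p r2 \<or> moves p r3)"
  by (induction ps) auto

theorem infinite_test_sound:
  assumes oct: "octant_model (code_step ` set l)" and "distinct l" "infinite_test l"
  shows "infinite (carrier (model_group (code_step ` set l)))"
proof -
  let ?S = "code_step ` set l"
  obtain p where p: "p \<in> set test_points"
    "moves p (prepare l) \<or> moves p (prepare (swap_yz l)) \<or> moves p (prepare (rotate3 l))"
    using assms(3) unfolding infinite_test_def any_moves_iff by blast
  have proper: "proper p" using p(1) by (auto simp: test_points_def)
  have perm: "infinite (carrier (model_group ?S))"
    if "\<sigma> permutes {..<3}" "code_step ` set l' = permute_step \<sigma> ` ?S" "distinct l'" "moves p (prepare l')" for \<sigma> l'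
  proof -
    have "infinite (carrier (model_group (permute_step \<sigma> ` ?S)))"
      using octant_model_permute[OF that(1) oct] that(2)
      by (intro moves_sound[OF _ _ that(3,4) proper]) simp_all
    thus ?thesis using finite_model_group_permute[OF that(1) oct] bij_betw_finite by blast
  qed
  show ?thesis
    using p(2) moves_sound[OF oct refl assms(2) _ proper]
      perm[OF swap_permutes swap_yz_steps distinct_permuted(1)[OF assms(2)]]
      perm[OF turn_permutes rotate3_steps distinct_permuted(2)[OF assms(2)]] by blast
qed


section \<open>Groups generated by three involutions\<close>

lemma (in group) generate_involutions_subset:
  assumes "H \<subseteq> carrier G" "\<And>h. h \<in> H \<Longrightarrow> h \<otimes> h = \<one>"
    and "W \<subseteq> carrier G" "\<one> \<in> W" "\<And>h w. h \<in> H \<Longrightarrow> w \<in> W \<Longrightarrow> h \<otimes> w \<in> W"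
  shows "generate G H \<subseteq> W"
proof
  fix g assume g: "g \<in> generate G H"
  have "\<forall>w\<in>W. g \<otimes> w \<in> W" using g
  proof (induction rule: generate.induct)
    case one
    thus ?case using assms(3) by auto
  next
    case (incl h)
    thus ?case using assms(5) by blast
  next
    case (inv h)
    have "inv h = h" using assms(1,2) inv by (intro inv_equality) auto
    thus ?case using assms(5) inv by simp
  next
    case (eng g h)
    show ?case
    proof
      fix w assume w: "w \<in> W"
      have "g \<otimes> h \<otimes> w = g \<otimes> (h \<otimes> w)"
        using eng(1,2) w assms(1,3) by (intro m_assoc) (auto dest: generate_in_carrier)
      thus "g \<otimes> h \<otimes> w \<in> W" using eng.IH w by simp
    qed
  qed
  hence "g \<otimes> \<one> \<in> W" using assms(4) by blast
  thus "g \<in> W" using generate_in_carrier[OF assms(1) g] by simp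
qed

text \<open>With \<open>t = a b\<close>, every product of generators can be brought to the form \<open>t\<^sup>n a\<^sup>e c\<^sup>f\<close>, since
  \<open>a t = t\<^sup>-\<^sup>1 a\<close> and \<open>c\<close> is central.\<close>

lemma (in group) dihedral_times_two:
  fixes k :: nat
  assumes "a \<in> carrier G" "b \<in> carrier G" "c \<in> carrier G"
    and inv: "a \<otimes> a = \<one>" "b \<otimes> b = \<one>" "c \<otimes> c = \<one>"
    and T: "(a \<otimes> b) [^] k = \<one>" "0 < k" and ca: "c \<otimes> a = a \<otimes> c" and cb: "c \<otimes> b = b \<otimes> c"
  shows "finite (generate G {a, b, c})" "card (generate G {a, b, c}) \<le> 4 * k"
proof -
  define t where "t = a \<otimes> b"
  have t: "t \<in> carrier G" unfolding t_def using assms by simp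
  have abc: "a \<in> carrier G" "b \<in> carrier G" "c \<in> carrier G" by fact+
  define el where "el n e f = t [^] (n::nat) \<otimes> (if e then a else \<one>) \<otimes> (if f then c else \<one>)" for n e f
  define W where "W = (\<lambda>(n, e, f). el n e f) ` ({..<k} \<times> UNIV \<times> UNIV)"
  have period: "t [^] n = t [^] (n mod k)" for n :: nat
  proof -
    have "t [^] (k * (n div k) + n mod k) = (t [^] k) [^] (n div k) \<otimes> t [^] (n mod k)"
      using t by (simp add: nat_pow_mult nat_pow_pow)
    thus ?thesis using T(1) t by (simp add: t_def)
  qed
  have W: "el n e f \<in> W" for n e f
    unfolding W_def el_def period[of n] using T(2) by (intro image_eqI[of _ _ "(n mod k, e, f)"]) auto
  have at: "a \<otimes> t = b" using abc inv(1) by (simp add: t_def flip: m_assoc)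
  have tk: "t [^] (k - 1) = b \<otimes> a"
  proof -
    have "t [^] (k - 1) \<otimes> t = \<one>"
      using T t by (metis nat_pow_Suc Suc_pred' t_def)
    moreover have "b \<otimes> a \<otimes> t = \<one>"
      using abc t inv(2) at by (simp add: m_assoc)
    ultimately show ?thesis using t abc by (metis m_closed nat_pow_closed right_cancel)
  qed
  have a_pow: "a \<otimes> t [^] n = t [^] ((k - 1) * n) \<otimes> a" for n :: nat
  proof (induction n)
    case (Suc n)
    have "a \<otimes> t [^] Suc n = (a \<otimes> t [^] n) \<otimes> t" using abc t by (simp add: m_assoc)
    also have "\<dots> = t [^] ((k - 1) * n) \<otimes> (a \<otimes> t)" unfolding Suc using abc t by (simp add: m_assoc)
    also have "a \<otimes> t = t [^] (k - 1) \<otimes> a"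
      unfolding at tk using abc inv(1) by (simp add: m_assoc)
    also have "t [^] ((k - 1) * n) \<otimes> (t [^] (k - 1) \<otimes> a) = t [^] ((k - 1) * n + (k - 1)) \<otimes> a"
      using abc t by (simp add: nat_pow_mult flip: m_assoc)
    finally show ?case by (simp add: add.commute)
  qed (use abc in simp)
  have tc: "c \<otimes> t [^] n = t [^] n \<otimes> c" for n :: nat
  proof (induction n)
    case (Suc n)
    have "c \<otimes> t = t \<otimes> c"
      unfolding t_def using abc ca cb by (metis m_assoc)
    thus ?case using Suc abc t by (metis m_assoc nat_pow_Suc nat_pow_closed)
  qed (use abc in simp)
  have a_el: "a \<otimes> el n e f = el ((k - 1) * n) (\<not> e) f" for n e f
  proof -
    have "a \<otimes> el n e f = (a \<otimes> t [^] n) \<otimes> (if e then a else \<one>) \<otimes> (if f then c else \<one>)"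
      unfolding el_def using abc t by (simp add: m_assoc)
    also have "\<dots> = t [^] ((k - 1) * n) \<otimes> (a \<otimes> (if e then a else \<one>)) \<otimes> (if f then c else \<one>)"
      unfolding a_pow using abc t by (simp add: m_assoc)
    finally show ?thesis unfolding el_def using abc inv(1) by simp
  qed
  have b_el: "b \<otimes> el n e f = el ((k - 1) * Suc n) (\<not> e) f" for n e f
  proof -
    have "t \<otimes> el n e f = el (Suc n) e f"
      unfolding el_def nat_pow_Suc2[OF t] using abc t by (simp add: m_assoc)
    moreover have "el n e f \<in> carrier G" unfolding el_def using abc t by simp
    ultimately have "b \<otimes> el n e f = a \<otimes> el (Suc n) e f"
      unfolding at[symmetric] using abc t by (simp add: m_assoc)
    thus ?thesis by (simp only: a_el)
  qed
  have c_el: "c \<otimes> el n e f = el n e (\<not> f)" for n e f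
  proof -
    define x where "x = (if e then a else \<one>)"
    have x: "x \<in> carrier G" "c \<otimes> x = x \<otimes> c" unfolding x_def using abc ca by auto
    have "c \<otimes> el n e f = (c \<otimes> t [^] n) \<otimes> x \<otimes> (if f then c else \<one>)"
      unfolding el_def x_def[symmetric] using abc t x(1) by (simp add: m_assoc)
    also have "\<dots> = t [^] n \<otimes> (c \<otimes> x) \<otimes> (if f then c else \<one>)"
      unfolding tc using abc t x(1) by (simp add: m_assoc)
    also have "\<dots> = t [^] n \<otimes> x \<otimes> (c \<otimes> (if f then c else \<one>))"
      unfolding x(2) using abc t x(1) by (simp add: m_assoc)
    finally show ?thesis unfolding el_def x_def[symmetric] using abc inv(3) by simp
  qed
  have sub: "generate G {a, b, c} \<subseteq> W"
  proof (rule generate_involutions_subset)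
    show "W \<subseteq> carrier G" unfolding W_def el_def using abc t by auto
    have "el 0 False False = \<one>" by (simp add: el_def)
    thus "\<one> \<in> W" using W[of 0 False False] by simp
    fix h w assume "h \<in> {a, b, c}" "w \<in> W"
    then obtain n e f where "w = el n e f" unfolding W_def by auto
    thus "h \<otimes> w \<in> W" using \<open>h \<in> {a, b, c}\<close> W by (auto simp: a_el b_el c_el)
  qed (use abc inv in auto)
  have fin: "finite W" unfolding W_def by simp
  show "finite (generate G {a, b, c})" using sub fin by (rule finite_subset)
  have "card W \<le> card ({..<k} \<times> (UNIV :: bool set) \<times> (UNIV :: bool set))"
    unfolding W_def by (rule card_image_le) simp
  also have "\<dots> = 4 * k" unfolding card_cartesian_product card_UNIV_bool by simp
  finally show "card (generate G {a, b, c}) \<le> 4 * k" using card_mono[OF fin sub] by simp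
qed


section \<open>Sums of monomials\<close>

definition vmono :: "(nat \<Rightarrow> ratfun) \<Rightarrow> step \<Rightarrow> ratfun" where
  "vmono f s = f 0 powi coord 0 s * f 1 powi coord 1 s * f 2 powi coord 2 s"

text \<open>A list of exponent vectors stands for the sum of its monomials; identities between such sums are
  checked by comparing multiplicities.\<close>

definition val :: "step list \<Rightarrow> ratfun" where
  "val L = sum_list (map (vmono var_at) L)"

lemma coords [simp]: "coord 0 (a, b, c) = a" "coord (Suc 0) (a, b, c) = b" "coord 2 (a, b, c) = c"
  by simp_all

lemma less_3_cases: "i < 3 \<Longrightarrow> i = 0 \<or> i = 1 \<or> i = (2::nat)"
  by auto

lemma is_subst_vmono:
  assumes "\<And>t. t < 3 \<Longrightarrow> f t \<noteq> 0"
  shows "is_subst (vmono var_at s) (tuple3 f) (vmono f s)"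
  unfolding vmono_def by (intro is_subst_mult is_subst_powi is_subst_var_at assms) simp_all

lemma is_subst_sum_list:
  assumes "\<And>s. s \<in> set L \<Longrightarrow> is_subst (f s) G (g s)"
  shows "is_subst (sum_list (map f L)) G (sum_list (map g L))"
  using assms by (induction L) (auto intro: is_subst_0 is_subst_add)

lemma val_fixed:
  assumes "\<And>t. t < 3 \<Longrightarrow> f t \<noteq> 0" "\<And>t. t < 3 \<Longrightarrow> t \<noteq> i \<Longrightarrow> f t = var_at t" "\<forall>s\<in>set L. coord i s = 0"
  shows "is_subst (val L) (tuple3 f) (val L)"
proof -
  have "vmono f s = vmono var_at s" if "s \<in> set L" for s
  proof -
    have "f t powi coord t s = var_at t powi coord t s" if "t < 3" for t
      using assms(2)[OF that] assms(3) \<open>s \<in> set L\<close> by (cases "t = i") auto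
    thus ?thesis by (simp add: vmono_def)
  qed
  hence "is_subst (vmono var_at s) (tuple3 f) (vmono var_at s)" if "s \<in> set L" for s
    using is_subst_vmono[of f s, OF assms(1)] that by simp
  thus ?thesis unfolding val_def by (rule is_subst_sum_list)
qed

lemma val_nonzero:
  assumes "L \<noteq> []"
  shows "val L \<noteq> 0"
proof
  have "has_value (of_rat :: rat \<Rightarrow> rat) (val L) (1, 1, 1) (of_nat (length L))"
    unfolding val_def
  proof (induction L)
    case (Cons s L)
    have "has_value (of_rat :: rat \<Rightarrow> rat) (vmono var_at s) (1, 1, 1)
        (1 powi coord 0 s * 1 powi coord 1 s * 1 powi coord 2 s)"
    proof -
      have "has_value (of_rat :: rat \<Rightarrow> rat) (vX powi coord 0 s * vY powi coord 1 s * vZ powi coord 2 s) (1, 1, 1)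
          (1 powi coord 0 s * 1 powi coord 1 s * 1 powi coord 2 s)"
        by (intro rat_point.has_value_mult rat_point.has_value_powi rat_point.has_value_var) simp_all
      thus ?thesis by (simp add: vmono_def var_at_def)
    qed
    from rat_point.has_value_add[OF this Cons]
    have "has_value (of_rat :: rat \<Rightarrow> rat) (sum_list (map (vmono var_at) (s # L))) (1, 1, 1)
        (1 powi coord 0 s * 1 powi coord 1 s * 1 powi coord 2 s + of_nat (length L))"
      by (simp only: list.map sum_list.Cons)
    moreover have "1 powi coord 0 s * 1 powi coord 1 s * 1 powi coord 2 s + of_nat (length L) = (of_nat (length (s # L)) :: rat)"
      by simp
    ultimately show ?case by (simp only:)
  next
    case Nil
    show ?case
      by (simp only: list.map sum_list.Nil list.size of_nat_0 rat_point.has_value_0)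
  qed
  moreover assume "val L = 0"
  ultimately have "of_nat (length L) = (0::rat)"
    using rat_point.has_value_0 rat_point.has_value_unique by metis
  thus False using assms by simp
qed

definition add3 :: "step \<Rightarrow> step \<Rightarrow> step" where
  "add3 = (\<lambda>(a, b, c) (a', b', c'). (a + a', b + b', c + c'))"

definition prods :: "step list \<Rightarrow> step list \<Rightarrow> step list" where
  "prods L M = concat (map (\<lambda>s. map (add3 s) M) L)"

lemma vmono_add3: "vmono var_at (add3 s t) = vmono var_at s * vmono var_at t"
  by (cases s; cases t) (simp add: vmono_def add3_def power_int_add var_at_nonzero)

lemma val_prods: "val (prods L M) = val L * val M"
proof (induction L)
  case (Cons s L)
  have "val (map (add3 s) M) = vmono var_at s * val M"
    unfolding val_def by (simp add: o_def vmono_add3 sum_list_const_mult)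
  thus ?case using Cons by (simp add: val_def prods_def algebra_simps)
qed (simp add: val_def prods_def)

definition same :: "step list \<Rightarrow> step list \<Rightarrow> bool" where
  "same L M \<longleftrightarrow> list_all (\<lambda>u. count_list L u = count_list M u) (L @ M)"

lemma same_val:
  assumes "same L M"
  shows "val L = val M"
proof -
  have "count_list L u = count_list M u" for u
    using assms by (cases "u \<in> set (L @ M)") (auto simp: same_def list_all_iff count_list_0_iff)
  hence "mset L = mset M" by (intro multiset_eqI) (simp add: count_mset)
  thus ?thesis unfolding val_def by (metis mset_map sum_mset_sum_list)
qed

definition zero_at :: "nat \<Rightarrow> step \<Rightarrow> step" where
  "zero_at i = (\<lambda>(a, b, c). (if i = 0 then 0 else a, if i = 1 then 0 else b, if i = 2 then 0 else c))"

definition part :: "step list \<Rightarrow> nat \<Rightarrow> int \<Rightarrow> step list" where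
  "part L i e = map (zero_at i) (filter (\<lambda>s. coord i s = e) L)"

definition unit :: "nat \<Rightarrow> int \<Rightarrow> step" where
  "unit i m = (if i = 0 then (m, 0, 0) else if i = 1 then (0, m, 0) else (0, 0, m))"

lemma vmono_unit: "i < 3 \<Longrightarrow> vmono var_at (unit i m) = var_at i powi m"
  using less_3_cases[of i] by (auto simp: vmono_def unit_def)

lemma zero_at_add3: "i < 3 \<Longrightarrow> add3 (unit i (coord i s)) (zero_at i s) = s"
  using less_3_cases[of i] by (cases s) (auto simp: add3_def unit_def zero_at_def)

lemma coord_zero_at: "i < 3 \<Longrightarrow> coord i (zero_at i s) = 0"
  using less_3_cases[of i] by (cases s) (auto simp: zero_at_def)

lemma coord_zero_at_other: "coord j s = 0 \<Longrightarrow> coord j (zero_at i s) = 0"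
  by (cases s) (auto simp: zero_at_def split: if_splits)

lemma coord_part: "i < 3 \<Longrightarrow> \<forall>s\<in>set (part L i e). coord i s = 0"
  and coord_part_other: "\<forall>s\<in>set L. coord j s = 0 \<Longrightarrow> \<forall>s\<in>set (part L i e). coord j s = 0"
  using coord_zero_at coord_zero_at_other unfolding part_def by auto

lemma val_split:
  assumes "i < 3" "\<forall>s\<in>set L. coord i s \<in> {-1, 0, 1}"
  shows "val L = val (part L i 1) * var_at i + val (part L i 0) + val (part L i (-1)) / var_at i"
  using assms(2)
proof (induction L)
  case (Cons s L)
  have "vmono var_at s = var_at i powi coord i s * vmono var_at (zero_at i s)"
    using vmono_add3[of "unit i (coord i s)" "zero_at i s"] by (simp add: zero_at_add3[OF assms(1)] vmono_unit[OF assms(1)])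
  moreover have "coord i s = -1 \<or> coord i s = 0 \<or> coord i s = 1" using Cons.prems by auto
  moreover have "val L = val (part L i 1) * var_at i + val (part L i 0) + val (part L i (-1)) / var_at i"
    using Cons by simp
  ultimately show ?case
    by (elim disjE) (simp_all add: val_def part_def field_simps var_at_nonzero power_int_minus)
qed (simp add: val_def part_def)

lemma gen_coeff_val:
  assumes "i < 3" "distinct l"
  shows "gen_coeff (set l) i e = val (part l i e)"
proof -
  have "(\<Prod>j\<in>{..<3} - {i}. var_at j powi coord j s) = vmono var_at (zero_at i s)" for s
  proof -
    have *: "{..<3::nat} - {0} = {1, 2}" "{..<3::nat} - {Suc 0} = {0, 2}" "{..<3::nat} - {2} = {0, 1}"
      by auto
    show ?thesis using less_3_cases[OF assms(1)]
      by (cases s) (auto simp: vmono_def zero_at_def *)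
  qed
  hence "gen_coeff (set l) i e = (\<Sum>s\<in>set (filter (\<lambda>s. coord i s = e) l). vmono var_at (zero_at i s))"
    unfolding gen_coeff_def by (simp add: set_filter)
  also have "\<dots> = sum_list (map (\<lambda>s. vmono var_at (zero_at i s)) (filter (\<lambda>s. coord i s = e) l))"
    using assms(2) by (intro sum.distinct_set_conv_list) simp
  finally show ?thesis by (simp add: val_def part_def o_def)
qed


section \<open>Relations between the generators\<close>

text \<open>The ratio \<open>A\<^sub>-/A\<^sub>+\<close> equals a quotient \<open>a = C/D\<close> that depends on neither of the two variables,
  and \<open>B\<^sub>-\<close>, \<open>B\<^sub>+\<close> are invariant under \<open>x \<mapsto> a/x\<close>.\<close>

definition commutes1 :: "step list \<Rightarrow> nat \<Rightarrow> nat \<Rightarrow> int \<Rightarrow> bool" where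
  "commutes1 l i j r \<longleftrightarrow> (let Am = part l i (-1); Ap = part l i 1; C = part Am j r; D = part Ap j r in
     C \<noteq> [] \<and> D \<noteq> [] \<and> same (prods Am D) (prods C Ap) \<and>
     (\<forall>e\<in>{-1, 1}. same (prods (part (part l j e) i (-1)) D) (prods (part (part l j e) i 1) C)))"

text \<open>The ratio \<open>A\<^sub>-/A\<^sub>+\<close> is \<open>y\<^sup>m\<close> times a quotient that depends on neither of the two variables.\<close>

definition twists :: "step list \<Rightarrow> nat \<Rightarrow> nat \<Rightarrow> int \<Rightarrow> int \<Rightarrow> bool" where
  "twists l i j m r \<longleftrightarrow> (let Am = part l i (-1); Ap = part l i 1; C = part Am j (r + m); D = part Ap j r in
     C \<noteq> [] \<and> D \<noteq> [] \<and> same (prods Am D) (prods [unit j m] (prods C Ap)))"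

locale listed_model = octant_model "set l" for l :: "step list" +
  assumes distinct: "distinct l"
begin

abbreviation gen :: "nat \<Rightarrow> ratmap" where "gen \<equiv> gen_map (set l)"
abbreviation ratio :: "nat \<Rightarrow> ratfun" where
  "ratio i \<equiv> gen_coeff (set l) i (-1) / gen_coeff (set l) i 1"
abbreviation flip :: "nat \<Rightarrow> nat \<Rightarrow> ratfun" where
  "flip i t \<equiv> (if t = i then 1 / var_at i * ratio i else var_at t)"

lemma gen_eq: "gen i = tuple3 (flip i)"
  by (simp add: gen_map_def)

lemma part_nonempty: "i < 3 \<Longrightarrow> e \<in> {-1, 1} \<Longrightarrow> part l i e \<noteq> []"
  unfolding part_def map_is_Nil_conv filter_empty_conv using nonempty[of i e] by blast

lemma val_part_nonzero: "i < 3 \<Longrightarrow> e \<in> {-1, 1} \<Longrightarrow> val (part l i e) \<noteq> 0"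
  by (intro val_nonzero part_nonempty)

lemma ratio_val: "i < 3 \<Longrightarrow> ratio i = val (part l i (-1)) / val (part l i 1)"
  by (simp add: gen_coeff_val distinct)

lemma flip_nonzero: "i < 3 \<Longrightarrow> flip i t \<noteq> 0"
  using val_part_nonzero[of i "-1"] val_part_nonzero[of i 1] by (auto simp: ratio_val var_at_nonzero)

lemma fixed_gen:
  assumes "i < 3" "\<forall>s\<in>set L. coord i s = 0"
  shows "is_subst (val L) (gen i) (val L)"
  unfolding gen_eq by (rule val_fixed[of _ i]) (use assms flip_nonzero in auto)

lemma coord_mem: "s \<in> set l \<Longrightarrow> coord i s \<in> {-1, 0, 1}"
  using model by (cases s) (auto simp: is_model_def)

lemma gen_in_Bir: "i < 3 \<Longrightarrow> gen i \<in> carrier Bir"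
  using generators_in_Bir less_3_cases[of i] by (auto simp: gen_map_eq gen_map_eq(2)[unfolded One_nat_def])

lemma gen_involution: "i < 3 \<Longrightarrow> rcomp (gen i) (gen i) = rid"
  using phi_involution(2) psi_involution(2) tau_involution(2) coeff_nonzero[of "-1"] coeff_nonzero[of 1]
    less_3_cases[of i] by (auto simp: gen_map_eq gen_map_eq(2)[unfolded One_nat_def])

lemma commutes1_sound:
  assumes ij: "i < 3" "j < 3" "i \<noteq> j" and c: "commutes1 l i j r"
  shows "rcomp (gen i) (gen j) = rcomp (gen j) (gen i)"
proof -
  define C where "C = part (part l i (-1)) j r"
  define D where "D = part (part l i 1) j r"
  define a where "a = val C / val D"
  have CD: "val C \<noteq> 0" "val D \<noteq> 0" and A: "same (prods (part l i (-1)) D) (prods C (part l i 1))"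
    and B: "\<And>e. e \<in> {-1, 1} \<Longrightarrow> same (prods (part (part l j e) i (-1)) D) (prods (part (part l j e) i 1) C)"
    using c val_nonzero unfolding commutes1_def Let_def C_def[symmetric] D_def[symmetric] by blast+
  have a0: "a \<noteq> 0" using CD by (simp add: a_def)
  have coordC: "\<forall>s\<in>set C. coord t s = 0" "\<forall>s\<in>set D. coord t s = 0" if "t = i \<or> t = j" for t
    using that ij coord_part coord_part_other unfolding C_def D_def by blast+
  have fix_a: "is_subst a (gen t) a" if "t = i \<or> t = j" for t
    unfolding a_def using that ij CD by (intro is_subst_divide fixed_gen coordC) auto
  have "val (part l i (-1)) * val D = val C * val (part l i 1)"
    using same_val[OF A] by (simp add: val_prods)
  hence rat: "ratio i = a"
    using CD val_part_nonzero[OF ij(1), of 1] unfolding ratio_val[OF ij(1)] a_def by (simp add: field_simps)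
  have x: "is_subst (var_at i) (gen i) (a / var_at i)"
    using is_subst_var_at[OF ij(1), of "flip i"] unfolding gen_eq by (simp add: rat)
  have fixB: "is_subst (val (part l j e)) (gen i) (val (part l j e))" if e: "e \<in> {-1, 1}" for e
  proof -
    define P where "P = part (part l j e) i 1"
    define Q where "Q = part (part l j e) i 0"
    define R where "R = part (part l j e) i (-1)"
    have "val R * val D = val P * val C"
      using same_val[OF B[OF e]] by (simp add: val_prods P_def R_def)
    hence R: "val R = a * val P" using CD by (simp add: a_def field_simps)
    have "\<forall>s\<in>set (part l j e). coord i s \<in> {-1, 0, 1}"
    proof
      fix s assume "s \<in> set (part l j e)"
      then obtain u where u: "u \<in> set l" "s = zero_at j u" unfolding part_def by auto
      have "coord i s = coord i u \<or> coord i s = 0"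
        unfolding u(2) using less_3_cases[OF ij(1)] by (cases u) (auto simp: zero_at_def)
      thus "coord i s \<in> {-1, 0, 1}" using coord_mem[OF u(1), of i] by auto
    qed
    hence "val (part l j e) = val P * var_at i + val Q + val R / var_at i"
      unfolding P_def Q_def R_def by (rule val_split[OF ij(1)])
    hence v: "val (part l j e) = val P * var_at i + val Q + (a * val P) / var_at i"
      by (simp only: R)
    have "is_subst (val P * var_at i + val Q + (a * val P) / var_at i) (gen i)
        (val P * (a / var_at i) + val Q + (a * val P) / (a / var_at i))"
      by (intro is_subst_add is_subst_mult is_subst_divide x fix_a fixed_gen)
         (use ij a0 var_at_nonzero coord_part in \<open>auto simp: P_def Q_def\<close>)
    moreover have "val P * (a / var_at i) + val Q + (a * val P) / (a / var_at i)
        = val P * var_at i + val Q + (a * val P) / var_at i"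
      using a0 by (simp add: field_simps var_at_nonzero)
    ultimately show ?thesis unfolding v by (simp only:)
  qed
  have fixr: "is_subst (ratio j) (gen i) (ratio j)"
    unfolding ratio_val[OF ij(2)] by (intro is_subst_divide fixB val_part_nonzero) (use ij in auto)
  define h where "h t = (if t = i then a / var_at i else if t = j then 1 / var_at j * ratio j else var_at t)" for t
  have "rcomp (gen i) (gen j) = tuple3 h"
    unfolding gen_eq[of i]
  proof (rule rcomp_tuple3)
    fix t :: nat assume t: "t < 3"
    have v: "is_subst (var_at t) (gen j) (flip j t)"
      unfolding gen_eq by (rule is_subst_var_at[OF t])
    show "is_subst (flip i t) (gen j) (h t)"
    proof (cases "t = i")
      case True
      have "is_subst (1 / var_at i * a) (gen j) (1 / var_at i * a)"
        using v True ij by (intro is_subst_mult is_subst_divide is_subst_1 fix_a) (auto simp: var_at_nonzero)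
      thus ?thesis using True by (simp add: h_def rat)
    qed (use v in \<open>auto simp: h_def\<close>)
  qed
  moreover have "rcomp (gen j) (gen i) = tuple3 h"
    unfolding gen_eq[of j]
  proof (rule rcomp_tuple3)
    fix t :: nat assume t: "t < 3"
    have v: "is_subst (var_at t) (gen i) (flip i t)"
      unfolding gen_eq by (rule is_subst_var_at[OF t])
    show "is_subst (flip j t) (gen i) (h t)"
    proof (cases "t = j")
      case True
      have "is_subst (1 / var_at j * ratio j) (gen i) (1 / var_at j * ratio j)"
        using v True ij by (intro is_subst_mult is_subst_divide is_subst_1 fixr) (auto simp: var_at_nonzero)
      thus ?thesis using True ij by (simp add: h_def)
    qed (use v in \<open>auto simp: h_def rat\<close>)
  qed
  ultimately show ?thesis by simp
qed

text \<open>If \<open>A\<^sub>-/A\<^sub>+ = a y\<^sup>m\<close> and \<open>B\<^sub>-/B\<^sub>+ = b x\<^sup>n\<close>, where \<open>a, b\<close> depend on the third coordinate only,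
  then both involutions act linearly on the exponents of \<open>a, b, x, y\<close>.\<close>

lemma twists_sound:
  assumes ij: "i < 3" "j < 3" "i \<noteq> j" and tw: "twists l i j m r"
  shows "\<exists>a. a \<noteq> 0 \<and> ratio i = a * var_at j powi m \<and> is_subst a (gen i) a \<and> is_subst a (gen j) a"
proof -
  define C where "C = part (part l i (-1)) j (r + m)"
  define D where "D = part (part l i 1) j r"
  define a where "a = val C / val D"
  have CD: "val C \<noteq> 0" "val D \<noteq> 0" and A: "same (prods (part l i (-1)) D) (prods [unit j m] (prods C (part l i 1)))"
    using tw val_nonzero unfolding twists_def Let_def C_def[symmetric] D_def[symmetric] by blast+
  have coordC: "\<forall>s\<in>set C. coord t s = 0" "\<forall>s\<in>set D. coord t s = 0" if "t = i \<or> t = j" for t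
    using that ij coord_part coord_part_other unfolding C_def D_def by blast+
  have "val [unit j m] = var_at j powi m" by (simp add: val_def vmono_unit ij)
  hence "val (part l i (-1)) * val D = var_at j powi m * (val C * val (part l i 1))"
    using same_val[OF A] by (simp add: val_prods)
  hence "ratio i = a * var_at j powi m"
    using CD val_part_nonzero[OF ij(1), of 1] unfolding ratio_val[OF ij(1)] a_def by (simp add: field_simps)
  moreover have "is_subst a (gen t) a" if "t = i \<or> t = j" for t
    unfolding a_def using that ij CD by (intro is_subst_divide fixed_gen coordC) auto
  ultimately show ?thesis using CD by (intro exI[of _ a]) (simp add: a_def)
qed

lemma twists_power:
  assumes ij: "i < 3" "j < 3" "i \<noteq> j" and tw: "twists l i j m r" "twists l j i n r'"
    and mn: "(m, n, q) \<in> {(1, 1, 3), (-1, -1, 3), (1, 2, 4), (2, 1, 4), (-1, -2, 4), (-2, -1, 4)}"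
  shows "(gen i \<otimes>\<^bsub>Bir\<^esub> gen j) [^]\<^bsub>Bir\<^esub> (q::nat) = \<one>\<^bsub>Bir\<^esub>"
proof -
  interpret B: group Bir by (rule group_Bir)
  obtain a where a: "a \<noteq> 0" "ratio i = a * var_at j powi m" "is_subst a (gen i) a" "is_subst a (gen j) a"
    using twists_sound[OF ij tw(1)] by blast
  obtain b where b: "b \<noteq> 0" "ratio j = b * var_at i powi n" "is_subst b (gen i) b" "is_subst b (gen j) b"
    using twists_sound[OF ij(2,1) ij(3)[symmetric] tw(2)] by blast
  define M where "M = (\<lambda>(p, q, r, s). a powi p * b powi q * var_at i powi r * var_at j powi s)"
  define E where "E u v = tuple3 (\<lambda>t. if t = i then M u else if t = j then M v else var_at t)" for u v
  have nz: "var_at i \<noteq> 0" "var_at j \<noteq> 0" by (simp_all add: var_at_nonzero)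
  define fi where "fi = (\<lambda>(p::int, q::int, r, s). (p + r, q, - r, s + m * r))"
  define fj where "fj = (\<lambda>(p::int, q, r, s::int). (p, q + s, r + n * s, - s))"
  have si: "is_subst (M u) (gen i) (M (fi u))" for u
  proof -
    obtain p q r s where u: "u = (p, q, r, s)" by (metis surj_pair)
    have x: "is_subst (var_at i) (gen i) (1 / var_at i * (a * var_at j powi m))"
      using is_subst_var_at[OF ij(1), of "flip i"] by (simp add: gen_eq a(2))
    have y: "is_subst (var_at j) (gen i) (var_at j)"
      using is_subst_var_at[OF ij(2), of "flip i"] ij(3) by (simp add: gen_eq)
    have "is_subst (M u) (gen i) (a powi p * b powi q * (1 / var_at i * (a * var_at j powi m)) powi r * var_at j powi s)"
      unfolding M_def u case_prod_conv
      by (intro is_subst_mult is_subst_powi a b x y) (use a(1) b(1) nz in simp_all)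
    moreover have "(1 / var_at i * (a * var_at j powi m)) powi r = var_at i powi (- r) * a powi r * var_at j powi (m * r)"
      by (simp add: power_int_mult_distrib power_int_divide_distrib power_int_mult power_int_minus divide_inverse
          power_int_inverse)
    ultimately show ?thesis
      unfolding M_def u fi_def case_prod_conv using a(1) nz by (simp add: power_int_add mult_ac)
  qed
  have sj: "is_subst (M u) (gen j) (M (fj u))" for u
  proof -
    obtain p q r s where u: "u = (p, q, r, s)" by (metis surj_pair)
    have y: "is_subst (var_at j) (gen j) (1 / var_at j * (b * var_at i powi n))"
      using is_subst_var_at[OF ij(2), of "flip j"] by (simp add: gen_eq b(2))
    have x: "is_subst (var_at i) (gen j) (var_at i)"
      using is_subst_var_at[OF ij(1), of "flip j"] ij(3) by (simp add: gen_eq)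
    have "is_subst (M u) (gen j) (a powi p * b powi q * var_at i powi r * (1 / var_at j * (b * var_at i powi n)) powi s)"
      unfolding M_def u case_prod_conv
      by (intro is_subst_mult is_subst_powi a b x y) (use a(1) b(1) nz in simp_all)
    moreover have "(1 / var_at j * (b * var_at i powi n)) powi s = var_at j powi (- s) * b powi s * var_at i powi (n * s)"
      by (simp add: power_int_mult_distrib power_int_divide_distrib power_int_mult power_int_minus divide_inverse
          power_int_inverse)
    ultimately show ?thesis
      unfolding M_def u fj_def case_prod_conv using b(1) nz by (simp add: power_int_add mult_ac)
  qed
  have Ei: "E u v \<otimes>\<^bsub>Bir\<^esub> gen i = E (fi u) (fi v)" and Ej: "E u v \<otimes>\<^bsub>Bir\<^esub> gen j = E (fj u) (fj v)" for u v
  proof -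
    have *: "is_subst (var_at t) (gen s) (var_at t)" if "t < 3" "t \<noteq> s" for t s
      using is_subst_var_at[OF that(1), of "flip s"] that(2) by (simp add: gen_eq)
    have "rcomp (E u v) (gen i) = E (fi u) (fi v)"
      unfolding E_def by (rule rcomp_tuple3) (use si * in auto)
    thus "E u v \<otimes>\<^bsub>Bir\<^esub> gen i = E (fi u) (fi v)" by (simp add: Bir_def)
    have "rcomp (E u v) (gen j) = E (fj u) (fj v)"
      unfolding E_def by (rule rcomp_tuple3) (use sj * in auto)
    thus "E u v \<otimes>\<^bsub>Bir\<^esub> gen j = E (fj u) (fj v)" by (simp add: Bir_def)
  qed
  have id: "\<one>\<^bsub>Bir\<^esub> = E (0, 0, 1, 0) (0, 0, 0, 1)"
    using ij less_3_cases[OF ij(1)] less_3_cases[OF ij(2)]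
    by (auto simp: Bir_def rid_def E_def tuple3_def M_def var_at_def)
  have TE: "x \<otimes>\<^bsub>Bir\<^esub> (gen i \<otimes>\<^bsub>Bir\<^esub> gen j) = x \<otimes>\<^bsub>Bir\<^esub> gen i \<otimes>\<^bsub>Bir\<^esub> gen j" if "x \<in> carrier Bir" for x
    using gen_in_Bir ij that by (simp add: B.m_assoc)
  define h where "h u = fj (fi u)" for u
  have pow: "(gen i \<otimes>\<^bsub>Bir\<^esub> gen j) [^]\<^bsub>Bir\<^esub> k = E ((h ^^ k) (0, 0, 1, 0)) ((h ^^ k) (0, 0, 0, 1))" for k :: nat
  proof (induction k)
    case 0
    show ?case by (simp add: id)
  next
    case (Suc k)
    have "(gen i \<otimes>\<^bsub>Bir\<^esub> gen j) [^]\<^bsub>Bir\<^esub> k \<in> carrier Bir" using gen_in_Bir ij by simp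
    thus ?case by (simp only: nat_pow_Suc TE Suc Ei Ej) (simp only: funpow.simps comp_apply h_def[symmetric])
  qed
  show ?thesis
    unfolding pow id using mn
    by (auto simp: h_def fi_def fj_def numeral_eq_Suc)
qed

end


section \<open>Groups of monomial maps\<close>

type_synonym mat3 = "step \<times> step \<times> step"

fun row_mult :: "step \<Rightarrow> mat3 \<Rightarrow> step" where
  "row_mult (p, q, r) ((a, b, c), (d, e, f), (g, h, i)) =
     (p * a + q * d + r * g, p * b + q * e + r * h, p * c + q * f + r * i)"

fun mat_mult :: "mat3 \<Rightarrow> mat3 \<Rightarrow> mat3" where
  "mat_mult (u, v, w) N = (row_mult u N, row_mult v N, row_mult w N)"

fun mono_map :: "mat3 \<Rightarrow> ratmap" where
  "mono_map (u, v, w) = (vmono var_at u, vmono var_at v, vmono var_at w)"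

lemma is_subst_row: "is_subst (vmono var_at s) (mono_map N) (vmono var_at (row_mult s N))"
proof -
  obtain p q r where s: "s = (p, q, r)" by (cases s)
  obtain a b c d e f g h i where N: "N = ((a, b, c), (d, e, f), (g, h, i))" by (metis surj_pair)
  have nz: "vmono var_at u \<noteq> 0" for u by (simp add: vmono_def var_at_nonzero)
  define F where "F t = (if t = 0 then vmono var_at (a, b, c) else
      if t = 1 then vmono var_at (d, e, f) else vmono var_at (g, h, i))" for t :: nat
  have "F t \<noteq> 0" for t by (simp add: F_def nz)
  hence "is_subst (vmono var_at s) (tuple3 F) (vmono F s)" by (intro is_subst_vmono)
  moreover have "vmono F s = vmono var_at (a, b, c) powi p * vmono var_at (d, e, f) powi q * vmono var_at (g, h, i) powi r"
    unfolding vmono_def[of F] by (simp add: s F_def)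
  moreover have "vmono var_at (a, b, c) powi p * vmono var_at (d, e, f) powi q * vmono var_at (g, h, i) powi r
      = vmono var_at (row_mult s N)"
    by (simp add: s N vmono_def power_int_add power_int_mult power_int_mult_distrib var_at_nonzero
        mult.commute[of p] mult.commute[of q] mult.commute[of r] mult_ac)
  moreover have "tuple3 F = mono_map N" by (simp add: N tuple3_def F_def)
  ultimately show ?thesis by (simp only:)
qed

lemma rcomp_mono_map: "rcomp (mono_map M) (mono_map N) = mono_map (mat_mult M N)"
  by (cases M) (simp add: rsubst_eqI is_subst_row)

definition mat_id :: mat3 where "mat_id = ((1, 0, 0), (0, 1, 0), (0, 0, 1))"

lemma mono_map_id: "mono_map mat_id = rid"
  by (simp add: mat_id_def rid_def vmono_def var_at_def)

text \<open>Breadth first search in the group generated by \<open>gs\<close>: \<open>W\<close> contains the matrices found so far,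
  and \<open>F\<close> those whose neighbours are still to be visited.\<close>

primrec closure :: "nat \<Rightarrow> mat3 list \<Rightarrow> mat3 list \<Rightarrow> mat3 list \<Rightarrow> mat3 list option" where
  "closure 0 gs F W = (if F = [] then Some W else None)"
| "closure (Suc n) gs F W = (case F of [] \<Rightarrow> Some W | v # F' \<Rightarrow>
     let N = remdups (filter (\<lambda>w. w \<notin> set W) (map (\<lambda>g. mat_mult g v) gs)) in closure n gs (F' @ N) (N @ W))"

lemma closure_sound:
  assumes "closure n gs F W = Some W'" "set F \<subseteq> set W"
    and "\<And>g w. g \<in> set gs \<Longrightarrow> w \<in> set W - set F \<Longrightarrow> mat_mult g w \<in> set W"
  shows "set W \<subseteq> set W' \<and> (\<forall>g\<in>set gs. \<forall>w\<in>set W'. mat_mult g w \<in> set W')"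
  using assms
proof (induction n arbitrary: F W)
  case 0
  thus ?case by (auto split: if_splits)
next
  case (Suc n)
  show ?case
  proof (cases F)
    case Nil
    thus ?thesis using Suc.prems by auto
  next
    case (Cons v F')
    define N where "N = remdups (filter (\<lambda>w. w \<notin> set W) (map (\<lambda>g. mat_mult g v) gs))"
    have "set (N @ W) \<subseteq> set W' \<and> (\<forall>g\<in>set gs. \<forall>w\<in>set W'. mat_mult g w \<in> set W')"
    proof (rule Suc.IH)
      show "closure n gs (F' @ N) (N @ W) = Some W'" using Suc.prems(1) Cons by (simp add: N_def Let_def)
      show "set (F' @ N) \<subseteq> set (N @ W)" using Suc.prems(2) Cons by auto
      fix g w assume g: "g \<in> set gs" and w: "w \<in> set (N @ W) - set (F' @ N)"
      show "mat_mult g w \<in> set (N @ W)"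
      proof (cases "w = v")
        case True
        thus ?thesis using g by (auto simp: N_def)
      next
        case False
        thus ?thesis using Suc.prems(3)[OF g, of w] w Cons by auto
      qed
    qed
    thus ?thesis by auto
  qed
qed

text \<open>The involution \<open>x \<mapsto> v\<^sup>m / x\<close> on exponent vectors.\<close>

definition flip_mat :: "nat \<Rightarrow> step \<Rightarrow> mat3" where
  "flip_mat i m = (if i = 0 then add3 (-1, 0, 0) m else (1, 0, 0),
     if i = 1 then add3 (0, -1, 0) m else (0, 1, 0), if i = 2 then add3 (0, 0, -1) m else (0, 0, 1))"

definition mono_ratio :: "step list \<Rightarrow> nat \<Rightarrow> step \<Rightarrow> bool" where
  "mono_ratio l i m \<longleftrightarrow> same (part l i (-1)) (prods [m] (part l i 1))"

definition monomial_check :: "step list \<Rightarrow> step \<times> step \<times> step \<Rightarrow> bool" where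
  "monomial_check l = (\<lambda>(m0, m1, m2). mono_ratio l 0 m0 \<and> mono_ratio l 1 m1 \<and> mono_ratio l 2 m2 \<and>
     (case closure 100 [flip_mat 0 m0, flip_mat 1 m1, flip_mat 2 m2] [mat_id] [mat_id] of
        None \<Rightarrow> False | Some W \<Rightarrow> length W < 200))"

datatype pair_cert = Commute bool int | Twist int int int int

primrec commute_check :: "step list \<Rightarrow> nat \<Rightarrow> nat \<Rightarrow> pair_cert \<Rightarrow> bool" where
  "commute_check l i j (Commute b r) = (if b then commutes1 l i j r else commutes1 l j i r)"
| "commute_check l i j (Twist m r n r') = False"

primrec pair_check :: "step list \<Rightarrow> nat \<Rightarrow> nat \<Rightarrow> pair_cert \<Rightarrow> bool" where
  "pair_check l i j (Commute b r) = (if b then commutes1 l i j r else commutes1 l j i r)"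
| "pair_check l i j (Twist m r n r') = (twists l i j m r \<and> twists l j i n r' \<and>
     list_ex (\<lambda>u. u = (m, n)) [(1, 1), (-1, -1), (1, 2), (2, 1), (-1, -2), (-2, -1)])"

definition product_check :: "step list \<Rightarrow> nat \<times> nat \<times> nat \<Rightarrow> pair_cert \<times> pair_cert \<times> pair_cert \<Rightarrow> bool" where
  "product_check l = (\<lambda>(i, j, k) (c1, c2, c3). list_ex (\<lambda>u. u = (i, j, k)) [(0, 1, 2), (0, 2, 1), (1, 2, 0)] \<and>
     commute_check l k i c1 \<and> commute_check l k j c2 \<and> pair_check l i j c3)"

datatype certificate = Product "nat \<times> nat \<times> nat" "pair_cert \<times> pair_cert \<times> pair_cert" | Monomial "step \<times> step \<times> step"

primrec certifies :: "step list \<Rightarrow> certificate \<Rightarrow> bool" where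
  "certifies l (Product ijk cs) = product_check l ijk cs"
| "certifies l (Monomial ms) = monomial_check l ms"

context listed_model
begin

lemma carrier_gen: "carrier (model_group (set l)) = generate Bir {gen 0, gen 1, gen 2}"
  by (simp add: model_group_def gen_map_eq gen_map_eq(2)[unfolded One_nat_def])

lemma monomial_check_sound:
  assumes "monomial_check l ms"
  shows "finite (carrier (model_group (set l))) \<and> card (carrier (model_group (set l))) < 200"
proof -
  interpret B: group Bir by (rule group_Bir)
  obtain m0 m1 m2 where ms: "ms = (m0, m1, m2)" by (cases ms)
  define gs where "gs = [flip_mat 0 m0, flip_mat 1 m1, flip_mat 2 m2]"
  obtain W where W: "closure 100 gs [mat_id] [mat_id] = Some W" "length W < 200"
    and rat: "mono_ratio l 0 m0" "mono_ratio l 1 m1" "mono_ratio l 2 m2"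
    using assms unfolding monomial_check_def ms gs_def by (auto split: option.splits)
  have cl: "mat_id \<in> set W" "\<And>g w. g \<in> set gs \<Longrightarrow> w \<in> set W \<Longrightarrow> mat_mult g w \<in> set W"
    using closure_sound[OF W(1)] by auto
  have ratio: "ratio i = vmono var_at m" if "i < 3" "mono_ratio l i m" for i m
  proof -
    have "val (part l i (-1)) = vmono var_at m * val (part l i 1)"
      using same_val[OF that(2)[unfolded mono_ratio_def]] by (simp add: val_prods val_def[of "[m]"])
    thus ?thesis using val_part_nonzero[OF that(1), of 1] by (simp add: ratio_val[OF that(1)])
  qed
  have "vmono var_at (-1, 0, 0) = 1 / var_at 0" "vmono var_at (0, -1, 0) = 1 / var_at 1"
    "vmono var_at (0, 0, -1) = 1 / var_at 2"
    by (simp_all add: vmono_def power_int_minus divide_inverse)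
  moreover have "vmono var_at (1, 0, 0) = var_at 0" "vmono var_at (0, 1, 0) = var_at 1"
    "vmono var_at (0, 0, 1) = var_at 2" by (simp_all add: vmono_def)
  ultimately have g: "gen 0 = mono_map (flip_mat 0 m0)" "gen 1 = mono_map (flip_mat 1 m1)"
    "gen 2 = mono_map (flip_mat 2 m2)"
    unfolding gen_eq using ratio[OF _ rat(1)] ratio[OF _ rat(2)] ratio[OF _ rat(3)]
    by (simp_all add: tuple3_def flip_mat_def vmono_add3)
  have gs: "{gen 0, gen 1, gen 2} = mono_map ` set gs"
    by (simp only: gs_def list.set image_insert image_empty g)
  have closed: "h \<otimes>\<^bsub>Bir\<^esub> w \<in> mono_map ` set W" if "h \<in> {gen 0, gen 1, gen 2}" "w \<in> mono_map ` set W" for h w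
  proof -
    obtain a b where "a \<in> set gs" "h = mono_map a" "b \<in> set W" "w = mono_map b"
      using \<open>h \<in> _\<close> \<open>w \<in> _\<close> unfolding gs by blast
    thus ?thesis using cl(2)[of a b] by (simp add: Bir_def rcomp_mono_map)
  qed
  have one: "\<one>\<^bsub>Bir\<^esub> = mono_map mat_id" by (simp add: mono_map_id Bir_def)
  have gens: "{gen 0, gen 1, gen 2} \<subseteq> carrier Bir" using gen_in_Bir by simp
  have "generate Bir {gen 0, gen 1, gen 2} \<subseteq> carrier Bir \<inter> mono_map ` set W"
  proof (rule B.generate_involutions_subset[OF gens])
    show "h \<otimes>\<^bsub>Bir\<^esub> h = \<one>\<^bsub>Bir\<^esub>" if "h \<in> {gen 0, gen 1, gen 2}" for h
      using that gen_involution by (auto simp: Bir_def)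
    show "\<one>\<^bsub>Bir\<^esub> \<in> carrier Bir \<inter> mono_map ` set W" using cl(1) one by blast
    show "h \<otimes>\<^bsub>Bir\<^esub> w \<in> carrier Bir \<inter> mono_map ` set W"
      if "h \<in> {gen 0, gen 1, gen 2}" "w \<in> carrier Bir \<inter> mono_map ` set W" for h w
      using closed[of h w] that gens B.m_closed[of h w] by blast
  qed simp
  hence sub: "carrier (model_group (set l)) \<subseteq> mono_map ` set W" unfolding carrier_gen by blast
  have "card (mono_map ` set W) \<le> length W" using card_image_le[of "set W"] card_length[of W] by (meson List.finite_set le_trans)
  thus ?thesis using finite_subset[OF sub] card_mono[OF _ sub] W(2) by (simp add: order_le_less_trans)
qed

lemma commute_sound:
  assumes "i < 3" "j < 3" "i \<noteq> j" "commute_check l i j c"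
  shows "gen i \<otimes>\<^bsub>Bir\<^esub> gen j = gen j \<otimes>\<^bsub>Bir\<^esub> gen i"
  using assms commutes1_sound[of i j] commutes1_sound[of j i]
  by (cases c) (auto simp: Bir_def split: if_splits)

lemma pair_check_sound:
  assumes "i < 3" "j < 3" "i \<noteq> j" "pair_check l i j c"
  shows "\<exists>q::nat. q \<in> {2, 3, 4} \<and> (gen i \<otimes>\<^bsub>Bir\<^esub> gen j) [^]\<^bsub>Bir\<^esub> q = \<one>\<^bsub>Bir\<^esub>"
proof (cases c)
  case (Commute b r)
  interpret B: group Bir by (rule group_Bir)
  have c: "gen i \<in> carrier Bir" "gen j \<in> carrier Bir" using gen_in_Bir assms by auto
  have inv: "gen i \<otimes>\<^bsub>Bir\<^esub> gen i = \<one>\<^bsub>Bir\<^esub>" "gen j \<otimes>\<^bsub>Bir\<^esub> gen j = \<one>\<^bsub>Bir\<^esub>"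
    using gen_involution assms by (auto simp: Bir_def)
  have "commute_check l i j c" using assms(4) Commute by simp
  hence "(gen i \<otimes>\<^bsub>Bir\<^esub> gen j) [^]\<^bsub>Bir\<^esub> (2::nat) = (gen i \<otimes>\<^bsub>Bir\<^esub> gen j) \<otimes>\<^bsub>Bir\<^esub> (gen j \<otimes>\<^bsub>Bir\<^esub> gen i)"
    using c commute_sound[OF assms(1-3)] by (simp add: numeral_2_eq_2)
  also have "\<dots> = gen i \<otimes>\<^bsub>Bir\<^esub> ((gen j \<otimes>\<^bsub>Bir\<^esub> gen j) \<otimes>\<^bsub>Bir\<^esub> gen i)" using c by (simp only: B.m_assoc B.m_closed)
  also have "\<dots> = \<one>\<^bsub>Bir\<^esub>" using c inv by simp
  finally show ?thesis by blast
next
  case (Twist m r n r')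
  have mn: "(m, n) \<in> {(1, 1), (-1, -1), (1, 2), (2, 1), (-1, -2), (-2, -1)}"
    "twists l i j m r" "twists l j i n r'"
    using assms(4) Twist by (auto simp: list_ex_iff)
  have "(m, n, if m * n = 1 then 3 else 4) \<in> {(1, 1, 3), (-1, -1, 3), (1, 2, 4), (2, 1, 4), (-1, -2, 4), (-2, -1, 4::nat)}"
    using mn(1) by auto
  from twists_power[OF assms(1-3) mn(2,3) this] show ?thesis by (auto split: if_splits)
qed

lemma product_check_sound:
  assumes "product_check l t cs"
  shows "finite (carrier (model_group (set l))) \<and> card (carrier (model_group (set l))) < 200"
proof -
  interpret B: group Bir by (rule group_Bir)
  obtain i j k c1 c2 c3 where "t = (i, j, k)" "cs = (c1, c2, c3)" by (metis surj_pair)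
  with assms have ijk: "(i, j, k) \<in> {(0, 1, 2), (0, 2, 1), (1, 2, 0::nat)}"
    "commute_check l k i c1" "commute_check l k j c2" "pair_check l i j c3"
    unfolding product_check_def by (auto simp: list_ex_iff)
  hence lt: "i < 3" "j < 3" "k < 3" and ne: "i \<noteq> j" "k \<noteq> i" "k \<noteq> j" by auto
  obtain q :: nat where q: "q \<in> {2, 3, 4}" "(gen i \<otimes>\<^bsub>Bir\<^esub> gen j) [^]\<^bsub>Bir\<^esub> q = \<one>\<^bsub>Bir\<^esub>"
    using pair_check_sound[OF lt(1,2) ne(1) ijk(4)] by blast
  have inv: "gen t \<otimes>\<^bsub>Bir\<^esub> gen t = \<one>\<^bsub>Bir\<^esub>" if "t < 3" for t
    using gen_involution[OF that] by (simp add: Bir_def)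
  have "0 < q" using q(1) by auto
  note * = B.dihedral_times_two[OF gen_in_Bir[OF lt(1)] gen_in_Bir[OF lt(2)] gen_in_Bir[OF lt(3)]
      inv[OF lt(1)] inv[OF lt(2)] inv[OF lt(3)] q(2) this
      commute_sound[OF lt(3,1) ne(2) ijk(2)] commute_sound[OF lt(3,2) ne(3) ijk(3)]]
  have "{gen 0, gen 1, gen 2} = {gen i, gen j, gen k}" using ijk(1) by auto
  thus ?thesis unfolding carrier_gen using * q(1) by auto
qed

theorem certifies_sound:
  assumes "certifies l c"
  shows "finite (carrier (model_group (set l)))" "card (carrier (model_group (set l))) < 200"
  using assms product_check_sound monomial_check_sound by (cases c; auto)+

end


section \<open>Models whose steps all occur in octant walks\<close>

text \<open>A step escapes from \<open>P\<close> if coordinates in \<open>P\<close> are enough to pay for it, and it increases a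
  coordinate outside \<open>P\<close>. A set of steps without such a step never leaves the plane in which the
  coordinates outside \<open>P\<close> vanish.\<close>

definition escapes :: "step \<Rightarrow> nat set \<Rightarrow> bool" where
  "escapes s P \<longleftrightarrow> (\<forall>i<3. coord i s < 0 \<longrightarrow> i \<in> P) \<and> (\<exists>i<3. 0 < coord i s \<and> i \<notin> P)"

lemma octant_walk_Nil: "octant_walk S []"
  by (simp add: octant_walk_def)

lemma octant_walk_snoc:
  "octant_walk S (w @ [s]) \<longleftrightarrow> octant_walk S w \<and> s \<in> S \<and>
     (\<forall>i<3. 0 \<le> sum_list (map (coord i) w) + coord i s)"
proof -
  have "(\<forall>n\<le>length (w @ [s]). \<forall>i<3. 0 \<le> (\<Sum>s\<leftarrow>take n (w @ [s]). coord i s)) \<longleftrightarrow>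
      (\<forall>n\<le>length w. \<forall>i<3. 0 \<le> (\<Sum>s\<leftarrow>take n w. coord i s)) \<and>
      (\<forall>i<3. 0 \<le> sum_list (map (coord i) w) + coord i s)"
    by (auto simp: le_Suc_eq)
  thus ?thesis unfolding octant_walk_def by auto
qed

lemma octant_walk_end:
  assumes "octant_walk S w" "i < 3"
  shows "0 \<le> sum_list (map (coord i) w)"
proof -
  have "\<forall>n\<le>length w. \<forall>i<3. 0 \<le> (\<Sum>s\<leftarrow>take n w. coord i s)"
    using assms(1) unfolding octant_walk_def by blast
  from this[rule_format, of "length w" i] assms(2) show ?thesis by simp
qed

lemma octant_walk_repeat:
  assumes "octant_walk S w" "s \<in> S" "\<And>i. i < 3 \<Longrightarrow> -1 \<le> coord i s"
    and "\<And>i. i < 3 \<Longrightarrow> coord i s < 0 \<Longrightarrow> int m \<le> sum_list (map (coord i) w)"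
  shows "octant_walk S (w @ replicate m s)"
  using assms(4)
proof (induction m)
  case (Suc m)
  have "octant_walk S (w @ replicate m s)" using Suc by fastforce
  moreover have "0 \<le> sum_list (map (coord i) (w @ replicate m s)) + coord i s" if "i < 3" for i
  proof (cases "coord i s < 0")
    case True
    hence "coord i s = -1" using assms(3)[OF that] by linarith
    thus ?thesis using Suc.prems[OF that True] by (simp add: sum_list_replicate)
  next
    case False
    thus ?thesis using octant_walk_end[OF assms(1) that] by (simp add: sum_list_replicate)
  qed
  moreover have "w @ replicate (Suc m) s = (w @ replicate m s) @ [s]"
    by (simp add: replicate_append_same)
  ultimately show ?case using assms(2) octant_walk_snoc by metis
qed (simp add: assms(1))

lemma coord_bounds:
  assumes "is_model S" "s \<in> S"
  shows "-1 \<le> coord i s" "coord i s \<le> 1"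
proof -
  have "s \<in> {-1, 0, 1} \<times> {-1, 0, 1} \<times> {-1, 0, 1}" using assms unfolding is_model_def by blast
  thus "-1 \<le> coord i s" "coord i s \<le> 1" by (cases s; auto)+
qed

text \<open>Coordinates that can be made arbitrarily large pay for the negative entries of an escaping
  step, which then makes a further coordinate arbitrarily large.\<close>

lemma escapes_imp_walks:
  assumes model: "is_model S" and esc: "\<And>P. P \<subset> {..<3} \<Longrightarrow> \<exists>s\<in>S. escapes s P" and "s \<in> S"
  shows "\<exists>w. octant_walk S w \<and> s \<in> set w"
proof -
  define reach where
    "reach P \<longleftrightarrow> (\<forall>N::nat. \<exists>w. octant_walk S w \<and> (\<forall>i\<in>P. int N \<le> sum_list (map (coord i) w)))" for P
  have "reach {}" unfolding reach_def using octant_walk_Nil by blast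
  have "finite {P. P \<subseteq> {..<3} \<and> reach P}"
    by (rule finite_subset[of _ "Pow {..<3}"]) auto
  moreover have "{P. P \<subseteq> {..<3} \<and> reach P} \<noteq> {}" using \<open>reach {}\<close> by blast
  ultimately have "\<exists>P\<in>{P. P \<subseteq> {..<3} \<and> reach P}. \<forall>Q\<in>{P. P \<subseteq> {..<3} \<and> reach P}. P \<le> Q \<longrightarrow> P = Q"
    by (rule finite_has_maximal)
  then obtain P where P': "P \<in> {P. P \<subseteq> {..<3} \<and> reach P}"
    and max': "\<forall>Q\<in>{P. P \<subseteq> {..<3} \<and> reach P}. P \<le> Q \<longrightarrow> P = Q" by (rule bexE)
  have P: "P \<subseteq> {..<3}" "reach P" using P' by simp_all
  have max: "P = Q" if "Q \<subseteq> {..<3}" "reach Q" "P \<subseteq> Q" for Q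
    using max'[rule_format, of Q] that by simp
  have "P = {..<3}"
  proof (rule ccontr)
    assume "P \<noteq> {..<3}"
    then obtain t i where t: "t \<in> S" "\<And>i. i < 3 \<Longrightarrow> coord i t < 0 \<Longrightarrow> i \<in> P"
      and i: "i < 3" "0 < coord i t" "i \<notin> P"
      using esc[of P] P(1) unfolding escapes_def by blast
    have "reach (insert i P)"
      unfolding reach_def
    proof
      fix N :: nat
      obtain w where w: "octant_walk S w" "\<forall>j\<in>P. int (2 * N) \<le> sum_list (map (coord j) w)"
        using P(2) unfolding reach_def by blast
      have "octant_walk S (w @ replicate N t)"
      proof (rule octant_walk_repeat[OF w(1) t(1) coord_bounds(1)[OF model t(1)]])
        fix j assume "j < (3::nat)" "coord j t < 0"
        with t(2) w(2) have "int (2 * N) \<le> sum_list (map (coord j) w)" by blast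
        thus "int N \<le> sum_list (map (coord j) w)" by simp
      qed
      moreover have "int N \<le> sum_list (map (coord j) (w @ replicate N t))" if "j \<in> insert i P" for j
      proof (cases "j = i")
        case True
        have "int N * 1 \<le> int N * coord i t" using i(2) by (intro mult_left_mono) auto
        thus ?thesis using octant_walk_end[OF w(1) i(1)] True by (simp add: sum_list_replicate)
      next
        case False
        hence "int (2 * N) \<le> sum_list (map (coord j) w)" using w(2) that by blast
        moreover have "int N * (-1) \<le> int N * coord j t"
          using coord_bounds(1)[OF model t(1)] by (intro mult_left_mono) auto
        ultimately show ?thesis by (simp add: sum_list_replicate)
      qed
      ultimately show "\<exists>w. octant_walk S w \<and> (\<forall>i\<in>insert i P. int N \<le> sum_list (map (coord i) w))"
        by blast
    qed
    with max[of "insert i P"] P(1) i show False by blast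
  qed
  with P(2) obtain w where w: "octant_walk S w" "\<forall>i\<in>{..<3}. int 1 \<le> sum_list (map (coord i) w)"
    unfolding reach_def by blast
  have "octant_walk S (w @ replicate 1 s)"
    using w by (intro octant_walk_repeat[OF w(1) \<open>s \<in> S\<close> coord_bounds(1)[OF model \<open>s \<in> S\<close>]]) auto
  thus ?thesis by (intro exI[of _ "w @ replicate 1 s"]) simp
qed

lemma walk_stays:
  assumes no: "\<And>s. s \<in> S \<Longrightarrow> \<not> escapes s P" and i: "i < 3" "i \<notin> P"
    and w: "octant_walk S w"
  shows "\<forall>s\<in>set w. coord i s = 0"
proof -
  have "(\<forall>i<3. i \<notin> P \<longrightarrow> (\<forall>s\<in>set w. coord i s = 0))" using w
  proof (induction w rule: rev_induct)
    case (snoc s w)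
    hence w: "octant_walk S w" "s \<in> S" "\<And>i. i < 3 \<Longrightarrow> 0 \<le> sum_list (map (coord i) w) + coord i s"
      by (simp_all add: octant_walk_snoc)
    have zero: "sum_list (map (coord i) w) = 0" if "i < 3" "i \<notin> P" for i
      using snoc.IH[OF w(1)] that by (intro sum_list_nonneg_eq_0_iff[THEN iffD2]) auto
    have nonneg: "0 \<le> coord i s" if "i < 3" "i \<notin> P" for i
      using w(3)[OF that(1)] zero[OF that] by simp
    have "coord i s = 0" if "i < 3" "i \<notin> P" for i
    proof -
      have "\<not> 0 < coord i s" using no[OF w(2)] nonneg that unfolding escapes_def by force
      thus ?thesis using nonneg[OF that] by simp
    qed
    thus ?case using snoc.IH[OF w(1)] by auto
  qed simp
  thus ?thesis using i by blast
qed


section \<open>Models of dimension three\<close>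

lemma model_dim_3_iff:
  "model_dim S = 3 \<longleftrightarrow>
     (\<forall>i<3. \<exists>a. (\<forall>j\<in>{..<3} - {i}. satisfies_ineq S a j) \<and> \<not> satisfies_ineq S a i)"
proof -
  have 3: "dim_at_most S 3"
    unfolding dim_at_most_def by (intro exI[of _ "{..<3}"]) auto
  have Suc: "dim_at_most S (Suc d)" if d: "dim_at_most S d" "d < 3" for d
  proof -
    obtain I where I: "I \<subseteq> {..<3}" "card I = d"
      "\<And>a. (\<forall>i\<in>I. satisfies_ineq S a i) \<Longrightarrow> (\<forall>i<3. satisfies_ineq S a i)"
      using d(1) unfolding dim_at_most_def by blast
    have "I \<noteq> {..<3}" using I(2) d(2) by auto
    then obtain i where i: "i < 3" "i \<notin> I" using I(1) by auto
    have "card (insert i I) = Suc d"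
      using i I(2) finite_subset[OF I(1)] by simp
    moreover have "insert i I \<subseteq> {..<3}" using I(1) i by auto
    ultimately show ?thesis
      unfolding dim_at_most_def using I(3) by (intro exI[of _ "insert i I"]) blast
  qed
  have "model_dim S = 3 \<longleftrightarrow> \<not> dim_at_most S 2"
  proof
    assume "model_dim S = 3"
    thus "\<not> dim_at_most S 2"
      unfolding model_dim_def using Least_le[of "dim_at_most S" 2] by auto
  next
    assume 2: "\<not> dim_at_most S 2"
    have 1: "\<not> dim_at_most S 1" using Suc[of 1] 2 by (auto simp: numeral_eq_Suc)
    have 0: "\<not> dim_at_most S 0" using Suc[of 0] 1 by auto
    show "model_dim S = 3"
      unfolding model_dim_def
    proof (rule Least_equality)
      show "dim_at_most S 3" by (rule 3)
      fix d assume d: "dim_at_most S d"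
      show "3 \<le> d"
      proof (rule ccontr)
        assume "\<not> 3 \<le> d"
        hence "d = 0 \<or> d = 1 \<or> d = 2" by auto
        thus False using d 0 1 2 by auto
      qed
    qed
  qed
  also have "\<dots> \<longleftrightarrow> (\<forall>i<3. \<exists>a. (\<forall>j\<in>{..<3} - {i}. satisfies_ineq S a j) \<and> \<not> satisfies_ineq S a i)"
  proof -
    have "(\<exists>I\<subseteq>{..<3}. card I = 2 \<and> Q I) \<longleftrightarrow> (\<exists>i<3. Q ({..<3} - {i}))" for Q :: "nat set \<Rightarrow> bool"
    proof
      assume "\<exists>I\<subseteq>{..<3}. card I = 2 \<and> Q I"
      then obtain I where I: "I \<subseteq> {..<3::nat}" "card I = 2" "Q I" by blast
      have "card ({..<3} - I) = 1" using I card_Diff_subset[of I "{..<3}"] finite_subset[OF I(1)] by simp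
      then obtain i where "{..<3} - I = {i}" by (auto simp: card_1_singleton_iff)
      hence "i < 3" "I = {..<3} - {i}" using I(1) by auto
      thus "\<exists>i<3. Q ({..<3} - {i})" using I(3) by blast
    next
      assume "\<exists>i<3. Q ({..<3} - {i})"
      then obtain i where "i < 3" "Q ({..<3} - {i})" by blast
      thus "\<exists>I\<subseteq>{..<3}. card I = 2 \<and> Q I" by (intro exI[of _ "{..<3} - {i}"]) auto
    qed
    from this[of "\<lambda>I. \<forall>a. (\<forall>i\<in>I. satisfies_ineq S a i) \<longrightarrow> (\<forall>i<3. satisfies_ineq S a i)"]
    have 2: "dim_at_most S 2 \<longleftrightarrow>
        (\<exists>i<3. \<forall>a. (\<forall>j\<in>{..<3} - {i}. satisfies_ineq S a j) \<longrightarrow> (\<forall>k<3. satisfies_ineq S a k))"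
      unfolding dim_at_most_def .
    have "(\<forall>k<3. Q k) \<longleftrightarrow> (\<forall>j\<in>{..<3} - {i}. Q j) \<and> Q i" if "i < 3" for Q and i :: nat
      using that by auto
    hence "(\<forall>a. (\<forall>j\<in>{..<3} - {i}. satisfies_ineq S a j) \<longrightarrow> (\<forall>k<3. satisfies_ineq S a k)) \<longleftrightarrow>
        (\<forall>a. (\<forall>j\<in>{..<3} - {i}. satisfies_ineq S a j) \<longrightarrow> satisfies_ineq S a i)" if "i < 3" for i
      using that by simp
    hence 3: "dim_at_most S 2 \<longleftrightarrow>
        (\<exists>i<3. \<forall>a. (\<forall>j\<in>{..<3} - {i}. satisfies_ineq S a j) \<longrightarrow> satisfies_ineq S a i)"
      unfolding 2 by (intro ex_cong1 conj_cong refl)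
    show ?thesis unfolding 3 by simp
  qed
  finally show ?thesis .
qed

text \<open>An inequality follows from the other two iff its coefficient vector dominates a non-negative
  combination of theirs. For entries in \<open>{-1, 0, 1}\<close> the seven half combinations listed here are
  enough; \<open>(l, m)\<close> stands for the coefficients \<open>l/2, m/2\<close>.\<close>

definition multipliers :: "(int \<times> int) list" where
  "multipliers = [(0, 0), (0, 2), (2, 0), (2, 2), (2, 4), (4, 2), (1, 1)]"

definition undercuts :: "int \<times> int \<Rightarrow> step \<Rightarrow> bool" where
  "undercuts = (\<lambda>(l, m) (p, q, r). 2 * r < l * p + m * q)"

definition all_steps :: "step list" where
  "all_steps = List.product [-1, 0, 1] (List.product [-1, 0, 1] [-1, 0, 1])"

fun combines :: "step list \<Rightarrow> step list \<Rightarrow> nat \<Rightarrow> step \<Rightarrow> bool" where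
  "combines V [] n (p, q, r) = (if 0 \<le> p then if 0 \<le> q then r < 0 else False else False)"
| "combines V (v # W) 0 (p, q, r) = (if 0 \<le> p then if 0 \<le> q then r < 0 else False else False)"
| "combines V ((a, b, c) # W) (Suc n) (p, q, r) =
     (if combines V V n (p + a, q + b, r + c) then True else combines V W (Suc n) (p, q, r))"

primrec witness :: "step list \<Rightarrow> bool" where
  "witness [] = False"
| "witness (v # V) = combines (v # V) (v # V) (Suc (Suc (Suc 0))) v"

primrec each :: "(step list \<Rightarrow> bool) \<Rightarrow> int \<times> int \<Rightarrow> step list \<Rightarrow> step list \<Rightarrow> bool" where
  "each f c V [] = True"
| "each f c V (w # ws) = (if undercuts c w then if f (w # V) then each f c V ws else False else each f c V ws)"

primrec some_undercuts :: "int \<times> int \<Rightarrow> step list \<Rightarrow> bool" where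
  "some_undercuts c [] = False"
| "some_undercuts c (w # ws) = (if undercuts c w then True else some_undercuts c ws)"

primrec violates_tree :: "(int \<times> int) list \<Rightarrow> step list \<Rightarrow> bool" where
  "violates_tree [] V = witness V"
| "violates_tree (c # cs) V = (if witness V then True else if some_undercuts c V then violates_tree cs V
     else each (violates_tree cs) c V all_steps)"

lemma all_steps_eq: "all_steps = [(-1, -1, -1), (-1, -1, 0),
    (-1, -1, 1), (-1, 0, -1), (-1, 0, 0), (-1, 0, 1), (-1, 1, -1), (-1, 1, 0), (-1, 1, 1),
    (0, -1, -1), (0, -1, 0), (0, -1, 1), (0, 0, -1), (0, 0, 0), (0, 0, 1), (0, 1, -1), (0, 1, 0), (0, 1, 1),
    (1, -1, -1), (1, -1, 0), (1, -1, 1), (1, 0, -1), (1, 0, 0), (1, 0, 1), (1, 1, -1), (1, 1, 0), (1, 1, 1)]"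
  by (simp add: all_steps_def)

text \<open>Any choice of steps that violates the inequalities for all seven multipliers contains at most four
  steps, with repetitions, whose sum violates the implication between the inequalities. The
  search over the choices ends as soon as such a sum is found.\<close>

lemma violates_tree_multipliers: "violates_tree multipliers []"
  by (simp add: multipliers_def all_steps_eq undercuts_def)

lemma each_iff: "each f c V ws \<longleftrightarrow> (\<forall>w\<in>set ws. undercuts c w \<longrightarrow> f (w # V))"
  by (induction ws) auto

lemma some_undercuts_iff: "some_undercuts c ws \<longleftrightarrow> (\<exists>w\<in>set ws. undercuts c w)"
  by (induction ws) auto

definition sum3 :: "step list \<Rightarrow> int \<times> int \<times> int" where
  "sum3 xs = (sum_list (map (coord 0) xs), sum_list (map (coord 1) xs), sum_list (map (coord 2) xs))"

lemma combines_sound: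
  assumes "combines V W n v" "set W \<subseteq> set V" "set xs \<subseteq> set V" "v = sum3 xs"
  shows "\<exists>xs p q r. set xs \<subseteq> set V \<and> sum3 xs = (p, q, r) \<and> 0 \<le> p \<and> 0 \<le> q \<and> r < 0"
  using assms
proof (induction V W n v arbitrary: xs rule: combines.induct)
  case (1 V n p q r)
  have "0 \<le> p \<and> 0 \<le> q \<and> r < 0" using 1(1) by (simp split: if_splits)
  thus ?case using 1(3) 1(4)[symmetric] by blast
next
  case (2 V v W p q r)
  have "0 \<le> p \<and> 0 \<le> q \<and> r < 0" using 2(1) by (simp split: if_splits)
  thus ?case using 2(3) 2(4)[symmetric] by blast
next
  case (3 V a b c W n p q r)
  show ?case
  proof (cases "combines V V n (p + a, q + b, r + c)")
    case True
    show ?thesis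
      by (rule "3.IH"(1)[OF True, of "(a, b, c) # xs"]) (use "3.prems" in \<open>auto simp: sum3_def\<close>)
  next
    case False
    hence "combines V W (Suc n) (p, q, r)" using "3.prems"(1) by (simp only: combines.simps if_False)
    thus ?thesis by (rule "3.IH"(2)[OF False, of xs]) (use "3.prems" in auto)
  qed
qed

lemma witness_sound:
  assumes "witness V"
  shows "\<exists>xs p q r. set xs \<subseteq> set V \<and> sum3 xs = (p, q, r) \<and> 0 \<le> p \<and> 0 \<le> q \<and> r < 0"
proof (cases V)
  case (Cons v W)
  have "v = sum3 [v]" by (cases v) (simp add: sum3_def)
  moreover have "combines V V (Suc (Suc (Suc 0))) v" using assms unfolding Cons by (simp only: witness.simps)
  ultimately show ?thesis using combines_sound[of V V _ v "[v]"] Cons by auto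
qed (use assms in simp)

lemma violates_tree_sound:
  assumes "violates_tree cs V" "set V \<subseteq> S" "S \<subseteq> set all_steps" "\<forall>c\<in>set cs. \<exists>v\<in>S. undercuts c v"
  shows "\<exists>xs p q r. set xs \<subseteq> S \<and> sum3 xs = (p, q, r) \<and> 0 \<le> p \<and> 0 \<le> q \<and> r < 0"
  using assms
proof (induction cs arbitrary: V)
  case Nil
  thus ?case using witness_sound[of V] by (simp only: violates_tree.simps) blast
next
  case (Cons c cs)
  show ?case
  proof (cases "witness V")
    case True
    thus ?thesis using witness_sound[of V] Cons.prems(2) by blast
  next
    case False
    have cs: "\<forall>c\<in>set cs. \<exists>v\<in>S. undercuts c v" using Cons.prems(4) by simp
    show ?thesis
    proof (cases "some_undercuts c V")
      case True
      hence "violates_tree cs V" using False Cons.prems(1) by (simp only: violates_tree.simps if_True if_False)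
      thus ?thesis by (rule Cons.IH[OF _ Cons.prems(2,3) cs])
    next
      case no: False
      obtain v where v: "v \<in> S" "undercuts c v" using Cons.prems(4) by auto
      have "v \<in> set all_steps" using v(1) Cons.prems(3) by blast
      moreover have "each (violates_tree cs) c V all_steps"
        using False no Cons.prems(1) by (simp only: violates_tree.simps if_False)
      ultimately have "violates_tree cs (v # V)" using v(2) unfolding each_iff by blast
      moreover have "set (v # V) \<subseteq> S" using Cons.prems(2) v(1) by simp
      ultimately show ?thesis by (rule Cons.IH[OF _ _ Cons.prems(3) cs])
    qed
  qed
qed

lemma sum_count_list:
  fixes f :: "'a \<Rightarrow> int"
  assumes "finite S" "set xs \<subseteq> S"
  shows "(\<Sum>s\<in>S. int (count_list xs s) * f s) = sum_list (map f xs)"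
  using assms(2)
proof (induction xs)
  case (Cons x xs)
  have "(\<Sum>s\<in>S. int (count_list (x # xs) s) * f s) =
      (\<Sum>s\<in>S. int (count_list xs s) * f s + (if s = x then f s else 0))"
    by (intro sum.cong) (auto simp: algebra_simps)
  also have "\<dots> = sum_list (map f xs) + f x"
    using Cons assms(1) by (simp add: sum.distrib)
  finally show ?case by simp
qed simp

definition others :: "nat \<Rightarrow> nat \<times> nat" where
  "others i = (if i = 0 then (1, 2) else if i = 1 then (0, 2) else (0, 1))"

definition view :: "nat \<Rightarrow> step \<Rightarrow> step" where
  "view i s = (coord (fst (others i)) s, coord (snd (others i)) s, coord i s)"

lemma undercuts_view:
  "undercuts (l, m) (view i s) \<longleftrightarrow> 2 * coord i s < l * coord (fst (others i)) s + m * coord (snd (others i)) s"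
  by (simp add: undercuts_def view_def)

lemma others_set: "i < 3 \<Longrightarrow> {..<3} - {i} = {fst (others i), snd (others i)}"
  by (auto simp: others_def)

lemma coords_sel: "coord 0 s = fst s" "coord (Suc 0) s = fst (snd s)" "coord 2 s = snd (snd s)"
  by (cases s; simp)+

lemma model_dim_3_iff_undercuts:
  assumes "is_model S"
  shows "model_dim S = 3 \<longleftrightarrow> (\<forall>i<3. \<forall>c\<in>set multipliers. \<exists>s\<in>S. undercuts c (view i s))"
proof -
  have fin: "finite S" using assms unfolding is_model_def by (rule finite_subset) auto
  have "(\<exists>a. (\<forall>j\<in>{..<3} - {i}. satisfies_ineq S a j) \<and> \<not> satisfies_ineq S a i) \<longleftrightarrow>
      (\<forall>c\<in>set multipliers. \<exists>s\<in>S. undercuts c (view i s))" (is "?L \<longleftrightarrow> ?R") if i: "i < 3" for i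
  proof
    assume ?L
    then obtain a where a: "0 \<le> (\<Sum>s\<in>S. int (a s) * coord (fst (others i)) s)"
      "0 \<le> (\<Sum>s\<in>S. int (a s) * coord (snd (others i)) s)" "(\<Sum>s\<in>S. int (a s) * coord i s) < 0"
      unfolding others_set[OF i] satisfies_ineq_def by auto
    show ?R
    proof (rule ccontr)
      assume "\<not> ?R"
      then obtain l m where lm: "(l, m) \<in> set multipliers" "\<And>s. s \<in> S \<Longrightarrow> \<not> undercuts (l, m) (view i s)"
        by auto
      have "0 \<le> l" "0 \<le> m" using lm(1) by (auto simp: multipliers_def)
      hence "0 \<le> l * (\<Sum>s\<in>S. int (a s) * coord (fst (others i)) s) + m * (\<Sum>s\<in>S. int (a s) * coord (snd (others i)) s)"
        using a by simp
      also have "\<dots> = (\<Sum>s\<in>S. int (a s) * (l * coord (fst (others i)) s + m * coord (snd (others i)) s))"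
        by (simp add: sum_distrib_left sum.distrib algebra_simps)
      also have "\<dots> \<le> (\<Sum>s\<in>S. int (a s) * (2 * coord i s))"
        using lm(2) by (intro sum_mono mult_left_mono) (auto simp: undercuts_view not_less)
      also have "\<dots> = 2 * (\<Sum>s\<in>S. int (a s) * coord i s)"
        by (simp add: sum_distrib_left algebra_simps)
      finally show False using a(3) by simp
    qed
  next
    assume R: ?R
    have "view i ` S \<subseteq> set all_steps"
    proof
        fix v assume "v \<in> view i ` S"
      then obtain s where s: "s \<in> S" "v = view i s" by blast
      have c: "coord j s \<in> {-1, 0, 1}" for j
        using coord_bounds[OF assms s(1), of j] by auto
      have "set all_steps = {-1, 0, 1} \<times> {-1, 0, 1} \<times> {-1, 0, 1}"
        by (simp only: all_steps_def set_product list.set)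
      thus "v \<in> set all_steps" unfolding s(2) view_def by (simp only:) (intro SigmaI c)
    qed
    moreover have "\<forall>c\<in>set multipliers. \<exists>v\<in>view i ` S. undercuts c v" using R by blast
    ultimately obtain xs p q r where xs: "set xs \<subseteq> view i ` S" "sum3 xs = (p, q, r)" "0 \<le> p" "0 \<le> q" "r < 0"
      using violates_tree_sound[OF violates_tree_multipliers, of "view i ` S"] by auto
    have "xs \<in> lists (view i ` S)" using xs(1) by auto
    then obtain ys where ys: "set ys \<subseteq> S" "xs = map (view i) ys" unfolding lists_image by auto
    define a where "a = count_list ys"
    have sum: "(\<Sum>s\<in>S. int (a s) * coord j s) = sum_list (map (coord j) ys)" for j
      unfolding a_def by (rule sum_count_list[OF fin ys(1)])
    have "sum_list (map (coord (fst (others i))) ys) = p" "sum_list (map (coord (snd (others i))) ys) = q"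
      "sum_list (map (coord i) ys) = r"
      using xs(2) unfolding ys(2) sum3_def by (simp_all add: o_def view_def coords_sel)
    hence "(\<forall>j\<in>{..<3} - {i}. satisfies_ineq S a j) \<and> \<not> satisfies_ineq S a i"
      unfolding others_set[OF i] satisfies_ineq_def sum using xs by simp
    thus ?L by blast
  qed
  thus ?thesis unfolding model_dim_3_iff by (intro all_cong1 imp_cong refl)
qed

theorem nontrivial_3_iff:
  assumes "is_model S"
  shows "nontrivial_model S \<and> model_dim S = 3 \<longleftrightarrow> (\<forall>P\<subset>{..<3}. \<exists>s\<in>S. escapes s P) \<and>
     (\<forall>i<3. \<forall>c\<in>set multipliers. \<exists>s\<in>S. undercuts c (view i s))"
proof
  assume L: "nontrivial_model S \<and> model_dim S = 3"
  have "\<exists>s\<in>S. escapes s P" if P: "P \<subset> {..<3}" for P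
  proof (rule ccontr)
    assume "\<not> (\<exists>s\<in>S. escapes s P)"
    hence no: "\<And>s. s \<in> S \<Longrightarrow> \<not> escapes s P" by blast
    obtain i where i: "i < 3" "i \<notin> P" using P by auto
    have "coord i s = 0" if "s \<in> S" for s
      using L walk_stays[OF no i] that unfolding nontrivial_model_def by blast
    hence "satisfies_ineq S a i" for a by (simp add: satisfies_ineq_def)
    thus False using L i(1) unfolding model_dim_3_iff by blast
  qed
  thus "(\<forall>P\<subset>{..<3}. \<exists>s\<in>S. escapes s P) \<and>
     (\<forall>i<3. \<forall>c\<in>set multipliers. \<exists>s\<in>S. undercuts c (view i s))"
    using L model_dim_3_iff_undercuts[OF assms] by (intro conjI) simp_all
next
  assume R: "(\<forall>P\<subset>{..<3}. \<exists>s\<in>S. escapes s P) \<and>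
     (\<forall>i<3. \<forall>c\<in>set multipliers. \<exists>s\<in>S. undercuts c (view i s))"
  have esc: "\<exists>s\<in>S. escapes s P" if "P \<subset> {..<3}" for P using R that by blast
  have dim: "model_dim S = 3" unfolding model_dim_3_iff_undercuts[OF assms] by (rule conjunct2[OF R])
  have "\<forall>s\<in>S. \<exists>w. octant_walk S w \<and> s \<in> set w"
    by (intro ballI escapes_imp_walks[OF assms esc])
  thus "nontrivial_model S \<and> model_dim S = 3" unfolding nontrivial_model_def by (simp add: dim)
qed


section \<open>Enumerating the models\<close>

fun extensions :: "nat \<Rightarrow> code list \<Rightarrow> code list \<Rightarrow> code list list" where
  "extensions k [] ch = [ch]"
| "extensions 0 (s # av) ch = [ch]"
| "extensions (Suc k) (s # av) ch = extensions k av (s # ch) @ extensions (Suc k) av ch"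

fun branch :: "(code list \<Rightarrow> clause list \<Rightarrow> code list \<Rightarrow> code list list) \<Rightarrow> code list \<Rightarrow> code list \<Rightarrow> clause \<Rightarrow>
    clause list \<Rightarrow> code list \<Rightarrow> code list list" where
  "branch f kept [] c cs ch = []"
| "branch f kept (s # av) c cs ch = (if hits c s
     then f (rev_onto kept av) (unhit s cs) (s # ch) @ branch f kept av c cs ch
     else branch f (s # kept) av c cs ch)"

primrec search :: "nat \<Rightarrow> code list \<Rightarrow> clause list \<Rightarrow> code list \<Rightarrow> code list list" where
  "search 0 av cs ch = (if cs = [] then [ch] else [])"
| "search (Suc k) av cs ch = (case cs of [] \<Rightarrow> extensions (Suc k) av ch
     | c # cs' \<Rightarrow> branch (search k) [] av c cs' ch)"

definition hits_all :: "clause list \<Rightarrow> code set \<Rightarrow> bool" where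
  "hits_all cs X \<longleftrightarrow> (\<forall>c\<in>set cs. \<exists>s\<in>X. hits c s)"

text \<open>The list contains the union of \<open>ch\<close> with every member of \<open>F\<close>, as a list without repetition, and
  contains it once.\<close>

definition enumerates :: "code list list \<Rightarrow> code list \<Rightarrow> code set set \<Rightarrow> bool" where
  "enumerates L ch F \<longleftrightarrow> set (map set L) = (\<lambda>X. set ch \<union> X) ` F \<and> distinct (map set L)
     \<and> (\<forall>l\<in>set L. distinct l)"

lemma enumerates_append:
  assumes "enumerates L (s # ch) F" "enumerates L' ch F'" "s \<notin> set ch" "\<And>X. X \<in> F' \<Longrightarrow> s \<notin> X"
  shows "enumerates (L @ L') ch (insert s ` F \<union> F')"
proof -
  have 1: "set (map set L) = (\<lambda>X. set (s # ch) \<union> X) ` F" and 2: "set (map set L') = (\<lambda>X. set ch \<union> X) ` F'"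
    using assms(1,2) unfolding enumerates_def by blast+
  have "\<forall>A\<in>set (map set L). s \<in> A" unfolding 1 by auto
  moreover have "\<forall>A\<in>set (map set L'). s \<notin> A" unfolding 2 using assms(3,4) by auto
  ultimately have "set (map set L) \<inter> set (map set L') = {}" by blast
  moreover have "set (map set (L @ L')) = (\<lambda>X. set ch \<union> X) ` (insert s ` F \<union> F')"
    unfolding map_append set_append 1 2 by (simp add: image_Un image_image)
  ultimately show ?thesis using assms(1,2) unfolding enumerates_def by auto
qed

lemma insert_subsets:
  assumes "s \<notin> A" "finite A"
  shows "{X. X \<subseteq> insert s A \<and> card X \<le> Suc k \<and> P X} =
    insert s ` {X. X \<subseteq> A \<and> card X \<le> k \<and> P (insert s X)} \<union> {X. X \<subseteq> A \<and> card X \<le> Suc k \<and> P X}"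
proof (intro equalityI subsetI)
  fix X assume X: "X \<in> {X. X \<subseteq> insert s A \<and> card X \<le> Suc k \<and> P X}"
  show "X \<in> insert s ` {X. X \<subseteq> A \<and> card X \<le> k \<and> P (insert s X)} \<union> {X. X \<subseteq> A \<and> card X \<le> Suc k \<and> P X}"
  proof (cases "s \<in> X")
    case True
    have "finite X" using X assms(2) by (auto intro: finite_subset)
    moreover have "card X \<le> Suc k" using X by simp
    ultimately have "card (X - {s}) \<le> k" using True by (simp add: card_Diff_singleton)
    moreover have "insert s (X - {s}) = X" using True by blast
    ultimately have "X - {s} \<in> {X. X \<subseteq> A \<and> card X \<le> k \<and> P (insert s X)}" using X by auto
    from imageI[OF this, of "insert s"] show ?thesis
      unfolding \<open>insert s (X - {s}) = X\<close> by (rule UnI1)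
  qed (use X in auto)
next
  fix X assume "X \<in> insert s ` {X. X \<subseteq> A \<and> card X \<le> k \<and> P (insert s X)} \<union> {X. X \<subseteq> A \<and> card X \<le> Suc k \<and> P X}"
  thus "X \<in> {X. X \<subseteq> insert s A \<and> card X \<le> Suc k \<and> P X}"
  proof
    assume "X \<in> insert s ` {X. X \<subseteq> A \<and> card X \<le> k \<and> P (insert s X)}"
    then obtain Y where Y: "X = insert s Y" "Y \<subseteq> A" "card Y \<le> k" "P (insert s Y)" by blast
    have "card X \<le> Suc k" using Y(1,3) card_insert_le_m1[of "Suc k" Y s] by simp
    thus ?thesis using Y by auto
  qed auto
qed

lemma finite_subsets_card_0: "finite A \<Longrightarrow> {X. X \<subseteq> A \<and> card X \<le> 0 \<and> P X} = {X. X = {} \<and> P {}}"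
  by (auto dest: finite_subset)

lemma extensions_enumerates:
  assumes "distinct av" "distinct ch" "set av \<inter> set ch = {}"
  shows "enumerates (extensions k av ch) ch {X. X \<subseteq> set av \<and> card X \<le> k \<and> True}"
  using assms
proof (induction k av ch rule: extensions.induct)
  case (3 k s av ch)
  have "enumerates (extensions k av (s # ch) @ extensions (Suc k) av ch) ch
    (insert s ` {X. X \<subseteq> set av \<and> card X \<le> k \<and> True} \<union> {X. X \<subseteq> set av \<and> card X \<le> Suc k \<and> True})"
    by (rule enumerates_append) (use 3 in auto)
  thus ?case using 3(3) insert_subsets[of s "set av" k "\<lambda>_. True"] by simp
next
  case (2 s av ch)
  have "X = {}" if "X \<subseteq> set (s # av)" "card X \<le> 0" for X
    using finite_subset[OF that(1)] that(2) by simp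
  hence "{X. X \<subseteq> set (s # av) \<and> card X \<le> 0 \<and> True} = {{}}" by auto
  thus ?case using 2 by (simp add: enumerates_def)
qed (auto simp: enumerates_def)

lemma set_rev_onto: "set (rev_onto xs ys) = set xs \<union> set ys"
  and distinct_rev_onto: "distinct (rev_onto xs ys) \<longleftrightarrow> distinct (xs @ ys)"
  by (induction xs arbitrary: ys) auto

lemma set_unhit: "set (unhit s cs) = {c\<in>set cs. \<not> hits c s}"
  by (induction cs) (auto simp: cons_if_def)

lemma hits_all_insert: "hits_all cs (insert s X) \<longleftrightarrow> hits_all (unhit s cs) X"
  by (auto simp: hits_all_def set_unhit)

text \<open>The models are split by their first step in the pool that meets the clause \<open>c\<close>. Steps in
  \<open>kept\<close> do not meet it and stay available.\<close>

lemma branch_enumerates: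
  assumes f: "\<And>av cs ch. distinct av \<Longrightarrow> distinct ch \<Longrightarrow> set av \<inter> set ch = {} \<Longrightarrow>
      enumerates (f av cs ch) ch {X. X \<subseteq> set av \<and> card X \<le> k \<and> hits_all cs X}"
    and "distinct (kept @ av)" "distinct ch" "set (kept @ av) \<inter> set ch = {}" "\<forall>s\<in>set kept. \<not> hits c s"
  shows "enumerates (branch f kept av c cs ch) ch
    {X. X \<subseteq> set (kept @ av) \<and> card X \<le> Suc k \<and> ((\<exists>s\<in>X. hits c s) \<and> hits_all cs X)}"
  using assms(2-5)
proof (induction av arbitrary: kept)
  case Nil
  have "{X. X \<subseteq> set (kept @ []) \<and> card X \<le> Suc k \<and> ((\<exists>s\<in>X. hits c s) \<and> hits_all cs X)} = {}"
    using Nil by auto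
  thus ?case by (simp add: enumerates_def)
next
  case (Cons s av)
  have perm: "set (kept @ s # av) = insert s (set kept \<union> set av)" by auto
  show ?case
  proof (cases "hits c s")
    case True
    have "enumerates (f (rev_onto kept av) (unhit s cs) (s # ch)) (s # ch)
        {X. X \<subseteq> set kept \<union> set av \<and> card X \<le> k \<and> hits_all (unhit s cs) X}"
      unfolding set_rev_onto[symmetric]
      by (rule f) (use Cons.prems in \<open>auto simp: set_rev_onto distinct_rev_onto\<close>)
    moreover have "enumerates (branch f kept av c cs ch) ch
        {X. X \<subseteq> set kept \<union> set av \<and> card X \<le> Suc k \<and> ((\<exists>s\<in>X. hits c s) \<and> hits_all cs X)}"
      using Cons.IH[of kept] Cons.prems by auto
    ultimately have "enumerates (branch f kept (s # av) c cs ch) ch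
        (insert s ` {X. X \<subseteq> set kept \<union> set av \<and> card X \<le> k \<and> hits_all (unhit s cs) X} \<union>
         {X. X \<subseteq> set kept \<union> set av \<and> card X \<le> Suc k \<and> ((\<exists>s\<in>X. hits c s) \<and> hits_all cs X)})"
      using True Cons.prems by (simp, intro enumerates_append) auto
    moreover have "{X. X \<subseteq> set kept \<union> set av \<and> card X \<le> k \<and> hits_all (unhit s cs) X} =
        {X. X \<subseteq> set kept \<union> set av \<and> card X \<le> k \<and> ((\<exists>u\<in>insert s X. hits c u) \<and> hits_all cs (insert s X))}"
      using True by (auto simp: hits_all_insert)
    ultimately show ?thesis
      unfolding perm using Cons.prems
      by (subst insert_subsets) auto
  next
    case False
    have "enumerates (branch f (s # kept) av c cs ch) ch
        {X. X \<subseteq> set ((s # kept) @ av) \<and> card X \<le> Suc k \<and> ((\<exists>s\<in>X. hits c s) \<and> hits_all cs X)}"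
      by (rule Cons.IH) (use Cons.prems False in auto)
    thus ?thesis using False unfolding perm by simp
  qed
qed

lemma search_enumerates:
  assumes "distinct av" "distinct ch" "set av \<inter> set ch = {}"
  shows "enumerates (search k av cs ch) ch {X. X \<subseteq> set av \<and> card X \<le> k \<and> hits_all cs X}"
  using assms
proof (induction k arbitrary: av cs ch)
  case 0
  have "hits_all cs {} \<longleftrightarrow> cs = []" by (cases cs) (auto simp: hits_all_def)
  thus ?case using 0 by (auto simp: enumerates_def finite_subsets_card_0[simplified])
next
  case (Suc k)
  show ?case
  proof (cases cs)
    case Nil
    thus ?thesis using extensions_enumerates[OF Suc.prems, of "Suc k"] by (simp add: hits_all_def)
  next
    case (Cons c cs')
    have "enumerates (branch (search k) [] av c cs' ch) ch
        {X. X \<subseteq> set ([] @ av) \<and> card X \<le> Suc k \<and> ((\<exists>s\<in>X. hits c s) \<and> hits_all cs' X)}"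
      by (rule branch_enumerates[OF Suc.IH]) (use Suc.prems in auto)
    thus ?thesis using Cons by (simp add: hits_all_def)
  qed
qed


section \<open>Clauses and models\<close>

lemma set_clauses: "set clauses = {Stuck p q r | p q r. \<not> (p \<and> q \<and> r)} \<union>
    {Half i l m | i l m. i < 3 \<and> (l, m) \<in> set multipliers}"
proof -
  have s: "{Stuck p q r | p q r. \<not> (p \<and> q \<and> r)} = {Stuck False False False, Stuck False False True, Stuck False True False,
      Stuck False True True, Stuck True False False, Stuck True False True, Stuck True True False}"
  proof (intro equalityI subsetI)
    fix x assume "x \<in> {Stuck p q r | p q r. \<not> (p \<and> q \<and> r)}"
    then obtain p q r where "x = Stuck p q r" "\<not> (p \<and> q \<and> r)" by blast
    thus "x \<in> {Stuck False False False, Stuck False False True, Stuck False True False,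
      Stuck False True True, Stuck True False False, Stuck True False True, Stuck True True False}"
      by (cases p; cases q; cases r) simp_all
  qed auto
  have h: "{Half i l m | i l m. i < 3 \<and> (l, m) \<in> set multipliers} =
      (\<Union>i\<in>{0, Suc 0, Suc (Suc 0)}. (\<lambda>(l, m). Half i l m) ` set multipliers)"
  proof (intro equalityI subsetI)
    fix x assume "x \<in> {Half i l m | i l m. i < 3 \<and> (l, m) \<in> set multipliers}"
    then obtain i l m where x: "x = Half i l m" "i < 3" "(l, m) \<in> set multipliers" by blast
    have "i = 0 \<or> i = Suc 0 \<or> i = Suc (Suc 0)" using x(2) by auto
    thus "x \<in> (\<Union>i\<in>{0, Suc 0, Suc (Suc 0)}. (\<lambda>(l, m). Half i l m) ` set multipliers)" using x(1,3) by force
  qed force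
  show ?thesis unfolding s h by (auto simp: clauses_def multipliers_def)
qed

lemma tri_int_sign: "tri_int a < 0 \<longleftrightarrow> a = Neg" "0 < tri_int a \<longleftrightarrow> a = Pos"
  by (cases a; simp)+

lemma all_less_3: "(\<forall>i<3. P i) \<longleftrightarrow> P 0 \<and> P (Suc 0) \<and> P (2::nat)"
  and ex_less_3: "(\<exists>i<3. P i) \<longleftrightarrow> P 0 \<or> P (Suc 0) \<or> P (2::nat)"
  by (auto simp: numeral_eq_Suc less_Suc_eq)

lemma hits_Stuck: "hits (Stuck p q r) u \<longleftrightarrow> escapes (code_step u) {i. i = 0 \<and> p \<or> i = 1 \<and> q \<or> i = 2 \<and> r}"
  by (cases u) (auto simp: escapes_def neg_in_def pos_out_def all_less_3 ex_less_3 tri_int_sign)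

lemma hits_Half: "i < 3 \<Longrightarrow> hits (Half i l m) u \<longleftrightarrow> undercuts (l, m) (view i (code_step u))"
proof -
  assume "i < 3"
  hence "i = 0 \<or> i = Suc 0 \<or> i = Suc (Suc 0)" by auto
  thus ?thesis by (cases u) (auto simp: below_def undercuts_def view_def others_def)
qed

lemma proper_subsets_3: "(\<forall>P\<subset>{..<3}. Q P) \<longleftrightarrow> (\<forall>p q r. \<not> (p \<and> q \<and> r) \<longrightarrow> Q {i::nat. i = 0 \<and> p \<or> i = 1 \<and> q \<or> i = 2 \<and> r})"
proof (intro iffI allI impI)
  fix p q r assume Q: "\<forall>P\<subset>{..<3}. Q P" and "\<not> (p \<and> q \<and> r)"
  have "{i::nat. i = 0 \<and> p \<or> i = 1 \<and> q \<or> i = 2 \<and> r} \<subset> {..<3}"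
  proof
    show "{i::nat. i = 0 \<and> p \<or> i = 1 \<and> q \<or> i = 2 \<and> r} \<subseteq> {..<3}" by auto
    have disj: "0 \<notin> {i::nat. i = 0 \<and> p \<or> i = 1 \<and> q \<or> i = 2 \<and> r} \<or> 1 \<notin> {i::nat. i = 0 \<and> p \<or> i = 1 \<and> q \<or> i = 2 \<and> r}
      \<or> 2 \<notin> {i::nat. i = 0 \<and> p \<or> i = 1 \<and> q \<or> i = 2 \<and> r}" using \<open>\<not> (p \<and> q \<and> r)\<close> by auto
    show "{i::nat. i = 0 \<and> p \<or> i = 1 \<and> q \<or> i = 2 \<and> r} \<noteq> {..<3}"
    proof
      assume eq: "{i::nat. i = 0 \<and> p \<or> i = 1 \<and> q \<or> i = 2 \<and> r} = {..<3}"
      from disj show False unfolding eq by simp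
    qed
  qed
  thus "Q {i. i = 0 \<and> p \<or> i = 1 \<and> q \<or> i = 2 \<and> r}" using Q by blast
next
  fix P :: "nat set"
  assume Q: "\<forall>p q r. \<not> (p \<and> q \<and> r) \<longrightarrow> Q {i. i = 0 \<and> p \<or> i = 1 \<and> q \<or> i = 2 \<and> r}" and P: "P \<subset> {..<3}"
  have "\<not> (0 \<in> P \<and> 1 \<in> P \<and> 2 \<in> P)"
  proof
    assume "0 \<in> P \<and> 1 \<in> P \<and> 2 \<in> P"
    hence "{..<3} \<subseteq> P" by (auto simp: numeral_eq_Suc less_Suc_eq)
    thus False using P by blast
  qed
  then have n: "\<not> (0 \<in> P \<and> 1 \<in> P \<and> 2 \<in> P)" .
  have eq: "P = {i. i = 0 \<and> 0 \<in> P \<or> i = 1 \<and> 1 \<in> P \<or> i = 2 \<and> 2 \<in> P}"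
    using P by (auto simp: numeral_eq_Suc less_Suc_eq dest!: psubsetD)
  have q: "Q {i. i = 0 \<and> 0 \<in> P \<or> i = 1 \<and> 1 \<in> P \<or> i = 2 \<and> 2 \<in> P}"
    by (rule Q[THEN spec, THEN spec, THEN spec, THEN mp, OF n])
  show "Q P" by (rule iffD2[OF arg_cong[of _ _ Q, OF eq] q])
qed

lemma code_steps: "code_step ` set all_codes = ({-1, 0, 1} \<times> {-1, 0, 1} \<times> {-1, 0, 1}) - {(0, 0, 0)}"
  by (simp add: all_codes_def insert_Times_insert) auto

lemma is_model_codes: "is_model S \<longleftrightarrow> (\<exists>X\<subseteq>set all_codes. S = code_step ` X)"
  unfolding is_model_def code_steps[symmetric] subset_image_iff by blast

lemma hits_all_clauses:
  assumes "is_model (code_step ` X)"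
  shows "hits_all clauses X \<longleftrightarrow> nontrivial_model (code_step ` X) \<and> model_dim (code_step ` X) = 3"
proof -
  have "hits_all clauses X \<longleftrightarrow> (\<forall>p q r. \<not> (p \<and> q \<and> r) \<longrightarrow> (\<exists>u\<in>X. hits (Stuck p q r) u)) \<and>
      (\<forall>i<3. \<forall>(l, m)\<in>set multipliers. \<exists>u\<in>X. hits (Half i l m) u)"
    unfolding hits_all_def set_clauses by blast
  also have "\<dots> \<longleftrightarrow> (\<forall>P\<subset>{..<3}. \<exists>s\<in>code_step ` X. escapes s P) \<and>
      (\<forall>i<3. \<forall>c\<in>set multipliers. \<exists>s\<in>code_step ` X. undercuts c (view i s))"
    unfolding proper_subsets_3 by (simp add: hits_Stuck hits_Half split_beta)
  finally show ?thesis using nontrivial_3_iff[OF assms] by simp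
qed


section \<open>One model from every orbit\<close>

datatype comparison = Less | Equal | Greater

fun compare_nat :: "nat \<Rightarrow> nat \<Rightarrow> comparison" where
  "compare_nat 0 0 = Equal" | "compare_nat 0 (Suc n) = Less" | "compare_nat (Suc m) 0 = Greater"
| "compare_nat (Suc m) (Suc n) = compare_nat m n"

primrec compare_then :: "comparison \<Rightarrow> nat \<Rightarrow> nat \<Rightarrow> comparison" where
  "compare_then Less p q = Less" | "compare_then Equal p q = compare_nat p q"
| "compare_then Greater p q = Greater"

lemma compare_nat: "compare_nat m n = (if m < n then Less else if m = n then Equal else Greater)"
  by (induction m n rule: compare_nat.induct) auto

lemma compare_then: "compare_then (compare_nat m n) p q =
    (if (m, p) < (n, q) then Less else if (m, p) = (n, q) then Equal else Greater)"
  by (auto simp: compare_nat less_prod_def)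

fun swap_xy :: "code list \<Rightarrow> code list" where
  "swap_xy [] = []" | "swap_xy (C a b c # l) = C b a c # swap_xy l"
fun swap_xz :: "code list \<Rightarrow> code list" where
  "swap_xz [] = []" | "swap_xz (C a b c # l) = C c b a # swap_xz l"

definition mask_le :: "code list \<Rightarrow> code list \<Rightarrow> bool" where
  "mask_le l l' \<longleftrightarrow> mask l \<le> mask l'"

fun least_if :: "comparison \<Rightarrow> comparison \<Rightarrow> code list \<Rightarrow> bool" where
  "least_if Greater b l = False" | "least_if Less Greater l = False" | "least_if Equal Greater l = False"
| "least_if Less Less l = True" | "least_if Equal Less l = mask_le l (swap_xy l)"
| "least_if Less Equal l = mask_le l (swap_yz l)"
| "least_if Equal Equal l = (mask_le l (swap_xy l) \<and> mask_le l (swap_yz l) \<and> mask_le l (swap_xz l)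
     \<and> mask_le l (rotate3 l) \<and> mask_le l (rotate3 (rotate3 l)))"

definition least_code :: "code list \<Rightarrow> bool" where
  "least_code l = least_if
     (compare_then (compare_nat (countX Neg l) (countY Neg l)) (countX Pos l) (countY Pos l))
     (compare_then (compare_nat (countY Neg l) (countZ Neg l)) (countY Pos l) (countZ Pos l)) l"

text \<open>The order of the components of a lexicographically least arrangement is determined by the keys
  unless keys coincide, so the expensive component is compared for ties only.\<close>

lemma rotations_least:
  fixes kx ky kz :: "'a::linorder" and m :: "'b::linorder"
  shows "(kx, ky, kz, m) \<le> (ky, kx, kz, m1) \<and> (kx, ky, kz, m) \<le> (kx, kz, ky, m2) \<and>
      (kx, ky, kz, m) \<le> (kz, ky, kx, m3) \<and> (kx, ky, kz, m) \<le> (ky, kz, kx, m4) \<and>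
      (kx, ky, kz, m) \<le> (kz, kx, ky, m5) \<longleftrightarrow>
    kx \<le> ky \<and> ky \<le> kz \<and> (kx = ky \<longrightarrow> m \<le> m1) \<and> (ky = kz \<longrightarrow> m \<le> m2) \<and>
    (kx = ky \<and> ky = kz \<longrightarrow> m \<le> m3 \<and> m \<le> m4 \<and> m \<le> m5)"
  by (cases kx ky rule: linorder_cases; cases ky kz rule: linorder_cases; cases kx kz rule: linorder_cases)
     (auto simp: less_eq_prod_simp)

definition key :: "nat \<Rightarrow> step set \<Rightarrow> nat \<times> nat" where
  "key i S = (card {s\<in>S. coord i s = -1}, card {s\<in>S. coord i s = 1})"

definition step_index :: "step \<Rightarrow> nat" where
  "step_index = (\<lambda>(a, b, c). nat (9 * a + 3 * b + c + 14))"

text \<open>Most orbits are decided by the numbers of negative and positive entries of each coordinate; the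
  last component makes the rank injective.\<close>

definition rank :: "step set \<Rightarrow> (nat \<times> nat) \<times> (nat \<times> nat) \<times> (nat \<times> nat) \<times> nat" where
  "rank S = (key 0 S, key 1 S, key 2 S, set_encode (step_index ` S))"

definition least_model :: "step set \<Rightarrow> bool" where
  "least_model S \<longleftrightarrow> (\<forall>\<sigma>. \<sigma> permutes {..<3} \<longrightarrow> rank S \<le> rank (permute_step \<sigma> ` S))"

lemma sum_count_tri:
  assumes "distinct l"
  shows "card {s\<in>code_step ` set l. coord 0 s = tri_int t} = countX t l"
    and "card {s\<in>code_step ` set l. coord 1 s = tri_int t} = countY t l"
    and "card {s\<in>code_step ` set l. coord 2 s = tri_int t} = countZ t l"
proof -
  have *: "card {s\<in>code_step ` set l. P s} = sum_list (map (\<lambda>u. if P (code_step u) then 1 else 0) l)" for P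
    using sum_code_steps[OF assms, where P = P and f = "\<lambda>_. 1::nat"] by simp
  show "card {s\<in>code_step ` set l. coord 0 s = tri_int t} = countX t l"
    unfolding * by (induction l rule: countX.induct[of _ t, case_names Nil Cons])
      (auto simp: suc_if_def tri_eq_def tri_int_eq)
  show "card {s\<in>code_step ` set l. coord 1 s = tri_int t} = countY t l"
    unfolding * by (induction l rule: countY.induct[of _ t, case_names Nil Cons])
      (auto simp: suc_if_def tri_eq_def tri_int_eq)
  show "card {s\<in>code_step ` set l. coord 2 s = tri_int t} = countZ t l"
    unfolding * by (induction l rule: countZ.induct[of _ t, case_names Nil Cons])
      (auto simp: suc_if_def tri_eq_def tri_int_eq)
qed

lemma key_code:
  assumes "distinct l"
  shows "key 0 (code_step ` set l) = (countX Neg l, countX Pos l)"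
    and "key 1 (code_step ` set l) = (countY Neg l, countY Pos l)"
    and "key 2 (code_step ` set l) = (countZ Neg l, countZ Pos l)"
  using sum_count_tri[OF assms, of Neg] sum_count_tri[OF assms, of Pos] by (simp_all add: key_def)

lemma step_index_code: "code_bit u = 2 ^ step_index (code_step u)"
  by (cases u) (simp add: step_index_def)

definition model_steps :: "step set" where
  "model_steps = ({-1, 0, 1} \<times> {-1, 0, 1} \<times> {-1, 0, 1}) - {(0, 0, 0)}"

lemma inj_step_index: "inj_on step_index model_steps"
proof (rule inj_onI)
  fix s t assume s: "s \<in> model_steps" and t: "t \<in> model_steps" and eq: "step_index s = step_index t"
  obtain a b c where s': "s = (a, b, c)" "a \<in> {-1, 0, 1}" "b \<in> {-1, 0, 1}" "c \<in> {-1, 0, 1}"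
    using s unfolding model_steps_def by (cases s) auto
  obtain d e f where t': "t = (d, e, f)" "d \<in> {-1, 0, 1}" "e \<in> {-1, 0, 1}" "f \<in> {-1, 0, 1}"
    using t unfolding model_steps_def by (cases t) auto
  have b: "-1 \<le> x \<and> x \<le> 1" if "x \<in> {-1, 0, 1}" for x :: int using that by auto
  note bounds = b[OF s'(2)] b[OF s'(3)] b[OF s'(4)] b[OF t'(2)] b[OF t'(3)] b[OF t'(4)]
  have p: "0 \<le> 9 * a + 3 * b + c + 14" "0 \<le> 9 * d + 3 * e + f + 14" using bounds by linarith+
  have "nat (9 * a + 3 * b + c + 14) = nat (9 * d + 3 * e + f + 14)"
    using eq unfolding s'(1) t'(1) step_index_def by (simp only: case_prod_conv)
  hence e: "9 * a + 3 * b + c + 14 = 9 * d + 3 * e + f + 14" using eq_nat_nat_iff[OF p] by blast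
  have "a \<le> d" "d \<le> a" using bounds e by linarith+
  hence 1: "a = d" by (rule order_antisym)
  have "b \<le> e" "e \<le> b" using bounds e 1 by linarith+
  hence 2: "b = e" by (rule order_antisym)
  have 3: "c = f" using e 1 2 by linarith
  show "s = t" by (simp only: s'(1) t'(1) 1 2 3)
qed

lemma is_model_subset: "is_model S \<longleftrightarrow> S \<subseteq> model_steps"
  by (simp add: is_model_def model_steps_def)

lemma code_step_model: "u \<noteq> C Zer Zer Zer \<Longrightarrow> code_step u \<in> model_steps"
proof -
  assume u: "u \<noteq> C Zer Zer Zer"
  obtain a b c where abc: "u = C a b c" by (cases u)
  have t: "tri_int t \<in> {-1, 0, 1}" for t by (cases t) auto
  have "tri_int t = 0 \<longleftrightarrow> t = Zer" for t by (cases t) auto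
  thus ?thesis using u unfolding abc model_steps_def code_step.simps
    by (intro DiffI SigmaI t) auto
qed

lemma mask_code:
  assumes "distinct l" "C Zer Zer Zer \<notin> set l"
  shows "set_encode (step_index ` code_step ` set l) = mask l"
proof -
  have "code_step ` set l \<subseteq> model_steps"
  proof (rule image_subsetI)
    fix u assume "u \<in> set l"
    hence "u \<noteq> C Zer Zer Zer" using assms(2) by blast
    thus "code_step u \<in> model_steps" by (rule code_step_model)
  qed
  hence inj: "inj_on (step_index \<circ> code_step) (set l)"
    by (intro comp_inj_on inj_on_subset[OF inj_step_index] inj_on_subset[OF inj_code_step]) auto
  have "set_encode (step_index ` code_step ` set l) = (\<Sum>u\<in>set l. 2 ^ step_index (code_step u))"
    unfolding set_encode_def image_comp by (subst sum.reindex[OF inj]) simp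
  also have "\<dots> = sum_list (map (\<lambda>u. 2 ^ step_index (code_step u)) l)"
    using assms(1) by (rule sum.distinct_set_conv_list)
  also have "\<dots> = sum_list (map code_bit l)"
    by (intro arg_cong[where f = sum_list] map_cong refl step_index_code[symmetric])
  also have "\<dots> = mask l" by (induction l) auto
  finally show ?thesis .
qed

lemma rank_code:
  assumes "distinct l" "C Zer Zer Zer \<notin> set l"
  shows "rank (code_step ` set l) =
    ((countX Neg l, countX Pos l), (countY Neg l, countY Pos l), (countZ Neg l, countZ Pos l), mask l)"
  using key_code[OF assms(1)] mask_code[OF assms] by (simp add: rank_def)

lemma finite_model: "is_model S \<Longrightarrow> finite S"
  unfolding is_model_def by (rule finite_subset) auto

lemma rank_inj:
  assumes "is_model S" "is_model T" "rank S = rank T"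
  shows "S = T"
proof -
  have "set_encode (step_index ` S) = set_encode (step_index ` T)" using assms(3) by (simp add: rank_def)
  hence "step_index ` S = step_index ` T"
    using finite_model assms(1,2) set_encode_inverse by (metis finite_imageI)
  thus ?thesis
    using assms(1,2) inj_on_image_eq_iff[OF inj_step_index] unfolding is_model_subset by blast
qed

definition image_maps :: "(nat \<times> nat \<times> nat) list" where
  "image_maps = [(0, 1, 2), (1, 0, 2), (0, 2, 1), (2, 1, 0), (1, 2, 0), (2, 0, 1)]"

definition permute_by :: "nat \<times> nat \<times> nat \<Rightarrow> step \<Rightarrow> step" where
  "permute_by = (\<lambda>(i, j, k) s. (coord i s, coord j s, coord k s))"

lemma permutes_3_iff: "(\<forall>\<sigma>. \<sigma> permutes {..<3} \<longrightarrow> P (permute_step \<sigma>)) \<longleftrightarrow> (\<forall>m\<in>set image_maps. P (permute_by m))"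
proof (intro iffI ballI allI impI)
  fix m assume P: "\<forall>\<sigma>. \<sigma> permutes {..<3} \<longrightarrow> P (permute_step \<sigma>)" and m: "m \<in> set image_maps"
  have sw: "transpose i j permutes {..<3::nat}" if "i < 3" "j < 3" for i j
    using that by (intro permutes_swap_id) auto
  have "id permutes {..<3::nat}" "transpose 0 1 permutes {..<3::nat}" "transpose 1 2 permutes {..<3::nat}"
    "transpose 0 2 permutes {..<3::nat}" "turn permutes {..<3::nat}" "turn \<circ> turn permutes {..<3::nat}"
    using permutes_id sw[of 0 1] sw[of 1 2] sw[of 0 2] turn_permutes permutes_compose[OF turn_permutes turn_permutes] by auto
  hence all: "P (permute_step id)" "P (permute_step (transpose 0 1))" "P (permute_step (transpose 1 2))"
    "P (permute_step (transpose 0 2))" "P (permute_step turn)" "P (permute_step (turn \<circ> turn))"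
    using P by blast+
  have eq: "permute_step id = permute_by (0, 1, 2)" "permute_step (transpose 0 1) = permute_by (1, 0, 2)"
    "permute_step (transpose 1 2) = permute_by (0, 2, 1)" "permute_step (transpose 0 2) = permute_by (2, 1, 0)"
    "permute_step turn = permute_by (1, 2, 0)" "permute_step (turn \<circ> turn) = permute_by (2, 0, 1)"
    by (auto simp: fun_eq_iff permute_step_def permute_by_def turn_def transpose_def)
  show "P (permute_by m)" using all m unfolding eq by (auto simp: image_maps_def)
next
  fix \<sigma> :: "nat \<Rightarrow> nat" assume P: "\<forall>m\<in>set image_maps. P (permute_by m)" and s: "\<sigma> permutes {..<3}"
  have c: "\<sigma> i = 0 \<or> \<sigma> i = 1 \<or> \<sigma> i = 2" if "i < 3" for i
    by (rule less_3_cases[OF perm_less[OF s that]])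
  have c': "\<sigma> 0 = 0 \<or> \<sigma> 0 = 1 \<or> \<sigma> 0 = 2" "\<sigma> 1 = 0 \<or> \<sigma> 1 = 1 \<or> \<sigma> 1 = 2" "\<sigma> 2 = 0 \<or> \<sigma> 2 = 1 \<or> \<sigma> 2 = 2"
    by (rule c; simp)+
  have d: "\<sigma> 0 \<noteq> \<sigma> 1" "\<sigma> 0 \<noteq> \<sigma> 2" "\<sigma> 1 \<noteq> \<sigma> 2" using perm_eq[OF s] by auto
  have six: "(x, y, z) \<in> set image_maps" if "x = 0 \<or> x = 1 \<or> x = 2" "y = 0 \<or> y = 1 \<or> y = 2"
    "z = 0 \<or> z = 1 \<or> z = 2" "x \<noteq> y" "x \<noteq> z" "y \<noteq> z" for x y z
    using that by (elim disjE) (simp_all add: image_maps_def)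
  have "(\<sigma> 0, \<sigma> 1, \<sigma> 2) \<in> set image_maps" by (rule six[OF c' d])
  moreover have "permute_step \<sigma> = permute_by (\<sigma> 0, \<sigma> 1, \<sigma> 2)"
    by (simp add: fun_eq_iff permute_step_def permute_by_def)
  ultimately show "P (permute_step \<sigma>)" using P by simp
qed

lemma permuted_codes:
  "permute_by (0, 1, 2) ` code_step ` set l = code_step ` set l"
  "permute_by (1, 0, 2) ` code_step ` set l = code_step ` set (swap_xy l)"
  "permute_by (0, 2, 1) ` code_step ` set l = code_step ` set (swap_yz l)"
  "permute_by (2, 1, 0) ` code_step ` set l = code_step ` set (swap_xz l)"
  "permute_by (1, 2, 0) ` code_step ` set l = code_step ` set (rotate3 l)"
  "permute_by (2, 0, 1) ` code_step ` set l = code_step ` set (rotate3 (rotate3 l))"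
  by (induction l rule: swap_xy.induct) (simp_all add: permute_by_def)

lemma permuted_counts:
  "countX t (swap_xy l) = countY t l" "countY t (swap_xy l) = countX t l" "countZ t (swap_xy l) = countZ t l"
  "countX t (swap_yz l) = countX t l" "countY t (swap_yz l) = countZ t l" "countZ t (swap_yz l) = countY t l"
  "countX t (swap_xz l) = countZ t l" "countY t (swap_xz l) = countY t l" "countZ t (swap_xz l) = countX t l"
  "countX t (rotate3 l) = countY t l" "countY t (rotate3 l) = countZ t l" "countZ t (rotate3 l) = countX t l"
  by (induction l rule: swap_xy.induct; simp)+

lemma permuted_distinct:
  assumes "distinct l" "C Zer Zer Zer \<notin> set l"
  shows "distinct (swap_xy l) \<and> C Zer Zer Zer \<notin> set (swap_xy l)"
    "distinct (swap_yz l) \<and> C Zer Zer Zer \<notin> set (swap_yz l)"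
    "distinct (swap_xz l) \<and> C Zer Zer Zer \<notin> set (swap_xz l)"
    "distinct (rotate3 l) \<and> C Zer Zer Zer \<notin> set (rotate3 l)"
proof -
  have *: "C a b c \<in> set (swap_xy l) \<longleftrightarrow> C b a c \<in> set l" "C a b c \<in> set (swap_yz l) \<longleftrightarrow> C a c b \<in> set l"
    "C a b c \<in> set (swap_xz l) \<longleftrightarrow> C c b a \<in> set l" "C a b c \<in> set (rotate3 l) \<longleftrightarrow> C c a b \<in> set l" for a b c l
    by (induction l rule: swap_xy.induct; auto)+
  show "distinct (swap_xy l) \<and> C Zer Zer Zer \<notin> set (swap_xy l)"
    "distinct (swap_yz l) \<and> C Zer Zer Zer \<notin> set (swap_yz l)"
    "distinct (swap_xz l) \<and> C Zer Zer Zer \<notin> set (swap_xz l)"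
    "distinct (rotate3 l) \<and> C Zer Zer Zer \<notin> set (rotate3 l)"
    using assms by (induction l rule: swap_xy.induct; auto simp: *)+
qed

lemma least_code_iff:
  assumes l: "distinct l" "C Zer Zer Zer \<notin> set l"
  shows "least_code l \<longleftrightarrow> least_model (code_step ` set l)"
proof -
  note d = permuted_distinct[OF l]
  have r: "distinct (rotate3 (rotate3 l)) \<and> C Zer Zer Zer \<notin> set (rotate3 (rotate3 l))"
    using permuted_distinct(4) d(4) by blast
  define kx where "kx = (countX Neg l, countX Pos l)"
  define ky where "ky = (countY Neg l, countY Pos l)"
  define kz where "kz = (countZ Neg l, countZ Pos l)"
  have rk: "rank (code_step ` set l) = (kx, ky, kz, mask l)"
    "rank (code_step ` set (swap_xy l)) = (ky, kx, kz, mask (swap_xy l))"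
    "rank (code_step ` set (swap_yz l)) = (kx, kz, ky, mask (swap_yz l))"
    "rank (code_step ` set (swap_xz l)) = (kz, ky, kx, mask (swap_xz l))"
    "rank (code_step ` set (rotate3 l)) = (ky, kz, kx, mask (rotate3 l))"
    "rank (code_step ` set (rotate3 (rotate3 l))) = (kz, kx, ky, mask (rotate3 (rotate3 l)))"
    using l d r by (simp_all add: rank_code permuted_counts kx_def ky_def kz_def)
  have "least_model (code_step ` set l) \<longleftrightarrow>
      (\<forall>m\<in>set image_maps. rank (code_step ` set l) \<le> rank (permute_by m ` code_step ` set l))"
    unfolding least_model_def by (rule permutes_3_iff)
  also have "\<dots> \<longleftrightarrow> kx \<le> ky \<and> ky \<le> kz \<and> (kx = ky \<longrightarrow> mask l \<le> mask (swap_xy l)) \<and>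
      (ky = kz \<longrightarrow> mask l \<le> mask (swap_yz l)) \<and> (kx = ky \<and> ky = kz \<longrightarrow> mask l \<le> mask (swap_xz l) \<and>
       mask l \<le> mask (rotate3 l) \<and> mask l \<le> mask (rotate3 (rotate3 l)))"
  proof -
    have all: "(\<forall>m\<in>set image_maps. Q m) \<longleftrightarrow> Q (0, 1, 2) \<and> Q (1, 0, 2) \<and> Q (0, 2, 1) \<and> Q (2, 1, 0)
        \<and> Q (1, 2, 0) \<and> Q (2, 0, 1)" for Q
      by (simp add: image_maps_def)
    have "(kx, ky, kz, mask l) \<le> (kx, ky, kz, mask l)" by (rule order_refl)
    thus ?thesis unfolding all permuted_codes rk rotations_least[symmetric] by blast
  qed
  also have "\<dots> \<longleftrightarrow> least_code l"
    unfolding least_code_def compare_then kx_def[symmetric] ky_def[symmetric] kz_def[symmetric]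
    by (cases kx ky rule: linorder_cases; cases ky kz rule: linorder_cases) (auto simp: mask_le_def)
  finally show ?thesis ..
qed


section \<open>Running the enumeration\<close>

definition candidates :: "code list list" where
  "candidates = search (Suc (Suc (Suc (Suc (Suc (Suc 0)))))) all_codes clauses []"

datatype tally = Tally nat "code list list"

text \<open>Least models that pass the test are only counted, the few others are listed.\<close>

primrec collect :: "code list \<Rightarrow> tally \<Rightarrow> tally" where
  "collect l (Tally n F) = (if least_code l then if infinite_test l then Tally (Suc n) F else Tally n (l # F) else Tally n F)"

lemma fold_collect:
  "fold collect L (Tally n F) = Tally (n + length (filter (\<lambda>l. least_code l \<and> infinite_test l) L))
     (rev (filter (\<lambda>l. least_code l \<and> \<not> infinite_test l) L) @ F)"
  by (induction L arbitrary: n F) auto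

definition branch_list where "branch_list b f kept s av c cs ch = (if b
     then f (rev_onto kept av) (unhit s cs) (s # ch) @ branch f kept av c cs ch
     else branch f (s # kept) av c cs ch)"

lemma split_rules:
  "branch f kept [] c cs ch = []"
  "branch f kept (s # av) c cs ch = branch_list (hits c s) f kept s av c cs ch"
  "branch_list True f kept s av c cs ch = f (rev_onto kept av) (unhit s cs) (s # ch) @ branch f kept av c cs ch"
  "branch_list False f kept s av c cs ch = branch f (s # kept) av c cs ch"
  "search (Suc k) av (c # cs) ch = branch (search k) [] av c cs ch"
  by (simp_all add: branch_list_def)

definition tally_extensions where
  "tally_extensions k av ch t = fold collect (extensions k av ch) t"
definition tally_branch where
  "tally_branch k kept av c cs ch t = fold collect (branch (search k) kept av c cs ch) t"
definition tally_search where
  "tally_search k av cs ch t = fold collect (search k av cs ch) t"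
definition tally_if where
  "tally_if b k kept s av c cs ch t = (if b
     then tally_branch k kept av c cs ch (tally_search k (rev_onto kept av) (unhit s cs) (s # ch) t)
     else tally_branch k (s # kept) av c cs ch t)"
definition collect_if where
  "collect_if b l n F = (if b then if infinite_test l then Tally (Suc n) F else Tally n (l # F) else Tally n F)"
definition collect_infinite where
  "collect_infinite b l n F = (if b then Tally (Suc n) F else Tally n (l # F))"
definition bump :: "nat \<Rightarrow> nat" where
  "bump n = Suc n"

text \<open>These equations evaluate the enumeration without building the list of all models, and decide
  every condition before its branches are looked at.\<close>

lemma tally_rules:
  "tally_extensions k [] ch t = collect ch t"
  "tally_extensions 0 (s # av) ch t = collect ch t"
  "tally_extensions (Suc k) (s # av) ch t = tally_extensions (Suc k) av ch (tally_extensions k av (s # ch) t)"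
  "tally_branch k kept [] c cs ch t = t"
  "tally_branch k kept (s # av) c cs ch t = tally_if (hits c s) k kept s av c cs ch t"
  "tally_if True k kept s av c cs ch t =
     tally_branch k kept av c cs ch (tally_search k (rev_onto kept av) (unhit s cs) (s # ch) t)"
  "tally_if False k kept s av c cs ch t = tally_branch k (s # kept) av c cs ch t"
  "tally_search 0 av [] ch t = collect ch t"
  "tally_search 0 av (c # cs) ch t = t"
  "tally_search (Suc k) av [] ch t = tally_extensions (Suc k) av ch t"
  "tally_search (Suc k) av (c # cs) ch t = tally_branch k [] av c cs ch t"
  "collect l (Tally n F) = collect_if (least_code l) l n F"
  "collect_if True l n F = collect_infinite (infinite_test l) l n F"
  "collect_if False l n F = Tally n F"
  "collect_infinite True l n F = Tally (bump n) F"
  "collect_infinite False l n F = Tally n (l # F)"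
  "bump 0 = 1" "bump 1 = 2" "bump (numeral w) = numeral (Num.inc w)"
  by (simp_all add: tally_extensions_def tally_branch_def tally_search_def tally_if_def
      collect_if_def collect_infinite_def bump_def numeral_inc)

lemmas search_rules = neg_in_table pos_out_table below_table hits.simps clauses_def all_codes_def
  rev_onto.simps unhit.simps cons_if_simps not_True_eq_False not_False_eq_True simp_thms

lemmas least_rules = suc_if_simps countX.simps countY.simps countZ.simps compare_nat.simps
  compare_then.simps least_if.simps least_code_def mask_le_def swap_xy.simps swap_xz.simps
  mask.simps code_bit_table Num.arith_simps Num.rel_simps add_0_left add_0_right Num.inc.simps


definition piece1 :: "code list list" where
  "piece1 = search (Suc (Suc (Suc (Suc (Suc 0)))))
    [C Neg Neg Neg, C Neg Neg Zer, C Neg Neg Pos, C Neg Zer Neg, C Neg Zer Zer, C Neg Zer Pos, C Neg Pos Neg,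
     C Neg Pos Zer, C Neg Pos Pos, C Zer Neg Neg, C Zer Neg Zer, C Zer Neg Pos, C Zer Zer Neg, C Zer Pos Neg,
     C Zer Pos Zer, C Zer Pos Pos, C Pos Neg Neg, C Pos Neg Zer, C Pos Neg Pos, C Pos Zer Neg, C Pos Zer Zer,
     C Pos Zer Pos, C Pos Pos Neg, C Pos Pos Zer, C Pos Pos Pos]
    [Stuck False False True, Stuck False True True, Stuck True False True, Half 0 0 0, Half 0 2 0,
     Half (Suc 0) 0 0, Half (Suc 0) 2 0, Half (Suc (Suc 0)) 0 0, Half (Suc (Suc 0)) 0 2, Half (Suc (Suc 0)) 2 0,
     Half (Suc (Suc 0)) 2 2, Half (Suc (Suc 0)) 2 4, Half (Suc (Suc 0)) 4 2, Half (Suc (Suc 0)) 1 1]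
    [C Zer Zer Pos]"

definition piece2 :: "code list list" where
  "piece2 = search (Suc (Suc (Suc (Suc (Suc 0)))))
    [C Neg Neg Neg, C Neg Neg Zer, C Neg Neg Pos, C Neg Zer Neg, C Neg Zer Zer, C Neg Zer Pos, C Neg Pos Neg,
     C Neg Pos Zer, C Neg Pos Pos, C Zer Neg Neg, C Zer Neg Zer, C Zer Neg Pos, C Zer Zer Neg, C Zer Pos Neg,
     C Zer Pos Pos, C Pos Neg Neg, C Pos Neg Zer, C Pos Neg Pos, C Pos Zer Neg, C Pos Zer Zer, C Pos Zer Pos,
     C Pos Pos Neg, C Pos Pos Zer, C Pos Pos Pos]
    [Stuck False True False, Stuck False True True, Stuck True True False, Half 0 0 0, Half 0 0 2,
     Half (Suc 0) 0 0, Half (Suc 0) 0 2, Half (Suc 0) 2 0, Half (Suc 0) 2 2, Half (Suc 0) 2 4, Half (Suc 0) 4 2,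
     Half (Suc 0) 1 1, Half (Suc (Suc 0)) 0 0, Half (Suc (Suc 0)) 2 0]
    [C Zer Pos Zer]"

definition piece3 :: "code list list" where
  "piece3 = search (Suc (Suc (Suc (Suc (Suc 0)))))
    [C Neg Neg Neg, C Neg Neg Zer, C Neg Neg Pos, C Neg Zer Neg, C Neg Zer Zer, C Neg Zer Pos, C Neg Pos Neg,
     C Neg Pos Zer, C Neg Pos Pos, C Zer Neg Neg, C Zer Neg Zer, C Zer Neg Pos, C Zer Zer Neg, C Zer Pos Neg,
     C Pos Neg Neg, C Pos Neg Zer, C Pos Neg Pos, C Pos Zer Neg, C Pos Zer Zer, C Pos Zer Pos, C Pos Pos Neg,
     C Pos Pos Zer, C Pos Pos Pos]
    [Stuck False True True, Half 0 0 0, Half (Suc 0) 0 0, Half (Suc 0) 0 2, Half (Suc 0) 2 0, Half (Suc 0) 2 2,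
     Half (Suc 0) 4 2, Half (Suc 0) 1 1, Half (Suc (Suc 0)) 0 0, Half (Suc (Suc 0)) 0 2, Half (Suc (Suc 0)) 2 0,
     Half (Suc (Suc 0)) 2 2, Half (Suc (Suc 0)) 4 2, Half (Suc (Suc 0)) 1 1]
    [C Zer Pos Pos]"

definition piece4 :: "code list list" where
  "piece4 = search (Suc (Suc (Suc (Suc (Suc 0)))))
    [C Neg Neg Neg, C Neg Neg Zer, C Neg Neg Pos, C Neg Zer Neg, C Neg Zer Zer, C Neg Zer Pos, C Neg Pos Neg,
     C Neg Pos Zer, C Neg Pos Pos, C Zer Neg Neg, C Zer Neg Zer, C Zer Neg Pos, C Zer Zer Neg, C Zer Pos Neg,
     C Pos Neg Neg, C Pos Neg Zer, C Pos Neg Pos, C Pos Zer Neg, C Pos Zer Pos, C Pos Pos Neg, C Pos Pos Zer,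
     C Pos Pos Pos]
    [Stuck True False False, Stuck True False True, Stuck True True False, Half 0 0 0, Half 0 0 2, Half 0 2 0,
     Half 0 2 2, Half 0 2 4, Half 0 4 2, Half 0 1 1, Half (Suc 0) 0 0, Half (Suc 0) 0 2, Half (Suc (Suc 0)) 0 0,
     Half (Suc (Suc 0)) 0 2]
    [C Pos Zer Zer]"

definition piece5 :: "code list list" where
  "piece5 = search (Suc (Suc (Suc (Suc (Suc 0)))))
    [C Neg Neg Neg, C Neg Neg Zer, C Neg Neg Pos, C Neg Zer Neg, C Neg Zer Zer, C Neg Zer Pos, C Neg Pos Neg,
     C Neg Pos Zer, C Neg Pos Pos, C Zer Neg Neg, C Zer Neg Zer, C Zer Neg Pos, C Zer Zer Neg, C Zer Pos Neg,
     C Pos Neg Neg, C Pos Neg Zer, C Pos Neg Pos, C Pos Zer Neg, C Pos Pos Neg, C Pos Pos Zer, C Pos Pos Pos]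
    [Stuck True False True, Half 0 0 0, Half 0 0 2, Half 0 2 0, Half 0 2 2, Half 0 4 2, Half 0 1 1,
     Half (Suc 0) 0 0, Half (Suc (Suc 0)) 0 0, Half (Suc (Suc 0)) 0 2, Half (Suc (Suc 0)) 2 0,
     Half (Suc (Suc 0)) 2 2, Half (Suc (Suc 0)) 2 4, Half (Suc (Suc 0)) 1 1]
    [C Pos Zer Pos]"

definition piece6 :: "code list list" where
  "piece6 = search (Suc (Suc (Suc (Suc (Suc 0)))))
    [C Neg Neg Neg, C Neg Neg Zer, C Neg Neg Pos, C Neg Zer Neg, C Neg Zer Zer, C Neg Zer Pos, C Neg Pos Neg,
     C Neg Pos Zer, C Neg Pos Pos, C Zer Neg Neg, C Zer Neg Zer, C Zer Neg Pos, C Zer Zer Neg, C Zer Pos Neg,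
     C Pos Neg Neg, C Pos Neg Zer, C Pos Neg Pos, C Pos Zer Neg, C Pos Pos Neg, C Pos Pos Pos]
    [Stuck True True False, Half 0 0 0, Half 0 0 2, Half 0 2 0, Half 0 2 2, Half 0 2 4, Half 0 1 1,
     Half (Suc 0) 0 0, Half (Suc 0) 0 2, Half (Suc 0) 2 0, Half (Suc 0) 2 2, Half (Suc 0) 2 4, Half (Suc 0) 1 1,
     Half (Suc (Suc 0)) 0 0]
    [C Pos Pos Zer]"

definition piece7 :: "code list list" where
  "piece7 = search (Suc (Suc (Suc (Suc (Suc 0)))))
    [C Neg Neg Neg, C Neg Neg Zer, C Neg Neg Pos, C Neg Zer Neg, C Neg Zer Zer, C Neg Zer Pos, C Neg Pos Neg,
     C Neg Pos Zer, C Neg Pos Pos, C Zer Neg Neg, C Zer Neg Zer, C Zer Neg Pos, C Zer Zer Neg, C Zer Pos Neg,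
     C Pos Neg Neg, C Pos Neg Zer, C Pos Neg Pos, C Pos Zer Neg, C Pos Pos Neg]
    [Half 0 0 0, Half 0 0 2, Half 0 2 0, Half 0 1 1, Half (Suc 0) 0 0, Half (Suc 0) 0 2, Half (Suc 0) 2 0,
     Half (Suc 0) 1 1, Half (Suc (Suc 0)) 0 0, Half (Suc (Suc 0)) 0 2, Half (Suc (Suc 0)) 2 0,
     Half (Suc (Suc 0)) 1 1]
    [C Pos Pos Pos]"

text \<open>The models are divided according to their first step without negative entries.\<close>

lemma candidates_pieces: "candidates = piece1 @ piece2 @ piece3 @ piece4 @ piece5 @ piece6 @ piece7"
  unfolding candidates_def piece1_def piece2_def piece3_def piece4_def piece5_def piece6_def piece7_def
  by (simp only: search_rules split_rules append_Nil2)

definition certificates1 :: "(code list \<times> certificate) list" where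
  "certificates1 = [
    
    ([C Zer Zer Neg, C Zer Neg Pos, C Neg Pos Pos, C Pos Pos Pos, C Zer Zer Pos], Product (0, 1, 2) (Commute False 1, Commute False 1, Commute True 1)),
    ([C Zer Zer Neg, C Zer Neg Pos, C Neg Zer Pos, C Pos Pos Pos, C Zer Zer Pos], Product (0, 1, 2) (Commute False 1, Commute False 1, Twist (-1) 1 (-1) 1)),
    ([C Zer Zer Neg, C Pos Neg Zer, C Neg Pos Zer, C Neg Neg Neg, C Pos Pos Pos, C Zer Zer Pos], Monomial ((0, 0, -1), (0, 0, -1), (-1, -1, 0))),
    ([C Pos Neg Pos, C Zer Zer Neg, C Pos Neg Neg, C Neg Zer Zer, C Pos Pos Zer, C Zer Zer Pos], Product (0, 1, 2) (Commute True 0, Commute True 0, Commute False 1)),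
    ([C Zer Zer Neg, C Zer Neg Pos, C Zer Neg Neg, C Neg Zer Zer, C Pos Pos Zer, C Zer Zer Pos], Product (0, 1, 2) (Commute True 0, Commute True 0, Twist (-1) 1 (-1) 1)),
    ([C Pos Pos Pos, C Zer Zer Neg, C Zer Neg Zer, C Neg Pos Zer, C Pos Pos Neg, C Zer Zer Pos], Product (0, 1, 2) (Commute True 0, Commute True 0, Commute True 1)),
    ([C Zer Neg Zer, C Neg Pos Neg, C Pos Pos Neg, C Zer Zer Pos], Product (1, 2, 0) (Commute True 1, Commute True (-1), Twist 1 (-1) 1 0)),
    ([C Zer Neg Neg, C Neg Pos Neg, C Pos Pos Neg, C Zer Zer Pos], Product (0, 1, 2) (Commute False (-1), Commute False (-1), Commute True 1)),
    ([C Zer Zer Neg, C Zer Neg Neg, C Neg Pos Neg, C Pos Pos Neg, C Zer Zer Pos], Product (0, 1, 2) (Commute False (-1), Commute False (-1), Commute True 1)),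
    ([C Pos Pos Pos, C Zer Zer Neg, C Zer Neg Zer, C Neg Zer Zer, C Pos Pos Neg, C Zer Zer Pos], Product (0, 1, 2) (Commute True 0, Commute True 0, Twist (-1) 1 (-1) 1)),
    ([C Zer Neg Neg, C Neg Zer Neg, C Pos Pos Neg, C Zer Zer Pos], Product (0, 1, 2) (Commute False (-1), Commute False (-1), Twist (-1) 1 (-1) 1)),
    ([C Zer Zer Neg, C Zer Neg Neg, C Neg Zer Neg, C Pos Pos Neg, C Zer Zer Pos], Product (0, 1, 2) (Commute False (-1), Commute False (-1), Twist (-1) 1 (-1) 1)),
    ([C Pos Neg Neg, C Neg Pos Neg, C Neg Neg Neg, C Pos Pos Neg, C Zer Zer Pos], Product (0, 1, 2) (Commute False (-1), Commute False (-1), Commute True (-1))),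
    ([C Zer Zer Neg, C Pos Neg Neg, C Neg Pos Neg, C Neg Neg Neg, C Pos Pos Neg, C Zer Zer Pos], Product (0, 1, 2) (Commute False (-1), Commute False (-1), Commute True (-1))),
    ([C Pos Neg Neg, C Zer Neg Neg, C Neg Pos Neg, C Neg Neg Neg, C Pos Pos Neg, C Zer Zer Pos], Product (0, 1, 2) (Commute False (-1), Commute False (-1), Commute True (-1))),
    ([C Zer Zer Neg, C Zer Neg Pos, C Zer Neg Neg, C Neg Pos Zer, C Pos Zer Zer, C Zer Zer Pos], Product (0, 1, 2) (Commute True 0, Commute True 0, Twist 1 0 1 (-1))),
    ([C Zer Zer Neg, C Zer Neg Pos, C Neg Pos Pos, C Pos Pos Pos, C Zer Pos Pos, C Zer Zer Pos], Product (0, 1, 2) (Commute False 1, Commute False 1, Commute True 1)),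
    ([C Zer Zer Neg, C Zer Neg Pos, C Neg Zer Pos, C Pos Zer Pos, C Zer Pos Pos, C Zer Zer Pos], Product (0, 1, 2) (Commute False 1, Commute False 1, Commute True 0)),
    ([C Zer Zer Neg, C Neg Neg Pos, C Pos Zer Pos, C Zer Pos Pos, C Zer Zer Pos], Product (0, 1, 2) (Commute False 1, Commute False 1, Twist (-1) 0 (-1) 0)),
    ([C Zer Zer Neg, C Zer Neg Pos, C Neg Zer Zer, C Pos Zer Zer, C Zer Pos Pos, C Zer Zer Pos], Product (0, 1, 2) (Commute True 0, Commute False 1, Commute True 0)),
    ([C Zer Zer Neg, C Zer Neg Neg, C Neg Zer Zer, C Pos Zer Zer, C Zer Pos Pos, C Zer Zer Pos], Product (1, 2, 0) (Commute True 0, Commute True 0, Twist (-2) 1 (-1) 0)),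
    ([C Zer Neg Pos, C Neg Zer Neg, C Pos Zer Zer, C Zer Pos Pos, C Zer Zer Pos], Product (0, 2, 1) (Commute True 0, Commute True 1, Twist (-1) 0 (-1) 0)),
    ([C Zer Neg Pos, C Neg Pos Neg, C Neg Neg Neg, C Pos Zer Zer, C Zer Pos Pos, C Zer Zer Pos], Product (0, 2, 1) (Commute True 0, Commute True (-1), Twist (-1) 0 (-1) 0)),
    ([C Zer Neg Pos, C Neg Zer Zer, C Pos Zer Neg, C Zer Pos Pos, C Zer Zer Pos], Product (0, 2, 1) (Commute True 0, Commute True 1, Twist 1 (-1) 1 0)),
    ([C Zer Neg Pos, C Neg Zer Neg, C Pos Zer Neg, C Zer Pos Pos, C Zer Zer Pos], Product (0, 1, 2) (Commute False (-1), Commute False 1, Commute True 0)),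
    ([C Zer Zer Neg, C Zer Neg Pos, C Neg Zer Neg, C Pos Zer Neg, C Zer Pos Pos, C Zer Zer Pos], Product (0, 1, 2) (Commute False (-1), Commute False 1, Commute True 0)),
    ([C Zer Neg Pos, C Neg Pos Neg, C Neg Neg Neg, C Pos Zer Neg, C Zer Pos Pos, C Zer Zer Pos], Product (0, 1, 2) (Commute False (-1), Commute False (-1), Commute False 0)),
    ([C Zer Zer Neg, C Neg Zer Pos, C Pos Neg Pos, C Zer Pos Pos, C Zer Zer Pos], Product (0, 1, 2) (Commute False 1, Commute False 1, Twist 1 (-1) 1 0)),
    ([C Zer Zer Neg, C Zer Neg Neg, C Neg Pos Zer, C Pos Neg Zer, C Zer Pos Pos, C Zer Zer Pos], Monomial ((0, 2, 0), (1, 0, -1), (0, -1, 0))),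
    ([C Zer Neg Pos, C Pos Pos Neg, C Neg Zer Zer, C Pos Neg Neg, C Zer Pos Pos, C Zer Zer Pos], Product (0, 2, 1) (Commute True 0, Commute True (-1), Twist 1 (-1) 1 0)),
    ([C Pos Pos Neg, C Zer Neg Pos, C Neg Zer Neg, C Pos Neg Neg, C Zer Pos Pos, C Zer Zer Pos], Product (0, 1, 2) (Commute False (-1), Commute False (-1), Commute False 0)),
    ([C Zer Zer Neg, C Zer Neg Zer, C Neg Neg Neg, C Pos Pos Pos, C Zer Pos Zer, C Zer Zer Pos], Monomial ((0, -2, -2), (-1, 0, -1), (-1, -1, 0))),
    ([C Zer Zer Neg, C Zer Neg Zer, C Neg Zer Zer, C Pos Zer Zer, C Zer Pos Zer, C Zer Zer Pos], Product (0, 1, 2) (Commute True 0, Commute True 0, Commute True 0)),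
    ([C Zer Neg Neg, C Neg Zer Zer, C Pos Zer Zer, C Zer Pos Zer, C Zer Zer Pos], Product (1, 2, 0) (Commute True 0, Commute True 0, Twist (-1) 0 (-1) 0)),
    ([C Neg Neg Neg, C Pos Zer Zer, C Zer Pos Zer, C Zer Zer Pos], Monomial ((0, -1, -1), (-1, 0, -1), (-1, -1, 0))),
    ([C Zer Zer Neg, C Neg Neg Pos, C Neg Neg Neg, C Pos Zer Zer, C Zer Pos Zer, C Zer Zer Pos], Product (0, 1, 2) (Commute True 0, Commute True 0, Twist (-1) 0 (-1) 0)),
    ([C Zer Zer Neg, C Zer Neg Zer, C Neg Zer Pos, C Pos Zer Neg, C Zer Pos Zer, C Zer Zer Pos], Product (0, 2, 1) (Commute True 0, Commute True 0, Twist 2 (-1) 1 0)),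
    ([C Zer Neg Zer, C Neg Zer Neg, C Pos Zer Neg, C Zer Pos Zer, C Zer Zer Pos], Product (0, 1, 2) (Commute False (-1), Commute True 0, Commute True 0)),
    ([C Zer Zer Neg, C Zer Neg Zer, C Neg Zer Neg, C Pos Zer Neg, C Zer Pos Zer, C Zer Zer Pos], Product (0, 1, 2) (Commute False (-1), Commute True 0, Commute True 0)),
    ([C Zer Neg Zer, C Neg Pos Neg, C Neg Neg Neg, C Pos Zer Neg, C Zer Pos Zer, C Zer Zer Pos], Product (0, 1, 2) (Commute False (-1), Commute False 0, Commute False 0)),
    ([C Zer Neg Zer, C Zer Zer Neg, C Neg Pos Neg, C Pos Neg Pos, C Zer Pos Zer, C Zer Zer Pos], Monomial ((0, 2, -2), (1, 0, 1), (-1, 1, 0))),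
    ([C Zer Zer Neg, C Neg Zer Zer, C Pos Neg Zer, C Zer Pos Zer, C Zer Zer Pos], Product (0, 1, 2) (Commute True 0, Commute True 0, Twist 1 (-1) 1 0)),
    ([C Neg Zer Neg, C Pos Neg Zer, C Zer Pos Zer, C Zer Zer Pos], Monomial ((0, 1, -1), (1, 0, 0), (-1, 0, 0))),
    ([C Zer Zer Neg, C Zer Neg Zer, C Neg Pos Pos, C Pos Neg Neg, C Zer Pos Zer, C Zer Zer Pos], Monomial ((0, 2, 2), (1, 0, -1), (1, -1, 0))),
    ([C Neg Zer Zer, C Pos Neg Neg, C Zer Pos Zer, C Zer Zer Pos], Monomial ((0, 1, 1), (1, 0, -1), (1, -1, 0))),
    ([C Pos Neg Pos, C Zer Zer Neg, C Neg Zer Zer, C Pos Neg Neg, C Zer Pos Zer, C Zer Zer Pos], Product (0, 1, 2) (Commute True 0, Commute True 0, Twist 1 (-1) 1 0)),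
    ([C Pos Pos Neg, C Zer Neg Zer, C Neg Zer Neg, C Pos Neg Neg, C Zer Pos Zer, C Zer Zer Pos], Product (0, 1, 2) (Commute False (-1), Commute False 0, Commute False 0)),
    ([C Neg Neg Neg, C Pos Neg Neg, C Zer Pos Zer, C Zer Zer Pos], Product (1, 2, 0) (Commute True (-1), Commute True (-1), Twist (-1) 0 (-1) 0)),
    ([C Zer Neg Neg, C Neg Neg Neg, C Pos Neg Neg, C Zer Pos Zer, C Zer Zer Pos], Product (1, 2, 0) (Commute True (-1), Commute True (-1), Twist (-1) 0 (-1) 0)),
    ([C Zer Neg Zer, C Neg Pos Neg, C Pos Pos Neg, C Zer Pos Neg, C Zer Zer Pos], Product (1, 2, 0) (Commute True 1, Commute True (-1), Twist 1 (-1) 1 0)),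
    ([C Zer Neg Neg, C Neg Pos Neg, C Pos Pos Neg, C Zer Pos Neg, C Zer Zer Pos], Product (0, 1, 2) (Commute False (-1), Commute False (-1), Commute True 1)),
    ([C Zer Zer Neg, C Zer Neg Neg, C Neg Pos Neg, C Pos Pos Neg, C Zer Pos Neg, C Zer Zer Pos], Product (0, 1, 2) (Commute False (-1), Commute False (-1), Commute True 1)),
    ([C Zer Neg Neg, C Neg Neg Neg, C Pos Pos Neg, C Zer Pos Neg, C Zer Zer Pos], Product (0, 1, 2) (Commute False (-1), Commute False (-1), Twist (-2) 1 (-1) 0)),
    ([C Zer Zer Neg, C Zer Neg Neg, C Neg Neg Neg, C Pos Pos Neg, C Zer Pos Neg, C Zer Zer Pos], Product (0, 1, 2) (Commute False (-1), Commute False (-1), Twist (-2) 1 (-1) 0)),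
    ([C Zer Neg Neg, C Neg Pos Pos, C Neg Neg Pos, C Pos Zer Pos, C Zer Pos Neg, C Zer Zer Pos], Product (0, 1, 2) (Commute False 1, Commute False (-1), Commute False 0)),
    ([C Zer Neg Neg, C Neg Pos Neg, C Neg Neg Neg, C Pos Zer Pos, C Zer Pos Neg, C Zer Zer Pos], Product (0, 2, 1) (Commute True 0, Commute True (-1), Twist (-2) 1 (-1) 0)),
    ([C Zer Pos Pos, C Zer Zer Neg, C Neg Neg Zer, C Pos Zer Zer, C Zer Pos Neg, C Zer Zer Pos], Product (0, 1, 2) (Commute True 0, Commute True 0, Twist (-1) 0 (-1) 0)),
    ([C Zer Neg Neg, C Neg Zer Neg, C Pos Zer Neg, C Zer Pos Neg, C Zer Zer Pos], Product (0, 1, 2) (Commute False (-1), Commute False (-1), Commute True 0)),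
    ([C Zer Zer Neg, C Zer Neg Neg, C Neg Zer Neg, C Pos Zer Neg, C Zer Pos Neg, C Zer Zer Pos], Product (0, 1, 2) (Commute False (-1), Commute False (-1), Commute True 0)),
    ([C Zer Neg Neg, C Neg Pos Pos, C Neg Neg Pos, C Pos Zer Neg, C Zer Pos Neg, C Zer Zer Pos], Product (0, 2, 1) (Commute True 0, Commute True (-1), Twist 2 (-1) 1 0)),
    ([C Neg Neg Neg, C Pos Zer Neg, C Zer Pos Neg, C Zer Zer Pos], Product (0, 1, 2) (Commute False (-1), Commute False (-1), Twist (-1) 0 (-1) 0)),
    ([C Zer Zer Neg, C Neg Neg Neg, C Pos Zer Neg, C Zer Pos Neg, C Zer Zer Pos], Product (0, 1, 2) (Commute False (-1), Commute False (-1), Twist (-1) 0 (-1) 0)),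
    ([C Zer Neg Neg, C Neg Pos Neg, C Neg Neg Neg, C Pos Zer Neg, C Zer Pos Neg, C Zer Zer Pos], Product (0, 1, 2) (Commute False (-1), Commute False (-1), Commute False 0)),
    ([C Pos Pos Pos, C Zer Neg Neg, C Neg Zer Pos, C Pos Neg Pos, C Zer Pos Neg, C Zer Zer Pos], Product (0, 1, 2) (Commute False 1, Commute False (-1), Commute False 0)),
    ([C Pos Pos Pos, C Zer Neg Neg, C Neg Zer Neg, C Pos Neg Pos, C Zer Pos Neg, C Zer Zer Pos], Product (0, 2, 1) (Commute True 0, Commute True (-1), Twist (-2) 1 (-1) 0)),
    ([C Zer Zer Neg, C Zer Neg Pos, C Neg Pos Zer, C Pos Neg Zer, C Zer Pos Neg, C Zer Zer Pos], Monomial ((0, 2, 0), (1, 0, 1), (0, 1, 0))),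
    ([C Neg Zer Zer, C Pos Neg Zer, C Zer Pos Neg, C Zer Zer Pos], Monomial ((0, 1, 0), (1, 0, 1), (0, 1, 0))),
    ([C Zer Pos Pos, C Zer Zer Neg, C Neg Zer Zer, C Pos Neg Zer, C Zer Pos Neg, C Zer Zer Pos], Product (0, 1, 2) (Commute True 0, Commute True 0, Twist 1 (-1) 1 0)),
    ([C Zer Pos Pos, C Zer Zer Neg, C Neg Neg Zer, C Pos Neg Zer, C Zer Pos Neg, C Zer Zer Pos], Product (0, 1, 2) (Commute True 0, Commute True 0, Commute True (-1))),
    ([C Pos Pos Neg, C Neg Pos Neg, C Neg Neg Zer, C Pos Neg Zer, C Zer Pos Neg, C Zer Zer Pos], Product (1, 2, 0) (Commute True (-1), Commute True 0, Twist 1 (-1) 1 0)),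
    ([C Zer Neg Neg, C Neg Pos Neg, C Pos Neg Neg, C Zer Pos Neg, C Zer Zer Pos], Product (0, 1, 2) (Commute False (-1), Commute False (-1), Twist 2 (-1) 1 0)),
    ([C Zer Zer Neg, C Zer Neg Neg, C Neg Pos Neg, C Pos Neg Neg, C Zer Pos Neg, C Zer Zer Pos], Product (0, 1, 2) (Commute False (-1), Commute False (-1), Twist 2 (-1) 1 0)),
    ([C Pos Pos Neg, C Zer Neg Neg, C Neg Zer Pos, C Pos Neg Neg, C Zer Pos Neg, C Zer Zer Pos], Product (0, 2, 1) (Commute True 0, Commute True (-1), Twist 2 (-1) 1 0)),
    ([C Neg Zer Neg, C Pos Neg Neg, C Zer Pos Neg, C Zer Zer Pos], Product (0, 1, 2) (Commute False (-1), Commute False (-1), Twist 1 (-1) 1 0)),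
    ([C Zer Zer Neg, C Neg Zer Neg, C Pos Neg Neg, C Zer Pos Neg, C Zer Zer Pos], Product (0, 1, 2) (Commute False (-1), Commute False (-1), Twist 1 (-1) 1 0)),
    ([C Pos Pos Neg, C Zer Neg Neg, C Neg Zer Neg, C Pos Neg Neg, C Zer Pos Neg, C Zer Zer Pos], Product (0, 1, 2) (Commute False (-1), Commute False (-1), Commute False 0)),
    ([C Neg Neg Neg, C Pos Neg Neg, C Zer Pos Neg, C Zer Zer Pos], Product (0, 1, 2) (Commute False (-1), Commute False (-1), Commute True (-1))),
    ([C Zer Zer Neg, C Neg Neg Neg, C Pos Neg Neg, C Zer Pos Neg, C Zer Zer Pos], Product (0, 1, 2) (Commute False (-1), Commute False (-1), Commute True (-1))),
    ([C Zer Neg Neg, C Neg Neg Neg, C Pos Neg Neg, C Zer Pos Neg, C Zer Zer Pos], Product (0, 1, 2) (Commute False (-1), Commute False (-1), Commute True (-1))),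
    ([C Zer Zer Neg, C Zer Neg Neg, C Neg Neg Neg, C Pos Neg Neg, C Zer Pos Neg, C Zer Zer Pos], Product (0, 1, 2) (Commute False (-1), Commute False (-1), Commute True (-1))),
    ([C Pos Pos Neg, C Neg Pos Neg, C Neg Neg Neg, C Pos Neg Neg, C Zer Pos Neg, C Zer Zer Pos], Product (0, 1, 2) (Commute False (-1), Commute False (-1), Commute True (-1)))]"

lemma certified1: "list_all (\<lambda>(l, c). certifies (map code_step l) c) certificates1"
  by code_simp

definition certificates2 :: "(code list \<times> certificate) list" where
  "certificates2 = [
    
    ([C Zer Pos Neg, C Zer Neg Zer, C Zer Neg Neg, C Neg Zer Pos, C Pos Zer Pos, C Zer Pos Zer], Product (0, 1, 2) (Commute False 1, Commute False 0, Commute True 0)),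
    ([C Pos Neg Neg, C Zer Neg Neg, C Neg Zer Pos, C Neg Neg Neg, C Pos Zer Pos, C Zer Pos Zer], Product (1, 2, 0) (Commute True 0, Commute True (-1), Twist (-1) 0 (-1) 0)),
    ([C Zer Neg Zer, C Pos Zer Neg, C Neg Pos Neg, C Neg Zer Pos, C Pos Neg Pos, C Zer Pos Zer], Monomial ((0, 1, 0), (1, 0, 1), (0, 1, 0))),
    ([C Zer Zer Neg, C Neg Zer Zer, C Pos Neg Pos, C Zer Pos Zer], Monomial ((0, 1, -1), (1, 0, 1), (-1, 1, 0))),
    ([C Zer Pos Neg, C Zer Neg Zer, C Neg Pos Neg, C Pos Pos Pos, C Zer Pos Pos, C Zer Pos Zer], Product (0, 2, 1) (Commute False 1, Commute False 1, Twist (-2) 1 (-1) 0)),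
    ([C Zer Pos Neg, C Zer Neg Zer, C Neg Pos Pos, C Pos Pos Neg, C Zer Pos Pos, C Zer Pos Zer], Product (0, 2, 1) (Commute False 1, Commute False 1, Twist 2 (-1) 1 0)),
    ([C Zer Neg Zer, C Neg Pos Neg, C Pos Pos Neg, C Zer Pos Pos, C Zer Pos Zer], Product (0, 1, 2) (Commute False (-1), Commute True 1, Commute True 1)),
    ([C Zer Pos Neg, C Zer Neg Zer, C Neg Pos Neg, C Pos Pos Neg, C Zer Pos Pos, C Zer Pos Zer], Product (0, 1, 2) (Commute False (-1), Commute True 1, Commute True 1)),
    ([C Zer Neg Zer, C Zer Neg Neg, C Neg Zer Neg, C Pos Zer Pos, C Zer Pos Pos, C Zer Pos Zer], Monomial ((0, 0, -2), (0, 0, -1), (-1, -1, 0))),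
    ([C Zer Pos Neg, C Pos Zer Pos, C Neg Neg Zer, C Pos Zer Neg, C Zer Pos Pos, C Zer Pos Zer], Product (0, 1, 2) (Commute True 0, Commute True 0, Twist (-1) 0 (-1) 0)),
    ([C Zer Neg Zer, C Zer Pos Neg, C Neg Zer Neg, C Pos Zer Pos, C Zer Neg Pos, C Zer Pos Zer], Monomial ((0, 0, -2), (0, 0, 1), (-1, 1, 0))),
    ([C Zer Neg Neg, C Neg Zer Pos, C Neg Zer Neg, C Pos Zer Zer, C Zer Neg Pos, C Zer Pos Zer], Product (0, 1, 2) (Commute True 0, Commute True 0, Commute True 0)),
    ([C Pos Zer Pos, C Zer Neg Neg, C Neg Zer Zer, C Pos Zer Neg, C Zer Neg Pos, C Zer Pos Zer], Product (0, 1, 2) (Commute True 0, Commute True 0, Commute True 0)),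
    ([C Neg Zer Neg, C Pos Zer Neg, C Zer Neg Pos, C Zer Pos Zer], Product (1, 2, 0) (Commute True 0, Commute True (-1), Twist 1 0 1 (-1))),
    ([C Zer Zer Neg, C Neg Zer Neg, C Pos Zer Neg, C Zer Neg Pos, C Zer Pos Zer], Product (1, 2, 0) (Commute True 0, Commute True (-1), Twist 1 0 1 (-1)))]"

lemma certified2: "list_all (\<lambda>(l, c). certifies (map code_step l) c) certificates2"
  by code_simp

definition certificates3 :: "(code list \<times> certificate) list" where
  "certificates3 = [
    
    ([C Zer Zer Neg, C Zer Neg Pos, C Neg Pos Pos, C Pos Pos Pos, C Zer Pos Pos], Product (0, 1, 2) (Commute False 1, Commute False 1, Commute True 1)),
    ([C Zer Zer Neg, C Zer Neg Zer, C Neg Pos Pos, C Pos Pos Pos, C Zer Pos Pos], Product (1, 2, 0) (Commute True 1, Commute True 1, Twist (-1) 1 (-1) 1)),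
    ([C Zer Pos Neg, C Zer Neg Zer, C Neg Pos Neg, C Pos Pos Pos, C Zer Pos Pos], Product (0, 2, 1) (Commute False 1, Commute False 1, Twist (-2) 1 (-1) 0)),
    ([C Zer Pos Neg, C Zer Neg Zer, C Neg Pos Pos, C Pos Pos Neg, C Zer Pos Pos], Product (0, 2, 1) (Commute False 1, Commute False 1, Twist 2 (-1) 1 0)),
    ([C Pos Pos Pos, C Zer Pos Neg, C Zer Neg Zer, C Neg Pos Zer, C Pos Pos Neg, C Zer Pos Pos], Product (0, 1, 2) (Commute True 0, Commute True 1, Commute True 1)),
    ([C Zer Neg Zer, C Neg Pos Neg, C Pos Pos Neg, C Zer Pos Pos], Product (0, 1, 2) (Commute False (-1), Commute True 1, Commute True 1)),
    ([C Zer Pos Neg, C Zer Neg Zer, C Neg Pos Neg, C Pos Pos Neg, C Zer Pos Pos], Product (0, 1, 2) (Commute False (-1), Commute True 1, Commute True 1)),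
    ([C Zer Zer Neg, C Zer Neg Pos, C Neg Zer Pos, C Pos Zer Pos, C Zer Pos Pos], Product (0, 1, 2) (Commute False 1, Commute False 1, Commute True 0)),
    ([C Zer Neg Pos, C Zer Pos Neg, C Zer Neg Neg, C Neg Zer Pos, C Pos Zer Pos, C Zer Pos Pos], Product (0, 1, 2) (Commute False 1, Commute False (-1), Commute True 0)),
    ([C Zer Zer Neg, C Neg Neg Pos, C Pos Zer Pos, C Zer Pos Pos], Product (0, 1, 2) (Commute False 1, Commute False 1, Twist (-1) 0 (-1) 0)),
    ([C Pos Pos Neg, C Zer Neg Neg, C Neg Zer Neg, C Neg Neg Pos, C Pos Zer Pos, C Zer Pos Pos], Product (0, 1, 2) (Commute False (-1), Commute False (-1), Twist (-1) 0 (-1) 0)),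
    ([C Pos Pos Zer, C Zer Neg Neg, C Neg Zer Neg, C Neg Neg Zer, C Pos Zer Pos, C Zer Pos Pos], Monomial ((0, -1, -1), (-1, 0, -1), (-1, -1, 0))),
    ([C Zer Neg Pos, C Zer Zer Neg, C Neg Pos Neg, C Neg Neg Neg, C Pos Zer Pos, C Zer Pos Pos], Product (0, 2, 1) (Commute True 0, Commute True (-1), Twist (-2) 1 (-1) 0)),
    ([C Zer Zer Neg, C Zer Neg Pos, C Neg Zer Zer, C Pos Zer Zer, C Zer Pos Pos], Product (0, 1, 2) (Commute True 0, Commute False 1, Commute True 0)),
    ([C Zer Zer Neg, C Zer Neg Zer, C Neg Zer Zer, C Pos Zer Zer, C Zer Pos Pos], Product (1, 2, 0) (Commute True 0, Commute True 0, Twist (-1) 1 (-1) 1)),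
    ([C Zer Pos Neg, C Zer Neg Pos, C Zer Neg Neg, C Neg Zer Zer, C Pos Zer Zer, C Zer Pos Pos], Product (0, 1, 2) (Commute True 0, Commute True (-1), Commute True 0)),
    ([C Zer Neg Pos, C Neg Zer Neg, C Pos Zer Zer, C Zer Pos Pos], Product (0, 2, 1) (Commute True 0, Commute True 1, Twist (-1) 0 (-1) 0)),
    ([C Zer Neg Zer, C Neg Zer Neg, C Pos Zer Zer, C Zer Pos Pos], Monomial ((0, 0, -1), (0, 0, -1), (-1, -1, 0))),
    ([C Neg Pos Neg, C Zer Neg Pos, C Neg Neg Neg, C Pos Zer Zer, C Zer Pos Pos], Product (0, 2, 1) (Commute True 0, Commute True (-1), Twist (-1) 0 (-1) 0)),
    ([C Zer Neg Pos, C Neg Zer Zer, C Pos Zer Neg, C Zer Pos Pos], Product (0, 2, 1) (Commute True 0, Commute True 1, Twist 1 (-1) 1 0)),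
    ([C Pos Zer Pos, C Zer Pos Neg, C Zer Neg Zer, C Neg Zer Zer, C Pos Zer Neg, C Zer Pos Pos], Product (0, 1, 2) (Commute True 0, Commute True 0, Commute True 0)),
    ([C Zer Neg Pos, C Neg Zer Neg, C Pos Zer Neg, C Zer Pos Pos], Product (0, 1, 2) (Commute False (-1), Commute False 1, Commute True 0)),
    ([C Zer Zer Neg, C Zer Neg Pos, C Neg Zer Neg, C Pos Zer Neg, C Zer Pos Pos], Product (0, 1, 2) (Commute False (-1), Commute False 1, Commute True 0)),
    ([C Zer Neg Zer, C Neg Zer Neg, C Pos Zer Neg, C Zer Pos Pos], Product (1, 2, 0) (Commute True 0, Commute True (-1), Twist (-1) 1 (-1) 1)),
    ([C Zer Zer Neg, C Zer Neg Zer, C Neg Zer Neg, C Pos Zer Neg, C Zer Pos Pos], Product (1, 2, 0) (Commute True 0, Commute True (-1), Twist (-1) 1 (-1) 1)),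
    ([C Zer Pos Neg, C Zer Neg Pos, C Zer Neg Neg, C Neg Zer Neg, C Pos Zer Neg, C Zer Pos Pos], Product (0, 1, 2) (Commute False (-1), Commute False (-1), Commute True 0)),
    ([C Zer Zer Neg, C Zer Neg Pos, C Neg Pos Pos, C Neg Neg Pos, C Pos Zer Neg, C Zer Pos Pos], Product (0, 2, 1) (Commute True 0, Commute True 1, Twist 2 (-1) 1 0)),
    ([C Zer Pos Neg, C Pos Zer Pos, C Neg Neg Zer, C Pos Zer Neg, C Zer Pos Pos], Product (0, 1, 2) (Commute True 0, Commute True 0, Twist (-1) 0 (-1) 0)),
    ([C Neg Pos Neg, C Zer Neg Pos, C Neg Neg Neg, C Pos Zer Neg, C Zer Pos Pos], Product (0, 1, 2) (Commute False (-1), Commute False (-1), Commute False 0)),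
    ([C Zer Zer Neg, C Neg Pos Neg, C Zer Neg Pos, C Neg Neg Neg, C Pos Zer Neg, C Zer Pos Pos], Product (0, 1, 2) (Commute False (-1), Commute False (-1), Commute False 0)),
    ([C Pos Zer Pos, C Zer Pos Neg, C Neg Neg Pos, C Neg Neg Neg, C Pos Zer Neg, C Zer Pos Pos], Product (0, 1, 2) (Commute True 0, Commute True 0, Twist (-1) 0 (-1) 0)),
    ([C Zer Zer Neg, C Neg Zer Pos, C Pos Neg Pos, C Zer Pos Pos], Product (0, 1, 2) (Commute False 1, Commute False 1, Twist 1 (-1) 1 0)),
    ([C Pos Zer Neg, C Zer Neg Neg, C Neg Pos Neg, C Neg Zer Pos, C Pos Neg Pos, C Zer Pos Pos], Product (0, 1, 2) (Commute False (-1), Commute False (-1), Twist 1 0 1 0)),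
    ([C Pos Zer Zer, C Zer Neg Neg, C Neg Pos Neg, C Neg Zer Zer, C Pos Neg Pos, C Zer Pos Pos], Monomial ((0, 1, -1), (1, 0, 0), (-1, 0, 0))),
    ([C Pos Pos Pos, C Zer Neg Pos, C Zer Zer Neg, C Neg Zer Neg, C Pos Neg Pos, C Zer Pos Pos], Product (0, 2, 1) (Commute True 0, Commute True 1, Twist (-2) 1 (-1) 0)),
    ([C Pos Zer Neg, C Neg Pos Zer, C Zer Neg Neg, C Neg Zer Pos, C Pos Neg Zer, C Zer Pos Pos], Monomial ((0, 1, 1), (1, 0, -1), (1, -1, 0))),
    ([C Zer Zer Neg, C Neg Zer Zer, C Pos Neg Zer, C Zer Pos Pos], Monomial ((0, 1, 0), (1, 0, -1), (0, -1, 0))),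
    ([C Pos Pos Neg, C Zer Pos Neg, C Neg Pos Neg, C Neg Neg Zer, C Pos Neg Zer, C Zer Pos Pos], Product (0, 1, 2) (Commute False 0, Commute True 1, Commute True (-1))),
    ([C Pos Pos Neg, C Zer Neg Pos, C Zer Zer Neg, C Neg Zer Pos, C Pos Neg Neg, C Zer Pos Pos], Product (0, 2, 1) (Commute True 0, Commute True (-1), Twist 2 (-1) 1 0)),
    ([C Zer Pos Neg, C Pos Neg Pos, C Neg Zer Zer, C Pos Neg Neg, C Zer Pos Pos], Product (0, 1, 2) (Commute True 0, Commute True (-1), Twist 1 (-1) 1 0)),
    ([C Pos Pos Neg, C Pos Zer Neg, C Zer Neg Pos, C Neg Zer Zer, C Pos Neg Neg, C Zer Pos Pos], Product (0, 2, 1) (Commute True 0, Commute True (-1), Twist 1 (-1) 1 0)),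
    ([C Pos Pos Neg, C Zer Neg Pos, C Neg Zer Neg, C Pos Neg Neg, C Zer Pos Pos], Product (0, 1, 2) (Commute False (-1), Commute False (-1), Commute False 0)),
    ([C Pos Pos Neg, C Pos Zer Neg, C Zer Neg Pos, C Neg Zer Neg, C Pos Neg Neg, C Zer Pos Pos], Product (0, 1, 2) (Commute False (-1), Commute False (-1), Commute False 0)),
    ([C Pos Pos Neg, C Zer Zer Neg, C Zer Neg Pos, C Neg Zer Neg, C Pos Neg Neg, C Zer Pos Pos], Product (0, 1, 2) (Commute False (-1), Commute False (-1), Commute False 0)),
    ([C Pos Neg Pos, C Zer Pos Neg, C Neg Zer Pos, C Neg Zer Neg, C Pos Neg Neg, C Zer Pos Pos], Product (0, 1, 2) (Commute True 0, Commute True 0, Twist 1 (-1) 1 0)),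
    ([C Pos Pos Neg, C Neg Pos Neg, C Zer Neg Pos, C Neg Neg Neg, C Pos Neg Neg, C Zer Pos Pos], Product (0, 1, 2) (Commute False (-1), Commute True (-1), Commute True (-1)))]"

lemma certified3: "list_all (\<lambda>(l, c). certifies (map code_step l) c) certificates3"
  by code_simp

definition certificates4 :: "(code list \<times> certificate) list" where
  "certificates4 = [
    
    ([C Pos Pos Neg, C Pos Neg Pos, C Pos Neg Neg, C Neg Zer Zer, C Pos Pos Pos, C Pos Zer Zer], Product (0, 1, 2) (Commute True 1, Commute True (-1), Commute False 1)),
    ([C Neg Pos Neg, C Zer Neg Pos, C Zer Neg Neg, C Neg Pos Pos, C Pos Zer Zer], Product (0, 1, 2) (Commute True 0, Commute True (-1), Twist 1 0 1 (-1))),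
    ([C Zer Pos Neg, C Zer Zer Neg, C Zer Neg Neg, C Neg Neg Pos, C Neg Pos Pos, C Pos Zer Zer], Product (0, 2, 1) (Commute True 0, Commute True (-1), Twist 1 0 1 (-1))),
    ([C Pos Zer Pos, C Pos Zer Neg, C Zer Neg Neg, C Zer Neg Pos, C Neg Pos Zer, C Pos Zer Zer], Product (0, 1, 2) (Commute True 0, Commute True 0, Twist 1 0 1 (-1)))]"

lemma certified4: "list_all (\<lambda>(l, c). certifies (map code_step l) c) certificates4"
  by code_simp

definition certificates5 :: "(code list \<times> certificate) list" where
  "certificates5 = [
    
    ([C Pos Zer Neg, C Pos Neg Pos, C Pos Neg Neg, C Neg Zer Zer, C Pos Pos Zer, C Pos Zer Pos], Product (0, 1, 2) (Commute True 1, Commute True 0, Commute False 1)),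
    ([C Pos Pos Pos, C Pos Neg Pos, C Pos Neg Neg, C Neg Zer Zer, C Pos Pos Neg, C Pos Zer Pos], Product (0, 1, 2) (Commute True 1, Commute False (-1), Commute False 1)),
    ([C Pos Pos Pos, C Pos Neg Pos, C Zer Neg Neg, C Neg Zer Pos, C Zer Pos Neg, C Pos Zer Pos], Product (0, 1, 2) (Commute False 1, Commute False (-1), Commute False 0)),
    ([C Pos Pos Pos, C Pos Neg Pos, C Zer Neg Neg, C Neg Zer Zer, C Zer Pos Neg, C Pos Zer Pos], Product (0, 2, 1) (Commute True 0, Commute True (-1), Twist (-1) 1 (-1) 1)),
    ([C Pos Neg Neg, C Zer Neg Neg, C Neg Zer Pos, C Neg Neg Neg, C Zer Pos Neg, C Pos Zer Pos], Product (0, 1, 2) (Commute False (-1), Commute False (-1), Commute True 0)),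
    ([C Zer Pos Neg, C Zer Neg Neg, C Neg Neg Pos, C Neg Pos Pos, C Pos Zer Pos], Product (0, 1, 2) (Commute False 1, Commute False (-1), Commute False 0)),
    ([C Zer Pos Neg, C Zer Zer Neg, C Zer Neg Neg, C Neg Neg Pos, C Neg Pos Pos, C Pos Zer Pos], Product (0, 1, 2) (Commute False 1, Commute False (-1), Commute False 0)),
    ([C Zer Neg Pos, C Pos Zer Neg, C Zer Neg Neg, C Neg Pos Zer, C Pos Zer Pos], Product (0, 1, 2) (Commute True 0, Commute True 0, Twist 1 0 1 (-1))),
    ([C Zer Pos Neg, C Zer Zer Neg, C Zer Neg Neg, C Neg Neg Zer, C Neg Pos Zer, C Pos Zer Pos], Product (0, 2, 1) (Commute True 0, Commute True 0, Twist (-1) 1 (-1) 1))]"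

lemma certified5: "list_all (\<lambda>(l, c). certifies (map code_step l) c) certificates5"
  by code_simp

definition certificates6 :: "(code list \<times> certificate) list" where
  "certificates6 = [
    
    ([C Zer Pos Neg, C Zer Zer Neg, C Pos Neg Zer, C Zer Neg Neg, C Neg Zer Pos, C Pos Pos Zer], Product (0, 2, 1) (Commute True 0, Commute True 0, Twist 1 0 1 (-1))),
    ([C Neg Zer Neg, C Zer Neg Pos, C Zer Neg Neg, C Neg Zer Pos, C Pos Pos Zer], Product (0, 1, 2) (Commute True 0, Commute True 0, Twist (-1) 1 (-1) 1))]"

lemma certified6: "list_all (\<lambda>(l, c). certifies (map code_step l) c) certificates6"
  by code_simp

definition certificates7 :: "(code list \<times> certificate) list" where
  "certificates7 = [
    
    ([C Zer Zer Neg, C Zer Neg Pos, C Neg Pos Pos, C Pos Pos Pos], Product (0, 1, 2) (Commute False 1, Commute False 1, Commute True 1)),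
    ([C Zer Zer Neg, C Zer Neg Zer, C Neg Pos Pos, C Pos Pos Pos], Product (1, 2, 0) (Commute True 1, Commute True 1, Twist (-1) 1 (-1) 1)),
    ([C Pos Pos Neg, C Zer Neg Pos, C Zer Neg Neg, C Neg Pos Pos, C Neg Pos Neg, C Pos Pos Pos], Product (0, 1, 2) (Commute True 0, Commute True (-1), Commute True 1)),
    ([C Zer Zer Neg, C Zer Neg Pos, C Neg Zer Pos, C Pos Pos Pos], Product (0, 1, 2) (Commute False 1, Commute False 1, Twist (-1) 1 (-1) 1)),
    ([C Pos Neg Pos, C Zer Pos Neg, C Zer Neg Neg, C Neg Zer Pos, C Pos Pos Pos], Product (0, 1, 2) (Commute False 1, Commute False (-1), Commute False 0)),
    ([C Pos Neg Pos, C Zer Pos Neg, C Zer Zer Neg, C Zer Neg Neg, C Neg Zer Pos, C Pos Pos Pos], Product (0, 1, 2) (Commute False 1, Commute False (-1), Commute False 0)),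
    ([C Pos Pos Neg, C Pos Neg Pos, C Pos Neg Neg, C Neg Zer Zer, C Pos Pos Pos], Product (0, 1, 2) (Commute True 1, Commute True (-1), Commute False 1)),
    ([C Pos Pos Neg, C Pos Zer Neg, C Pos Neg Pos, C Pos Neg Neg, C Neg Zer Zer, C Pos Pos Pos], Product (0, 1, 2) (Commute True 1, Commute False (-1), Commute False 1)),
    ([C Zer Zer Neg, C Zer Neg Zer, C Neg Zer Zer, C Pos Pos Pos], Monomial ((0, -1, -1), (-1, 0, -1), (-1, -1, 0))),
    ([C Zer Pos Neg, C Pos Neg Pos, C Zer Neg Neg, C Neg Zer Zer, C Pos Pos Pos], Product (0, 2, 1) (Commute True 0, Commute True (-1), Twist (-1) 1 (-1) 1)),
    ([C Zer Pos Neg, C Zer Zer Neg, C Pos Neg Pos, C Zer Neg Neg, C Neg Zer Zer, C Pos Pos Pos], Product (0, 2, 1) (Commute True 0, Commute True (-1), Twist (-1) 1 (-1) 1)),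
    ([C Pos Pos Neg, C Zer Neg Pos, C Zer Neg Neg, C Neg Zer Pos, C Neg Zer Neg, C Pos Pos Pos], Product (0, 1, 2) (Commute True 0, Commute True 0, Twist (-1) 1 (-1) 1)),
    ([C Pos Zer Neg, C Zer Pos Neg, C Zer Neg Pos, C Neg Zer Pos, C Neg Neg Neg, C Pos Pos Pos], Product (0, 1, 2) (Commute False (-1), Commute False (-1), Twist (-1) 0 (-1) 0))]"

lemma certified7: "list_all (\<lambda>(l, c). certifies (map code_step l) c) certificates7"
  by code_simp

lemma tally1: "fold collect piece1 (Tally 0 []) = Tally 7317 (map fst certificates1)"
  unfolding piece1_def certificates1_def list.map fst_conv tally_search_def[symmetric]
  by (simp only: search_rules test_simps tally_rules least_rules)

lemma tally2: "fold collect piece2 (Tally 0 []) = Tally 2914 (map fst certificates2)"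
  unfolding piece2_def certificates2_def list.map fst_conv tally_search_def[symmetric]
  by (simp only: search_rules test_simps tally_rules least_rules)

lemma tally3: "fold collect piece3 (Tally 0 []) = Tally 5813 (map fst certificates3)"
  unfolding piece3_def certificates3_def list.map fst_conv tally_search_def[symmetric]
  by (simp only: search_rules test_simps tally_rules least_rules)

lemma tally4: "fold collect piece4 (Tally 0 []) = Tally 691 (map fst certificates4)"
  unfolding piece4_def certificates4_def list.map fst_conv tally_search_def[symmetric]
  by (simp only: search_rules test_simps tally_rules least_rules)

lemma tally5: "fold collect piece5 (Tally 0 []) = Tally 1473 (map fst certificates5)"
  unfolding piece5_def certificates5_def list.map fst_conv tally_search_def[symmetric]
  by (simp only: search_rules test_simps tally_rules least_rules)

lemma tally6: "fold collect piece6 (Tally 0 []) = Tally 810 (map fst certificates6)"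
  unfolding piece6_def certificates6_def list.map fst_conv tally_search_def[symmetric]
  by (simp only: search_rules test_simps tally_rules least_rules)

lemma tally7: "fold collect piece7 (Tally 0 []) = Tally 1616 (map fst certificates7)"
  unfolding piece7_def certificates7_def list.map fst_conv tally_search_def[symmetric]
  by (simp only: search_rules test_simps tally_rules least_rules)


section \<open>Counting orbits\<close>

definition octant_models :: "step set set" where
  "octant_models = {S. is_model S \<and> nontrivial_model S \<and> model_dim S = 3 \<and> card S \<le> 6}"

abbreviation steps_of :: "code list \<Rightarrow> step set" where
  "steps_of l \<equiv> code_step ` set l"

lemma candidates_enumerate:
  "set ` set candidates = {X. X \<subseteq> set all_codes \<and> card X \<le> 6 \<and> hits_all clauses X}"
  "distinct (map set candidates)" "l \<in> set candidates \<Longrightarrow> distinct l"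
proof -
  have "distinct all_codes" by (simp add: all_codes_def)
  from search_enumerates[OF this, of "[]" "Suc (Suc (Suc (Suc (Suc (Suc 0)))))" clauses]
  have e: "enumerates candidates [] {X. X \<subseteq> set all_codes \<and> card X \<le> 6 \<and> hits_all clauses X}"
    by (simp add: candidates_def eval_nat_numeral)
  show "set ` set candidates = {X. X \<subseteq> set all_codes \<and> card X \<le> 6 \<and> hits_all clauses X}"
    using e unfolding enumerates_def by simp
  show "distinct (map set candidates)" "l \<in> set candidates \<Longrightarrow> distinct l"
    using e unfolding enumerates_def by blast+
qed

lemma octant_models_eq: "octant_models = steps_of ` set candidates"
proof -
  have "octant_models = {S. \<exists>X\<subseteq>set all_codes. S = code_step ` X \<and> card X \<le> 6 \<and> hits_all clauses X}"
  proof (intro equalityI subsetI)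
    fix S assume S: "S \<in> octant_models"
    then obtain X where X: "X \<subseteq> set all_codes" "S = code_step ` X"
      using is_model_codes unfolding octant_models_def by blast
    have "card X \<le> 6" using S card_image[OF inj_on_subset[OF inj_code_step], of X] unfolding octant_models_def X(2) by simp
    moreover have "hits_all clauses X" using S hits_all_clauses[of X] unfolding octant_models_def X(2) by simp
    ultimately show "S \<in> {S. \<exists>X\<subseteq>set all_codes. S = code_step ` X \<and> card X \<le> 6 \<and> hits_all clauses X}"
      using X by blast
  next
    fix S assume "S \<in> {S. \<exists>X\<subseteq>set all_codes. S = code_step ` X \<and> card X \<le> 6 \<and> hits_all clauses X}"
    then obtain X where X: "X \<subseteq> set all_codes" "S = code_step ` X" "card X \<le> 6" "hits_all clauses X" by blast
    have m: "is_model (code_step ` X)" using X(1) is_model_codes by blast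
    thus "S \<in> octant_models"
      using X(3,4) hits_all_clauses[OF m] card_image[OF inj_on_subset[OF inj_code_step], of X]
      unfolding octant_models_def X(2) by simp
  qed
  also have "\<dots> = (\<lambda>X. code_step ` X) ` set ` set candidates"
    unfolding candidates_enumerate(1) by blast
  finally show ?thesis by (simp add: image_image)
qed

lemma steps_of_inj: "inj_on steps_of (set candidates)"
proof (rule inj_onI)
  fix k l assume kl: "k \<in> set candidates" "l \<in> set candidates" "steps_of k = steps_of l"
  hence "set k = set l" using inj_image_eq_iff[OF inj_code_step] by blast
  thus "k = l" using candidates_enumerate(2) kl(1,2) by (simp add: distinct_map inj_on_def)
qed

lemma candidate_codes:
  assumes "l \<in> set candidates"
  shows "distinct l" "C Zer Zer Zer \<notin> set l"
proof -
  have "set l \<subseteq> set all_codes" using candidates_enumerate(1) assms by auto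
  thus "C Zer Zer Zer \<notin> set l" by (auto simp: all_codes_def)
qed (rule candidates_enumerate(3)[OF assms])

lemma octant_models_octant_model:
  assumes "S \<in> octant_models"
  shows "octant_model S"
proof
  show m: "is_model S" using assms by (simp add: octant_models_def)
  have c: "\<forall>P\<subset>{..<3}. \<exists>s\<in>S. escapes s P" "\<forall>i<3. \<forall>c\<in>set multipliers. \<exists>s\<in>S. undercuts c (view i s)"
    using assms nontrivial_3_iff[OF m] by (simp_all add: octant_models_def)
  fix i :: nat and e :: int assume i: "i < 3" and e: "e \<in> {-1, 1}"
  have "\<exists>s\<in>S. coord i s = 1"
  proof -
    have "{..<3} - {i} \<subset> {..<3}" using i by auto
    then obtain s where s: "s \<in> S" "escapes s ({..<3} - {i})" using c(1) by blast
    have "0 < coord i s" using s(2) unfolding escapes_def by auto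
    hence "coord i s = 1" using coord_bounds(2)[OF m s(1), of i] by linarith
    thus ?thesis using s(1) by blast
  qed
  moreover have "\<exists>s\<in>S. coord i s = -1"
  proof -
    have "(0, 0) \<in> set multipliers" by (simp add: multipliers_def)
    then obtain s where s: "s \<in> S" "undercuts (0, 0) (view i s)" using c(2) i by blast
    have "coord i s < 0" using s(2) by (simp add: undercuts_view)
    hence "coord i s = -1" using coord_bounds(1)[OF m s(1), of i] by linarith
    thus ?thesis using s(1) by blast
  qed
  ultimately have "\<exists>s\<in>S. coord i s = e" using e by blast
  thus "{s \<in> S. coord i s = e} \<noteq> {}" by blast
qed

lemma permute_step_comp: "\<tau> permutes {..<3} \<Longrightarrow> permute_step \<tau> (permute_step \<sigma> s) = permute_step (\<sigma> \<circ> \<tau>) s"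
proof -
  assume "\<tau> permutes {..<3}"
  from perm_less[OF this] have "\<tau> 0 < 3" "\<tau> 1 < 3" "\<tau> 2 < 3" by simp_all
  moreover have "coord i (permute_step \<sigma> s) = coord (\<sigma> i) s" if "i < 3" for i
    using that less_3_cases[OF that] by (auto simp: permute_step_def)
  ultimately show ?thesis by (simp add: permute_step_def[of \<tau>] permute_step_def[of "\<sigma> \<circ> \<tau>"])
qed

lemma permute_step_id: "permute_step id s = s"
  by (cases s) (simp add: permute_step_def)

lemma walk_permute:
  assumes "\<sigma> permutes {..<3}" "octant_walk S w"
  shows "octant_walk (permute_step \<sigma> ` S) (map (permute_step \<sigma>) w)"
proof -
  have "0 \<le> (\<Sum>s\<leftarrow>take n (map (permute_step \<sigma>) w). coord i s)" if "n \<le> length w" "i < 3" for n i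
  proof -
    have "(\<Sum>s\<leftarrow>take n (map (permute_step \<sigma>) w). coord i s) = (\<Sum>s\<leftarrow>take n w. coord (\<sigma> i) s)"
      by (simp add: take_map o_def coord_permute_step[OF assms(1) that(2)])
    thus ?thesis using assms(2) that perm_less[OF assms(1) that(2)] unfolding octant_walk_def by simp
  qed
  moreover have "set (map (permute_step \<sigma>) w) \<subseteq> permute_step \<sigma> ` S"
    using assms(2) unfolding octant_walk_def by auto
  ultimately show ?thesis unfolding octant_walk_def by simp
qed

lemma octant_models_permute:
  assumes \<sigma>: "\<sigma> permutes {..<3}" and S: "S \<in> octant_models"
  shows "permute_step \<sigma> ` S \<in> octant_models"
proof -
  have S': "is_model S" "nontrivial_model S" "model_dim S = 3" "card S \<le> 6"
    using S by (simp_all add: octant_models_def)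
  have inj: "inj_on (permute_step \<sigma>) S" using inj_permute_step[OF \<sigma>] by (rule inj_on_subset) simp
  have dim: "model_dim (permute_step \<sigma> ` S) = 3"
    unfolding model_dim_3_iff
  proof (intro allI impI)
    fix i :: nat assume i: "i < 3"
    obtain a where a: "\<forall>j\<in>{..<3} - {\<sigma> i}. satisfies_ineq S a j" "\<not> satisfies_ineq S a (\<sigma> i)"
      using S'(3) perm_less[OF \<sigma> i] unfolding model_dim_3_iff by blast
    define b where "b t = a (inv_into S (permute_step \<sigma>) t)" for t
    have sat: "satisfies_ineq (permute_step \<sigma> ` S) b j \<longleftrightarrow> satisfies_ineq S a (\<sigma> j)" if "j < 3" for j
    proof -
      have "(\<Sum>t\<in>permute_step \<sigma> ` S. int (b t) * coord j t) = (\<Sum>s\<in>S. int (a s) * coord (\<sigma> j) s)"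
        unfolding sum.reindex[OF inj]
        by (intro sum.cong) (simp_all add: b_def inv_into_f_f[OF inj] coord_permute_step[OF \<sigma> that])
      thus ?thesis by (simp add: satisfies_ineq_def)
    qed
    have "satisfies_ineq (permute_step \<sigma> ` S) b j" if "j \<in> {..<3} - {i}" for j
      using that a(1) sat[of j] perm_less[OF \<sigma>, of j] perm_eq[OF \<sigma>, of j i] by auto
    thus "\<exists>a. (\<forall>j\<in>{..<3} - {i}. satisfies_ineq (permute_step \<sigma> ` S) a j) \<and> \<not> satisfies_ineq (permute_step \<sigma> ` S) a i"
      using a(2) sat[OF i] by blast
  qed
  have "\<exists>w. octant_walk (permute_step \<sigma> ` S) w \<and> t \<in> set w" if t: "t \<in> permute_step \<sigma> ` S" for t
  proof -
    obtain s w where "t = permute_step \<sigma> s" "octant_walk S w" "s \<in> set w"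
      using t S'(2) unfolding nontrivial_model_def by blast
    thus ?thesis using walk_permute[OF \<sigma>, of S w] by (intro exI[of _ "map (permute_step \<sigma>) w"]) simp
  qed
  hence "nontrivial_model (permute_step \<sigma> ` S)" unfolding nontrivial_model_def using dim by simp
  thus ?thesis
    using dim is_model_permute[OF \<sigma> S'(1)] S'(4) card_image[OF inj] by (simp add: octant_models_def)
qed

lemma group_order_permute:
  assumes "\<sigma> permutes {..<3}" "S \<in> octant_models"
  shows "finite (carrier (model_group (permute_step \<sigma> ` S))) \<longleftrightarrow> finite (carrier (model_group S))"
    and "card (carrier (model_group (permute_step \<sigma> ` S))) = card (carrier (model_group S))"
  using finite_model_group_permute[OF assms(1) octant_models_octant_model[OF assms(2)]]
    bij_betw_finite bij_betw_same_card by metis+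

lemma large_group_models_eq: "large_group_models = {S \<in> octant_models. group_order_at_least 200 S}"
  by (auto simp: large_group_models_def octant_models_def)

lemma least_model_exists:
  assumes "S \<in> octant_models"
  shows "\<exists>\<sigma>. \<sigma> permutes {..<3} \<and> least_model (permute_step \<sigma> ` S)"
proof -
  define R where "R = (\<lambda>\<sigma>. rank (permute_step \<sigma> ` S)) ` {\<sigma>. \<sigma> permutes {..<3}}"
  have R: "finite R" "R \<noteq> {}"
  proof -
    show "finite R" unfolding R_def by (intro finite_imageI finite_permutations) simp
    have "id \<in> {\<sigma>. \<sigma> permutes {..<3::nat}}" by (intro CollectI permutes_id)
    thus "R \<noteq> {}" unfolding R_def by blast
  qed
  obtain \<sigma> where \<sigma>: "\<sigma> permutes {..<3}" "Min R = rank (permute_step \<sigma> ` S)"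
    using Min_in[OF R] unfolding R_def by auto
  have "rank (permute_step \<sigma> ` S) \<le> rank (permute_step \<tau> ` permute_step \<sigma> ` S)" if \<tau>: "\<tau> permutes {..<3}" for \<tau>
  proof -
    have "permute_step \<tau> ` permute_step \<sigma> ` S = permute_step (\<sigma> \<circ> \<tau>) ` S"
      unfolding image_image by (intro image_cong refl permute_step_comp \<tau>)
    moreover have "\<sigma> \<circ> \<tau> permutes {..<3}" using \<tau> \<sigma>(1) by (rule permutes_compose)
    ultimately have "rank (permute_step \<tau> ` permute_step \<sigma> ` S) \<in> R" unfolding R_def by auto
    thus ?thesis unfolding \<sigma>(2)[symmetric] using Min_le[OF R(1)] by blast
  qed
  thus ?thesis unfolding least_model_def using \<sigma>(1) by blast
qed

lemma same_up_to_permutation_equiv: "equiv UNIV same_up_to_permutation"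
proof (rule equivI)
  show "refl same_up_to_permutation"
    unfolding refl_on_def same_up_to_permutation_def
    by (auto intro!: exI[of _ id] simp: permutes_id permute_step_id)
  have "(T, S) \<in> same_up_to_permutation" if ST: "(S, T) \<in> same_up_to_permutation" for S T
  proof -
    obtain \<sigma> where \<sigma>: "\<sigma> permutes {..<3}" "T = permute_step \<sigma> ` S"
      using ST unfolding same_up_to_permutation_def by blast
    have "inv_into UNIV \<sigma> permutes {..<3}" using \<sigma>(1) by (rule permutes_inv)
    moreover have "S = permute_step (inv_into UNIV \<sigma>) ` T"
      unfolding \<sigma>(2) image_image
      using permute_step_comp[OF permutes_inv[OF \<sigma>(1)], of \<sigma>] permutes_inv_o(1)[OF \<sigma>(1)]
      by (simp add: permute_step_id)
    ultimately show ?thesis unfolding same_up_to_permutation_def by blast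
  qed
  thus "sym same_up_to_permutation" by (rule symI)
  have "(S, U) \<in> same_up_to_permutation" if ST: "(S, T) \<in> same_up_to_permutation" "(T, U) \<in> same_up_to_permutation" for S T U
  proof -
    obtain \<sigma> \<tau> where st: "\<sigma> permutes {..<3}" "T = permute_step \<sigma> ` S" "\<tau> permutes {..<3}" "U = permute_step \<tau> ` T"
      using ST unfolding same_up_to_permutation_def by blast
    have "U = permute_step (\<sigma> \<circ> \<tau>) ` S"
      unfolding st(2,4) image_image by (intro image_cong refl permute_step_comp st(3))
    moreover have "\<sigma> \<circ> \<tau> permutes {..<3}" using st(3,1) by (rule permutes_compose)
    ultimately show ?thesis unfolding same_up_to_permutation_def by blast
  qed
  thus "trans same_up_to_permutation" by (rule transI)
qed simp

lemma large_permute: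
  assumes "\<sigma> permutes {..<3}" "S \<in> large_group_models"
  shows "permute_step \<sigma> ` S \<in> large_group_models"
  using assms octant_models_permute group_order_permute
  unfolding large_group_models_eq group_order_at_least_def by auto

text \<open>Every orbit contains exactly one least model, because its members have different ranks.\<close>

lemma card_orbits:
  "card (large_group_models // same_up_to_permutation) = card {S \<in> large_group_models. least_model S}"
proof -
  define f where "f S = same_up_to_permutation `` {S}" for S
  note eq = same_up_to_permutation_equiv
  have "inj_on f {S \<in> large_group_models. least_model S}"
  proof (rule inj_onI)
    fix S T assume S: "S \<in> {S \<in> large_group_models. least_model S}"
      and T: "T \<in> {S \<in> large_group_models. least_model S}" and "f S = f T"
    hence ST: "(S, T) \<in> same_up_to_permutation" using eq_equiv_class[OF _ eq] unfolding f_def by blast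
    moreover have "(T, S) \<in> same_up_to_permutation" using ST eq unfolding equiv_def by (blast dest: symD)
    moreover have "rank A \<le> rank B" if AB: "(A, B) \<in> same_up_to_permutation" "least_model A" for A B
    proof -
      obtain \<sigma> where \<sigma>: "\<sigma> permutes {..<3}" "B = permute_step \<sigma> ` A"
        using AB(1) unfolding same_up_to_permutation_def by blast
      have "rank A \<le> rank (permute_step \<sigma> ` A)" using AB(2) \<sigma>(1) unfolding least_model_def by blast
      thus ?thesis by (simp only: \<sigma>(2))
    qed
    ultimately have "rank S \<le> rank T" "rank T \<le> rank S" using S T by blast+
    hence "rank S = rank T" by (rule order_antisym)
    thus "S = T" using S T by (intro rank_inj) (simp_all add: large_group_models_def)
  qed
  moreover have "f ` {S \<in> large_group_models. least_model S} = large_group_models // same_up_to_permutation"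
  proof (intro equalityI subsetI)
    fix X assume "X \<in> large_group_models // same_up_to_permutation"
    then obtain S where S: "S \<in> large_group_models" "X = f S" unfolding f_def quotient_def by blast
    obtain \<sigma> where \<sigma>: "\<sigma> permutes {..<3}" "least_model (permute_step \<sigma> ` S)"
      using least_model_exists S(1) unfolding large_group_models_eq by blast
    have "(S, permute_step \<sigma> ` S) \<in> same_up_to_permutation"
      using \<sigma>(1) unfolding same_up_to_permutation_def by blast
    hence "X = f (permute_step \<sigma> ` S)" unfolding S(2) f_def by (rule equiv_class_eq[OF eq])
    thus "X \<in> f ` {S \<in> large_group_models. least_model S}"
      using large_permute[OF \<sigma>(1) S(1)] \<sigma>(2) by blast
  qed (auto simp: f_def intro: quotientI)
  ultimately show ?thesis by (metis card_image)
qed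


lemma piece_result:
  assumes "fold collect L (Tally 0 []) = Tally n (map fst cs)"
    and "list_all (\<lambda>(l, c). certifies (map code_step l) c) cs"
  shows "length (filter (\<lambda>l. least_code l \<and> infinite_test l) L) = n"
    and "\<forall>l\<in>set L. least_code l \<longrightarrow> \<not> infinite_test l \<longrightarrow> (\<exists>c. certifies (map code_step l) c)"
proof -
  have *: "length (filter (\<lambda>l. least_code l \<and> infinite_test l) L) = n"
    "rev (filter (\<lambda>l. least_code l \<and> \<not> infinite_test l) L) = map fst cs"
    using assms(1) by (simp_all add: fold_collect)
  show "length (filter (\<lambda>l. least_code l \<and> infinite_test l) L) = n" by (rule *(1))
  show "\<forall>l\<in>set L. least_code l \<longrightarrow> \<not> infinite_test l \<longrightarrow> (\<exists>c. certifies (map code_step l) c)"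
  proof (intro ballI impI)
    fix l assume "l \<in> set L" "least_code l" "\<not> infinite_test l"
    hence "l \<in> set (rev (filter (\<lambda>l. least_code l \<and> \<not> infinite_test l) L))" by simp
    then obtain c where "(l, c) \<in> set cs" unfolding *(2) by auto
    thus "\<exists>c. certifies (map code_step l) c" using assms(2) by (auto simp: list_all_iff)
  qed
qed

lemmas piece_results = piece_result[OF tally1 certified1] piece_result[OF tally2 certified2]
  piece_result[OF tally3 certified3] piece_result[OF tally4 certified4] piece_result[OF tally5 certified5]
  piece_result[OF tally6 certified6] piece_result[OF tally7 certified7]

lemma count_infinite: "length (filter (\<lambda>l. least_code l \<and> infinite_test l) candidates) = 20634"
  unfolding candidates_pieces filter_append length_append piece_results by simp

text \<open>The lists of certificates contain exactly the least models for which the test fails.\<close>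

lemma certificate_exists:
  assumes "l \<in> set candidates" "least_code l" "\<not> infinite_test l"
  shows "\<exists>c. certifies (map code_step l) c"
  using assms piece_results unfolding candidates_pieces by auto

lemma dichotomy:
  assumes l: "l \<in> set candidates" and least: "least_code l"
  shows "if infinite_test l then infinite (carrier (model_group (steps_of l)))
    else finite (carrier (model_group (steps_of l))) \<and> card (carrier (model_group (steps_of l))) < 200"
proof -
  have oct: "octant_model (steps_of l)"
    using l octant_models_eq by (intro octant_models_octant_model) blast
  have d: "distinct l" by (rule candidate_codes(1)[OF l])
  show ?thesis
  proof (cases "infinite_test l")
    case True
    thus ?thesis using infinite_test_sound[OF oct d] by simp
  next
    case False
    interpret listed_model "map code_step l"
      using oct d inj_code_step
      by (auto simp: listed_model_def listed_model_axioms_def distinct_map intro: inj_on_subset)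
    obtain c where "certifies (map code_step l) c" using certificate_exists[OF l least False] by blast
    from certifies_sound[OF this] show ?thesis using False by simp
  qed
qed

lemma least_large_models:
  "{S \<in> large_group_models. least_model S} =
     steps_of ` set (filter (\<lambda>l. least_code l \<and> infinite_test l) candidates)"
proof (intro equalityI subsetI)
  fix S assume S: "S \<in> {S \<in> large_group_models. least_model S}"
  then obtain l where l: "l \<in> set candidates" "S = steps_of l"
    unfolding large_group_models_eq octant_models_eq by blast
  have least: "least_code l" using S l(2) least_code_iff[OF candidate_codes[OF l(1)]] by blast
  have "group_order_at_least 200 (steps_of l)" using S l(2) unfolding large_group_models_eq by blast
  hence "infinite_test l"
    using dichotomy[OF l(1) least] unfolding group_order_at_least_def by (auto split: if_splits)
  thus "S \<in> steps_of ` set (filter (\<lambda>l. least_code l \<and> infinite_test l) candidates)"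
    using l least by auto
next
  fix S assume "S \<in> steps_of ` set (filter (\<lambda>l. least_code l \<and> infinite_test l) candidates)"
  then obtain l where l: "l \<in> set candidates" "least_code l" "infinite_test l" "S = steps_of l" by auto
  have "infinite (carrier (model_group S))" using dichotomy[OF l(1,2)] l(3,4) by simp
  moreover have "S \<in> octant_models" using l(1,4) unfolding octant_models_eq by blast
  moreover have "least_model S" using l(2,4) least_code_iff[OF candidate_codes[OF l(1)]] by blast
  ultimately show "S \<in> {S \<in> large_group_models. least_model S}"
    unfolding large_group_models_eq group_order_at_least_def by blast
qed

theorem theorem3:
  shows "(\<forall>S. is_model S \<and> nontrivial_model S \<and> model_dim S = 3 \<and> card S \<le> 6
              \<and> group_order_at_least 200 S
            \<longrightarrow> infinite (carrier (model_group S)))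
         \<and> card (large_group_models // same_up_to_permutation) = 20634"
proof
  have "infinite (carrier (model_group S))" if S: "S \<in> large_group_models" for S
  proof -
    obtain \<sigma> where \<sigma>: "\<sigma> permutes {..<3}" "least_model (permute_step \<sigma> ` S)"
      using least_model_exists S unfolding large_group_models_eq by blast
    have "permute_step \<sigma> ` S \<in> {S \<in> large_group_models. least_model S}"
      using large_permute[OF \<sigma>(1) that] \<sigma>(2) by blast
    then obtain l where l: "l \<in> set candidates" "least_code l" "infinite_test l" "permute_step \<sigma> ` S = steps_of l"
      unfolding least_large_models by auto
    have "infinite (carrier (model_group (permute_step \<sigma> ` S)))"
      using dichotomy[OF l(1,2)] l(3,4) by simp
    thus ?thesis using group_order_permute(1)[OF \<sigma>(1)] that unfolding large_group_models_eq by blast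
  qed
  thus "\<forall>S. is_model S \<and> nontrivial_model S \<and> model_dim S = 3 \<and> card S \<le> 6
              \<and> group_order_at_least 200 S
            \<longrightarrow> infinite (carrier (model_group S))"
    unfolding large_group_models_def by blast
  let ?L = "filter (\<lambda>l. least_code l \<and> infinite_test l) candidates"
  have "inj_on steps_of (set ?L)"
    using steps_of_inj by (rule inj_on_subset) auto
  hence "card (steps_of ` set ?L) = card (set ?L)" by (rule card_image)
  also have "\<dots> = length ?L"
    using candidates_enumerate(2) by (intro distinct_card) (simp add: distinct_map)
  finally show "card (large_group_models // same_up_to_permutation) = 20634"
    unfolding card_orbits least_large_models count_infinite .
qed

end
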